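(* Let $\mathcal{A}$ denote the class of all topological rings isomorphic (as topological rings) to a product of complete matrix rings over finite fields whose sizes (cardinalities) are bounded by a common finite number, and let $\mathcal{A}_0$ be its subclass consisting of (the topological rings isomorphic to) such products of only countably many matrix rings. Then: (1) $\mathcal{A}$ is the class of all semisimple weakly locally finite profinite rings. (2) $\mathcal{A}$ is the class of all semisimple locally finite profinite rings. (3) $\mathcal{A}_0$ is the class of all semisimple topological rings admitting a structure of a small compact $G$-ring (that is, those semisimple topological rings $R$ for which there exist a Polish group $G$ and an action of $G$ on $R$ such that $(R,G)$ is a small compact $G$-ring).
   Context: Rings are associative, not necessarily commutative and not necessarily unital. A topological ring is a ring with a Hausdorff topology for which addition, additive inversion and multiplication are continuous. A profinite ring is the limit of an inverse system of finite rings, with the limit topology. A ring is locally finite if each of its finitely generated subrings is finite, and weakly locally finite if each of its subrings generated by one element is finite (subrings need not contain a unit). The Jacobson radical is $J(R)=\{x\in R : \forall y\in R\ \exists z\in R\ (yx+z+zyx=0)\}$; $R$ is semisimple if $J(R)=\{0\}$. A complete matrix ring over a field $F$ is $M_k(F)$ for some integer $k\ge 1$. Products of finite rings carry the product topology of the discrete topologies; index sets may be arbitrary (possibly empty or infinite), and "countable" includes finite. A compact $G$-ring is a pair $(R,G)$, where $G$ is a Polish group, $R$ is a compact topological ring, and $G$ acts continuously on $R$ as a group of (ring) automorphisms. It is small if for every $n<\omega$ there are only countably many orbits of the (diagonal) action of $G$ on the set $R^{\times n}$ of $n$-tuples. *)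

theory Defs
  imports "HOL-Analysis.Analysis" "HOL-Algebra.Algebra"
begin

section \<open>Rings without unit\<close>

text \<open>
  Rings need be neither commutative nor unital. They are carried by the record type of HOL-Algebra,
  whose field \<open>one\<close> is ignored: no notion below that is applied to a general ring refers to it.
\<close>

locale nonunital_ring = abelian_group R for R (structure) +
  assumes m_closed: "\<lbrakk>x \<in> carrier R; y \<in> carrier R\<rbrakk> \<Longrightarrow> x \<otimes> y \<in> carrier R"
    and m_assoc: "\<lbrakk>x \<in> carrier R; y \<in> carrier R; z \<in> carrier R\<rbrakk>
      \<Longrightarrow> (x \<otimes> y) \<otimes> z = x \<otimes> (y \<otimes> z)"
    and l_distr: "\<lbrakk>x \<in> carrier R; y \<in> carrier R; z \<in> carrier R\<rbrakk>
      \<Longrightarrow> (x \<oplus> y) \<otimes> z = x \<otimes> z \<oplus> y \<otimes> z"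
    and r_distr: "\<lbrakk>x \<in> carrier R; y \<in> carrier R; z \<in> carrier R\<rbrakk>
      \<Longrightarrow> z \<otimes> (x \<oplus> y) = z \<otimes> x \<oplus> z \<otimes> y"

definition nonunital_hom :: "('a, 'm) ring_scheme \<Rightarrow> ('b, 'n) ring_scheme \<Rightarrow> ('a \<Rightarrow> 'b) set" where
  "nonunital_hom R S = {h \<in> carrier R \<rightarrow> carrier S.
     \<forall>x\<in>carrier R. \<forall>y\<in>carrier R.
       h (x \<oplus>\<^bsub>R\<^esub> y) = h x \<oplus>\<^bsub>S\<^esub> h y \<and> h (x \<otimes>\<^bsub>R\<^esub> y) = h x \<otimes>\<^bsub>S\<^esub> h y}"

definition nonunital_subring :: "'a set \<Rightarrow> ('a, 'm) ring_scheme \<Rightarrow> bool" where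
  "nonunital_subring H R \<longleftrightarrow>
     additive_subgroup H R \<and> (\<forall>x\<in>H. \<forall>y\<in>H. x \<otimes>\<^bsub>R\<^esub> y \<in> H)"

definition generated_subring :: "('a, 'm) ring_scheme \<Rightarrow> 'a set \<Rightarrow> 'a set" where
  "generated_subring R A = \<Inter>{H. nonunital_subring H R \<and> A \<subseteq> H}"

definition locally_finite_ring :: "('a, 'm) ring_scheme \<Rightarrow> bool" where
  "locally_finite_ring R \<longleftrightarrow>
     (\<forall>A. finite A \<and> A \<subseteq> carrier R \<longrightarrow> finite (generated_subring R A))"

definition weakly_locally_finite_ring :: "('a, 'm) ring_scheme \<Rightarrow> bool" where
  "weakly_locally_finite_ring R \<longleftrightarrow> (\<forall>x\<in>carrier R. finite (generated_subring R {x}))"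

definition jacobson_radical :: "('a, 'm) ring_scheme \<Rightarrow> 'a set" where
  "jacobson_radical R = {x \<in> carrier R. \<forall>y\<in>carrier R. \<exists>z\<in>carrier R.
     y \<otimes>\<^bsub>R\<^esub> x \<oplus>\<^bsub>R\<^esub> z \<oplus>\<^bsub>R\<^esub> z \<otimes>\<^bsub>R\<^esub> y \<otimes>\<^bsub>R\<^esub> x = \<zero>\<^bsub>R\<^esub>}"

definition semisimple_ring :: "('a, 'm) ring_scheme \<Rightarrow> bool" where
  "semisimple_ring R \<longleftrightarrow> jacobson_radical R = {\<zero>\<^bsub>R\<^esub>}"

definition matrix_ring :: "('a, 'm) ring_scheme \<Rightarrow> nat \<Rightarrow> (nat \<times> nat \<Rightarrow> 'a) ring" where
  "matrix_ring F k =
     \<lparr>carrier = {..<k} \<times> {..<k} \<rightarrow>\<^sub>E carrier F,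
      monoid.mult = (\<lambda>A B. \<lambda>(i, j)\<in>{..<k} \<times> {..<k}. \<Oplus>\<^bsub>F\<^esub>l\<in>{..<k}. A (i, l) \<otimes>\<^bsub>F\<^esub> B (l, j)),
      monoid.one = (\<lambda>(i, j)\<in>{..<k} \<times> {..<k}. if i = j then \<one>\<^bsub>F\<^esub> else \<zero>\<^bsub>F\<^esub>),
      ring.zero = (\<lambda>_\<in>{..<k} \<times> {..<k}. \<zero>\<^bsub>F\<^esub>),
      ring.add = (\<lambda>A B. \<lambda>p\<in>{..<k} \<times> {..<k}. A p \<oplus>\<^bsub>F\<^esub> B p)\<rparr>"

definition product_ring :: "'i set \<Rightarrow> ('i \<Rightarrow> ('a, 'm) ring_scheme) \<Rightarrow> ('i \<Rightarrow> 'a) ring" where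
  "product_ring I S =
     \<lparr>carrier = (\<Pi>\<^sub>E i\<in>I. carrier (S i)),
      monoid.mult = (\<lambda>x y. \<lambda>i\<in>I. x i \<otimes>\<^bsub>S i\<^esub> y i),
      monoid.one = (\<lambda>i\<in>I. \<one>\<^bsub>S i\<^esub>),
      ring.zero = (\<lambda>i\<in>I. \<zero>\<^bsub>S i\<^esub>),
      ring.add = (\<lambda>x y. \<lambda>i\<in>I. x i \<oplus>\<^bsub>S i\<^esub> y i)\<rparr>"


section \<open>Topological rings\<close>

definition topological_ring :: "('a, 'm) ring_scheme \<Rightarrow> 'a topology \<Rightarrow> bool" where
  "topological_ring R T \<longleftrightarrow>
     nonunital_ring R \<and> topspace T = carrier R \<and> Hausdorff_space T \<and>
     continuous_map (prod_topology T T) T (\<lambda>(x, y). x \<oplus>\<^bsub>R\<^esub> y) \<and>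
     continuous_map T T (\<lambda>x. \<ominus>\<^bsub>R\<^esub> x) \<and>
     continuous_map (prod_topology T T) T (\<lambda>(x, y). x \<otimes>\<^bsub>R\<^esub> y)"

definition topological_ring_iso ::
  "('a, 'm) ring_scheme \<Rightarrow> 'a topology \<Rightarrow> ('b, 'n) ring_scheme \<Rightarrow> 'b topology \<Rightarrow> bool" where
  "topological_ring_iso R T S U \<longleftrightarrow>
     (\<exists>h\<in>nonunital_hom R S. bij_betw h (carrier R) (carrier S) \<and> homeomorphic_map T U h)"

definition discrete_product_topology ::
  "'i set \<Rightarrow> ('i \<Rightarrow> ('a, 'm) ring_scheme) \<Rightarrow> ('i \<Rightarrow> 'a) topology" where
  "discrete_product_topology I S = product_topology (\<lambda>i. discrete_topology (carrier (S i))) I"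

text \<open>
  HOL has no quantification over types, so the auxiliary objects whose existence is asserted below
  (index sets, finite fields, finite rings, Polish groups) all live in one type \<open>'u\<close>, passed as a
  type argument. The main statement holds for every \<open>'u\<close> that is large enough; as every set of such
  objects fits into a large enough type, no restriction on index sets results.
\<close>

definition matrix_product ::
  "'u set \<Rightarrow> ('u \<Rightarrow> 'u ring) \<Rightarrow> ('u \<Rightarrow> nat) \<Rightarrow> ('a, 'm) ring_scheme \<Rightarrow> 'a topology \<Rightarrow> bool" where
  "matrix_product I F k R T \<longleftrightarrow>
     (\<forall>i\<in>I. field (F i) \<and> finite (carrier (F i)) \<and> k i \<ge> 1) \<and>
     (\<exists>N. \<forall>i\<in>I. card (carrier (matrix_ring (F i) (k i))) \<le> N) \<and>
     topological_ring_iso R T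
       (product_ring I (\<lambda>i. matrix_ring (F i) (k i)))
       (discrete_product_topology I (\<lambda>i. matrix_ring (F i) (k i)))"

definition matrix_products :: "'u itself \<Rightarrow> ('a ring \<times> 'a topology) set" where
  "matrix_products _ = {(R, T). topological_ring R T \<and>
     (\<exists>(I :: 'u set) F k. matrix_product I F k R T)}"

definition countable_matrix_products :: "'u itself \<Rightarrow> ('a ring \<times> 'a topology) set" where
  "countable_matrix_products _ = {(R, T). topological_ring R T \<and>
     (\<exists>(I :: 'u set) F k. countable I \<and> matrix_product I F k R T)}"


section \<open>Profinite rings\<close>

definition directed_poset :: "'i set \<Rightarrow> ('i \<times> 'i) set \<Rightarrow> bool" where
  "directed_poset I r \<longleftrightarrow> partial_order_on I r \<and> I \<noteq> {} \<and>
     (\<forall>i\<in>I. \<forall>j\<in>I. \<exists>k\<in>I. (i, k) \<in> r \<and> (j, k) \<in> r)"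

text \<open>For \<open>(i, j) \<in> r\<close>, that is \<open>i \<le> j\<close>, the transition map \<open>p i j\<close> goes from \<open>S j\<close> to \<open>S i\<close>.\<close>

definition finite_ring_inverse_system ::
  "'i set \<Rightarrow> ('i \<times> 'i) set \<Rightarrow> ('i \<Rightarrow> ('a, 'm) ring_scheme) \<Rightarrow> ('i \<Rightarrow> 'i \<Rightarrow> 'a \<Rightarrow> 'a) \<Rightarrow> bool" where
  "finite_ring_inverse_system I r S p \<longleftrightarrow>
     directed_poset I r \<and>
     (\<forall>i\<in>I. nonunital_ring (S i) \<and> finite (carrier (S i))) \<and>
     (\<forall>i\<in>I. \<forall>j\<in>I. (i, j) \<in> r \<longrightarrow> p i j \<in> nonunital_hom (S j) (S i)) \<and>
     (\<forall>i\<in>I. \<forall>x\<in>carrier (S i). p i i x = x) \<and>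
     (\<forall>i\<in>I. \<forall>j\<in>I. \<forall>k\<in>I. (i, j) \<in> r \<and> (j, k) \<in> r \<longrightarrow>
        (\<forall>x\<in>carrier (S k). p i j (p j k x) = p i k x))"

definition inverse_limit_ring ::
  "'i set \<Rightarrow> ('i \<times> 'i) set \<Rightarrow> ('i \<Rightarrow> ('a, 'm) ring_scheme) \<Rightarrow> ('i \<Rightarrow> 'i \<Rightarrow> 'a \<Rightarrow> 'a)
     \<Rightarrow> ('i \<Rightarrow> 'a) ring" where
  "inverse_limit_ring I r S p = (product_ring I S)
     \<lparr>carrier := {x \<in> carrier (product_ring I S).
        \<forall>i\<in>I. \<forall>j\<in>I. (i, j) \<in> r \<longrightarrow> p i j (x j) = x i}\<rparr>"

definition profinite_ring :: "'u itself \<Rightarrow> ('a, 'm) ring_scheme \<Rightarrow> 'a topology \<Rightarrow> bool" where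
  "profinite_ring _ R T \<longleftrightarrow>
     topological_ring R T \<and>
     (\<exists>(I :: 'u set) r (S :: 'u \<Rightarrow> 'u ring) p.
        finite_ring_inverse_system I r S p \<and>
        topological_ring_iso R T
          (inverse_limit_ring I r S p)
          (subtopology (discrete_product_topology I S) (carrier (inverse_limit_ring I r S p))))"


section \<open>Small compact \<open>G\<close>-rings\<close>

definition polish_group :: "('g, 'm) monoid_scheme \<Rightarrow> 'g topology \<Rightarrow> bool" where
  "polish_group G TG \<longleftrightarrow>
     group G \<and> topspace TG = carrier G \<and>
     continuous_map (prod_topology TG TG) TG (\<lambda>(x, y). x \<otimes>\<^bsub>G\<^esub> y) \<and>
     continuous_map TG TG (\<lambda>x. inv\<^bsub>G\<^esub> x) \<and>
     completely_metrizable_space TG \<and> separable_space TG"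

definition compact_G_ring ::
  "('a, 'm) ring_scheme \<Rightarrow> 'a topology \<Rightarrow> ('g, 'n) monoid_scheme \<Rightarrow> 'g topology
     \<Rightarrow> ('g \<Rightarrow> 'a \<Rightarrow> 'a) \<Rightarrow> bool" where
  "compact_G_ring R T G TG \<phi> \<longleftrightarrow>
     topological_ring R T \<and> compact_space T \<and> polish_group G TG \<and>
     group_action G (carrier R) \<phi> \<and> (\<forall>g\<in>carrier G. \<phi> g \<in> nonunital_hom R R) \<and>
     continuous_map (prod_topology TG T) T (\<lambda>(g, x). \<phi> g x)"

definition small_compact_G_ring ::
  "('a, 'm) ring_scheme \<Rightarrow> 'a topology \<Rightarrow> ('g, 'n) monoid_scheme \<Rightarrow> 'g topology
     \<Rightarrow> ('g \<Rightarrow> 'a \<Rightarrow> 'a) \<Rightarrow> bool" where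
  "small_compact_G_ring R T G TG \<phi> \<longleftrightarrow>
     compact_G_ring R T G TG \<phi> \<and>
     (\<forall>n::nat. countable
        (orbits G ({..<n} \<rightarrow>\<^sub>E carrier R) (\<lambda>g. \<lambda>x\<in>{..<n} \<rightarrow>\<^sub>E carrier R. \<lambda>i\<in>{..<n}. \<phi> g (x i))))"

end

theory Submission
  imports Defs
begin

text \<open>
  A semisimple compact ring whose open ideals separate points is a product of finite simple rings, and
  these are matrix rings over finite fields by Wedderburn's theorems. If the ring is weakly locally
  finite, an element whose coordinates have as many different powers as possible shows that the
  factors are of bounded size. Conversely, a bounded product involves only finitely many addition and
  multiplication tables, so finitely many elements induce a finite partition of the index set such
  that the elements with constant coordinates on its classes form a finite subring.

  In a small compact \<open>G\<close>-ring the elements fixed by the stabilizer of \<open>a\<close> form a countable closed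
  subring, which is finite by Baire's theorem; so the ring is weakly locally finite. In particular
  it is torsion, hence (by Baire's theorem again) of finite exponent, and Bogolyubov's lemma provides
  enough open subgroups, hence enough open ideals. The orbit maps of countably many points carry a
  countable base of \<open>G\<close> to a countable network, so there are only countably many factors. Conversely,
  on a countable bounded product the permutations of the index set that preserve the tables act with
  countably many orbits: the orbit of a tuple is determined by how often each of the finitely many
  possible families of coordinates occurs.
\<close>

section \<open>Rings without unit, ideals and quotients\<close>

text \<open>Two obstacles shape the development. Quotients of \<open>R\<close> have no unit to start
  from, and a maximal ideal may have a quotient with zero multiplication. An idempotent takes the
  place of the unit: an element that is not quasi-regular modulo an open ideal has a nonzero
  idempotent power there, and an ideal maximal among those avoiding this power has a simple quotient
  with nonzero multiplication. The other obstacle is that a small compact G-ring is not given as a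
  profinite ring, so open subgroups of a compact abelian group of exponent m have to be found. On
  the finite groups (Z/m)^E Bogolyubov's lemma is finite Fourier analysis, and its bound 2 K^2 on
  the number of characters depends only on the number K of translates that cover the group, not on
  E. This uniformity permits the passage to the limit by Tychonoff's theorem. Finally, all index
  sets, fields and groups asserted to exist must lie in the type \<open>'u\<close>: quotients are
  formed along an injection of \<open>'a set\<close> into \<open>'u\<close>, and an injection of the
  reals makes room for a group of permutations of a countable set.\<close>

context nonunital_ring
begin

lemma l_null [simp]: "x \<in> carrier R \<Longrightarrow> \<zero> \<otimes> x = \<zero>"
  by (metis add.r_cancel_one' l_distr m_closed r_zero zero_closed)

lemma r_null [simp]: "x \<in> carrier R \<Longrightarrow> x \<otimes> \<zero> = \<zero>"
  by (metis add.r_cancel_one' r_distr m_closed r_zero zero_closed)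

lemma l_minus: "\<lbrakk>x \<in> carrier R; y \<in> carrier R\<rbrakk> \<Longrightarrow> (\<ominus> x) \<otimes> y = \<ominus> (x \<otimes> y)"
  by (metis a_inv_closed l_distr l_neg l_null m_closed minus_equality)

lemma r_minus: "\<lbrakk>x \<in> carrier R; y \<in> carrier R\<rbrakk> \<Longrightarrow> x \<otimes> (\<ominus> y) = \<ominus> (x \<otimes> y)"
  by (metis a_inv_closed r_distr l_neg r_null m_closed minus_equality)

lemma minus_l_distr:
  "\<lbrakk>x \<in> carrier R; y \<in> carrier R; z \<in> carrier R\<rbrakk> \<Longrightarrow> (x \<ominus> y) \<otimes> z = x \<otimes> z \<ominus> y \<otimes> z"
  by (simp add: a_minus_def l_distr l_minus)

lemma minus_r_distr:
  "\<lbrakk>x \<in> carrier R; y \<in> carrier R; z \<in> carrier R\<rbrakk> \<Longrightarrow> z \<otimes> (x \<ominus> y) = z \<otimes> x \<ominus> z \<otimes> y"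
  by (simp add: a_minus_def r_distr r_minus)

lemma minus_eq_zero_iff: "\<lbrakk>x \<in> carrier R; y \<in> carrier R\<rbrakk> \<Longrightarrow> x \<ominus> y = \<zero> \<longleftrightarrow> x = y"
  by (metis a_minus_def add.inv_closed minus_equality minus_minus r_neg)

lemma minus_add_cancel: "\<lbrakk>x \<in> carrier R; y \<in> carrier R\<rbrakk> \<Longrightarrow> x \<ominus> y \<oplus> y = x"
  by (simp add: a_minus_def add.m_assoc l_neg)

lemma m_finsum_ldistr:
  "\<lbrakk>finite A; a \<in> carrier R; f \<in> A \<rightarrow> carrier R\<rbrakk> \<Longrightarrow> finsum R f A \<otimes> a = (\<Oplus>i\<in>A. f i \<otimes> a)"
proof (induction A rule: finite_induct)
  case (insert i A)
  then have "f i \<in> carrier R" "f \<in> A \<rightarrow> carrier R" by auto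
  with insert show ?case
    by (simp add: l_distr finsum_closed Pi_def m_closed)
qed simp

lemma m_finsum_rdistr:
  "\<lbrakk>finite A; a \<in> carrier R; f \<in> A \<rightarrow> carrier R\<rbrakk> \<Longrightarrow> a \<otimes> finsum R f A = (\<Oplus>i\<in>A. a \<otimes> f i)"
proof (induction A rule: finite_induct)
  case (insert i A)
  then have "f i \<in> carrier R" "f \<in> A \<rightarrow> carrier R" by auto
  with insert show ?case
    by (simp add: r_distr finsum_closed Pi_def m_closed)
qed simp

lemma additive_subgroup_iff:
  "additive_subgroup H R \<longleftrightarrow>
     H \<subseteq> carrier R \<and> \<zero> \<in> H \<and> (\<forall>x\<in>H. \<forall>y\<in>H. x \<oplus> y \<in> H) \<and> (\<forall>x\<in>H. \<ominus> x \<in> H)"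
  unfolding additive_subgroup_def subgroup_def
  by (simp add: a_inv_def) blast

end

text \<open>Closedness under negation has to be demanded, here through
  \<open>additive_subgroup\<close>: without a unit \<open>\<ominus> x\<close> need not be a multiple
  of \<open>x\<close>.\<close>

definition nonunital_ideal :: "'a set \<Rightarrow> ('a, 'm) ring_scheme \<Rightarrow> bool" where
  "nonunital_ideal M R \<longleftrightarrow> additive_subgroup M R \<and>
     (\<forall>x\<in>M. \<forall>y\<in>carrier R. y \<otimes>\<^bsub>R\<^esub> x \<in> M \<and> x \<otimes>\<^bsub>R\<^esub> y \<in> M)"

context nonunital_ring
begin

lemma nonunital_idealI:
  assumes "H \<subseteq> carrier R" "\<zero> \<in> H" "\<And>x y. \<lbrakk>x \<in> H; y \<in> H\<rbrakk> \<Longrightarrow> x \<oplus> y \<in> H" "\<And>x. x \<in> H \<Longrightarrow> \<ominus> x \<in> H"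
    and "\<And>x y. \<lbrakk>x \<in> H; y \<in> carrier R\<rbrakk> \<Longrightarrow> y \<otimes> x \<in> H" "\<And>x y. \<lbrakk>x \<in> H; y \<in> carrier R\<rbrakk> \<Longrightarrow> x \<otimes> y \<in> H"
  shows "nonunital_ideal H R"
  unfolding nonunital_ideal_def additive_subgroup_iff
  by (intro conjI ballI) (fact assms | erule assms, assumption | erule assms)+

lemma nonunital_idealD:
  assumes "nonunital_ideal M R"
  shows "M \<subseteq> carrier R" "\<zero> \<in> M" "\<And>x y. \<lbrakk>x \<in> M; y \<in> M\<rbrakk> \<Longrightarrow> x \<oplus> y \<in> M" "\<And>x. x \<in> M \<Longrightarrow> \<ominus> x \<in> M"
    "\<And>x y. \<lbrakk>x \<in> M; y \<in> M\<rbrakk> \<Longrightarrow> x \<ominus> y \<in> M"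
    "\<And>x y. \<lbrakk>x \<in> M; y \<in> carrier R\<rbrakk> \<Longrightarrow> y \<otimes> x \<in> M" "\<And>x y. \<lbrakk>x \<in> M; y \<in> carrier R\<rbrakk> \<Longrightarrow> x \<otimes> y \<in> M"
  using assms unfolding nonunital_ideal_def additive_subgroup_iff a_minus_def
  by (simp_all add: Ball_def)

lemma minus_swap_in_ideal:
  assumes "nonunital_ideal M R" "x \<in> carrier R" "y \<in> carrier R" "x \<ominus> y \<in> M"
  shows "y \<ominus> x \<in> M"
proof -
  have "y \<ominus> x = \<ominus> (x \<ominus> y)"
    using assms(2,3) by (simp add: a_minus_def minus_add a_comm)
  then show ?thesis using nonunital_idealD(4)[OF assms(1)] assms(4) by simp
qed

lemma minus_trans_in_ideal:
  assumes "nonunital_ideal M R" "x \<in> carrier R" "y \<in> carrier R" "z \<in> carrier R" "x \<ominus> y \<in> M" "y \<ominus> z \<in> M"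
  shows "x \<ominus> z \<in> M"
proof -
  have "x \<ominus> z = (x \<ominus> y) \<oplus> (y \<ominus> z)"
    using assms(2-4) by (simp add: a_minus_def a_assoc r_neg1)
  then show ?thesis using nonunital_idealD(3)[OF assms(1)] assms(5,6) by simp
qed

lemma ideal_add_congruence:
  assumes M: "nonunital_ideal M R" and c: "x \<in> carrier R" "x' \<in> carrier R" "y \<in> carrier R" "y' \<in> carrier R"
    and "x \<ominus> x' \<in> M" "y \<ominus> y' \<in> M"
  shows "(x \<oplus> y) \<ominus> (x' \<oplus> y') \<in> M"
proof -
  have "(x \<oplus> y) \<ominus> (x' \<oplus> y') = (x \<ominus> x') \<oplus> (y \<ominus> y')"
    using c by (simp add: a_minus_def minus_add a_ac)
  then show ?thesis using nonunital_idealD(3)[OF M] assms by simp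
qed

lemma ideal_mult_congruence:
  assumes M: "nonunital_ideal M R" and c: "x \<in> carrier R" "x' \<in> carrier R" "y \<in> carrier R" "y' \<in> carrier R"
    and "x \<ominus> x' \<in> M" "y \<ominus> y' \<in> M"
  shows "(x \<otimes> y) \<ominus> (x' \<otimes> y') \<in> M"
proof -
  have "(x \<ominus> x') \<otimes> y \<in> M" "x' \<otimes> (y \<ominus> y') \<in> M"
    using nonunital_idealD[OF M] assms by auto
  then have "x \<otimes> y \<ominus> x' \<otimes> y \<in> M" "x' \<otimes> y \<ominus> x' \<otimes> y' \<in> M"
    using c by (simp_all add: minus_l_distr minus_r_distr)
  then show ?thesis using minus_trans_in_ideal[OF M] c m_closed by meson
qed

end

section \<open>Homomorphisms, and quotient rings carried by a prescribed type\<close>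

lemma nonunital_homD:
  assumes "h \<in> nonunital_hom R S"
  shows "\<And>x. x \<in> carrier R \<Longrightarrow> h x \<in> carrier S"
    "\<And>x y. \<lbrakk>x \<in> carrier R; y \<in> carrier R\<rbrakk> \<Longrightarrow> h (x \<oplus>\<^bsub>R\<^esub> y) = h x \<oplus>\<^bsub>S\<^esub> h y"
    "\<And>x y. \<lbrakk>x \<in> carrier R; y \<in> carrier R\<rbrakk> \<Longrightarrow> h (x \<otimes>\<^bsub>R\<^esub> y) = h x \<otimes>\<^bsub>S\<^esub> h y"
  using assms unfolding nonunital_hom_def by auto

lemma nonunital_hom_zero:
  assumes "abelian_group R" "abelian_group S" "h \<in> nonunital_hom R S"
  shows "h \<zero>\<^bsub>R\<^esub> = \<zero>\<^bsub>S\<^esub>"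
proof -
  interpret R: abelian_group R by fact
  interpret S: abelian_group S by fact
  show ?thesis using nonunital_homD[OF assms(3)]
    by (metis R.r_zero R.zero_closed S.add.r_cancel_one')
qed

lemma nonunital_hom_a_inv:
  assumes "abelian_group R" "abelian_group S" "h \<in> nonunital_hom R S" "x \<in> carrier R"
  shows "h (\<ominus>\<^bsub>R\<^esub> x) = \<ominus>\<^bsub>S\<^esub> h x"
proof -
  interpret R: abelian_group R by fact
  interpret S: abelian_group S by fact
  show ?thesis using nonunital_homD[OF assms(3)] nonunital_hom_zero[OF assms(1-3)]
    by (metis R.a_inv_closed R.l_neg S.minus_equality assms(4))
qed

lemma nonunital_hom_minus:
  assumes "abelian_group R" "abelian_group S" "h \<in> nonunital_hom R S" "x \<in> carrier R" "y \<in> carrier R"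
  shows "h (x \<ominus>\<^bsub>R\<^esub> y) = h x \<ominus>\<^bsub>S\<^esub> h y"
proof -
  interpret R: abelian_group R by fact
  show ?thesis using nonunital_homD[OF assms(3)] nonunital_hom_a_inv[OF assms(1-3)] assms(4,5)
    by (simp add: a_minus_def)
qed

lemma nonunital_hom_compose:
  "\<lbrakk>h \<in> nonunital_hom R S; g \<in> nonunital_hom S T\<rbrakk> \<Longrightarrow> g \<circ> h \<in> nonunital_hom R T"
  unfolding nonunital_hom_def by (auto simp: Pi_iff)

lemma hom_kernel_ideal:
  assumes "nonunital_ring R" "nonunital_ring S" "h \<in> nonunital_hom R S"
  shows "nonunital_ideal {x \<in> carrier R. h x = \<zero>\<^bsub>S\<^esub>} R"
proof -
  interpret R: nonunital_ring R by fact
  interpret S: nonunital_ring S by fact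
  note H = nonunital_homD[OF assms(3)] nonunital_hom_zero[OF R.abelian_group_axioms S.abelian_group_axioms assms(3)]
    nonunital_hom_a_inv[OF R.abelian_group_axioms S.abelian_group_axioms assms(3)]
  show ?thesis by (rule R.nonunital_idealI) (auto simp: H R.m_closed)
qed

text \<open>With \<open>quotient_map\<close> for \<open>f\<close> this is a quotient ring whose
  elements are names of cosets in the target type. Representatives are picked by
  \<open>inv_into\<close>, so the operations are meaningful only if equality of
  \<open>f\<close>-values is a congruence.\<close>

definition transport_ring :: "('a \<Rightarrow> 'b) \<Rightarrow> ('a, 'm) ring_scheme \<Rightarrow> 'b ring" where
  "transport_ring f R =
     \<lparr>carrier = f ` carrier R,
      monoid.mult = (\<lambda>u v. f (inv_into (carrier R) f u \<otimes>\<^bsub>R\<^esub> inv_into (carrier R) f v)),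
      monoid.one = f \<one>\<^bsub>R\<^esub>,
      ring.zero = f \<zero>\<^bsub>R\<^esub>,
      ring.add = (\<lambda>u v. f (inv_into (carrier R) f u \<oplus>\<^bsub>R\<^esub> inv_into (carrier R) f v))\<rparr>"

lemma transport_ring_simps:
  "carrier (transport_ring f R) = f ` carrier R" "\<zero>\<^bsub>transport_ring f R\<^esub> = f \<zero>\<^bsub>R\<^esub>"
  by (simp_all add: transport_ring_def)

text \<open>The two assumptions say that equality of \<open>f\<close>-values is a congruence, which
  makes the choice of representatives irrelevant. Every ring law is then inherited from
  \<open>R\<close>, because \<open>f\<close> is onto by construction.\<close>

lemma (in nonunital_ring) transport_ring_hom:
  assumes add: "\<And>x x' y y'. \<lbrakk>x \<in> carrier R; x' \<in> carrier R; y \<in> carrier R; y' \<in> carrier R; f x = f x'; f y = f y'\<rbrakk>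
      \<Longrightarrow> f (x \<oplus> y) = f (x' \<oplus> y')"
    and mult: "\<And>x x' y y'. \<lbrakk>x \<in> carrier R; x' \<in> carrier R; y \<in> carrier R; y' \<in> carrier R; f x = f x'; f y = f y'\<rbrakk>
      \<Longrightarrow> f (x \<otimes> y) = f (x' \<otimes> y')"
  shows "nonunital_ring (transport_ring f R)" "f \<in> nonunital_hom R (transport_ring f R)"
proof -
  let ?s = "inv_into (carrier R) f" and ?Q = "transport_ring f R"
  have s: "?s (f x) \<in> carrier R" "f (?s (f x)) = f x" if "x \<in> carrier R" for x
    using that by (auto intro: inv_into_into f_inv_into_f)
  have a: "f x \<oplus>\<^bsub>?Q\<^esub> f y = f (x \<oplus> y)" and m: "f x \<otimes>\<^bsub>?Q\<^esub> f y = f (x \<otimes> y)"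
    if "x \<in> carrier R" "y \<in> carrier R" for x y
    using that s by (auto simp: transport_ring_def intro!: add mult)
  show "f \<in> nonunital_hom R ?Q"
    by (auto simp: nonunital_hom_def a m transport_ring_simps)
  have ab: "abelian_group ?Q"
  proof (rule abelian_groupI)
    fix u assume "u \<in> carrier ?Q"
    then obtain x where "x \<in> carrier R" "u = f x" by (auto simp: transport_ring_simps)
    then show "\<exists>y\<in>carrier ?Q. y \<oplus>\<^bsub>?Q\<^esub> u = \<zero>\<^bsub>?Q\<^esub>"
      by (intro bexI[of _ "f (\<ominus> x)"]) (auto simp: a transport_ring_simps l_neg)
  qed (auto simp: transport_ring_simps a a_ac)
  show "nonunital_ring ?Q"
    by (intro nonunital_ring.intro ab nonunital_ring_axioms.intro)
      (auto simp: transport_ring_simps a m m_assoc l_distr r_distr m_closed)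
qed

text \<open>The coset of \<open>x\<close> modulo \<open>M\<close>, named by a map \<open>e\<close>
  on the power set that will be injective. This brings quotients into the type in which inverse
  systems and fields have to live.\<close>

definition quotient_map :: "('a set \<Rightarrow> 'u) \<Rightarrow> ('a, 'm) ring_scheme \<Rightarrow> 'a set \<Rightarrow> 'a \<Rightarrow> 'u" where
  "quotient_map e R M x = e {y \<in> carrier R. y \<ominus>\<^bsub>R\<^esub> x \<in> M}"

lemma (in nonunital_ring) quotient_map_eq_iff:
  assumes e: "inj e" and M: "nonunital_ideal M R" and xy: "x \<in> carrier R" "y \<in> carrier R"
  shows "quotient_map e R M x = quotient_map e R M y \<longleftrightarrow> x \<ominus> y \<in> M"
proof -
  have "x \<ominus> x \<in> M"
    using nonunital_idealD(2)[OF M] minus_eq_zero_iff[of x x] xy by simp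
  have "{z \<in> carrier R. z \<ominus> x \<in> M} = {z \<in> carrier R. z \<ominus> y \<in> M} \<longleftrightarrow> x \<ominus> y \<in> M"
  proof
    assume "{z \<in> carrier R. z \<ominus> x \<in> M} = {z \<in> carrier R. z \<ominus> y \<in> M}"
    then show "x \<ominus> y \<in> M" using \<open>x \<ominus> x \<in> M\<close> xy by blast
  next
    assume d: "x \<ominus> y \<in> M"
    then have d': "y \<ominus> x \<in> M" by (rule minus_swap_in_ideal[OF M xy])
    show "{z \<in> carrier R. z \<ominus> x \<in> M} = {z \<in> carrier R. z \<ominus> y \<in> M}"
      using minus_trans_in_ideal[OF M _ xy(1,2) _ d] minus_trans_in_ideal[OF M _ xy(2,1) _ d'] by auto
  qed
  then show ?thesis
    unfolding quotient_map_def using inj_eq[OF e] by simp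
qed

lemma (in nonunital_ring) quotient_ring:
  assumes e: "inj e" and M: "nonunital_ideal M R"
  shows "nonunital_ring (transport_ring (quotient_map e R M) R)"
    "quotient_map e R M \<in> nonunital_hom R (transport_ring (quotient_map e R M) R)"
proof -
  have add: "quotient_map e R M (x \<oplus> y) = quotient_map e R M (x' \<oplus> y')"
    and mult: "quotient_map e R M (x \<otimes> y) = quotient_map e R M (x' \<otimes> y')"
    if c: "x \<in> carrier R" "x' \<in> carrier R" "y \<in> carrier R" "y' \<in> carrier R"
      "quotient_map e R M x = quotient_map e R M x'" "quotient_map e R M y = quotient_map e R M y'"
    for x x' y y'
  proof -
    have "x \<ominus> x' \<in> M" "y \<ominus> y' \<in> M"
      using c(5,6) by (simp_all add: quotient_map_eq_iff[OF e M c(1,2)] quotient_map_eq_iff[OF e M c(3,4)])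
    then have "(x \<oplus> y) \<ominus> (x' \<oplus> y') \<in> M" "(x \<otimes> y) \<ominus> (x' \<otimes> y') \<in> M"
      using c(1-4) by (blast intro: ideal_add_congruence[OF M] ideal_mult_congruence[OF M])+
    then show "quotient_map e R M (x \<oplus> y) = quotient_map e R M (x' \<oplus> y')"
      "quotient_map e R M (x \<otimes> y) = quotient_map e R M (x' \<otimes> y')"
      using c(1-4) by (simp_all add: quotient_map_eq_iff[OF e M] m_closed)
  qed
  show "nonunital_ring (transport_ring (quotient_map e R M) R)"
    by (rule transport_ring_hom(1)) (fact add mult)+
  show "quotient_map e R M \<in> nonunital_hom R (transport_ring (quotient_map e R M) R)"
    by (rule transport_ring_hom(2)) (fact add mult)+
qed

section \<open>Bogolyubov's lemma\<close>

text \<open>The characters of Z/m, written on the integers. Elements of (Z/m)^E are represented by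
  integer vectors, and equality modulo m by \<open>dvd\<close>.\<close>

definition add_char :: "nat \<Rightarrow> int \<Rightarrow> complex" where
  "add_char m k = cis (2 * pi * of_int k / of_nat m)"

lemma add_char_add: "add_char m (k + l) = add_char m k * add_char m l"
  by (simp add: add_char_def cis_mult distrib_left add_divide_distrib)

lemma add_char_0 [simp]: "add_char m 0 = 1"
  by (simp add: add_char_def)

lemma norm_add_char [simp]: "norm (add_char m k) = 1"
  by (simp add: add_char_def)

lemma cnj_add_char: "cnj (add_char m k) = add_char m (- k)"
  by (simp add: add_char_def cis_cnj)

lemma add_char_sum: "finite A \<Longrightarrow> add_char m (sum f A) = (\<Prod>i\<in>A. add_char m (f i))"
  by (induction A rule: finite_induct) (auto simp: add_char_add)

lemma add_char_of_nat_mult: "add_char m (int j * k) = add_char m k ^ j"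
  by (induction j) (auto simp: add_char_add distrib_right)

lemma add_char_eq_1_iff:
  assumes "m > 0"
  shows "add_char m k = 1 \<longleftrightarrow> int m dvd k"
proof -
  have "add_char m k = 1 \<longleftrightarrow> (\<exists>n::int. 2 * pi * real_of_int k / real m = of_int (2 * n) * pi)"
    by (simp add: add_char_def cis_conv_exp exp_eq_1)
  also have "\<dots> \<longleftrightarrow> (\<exists>n::int. real_of_int k = real_of_int (int m * n))"
    using assms by (auto simp: field_simps)
  also have "\<dots> \<longleftrightarrow> int m dvd k"
    unfolding of_int_eq_iff by (auto simp: dvd_def)
  finally show ?thesis .
qed

lemma sum_add_char:
  assumes "m > 0"
  shows "(\<Sum>j = 0..<int m. add_char m (j * k)) = (if int m dvd k then of_nat m else 0)"
proof -
  have "(\<Sum>j = 0..<int m. add_char m (j * k)) = (\<Sum>j<m. add_char m k ^ j)"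
    by (rule sum.reindex_bij_witness[of _ int nat]) (auto simp: add_char_of_nat_mult[symmetric])
  also have "\<dots> = (if int m dvd k then of_nat m else 0)"
  proof (cases "int m dvd k")
    case True
    then show ?thesis using add_char_eq_1_iff[OF assms, of k] by simp
  next
    case False
    then have "add_char m k \<noteq> 1" using add_char_eq_1_iff[OF assms] by simp
    moreover have "add_char m k ^ m = 1"
      using add_char_of_nat_mult[of m m k] add_char_eq_1_iff[OF assms, of "int m * k"] by simp
    ultimately show ?thesis using False by (simp add: sum_gp_strict)
  qed
  finally show ?thesis .
qed

text \<open>Orthogonality of characters on (Z/m)^E: the sum splits into a product of one geometric
  sum per coordinate.\<close>

lemma sum_add_char_PiE:
  assumes "finite E" "m > 0"
  shows "(\<Sum>\<xi>\<in>E \<rightarrow>\<^sub>E {0..<int m}. add_char m (\<Sum>i\<in>E. \<xi> i * u i)) =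
    (if \<forall>i\<in>E. int m dvd u i then of_nat m ^ card E else 0)"
proof -
  have "(\<Sum>\<xi>\<in>E \<rightarrow>\<^sub>E {0..<int m}. add_char m (\<Sum>i\<in>E. \<xi> i * u i)) =
      (\<Sum>\<xi>\<in>E \<rightarrow>\<^sub>E {0..<int m}. \<Prod>i\<in>E. add_char m (\<xi> i * u i))"
    using assms by (simp add: add_char_sum)
  also have "\<dots> = (\<Prod>i\<in>E. \<Sum>j = 0..<int m. add_char m (j * u i))"
    using assms by (subst prod_sum_PiE) auto
  also have "\<dots> = (\<Prod>i\<in>E. if int m dvd u i then of_nat m else 0)"
    using assms by (simp add: sum_add_char)
  also have "\<dots> = (if \<forall>i\<in>E. int m dvd u i then of_nat m ^ card E else 0)"
    using assms by (auto simp: prod_zero_iff)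
  finally show ?thesis .
qed

text \<open>Here (Z/m)^E has \<open>N\<close> elements, \<open>A\<close> is a subset of density at
  least 1/K, and \<open>\<Lambda>\<close> consists of the frequencies at which the Fourier transform
  \<open>F\<close> of \<open>A\<close> is large. The number of ways to write x as a + b - c - d is,
  up to the factor \<open>N\<close>, the sum of |F|^4 against the character of x. If all large
  frequencies annihilate x, they contribute at least the |A|^4 of the trivial frequency, and the
  small ones cannot cancel more than half of that. The bound on \<open>\<Lambda>\<close> comes from
  Parseval's identity and does not involve \<open>E\<close>.\<close>

lemma bogolyubov:
  fixes A :: "('i \<Rightarrow> int) set" and K :: nat
  defines "Q \<equiv> \<lambda>E m. E \<rightarrow>\<^sub>E {0..<int m}"
  assumes E: "finite E" and m: "m > 0" and A: "A \<subseteq> Q E m" "A \<noteq> {}" and K: "m ^ card E \<le> K * card A"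
  obtains \<Lambda> where "finite \<Lambda>" "card \<Lambda> \<le> 2 * K\<^sup>2"
    "\<And>x. (\<forall>\<xi>\<in>\<Lambda>. int m dvd (\<Sum>i\<in>E. \<xi> i * x i)) \<Longrightarrow>
       \<exists>a\<in>A. \<exists>b\<in>A. \<exists>c\<in>A. \<exists>d\<in>A. \<forall>i\<in>E. int m dvd a i + b i - c i - d i - x i"
proof -
  define N where "N = m ^ card E"
  have finX: "finite (Q E m)" unfolding Q_def using E by (auto intro: finite_PiE)
  have finA: "finite A" using A finX finite_subset by blast
  have cardQ: "card (Q E m) = N" unfolding Q_def N_def using E by (simp add: card_PiE)
  have A0: "card A > 0" and AN: "card A \<le> N" and N0: "N > 0"
    using A finA finX cardQ card_mono[OF finX] m by (auto simp: card_gt_0_iff N_def)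
  define ip where "ip = (\<lambda>\<xi> (x :: 'i \<Rightarrow> int). \<Sum>i\<in>E. \<xi> i * x i)"
  have ip_add: "ip \<xi> (\<lambda>i. f i + g i) = ip \<xi> f + ip \<xi> g" for \<xi> f g
    unfolding ip_def by (simp add: distrib_left sum.distrib)
  have ip_diff: "ip \<xi> (\<lambda>i. f i - g i) = ip \<xi> f - ip \<xi> g" for \<xi> f g
    unfolding ip_def by (simp add: right_diff_distrib sum_subtractf)
  have orth: "(\<Sum>\<xi>\<in>Q E m. add_char m (ip \<xi> u)) = (if \<forall>i\<in>E. int m dvd u i then of_nat N else 0)" for u
    using sum_add_char_PiE[OF E m, of u] by (simp add: ip_def Q_def N_def)
  define F where "F = (\<lambda>\<xi>. \<Sum>a\<in>A. add_char m (ip \<xi> a))"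
  have F2: "F \<xi> * cnj (F \<xi>) = (\<Sum>a\<in>A. \<Sum>b\<in>A. add_char m (ip \<xi> (\<lambda>i. a i - b i)))" for \<xi>
    unfolding F_def by (simp add: sum_product cnj_add_char add_char_add[symmetric] ip_diff)
  have parseval: "(\<Sum>\<xi>\<in>Q E m. (cmod (F \<xi>))\<^sup>2) = real N * real (card A)"
  proof -
    \<comment> \<open>All coordinates lie in \<open>{0..<int m}\<close>, so congruent vectors of
      \<open>A\<close> are equal and only the diagonal survives in Parseval's identity.\<close>
    have inj: "(\<forall>i\<in>E. int m dvd a i - b i) \<longleftrightarrow> b = a" if "a \<in> A" "b \<in> A" for a b
    proof
      assume *: "\<forall>i\<in>E. int m dvd a i - b i"
      show "b = a"
      proof (rule PiE_ext[of _ E "\<lambda>_. {0..<int m}"])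
        fix i assume "i \<in> E"
        then have "a i \<in> {0..<int m}" "b i \<in> {0..<int m}"
          using PiE_mem[of a E "\<lambda>_. {0..<int m}" i] PiE_mem[of b E "\<lambda>_. {0..<int m}" i] that A
          by (auto simp: Q_def subset_iff)
        moreover have "a i mod int m = b i mod int m"
          using * \<open>i \<in> E\<close> by (simp add: mod_eq_dvd_iff)
        ultimately have "a i = b i" by simp
        then show "b i = a i" by simp
      qed (use that A in \<open>auto simp: Q_def\<close>)
    qed auto
    have "complex_of_real (\<Sum>\<xi>\<in>Q E m. (cmod (F \<xi>))\<^sup>2) = (\<Sum>\<xi>\<in>Q E m. F \<xi> * cnj (F \<xi>))"
      by (simp only: of_real_sum complex_norm_square)
    also have "\<dots> = (\<Sum>a\<in>A. \<Sum>b\<in>A. \<Sum>\<xi>\<in>Q E m. add_char m (ip \<xi> (\<lambda>i. a i - b i)))"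
      unfolding F2 by (subst sum.swap, rule sum.cong[OF refl], rule sum.swap)
    also have "\<dots> = (\<Sum>a\<in>A. \<Sum>b\<in>A. if b = a then of_nat N else 0)"
      using inj by (simp add: orth cong: sum.cong)
    also have "\<dots> = of_nat N * of_nat (card A)"
      using finA by simp
    also have "\<dots> = complex_of_real (real N * real (card A))" by simp
    finally show ?thesis unfolding of_real_eq_iff .
  qed
  \<comment> \<open>The threshold meets two demands: Parseval's identity bounds the number of
    frequencies above it by 2 (N/|A|)^2, and those below it contribute at most t N |A| = |A|^4 / 2
    in absolute value.\<close>
  define t where "t = real (card A) ^ 3 / (2 * real N)"
  have t0: "t > 0" using A0 N0 by (simp add: t_def)
  define \<Lambda> where "\<Lambda> = {\<xi> \<in> Q E m. t \<le> (cmod (F \<xi>))\<^sup>2}"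
  have fin\<Lambda>: "finite \<Lambda>" and \<Lambda>Q: "\<Lambda> \<subseteq> Q E m" using finX by (auto simp: \<Lambda>_def)
  have "real (card \<Lambda>) * t \<le> (\<Sum>\<xi>\<in>\<Lambda>. (cmod (F \<xi>))\<^sup>2)"
    using sum_bounded_below[of \<Lambda> t "\<lambda>\<xi>. (cmod (F \<xi>))\<^sup>2"] by (simp add: \<Lambda>_def)
  also have "\<dots> \<le> (\<Sum>\<xi>\<in>Q E m. (cmod (F \<xi>))\<^sup>2)"
    using finX \<Lambda>Q by (intro sum_mono2) auto
  finally have "real (card \<Lambda>) * t \<le> real N * real (card A)" unfolding parseval .
  then have "real (card \<Lambda>) * real (card A) ^ 3 \<le> real N * real (card A) * (2 * real N)"
    using N0 by (simp add: t_def field_simps)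
  then have "real (card A) * (real (card \<Lambda>) * (real (card A))\<^sup>2) \<le> real (card A) * (2 * (real N)\<^sup>2)"
    by (simp add: power2_eq_square power3_eq_cube mult_ac)
  then have "real (card \<Lambda>) * (real (card A))\<^sup>2 \<le> 2 * (real N)\<^sup>2"
    using A0 by (simp add: mult_le_cancel_left)
  also have "\<dots> \<le> 2 * (real K * real (card A))\<^sup>2"
    using K by (simp add: N_def power_mono flip: of_nat_mult of_nat_power)
  finally have "real (card \<Lambda>) * (real (card A))\<^sup>2 \<le> (2 * (real K)\<^sup>2) * (real (card A))\<^sup>2"
    by (simp add: power_mult_distrib mult_ac)
  then have "real (card \<Lambda>) \<le> 2 * (real K)\<^sup>2"
    by (rule mult_right_le_imp_le) (use A0 in simp)
  then have "real (card \<Lambda>) \<le> real (2 * K\<^sup>2)" by simp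
  then have card\<Lambda>: "card \<Lambda> \<le> 2 * K\<^sup>2" unfolding of_nat_le_iff .
  have main: "\<exists>a\<in>A. \<exists>b\<in>A. \<exists>c\<in>A. \<exists>d\<in>A. \<forall>i\<in>E. int m dvd a i + b i - c i - d i - x i"
    if x: "\<forall>\<xi>\<in>\<Lambda>. int m dvd ip \<xi> x" for x
  proof (rule ccontr)
    assume neg: "\<not> ?thesis"
    have F4: "F \<xi> * F \<xi> * (cnj (F \<xi>) * cnj (F \<xi>)) * cnj (add_char m (ip \<xi> x)) =
       (\<Sum>a\<in>A. \<Sum>b\<in>A. \<Sum>c\<in>A. \<Sum>d\<in>A. add_char m (ip \<xi> (\<lambda>i. a i + b i - c i - d i - x i)))" for \<xi>
    proof -
      have "add_char m (ip \<xi> (\<lambda>i. a i + b i - c i - d i - x i)) =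
          add_char m (ip \<xi> a) * add_char m (ip \<xi> b) * (cnj (add_char m (ip \<xi> c)) * cnj (add_char m (ip \<xi> d)))
            * cnj (add_char m (ip \<xi> x))" for a b c d
        by (simp add: cnj_add_char add_char_add[symmetric] ip_diff ip_add algebra_simps)
      then have e: "add_char m (ip \<xi> a) * add_char m (ip \<xi> b) * (cnj (add_char m (ip \<xi> c)) * cnj (add_char m (ip \<xi> d)))
            * cnj (add_char m (ip \<xi> x)) = add_char m (ip \<xi> (\<lambda>i. a i + b i - c i - d i - x i))" for a b c d
        by simp
      have FF: "F \<xi> * F \<xi> = (\<Sum>a\<in>A. \<Sum>b\<in>A. add_char m (ip \<xi> a) * add_char m (ip \<xi> b))"
        by (simp add: F_def sum_product)
      define G where "G = cnj (F \<xi>) * cnj (F \<xi>)"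
      have G: "G = (\<Sum>c\<in>A. \<Sum>d\<in>A. cnj (add_char m (ip \<xi> c)) * cnj (add_char m (ip \<xi> d)))"
        by (simp add: G_def F_def sum_product)
      have "F \<xi> * F \<xi> * G * cnj (add_char m (ip \<xi> x)) =
        (\<Sum>a\<in>A. \<Sum>b\<in>A. add_char m (ip \<xi> a) * add_char m (ip \<xi> b) * G * cnj (add_char m (ip \<xi> x)))"
        unfolding FF by (simp only: sum_distrib_right)
      also have "\<dots> = (\<Sum>a\<in>A. \<Sum>b\<in>A. \<Sum>c\<in>A. \<Sum>d\<in>A. add_char m (ip \<xi> (\<lambda>i. a i + b i - c i - d i - x i)))"
        unfolding G by (simp only: sum_distrib_left sum_distrib_right e)
      finally show ?thesis unfolding G_def .
    qed
    \<comment> \<open>By \<open>F4\<close> and orthogonality this sum is \<open>N\<close> times the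
      number of quadruples from \<open>A\<close> that represent x, and \<open>neg\<close> says that
      there are none.\<close>
    have "(\<Sum>\<xi>\<in>Q E m. F \<xi> * F \<xi> * (cnj (F \<xi>) * cnj (F \<xi>)) * cnj (add_char m (ip \<xi> x))) =
       (\<Sum>a\<in>A. \<Sum>b\<in>A. \<Sum>c\<in>A. \<Sum>d\<in>A. \<Sum>\<xi>\<in>Q E m. add_char m (ip \<xi> (\<lambda>i. a i + b i - c i - d i - x i)))"
      unfolding F4
      by (subst sum.swap, rule sum.cong[OF refl], subst sum.swap, rule sum.cong[OF refl],
          subst sum.swap, rule sum.cong[OF refl], rule sum.swap)
    also have "\<dots> = 0"
    proof -
      have "(\<Sum>\<xi>\<in>Q E m. add_char m (ip \<xi> (\<lambda>i. a i + b i - c i - d i - x i))) = 0"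
        if "a \<in> A" "b \<in> A" "c \<in> A" "d \<in> A" for a b c d
      proof -
        have "\<not> (\<forall>i\<in>E. int m dvd a i + b i - c i - d i - x i)" using neg that by blast
        then show ?thesis unfolding orth by (rule if_not_P)
      qed
      then show ?thesis by simp
    qed
    finally have zero: "(\<Sum>\<xi>\<in>Q E m. F \<xi> * F \<xi> * (cnj (F \<xi>) * cnj (F \<xi>)) * cnj (add_char m (ip \<xi> x))) = 0" .
    \<comment> \<open>The coefficient |F|^4 is a nonnegative real, so real parts may be taken: those
      of the characters are 1 on \<open>\<Lambda>\<close> and at least -1 elsewhere.\<close>
    define g where "g = (\<lambda>\<xi>. (cmod (F \<xi>)) ^ 4)"
    have g: "F \<xi> * F \<xi> * (cnj (F \<xi>) * cnj (F \<xi>)) = complex_of_real (g \<xi>)" for \<xi>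
    proof -
      have "F \<xi> * F \<xi> * (cnj (F \<xi>) * cnj (F \<xi>)) = (F \<xi> * cnj (F \<xi>)) * (F \<xi> * cnj (F \<xi>))"
        by (simp add: mult_ac)
      also have "\<dots> = complex_of_real ((cmod (F \<xi>))\<^sup>2 * (cmod (F \<xi>))\<^sup>2)"
        by (simp only: of_real_mult complex_norm_square)
      also have "(cmod (F \<xi>))\<^sup>2 * (cmod (F \<xi>))\<^sup>2 = g \<xi>"
        by (simp add: g_def power2_eq_square power4_eq_xxxx)
      finally show ?thesis .
    qed
    have "(\<Sum>\<xi>\<in>Q E m. g \<xi> * Re (add_char m (ip \<xi> x))) = 0"
    proof -
      have "(\<Sum>\<xi>\<in>Q E m. complex_of_real (g \<xi>) * cnj (add_char m (ip \<xi> x))) = 0"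
        using zero unfolding g .
      then have "Re (\<Sum>\<xi>\<in>Q E m. complex_of_real (g \<xi>) * cnj (add_char m (ip \<xi> x))) = 0" by simp
      then show ?thesis by simp
    qed
    moreover have "(\<Sum>\<xi>\<in>Q E m. g \<xi> * Re (add_char m (ip \<xi> x))) =
       (\<Sum>\<xi>\<in>\<Lambda>. g \<xi> * Re (add_char m (ip \<xi> x))) + (\<Sum>\<xi>\<in>Q E m - \<Lambda>. g \<xi> * Re (add_char m (ip \<xi> x)))"
      by (subst sum.subset_diff[OF \<Lambda>Q finX]) (rule add.commute)
    moreover have "(\<Sum>\<xi>\<in>\<Lambda>. g \<xi> * Re (add_char m (ip \<xi> x))) = (\<Sum>\<xi>\<in>\<Lambda>. g \<xi>)"
    proof (rule sum.cong[OF refl])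
      fix \<xi> assume "\<xi> \<in> \<Lambda>"
      then have "add_char m (ip \<xi> x) = 1" using x add_char_eq_1_iff[OF m] by blast
      then show "g \<xi> * Re (add_char m (ip \<xi> x)) = g \<xi>" by simp
    qed
    moreover have "(\<Sum>\<xi>\<in>\<Lambda>. g \<xi>) \<ge> real (card A) ^ 4"
    proof -
      \<comment> \<open>The trivial frequency, in its extensional form as an element of
        \<open>Q E m\<close>. Since \<open>F z\<close> is |A|, it is above the threshold and alone
        supplies |A|^4.\<close>
      define z where "z = (\<lambda>i\<in>E. 0 :: int)"
      have Fz: "F z = of_nat (card A)" by (simp add: F_def ip_def z_def cong: sum.cong)
      have "t \<le> (real (card A))\<^sup>2"
      proof -
        have "real (card A) ^ 3 = real (card A) * (real (card A))\<^sup>2"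
          by (simp add: power2_eq_square power3_eq_cube)
        also have "\<dots> \<le> (2 * real N) * (real (card A))\<^sup>2"
          using AN by (intro mult_right_mono) auto
        finally show ?thesis using N0 by (simp add: t_def field_simps)
      qed
      then have "z \<in> \<Lambda>" using m Fz by (auto simp: \<Lambda>_def Q_def z_def)
      then have "g z \<le> (\<Sum>\<xi>\<in>\<Lambda>. g \<xi>)" using fin\<Lambda> by (intro member_le_sum) (auto simp: g_def)
      then show ?thesis by (simp add: g_def Fz)
    qed
    moreover have "(\<Sum>\<xi>\<in>Q E m - \<Lambda>. g \<xi> * Re (add_char m (ip \<xi> x))) \<ge> - (real (card A) ^ 4 / 2)"
    proof -
      have "- (real (card A) ^ 4 / 2) = - (t * (real N * real (card A)))"
        using N0 by (simp add: t_def power4_eq_xxxx power3_eq_cube)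
      also have "\<dots> \<le> - (t * (\<Sum>\<xi>\<in>Q E m - \<Lambda>. (cmod (F \<xi>))\<^sup>2))"
      proof -
        have "(\<Sum>\<xi>\<in>Q E m - \<Lambda>. (cmod (F \<xi>))\<^sup>2) \<le> (\<Sum>\<xi>\<in>Q E m. (cmod (F \<xi>))\<^sup>2)"
          using finX by (intro sum_mono2) auto
        then show ?thesis using t0 by (simp add: parseval)
      qed
      also have "\<dots> = (\<Sum>\<xi>\<in>Q E m - \<Lambda>. - (t * (cmod (F \<xi>))\<^sup>2))"
        by (simp add: sum_distrib_left sum_negf)
      also have "\<dots> \<le> (\<Sum>\<xi>\<in>Q E m - \<Lambda>. g \<xi> * Re (add_char m (ip \<xi> x)))"
      proof (rule sum_mono)
        fix \<xi> assume "\<xi> \<in> Q E m - \<Lambda>"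
        then have "(cmod (F \<xi>))\<^sup>2 \<le> t" by (auto simp: \<Lambda>_def)
        then have "(cmod (F \<xi>))\<^sup>2 * (cmod (F \<xi>))\<^sup>2 \<le> t * (cmod (F \<xi>))\<^sup>2"
          by (intro mult_right_mono) auto
        then have gt: "g \<xi> \<le> t * (cmod (F \<xi>))\<^sup>2"
          by (simp add: g_def power2_eq_square power4_eq_xxxx)
        have "\<bar>Re (add_char m (ip \<xi> x))\<bar> \<le> 1"
          using abs_Re_le_cmod[of "add_char m (ip \<xi> x)"] by simp
        then have "g \<xi> * (-1) \<le> g \<xi> * Re (add_char m (ip \<xi> x))"
          by (intro mult_left_mono) (auto simp: g_def)
        with gt show "- (t * (cmod (F \<xi>))\<^sup>2) \<le> g \<xi> * Re (add_char m (ip \<xi> x))" by linarith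
      qed
      finally show ?thesis .
    qed
    moreover have "real (card A) ^ 4 > 0" using A0 by simp
    ultimately show False by linarith
  qed
  show thesis
    using that[OF fin\<Lambda> card\<Lambda>] main unfolding ip_def by blast
qed

section \<open>Wedderburn's little theorem\<close>

text \<open>For n = 0 this is the whole plane, whence the positivity assumptions below.\<close>

definition prim_roots :: "nat \<Rightarrow> complex set" where
  "prim_roots n = {z. z ^ n = 1 \<and> (\<forall>k. 0 < k \<and> k < n \<longrightarrow> z ^ k \<noteq> 1)}"

text \<open>The n-th cyclotomic polynomial. It is kept over the complex numbers because its value at
  q is estimated by the distances of q to the roots; that its coefficients are integers is proved
  separately.\<close>

definition cyclo :: "nat \<Rightarrow> complex poly" where
  "cyclo n = (\<Prod>z\<in>prim_roots n. [:- z, 1:])"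

lemma finite_prim_roots: "n > 0 \<Longrightarrow> finite (prim_roots n)"
  by (rule finite_subset[OF _ finite_roots_unity[of n]]) (auto simp: prim_roots_def)

lemma prim_roots_pow_eq_1_iff:
  assumes "d > 0" "z \<in> prim_roots d"
  shows "z ^ n = 1 \<longleftrightarrow> d dvd n"
proof
  assume *: "z ^ n = 1"
  have "z ^ (d * (n div d) + n mod d) = 1" using * by simp
  then have "z ^ (n mod d) = 1"
    using assms by (simp only: power_add power_mult) (simp add: prim_roots_def)
  then have "n mod d = 0"
    using assms by (metis (mono_tags, lifting) prim_roots_def mem_Collect_eq mod_less_divisor neq0_conv)
  then show "d dvd n" by auto
next
  assume "d dvd n"
  then show "z ^ n = 1" using assms by (auto simp: prim_roots_def power_mult)
qed

text \<open>The index d to which a root z belongs is its order, the least positive exponent with z^d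
  = 1.\<close>

lemma roots_unity_eq_Union:
  assumes "n > 0"
  shows "{z :: complex. z ^ n = 1} = (\<Union>d\<in>{d. d dvd n}. prim_roots d)"
proof (intro equalityI subsetI)
  fix z :: complex assume "z \<in> {z. z ^ n = 1}"
  then have ex: "\<exists>k. k > 0 \<and> z ^ k = 1" using assms by auto
  define d where "d = (LEAST k. k > 0 \<and> z ^ k = 1)"
  have d: "d > 0" "z ^ d = 1" using LeastI_ex[OF ex] by (auto simp: d_def)
  have "z ^ k \<noteq> 1" if "0 < k" "k < d" for k using not_less_Least[of k] that unfolding d_def by blast
  then have "z \<in> prim_roots d" using d by (auto simp: prim_roots_def)
  moreover have "d dvd n"
    using prim_roots_pow_eq_1_iff[OF d(1) \<open>z \<in> prim_roots d\<close>] \<open>z \<in> {z. z ^ n = 1}\<close> by auto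
  ultimately show "z \<in> (\<Union>d\<in>{d. d dvd n}. prim_roots d)" by auto
qed (auto simp: prim_roots_def power_mult elim!: dvdE)

lemma prim_roots_disjoint:
  assumes "c > 0" "d > 0" "c \<noteq> d"
  shows "prim_roots c \<inter> prim_roots d = {}"
proof (rule ccontr)
  assume "\<not> ?thesis"
  then obtain z where z: "z \<in> prim_roots c" "z \<in> prim_roots d" by blast
  then have "c dvd d" "d dvd c"
    using prim_roots_pow_eq_1_iff[OF assms(1) z(1)] prim_roots_pow_eq_1_iff[OF assms(2) z(2)]
    by (auto simp: prim_roots_def)
  then show False using assms(3) dvd_antisym by blast
qed

lemma monic_cyclo: "n > 0 \<Longrightarrow> Polynomial.lead_coeff (cyclo n) = 1"
  unfolding cyclo_def lead_coeff_prod by simp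

text \<open>Both sides are monic of degree n, so their difference has smaller degree; as it is zero
  at n points, it vanishes.\<close>

lemma prod_roots_unity:
  assumes "n > 0"
  shows "(\<Prod>z\<in>{z :: complex. z ^ n = 1}. [:- z, 1:]) = Polynomial.monom 1 n - 1" (is "?P = ?Q")
proof (rule ccontr)
  assume "?P \<noteq> ?Q"
  let ?S = "{z :: complex. z ^ n = 1}"
  have S: "finite ?S" "card ?S = n"
    using assms by (auto intro: finite_roots_unity card_roots_unity_eq)
  have degP: "Polynomial.degree ?P = n"
    using S by (subst degree_prod_sum_eq) auto
  have lcP: "Polynomial.coeff ?P n = 1" using lead_coeff_prod[of "\<lambda>z. [:- z, 1:]" ?S] degP by simp
  have "Polynomial.degree (?P - ?Q) \<le> n"
    by (rule degree_diff_le) (auto simp: degP intro!: degree_diff_le degree_monom_le)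
  moreover have "Polynomial.coeff (?P - ?Q) n = 0" using assms lcP by (simp add: coeff_1)
  ultimately have deg: "Polynomial.degree (?P - ?Q) < n"
    using \<open>?P \<noteq> ?Q\<close> by (metis diff_eq_diff_eq le_neq_implies_less leading_coeff_0_iff right_minus_eq)
  have "?S \<subseteq> {z. poly (?P - ?Q) z = 0}"
    using S by (auto simp: poly_prod poly_monom intro!: prod_zero)
  then have "n \<le> card {z. poly (?P - ?Q) z = 0}"
    using \<open>?P \<noteq> ?Q\<close> S(2) by (metis card_mono poly_roots_finite right_minus_eq)
  also have "\<dots> \<le> Polynomial.degree (?P - ?Q)"
    using \<open>?P \<noteq> ?Q\<close> by (intro card_poly_roots_bound) auto
  finally show False using deg by simp
qed

lemma prod_cyclo:
  assumes "n > 0"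
  shows "(\<Prod>d\<in>{d. d dvd n}. cyclo d) = Polynomial.monom 1 n - 1"
proof -
  have "(\<Prod>d\<in>{d. d dvd n}. cyclo d) = (\<Prod>z\<in>(\<Union>d\<in>{d. d dvd n}. prim_roots d). [:- z, 1:])"
    unfolding cyclo_def
  proof (rule prod.UNION_disjoint[symmetric])
    show "finite {d. d dvd n}" using assms by simp
    show "\<forall>d\<in>{d. d dvd n}. finite (prim_roots d)"
      using assms by (auto intro!: finite_prim_roots intro: dvd_pos_nat)
    show "\<forall>c\<in>{d. d dvd n}. \<forall>d\<in>{d. d dvd n}. c \<noteq> d \<longrightarrow> prim_roots c \<inter> prim_roots d = {}"
    proof (intro ballI impI)
      fix c d assume "c \<in> {d. d dvd n}" "d \<in> {d. d dvd n}" "c \<noteq> d"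
      then show "prim_roots c \<inter> prim_roots d = {}"
        using assms by (intro prim_roots_disjoint) (auto intro: dvd_pos_nat)
    qed
  qed
  then show ?thesis using roots_unity_eq_Union[OF assms] prod_roots_unity[OF assms] by simp
qed

section \<open>Integrality and size of the values of cyclotomic polynomials\<close>

definition int_coeffs :: "complex poly \<Rightarrow> bool" where
  "int_coeffs p \<longleftrightarrow> (\<forall>i. Polynomial.coeff p i \<in> \<int>)"

lemma int_coeffs_mult: "\<lbrakk>int_coeffs p; int_coeffs q\<rbrakk> \<Longrightarrow> int_coeffs (p * q)"
  unfolding int_coeffs_def coeff_mult by (auto intro!: Ints_sum Ints_mult)

lemma int_coeffs_prod: "(\<And>x. x \<in> A \<Longrightarrow> int_coeffs (f x)) \<Longrightarrow> int_coeffs (prod f A)"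
  by (induction A rule: infinite_finite_induct) (simp_all add: int_coeffs_mult, simp_all add: int_coeffs_def coeff_1)

text \<open>Coefficients are compared from the top down: as \<open>g\<close> is monic, the
  coefficient of \<open>g * p\<close> at deg g + i is the i-th coefficient of \<open>p\<close> plus
  products that involve only higher coefficients of \<open>p\<close>.\<close>

lemma int_coeffs_monic_quotient:
  assumes "int_coeffs (g * p)" "int_coeffs g" "Polynomial.lead_coeff g = 1"
  shows "int_coeffs p"
proof -
  have "Polynomial.coeff p i \<in> \<int>" for i
  proof (induction "Suc (Polynomial.degree p) - i" arbitrary: i rule: less_induct)
    case less
    show ?case
    proof (cases "i > Polynomial.degree p")
      case True
      then show ?thesis by (simp add: coeff_eq_0)
    next
      case False
      have hi: "Polynomial.coeff p j \<in> \<int>" if "j > i" for j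
        using less[of j] that False by auto
      let ?n = "Polynomial.degree g + i"
      have "Polynomial.coeff (g * p) ?n = (\<Sum>j\<le>?n. Polynomial.coeff p j * Polynomial.coeff g (?n - j))"
        by (simp add: mult.commute[of g] coeff_mult)
      also have "\<dots> = Polynomial.coeff p i * Polynomial.coeff g (?n - i) + (\<Sum>j\<in>{..?n} - {i}. Polynomial.coeff p j * Polynomial.coeff g (?n - j))"
        by (rule sum.remove) auto
      also have "\<dots> = Polynomial.coeff p i + (\<Sum>j\<in>{..?n} - {i}. Polynomial.coeff p j * Polynomial.coeff g (?n - j))"
        using assms(3) by simp
      finally have "Polynomial.coeff p i = Polynomial.coeff (g * p) ?n - (\<Sum>j\<in>{..?n} - {i}. Polynomial.coeff p j * Polynomial.coeff g (?n - j))"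
        by simp
      moreover have "(\<Sum>j\<in>{..?n} - {i}. Polynomial.coeff p j * Polynomial.coeff g (?n - j)) \<in> \<int>"
      proof (rule Ints_sum)
        fix j assume j: "j \<in> {..?n} - {i}"
        show "Polynomial.coeff p j * Polynomial.coeff g (?n - j) \<in> \<int>"
        proof (cases "j < i")
          case True
          then have "Polynomial.coeff g (?n - j) = 0" by (intro coeff_eq_0) auto
          then show ?thesis by simp
        next
          case False
          then show ?thesis using j hi assms(2) by (auto simp: int_coeffs_def)
        qed
      qed
      ultimately show ?thesis using assms(1) by (auto simp: int_coeffs_def)
    qed
  qed
  then show ?thesis by (simp add: int_coeffs_def)
qed

lemma prod_proper_cyclo:
  assumes "n > 0"
  shows "(\<Prod>d\<in>{d. d dvd n \<and> d \<noteq> n}. cyclo d) * cyclo n = Polynomial.monom 1 n - 1"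
proof -
  have "{d. d dvd n} = insert n {d. d dvd n \<and> d \<noteq> n}" by auto
  moreover have "finite {d. d dvd n \<and> d \<noteq> n}" using assms by (auto intro: finite_subset[of _ "{d. d dvd n}"])
  ultimately show ?thesis using prod_cyclo[OF assms] by (simp add: mult.commute)
qed

text \<open>By strong induction the product over the proper divisors of n is monic with integer
  coefficients, and it divides X^n - 1 with quotient \<open>cyclo n\<close>.\<close>

lemma int_coeffs_cyclo: "n > 0 \<Longrightarrow> int_coeffs (cyclo n)"
proof (induction n rule: less_induct)
  case (less n)
  let ?g = "\<Prod>d\<in>{d. d dvd n \<and> d \<noteq> n}. cyclo d"
  have d: "0 < d \<and> d < n" if "d dvd n" "d \<noteq> n" for d
    using that less.prems dvd_imp_le[of d n] by (auto intro: Nat.gr0I)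
  show ?case
  proof (rule int_coeffs_monic_quotient)
    show "int_coeffs (?g * cyclo n)"
      unfolding prod_proper_cyclo[OF less.prems] by (auto simp: int_coeffs_def coeff_1)
    show "int_coeffs ?g" using less.IH d by (intro int_coeffs_prod) auto
    show "Polynomial.lead_coeff ?g = 1" unfolding lead_coeff_prod using d by (simp add: monic_cyclo)
  qed
qed

lemma int_coeffs_poly: "\<lbrakk>int_coeffs p; x \<in> \<int>\<rbrakk> \<Longrightarrow> poly p x \<in> \<int>"
  unfolding poly_altdef int_coeffs_def by (auto intro!: Ints_sum Ints_mult Ints_power)

text \<open>A root z lies on the unit circle and differs from 1 because n >= 2, so Re z < 1 and |q -
  z| > q - 1 >= 1. One factor gives the strict bound, and the others do not decrease it.\<close>

lemma norm_poly_cyclo: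
  assumes "n \<ge> 2" "q \<ge> (2 :: nat)"
  shows "norm (poly (cyclo n) (of_nat q)) > real q - 1"
proof -
  have n0: "n > 0" using assms by simp
  have ge: "norm (of_nat q - z) \<ge> real q - Re z" for z :: complex
    using complex_Re_le_cmod[of "of_nat q - z"] by simp
  have norm1: "norm z = 1" if "z \<in> prim_roots n" for z
  proof -
    have "norm z ^ n = 1" using that by (simp add: prim_roots_def flip: norm_power)
    then show ?thesis using n0 power_eq_iff_eq_base[of n "norm z" 1] by simp
  qed
  have big: "norm (of_nat q - z) > real q - 1" if "z \<in> prim_roots n" for z
  proof -
    have "z \<noteq> 1" using that assms by (auto simp: prim_roots_def dest!: spec[of _ 1])
    moreover have "Re z \<le> 1" using complex_Re_le_cmod[of z] norm1[OF that] by simp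
    moreover have "Re z \<noteq> 1"
    proof
      assume "Re z = 1"
      then have "Im z = 0" using norm1[OF that] cmod_power2[of z] by simp
      with \<open>Re z = 1\<close> \<open>z \<noteq> 1\<close> show False by (simp add: complex_eq_iff)
    qed
    ultimately have "Re z < 1" by simp
    then show ?thesis using ge[of z] by simp
  qed
  \<comment> \<open>At least one factor is required: an empty product would be 1, which does not
    exceed q - 1.\<close>
  have "cis (2 * pi / n) \<in> prim_roots n"
  proof -
    have "cis (2 * pi / n) ^ k \<noteq> 1" if "0 < k" "k < n" for k
    proof
      assume "cis (2 * pi / n) ^ k = 1"
      then have "cis (real k * (2 * pi / n)) = 1" unfolding Complex.DeMoivre .
      then obtain j :: int where "real k * (2 * pi / n) = of_int (2 * j) * pi"
        by (auto simp: cis_conv_exp exp_eq_1)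
      then have "real k = of_int j * real n" using n0 by (simp add: field_simps)
      then have "real_of_int (int k) = real_of_int (j * int n)" by simp
      then have "int k = j * int n" unfolding of_int_eq_iff .
      then have "int n dvd int k" by simp
      then show False using that by (simp add: nat_dvd_not_less)
    qed
    then show ?thesis using n0 by (auto simp: prim_roots_def Complex.DeMoivre)
  qed
  then obtain z where z: "z \<in> prim_roots n" by blast
  have "real q - 1 < norm (of_nat q - z)" using big z by simp
  also have "\<dots> \<le> norm (of_nat q - z) * (\<Prod>w\<in>prim_roots n - {z}. norm (of_nat q - w))"
  proof -
    have "1 \<le> norm (of_nat q - w)" if "w \<in> prim_roots n" for w
      using big[OF that] assms(2) by linarith
    then have "1 \<le> (\<Prod>w\<in>prim_roots n - {z}. norm (of_nat q - w))" by (intro prod_ge_1) auto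
    then show ?thesis using mult_left_mono[OF _ norm_ge_zero] by fastforce
  qed
  also have "\<dots> = (\<Prod>w\<in>prim_roots n. norm (of_nat q - w))"
    using finite_prim_roots[OF n0] z by (simp add: prod.remove)
  also have "\<dots> = norm (poly (cyclo n) (of_nat q))"
    by (simp add: cyclo_def poly_prod prod_norm)
  finally show ?thesis .
qed

text \<open>The number c is the value of the n-th cyclotomic polynomial at q. The divisors of a
  proper divisor d of n, together with n itself, are distinct divisors of n, so the corresponding
  factors of q^n - 1 multiply up to c (q^d - 1). In this form the divisibility of (q^n - 1)/(q^d -
  1) by c is stated without division.\<close>

lemma cyclotomic_divisor:
  assumes "n \<ge> 2" "q \<ge> (2 :: nat)"
  obtains c :: int where "\<bar>c\<bar> > int q - 1" "c dvd int q ^ n - 1"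
    "\<And>d. \<lbrakk>d dvd n; d \<noteq> n\<rbrakk> \<Longrightarrow> c * (int q ^ d - 1) dvd int q ^ n - 1"
proof -
  have n0: "n > 0" using assms by simp
  have "\<exists>c. poly (cyclo d) (of_nat q) = of_int c" if "d dvd n" for d
  proof -
    have "d > 0" using that n0 by (auto intro: Nat.gr0I)
    then have "poly (cyclo d) (of_nat q) \<in> \<int>" by (intro int_coeffs_poly int_coeffs_cyclo) auto
    then show ?thesis by (auto elim: Ints_cases)
  qed
  then obtain c where c: "\<And>d. d dvd n \<Longrightarrow> poly (cyclo d) (of_nat q) = of_int (c d)" by metis
  have pr: "(\<Prod>e\<in>{e. e dvd d}. c e) = int q ^ d - 1" if "d dvd n" for d
  proof -
    have "d > 0" using that n0 by (auto intro: Nat.gr0I)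
    have "(of_int (\<Prod>e\<in>{e. e dvd d}. c e) :: complex) = (\<Prod>e\<in>{e. e dvd d}. poly (cyclo e) (of_nat q))"
      unfolding of_int_prod by (rule prod.cong[OF refl]) (use that c dvd_trans in auto)
    also have "\<dots> = poly (Polynomial.monom 1 d - 1) (of_nat q)"
      unfolding prod_cyclo[OF \<open>d > 0\<close>, symmetric] poly_prod ..
    also have "\<dots> = of_int (int q ^ d - 1)" by (simp add: poly_monom)
    finally show ?thesis unfolding of_int_eq_iff .
  qed
  have fin: "finite {e. e dvd n}" using n0 by simp
  show thesis
  proof (rule that[of "c n"])
    have "norm (of_int (c n) :: complex) > real q - 1"
      using norm_poly_cyclo[OF assms] c[of n] by simp
    then have "real_of_int \<bar>c n\<bar> > real_of_int (int q - 1)" by simp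
    then show "\<bar>c n\<bar> > int q - 1" unfolding of_int_less_iff .
    show "c n dvd int q ^ n - 1" using dvd_prodI[OF fin, of n c] pr[of n] by simp
    fix d assume d: "d dvd n" "d \<noteq> n"
    have "insert n {e. e dvd d} \<subseteq> {e. e dvd n}" using d by (auto intro: dvd_trans)
    then have "prod c (insert n {e. e dvd d}) dvd prod c {e. e dvd n}"
      by (intro prod_dvd_prod_subset fin)
    moreover have "\<not> n dvd d"
    proof
      assume "n dvd d"
      then have "n = d" using d(1) by (rule dvd_antisym)
      with d(2) show False by simp
    qed
    moreover have "finite {e. e dvd d}"
      by (rule finite_subset[OF _ fin]) (use d(1) in \<open>auto intro: dvd_trans\<close>)
    ultimately show "c n * (int q ^ d - 1) dvd int q ^ n - 1"
      using pr[of n] pr[OF d(1)] by simp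
  qed
qed

text \<open>One step of Euclid's algorithm on the exponents: q^n - 1 = q^(n-d) (q^d - 1) + (q^(n-d)
  - 1).\<close>

lemma power_minus_1_dvd_imp_dvd:
  assumes "q \<ge> (2 :: nat)" "q ^ d - 1 dvd q ^ n - 1" "d > 0"
  shows "d dvd n"
  using assms(2)
proof (induction n rule: less_induct)
  case (less n)
  show ?case
  proof (cases "n < d")
    case True
    have "q ^ n < q ^ d" using assms(1) True by (simp add: power_strict_increasing)
    then have "q ^ n - 1 < q ^ d - 1" using assms(1) by (intro diff_less_mono) auto
    then have "q ^ n - 1 = 0" using less.prems by (metis dvd_imp_le gr0I leD)
    then have "q ^ n \<le> 1" by simp
    then have "n = 0" using assms(1) one_less_power[of q n] by (cases n) auto
    then show ?thesis by simp
  next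
    case False
    have "q ^ n - 1 = q ^ (n - d) * (q ^ d - 1) + (q ^ (n - d) - 1)"
    proof -
      have "q ^ n = q ^ (n - d) * q ^ d" using False by (simp flip: power_add)
      moreover have "q ^ (n - d) \<ge> 1" "q ^ d \<ge> 1" using assms(1) by auto
      ultimately have "q ^ (n - d) * (q ^ d - 1) = q ^ n - q ^ (n - d)" "q ^ (n - d) \<le> q ^ n"
        by (simp_all only: diff_mult_distrib2 mult_1_right) simp
      then show ?thesis using \<open>q ^ (n - d) \<ge> 1\<close> by linarith
    qed
    then have "q ^ d - 1 dvd q ^ (n - d) - 1"
      using less.prems dvd_add_right_iff[of "q ^ d - 1" "q ^ (n - d) * (q ^ d - 1)" "q ^ (n - d) - 1"] by simp
    then have "d dvd n - d" using less.IH[of "n - d"] assms(3) False by simp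
    then show ?thesis using False using dvd_add[of d "n - d" d] by simp
  qed
qed

text \<open>\<open>Z\<close> is a division ring inside \<open>R\<close>, and \<open>V\<close> is a
  finite left vector space over it. A proper subspace W is enlarged by a vector v outside it to W +
  Zv, which has |W| |Z| elements. The lemma is used with the centre as \<open>Z\<close>, both for
  the whole ring and for centralizers.\<close>

lemma (in ring) card_eq_power_of_card:
  assumes Z: "finite Z" "Z \<subseteq> carrier R" "\<one> \<in> Z" "\<one> \<noteq> \<zero>" "\<zero> \<in> Z"
    and Zdiff: "\<And>z w. \<lbrakk>z \<in> Z; w \<in> Z\<rbrakk> \<Longrightarrow> z \<ominus> w \<in> Z" "\<And>z w. \<lbrakk>z \<in> Z; w \<in> Z\<rbrakk> \<Longrightarrow> z \<oplus> w \<in> Z"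
    and Zmult: "\<And>z w. \<lbrakk>z \<in> Z; w \<in> Z\<rbrakk> \<Longrightarrow> z \<otimes> w \<in> Z"
    and Zinv: "\<And>z. \<lbrakk>z \<in> Z; z \<noteq> \<zero>\<rbrakk> \<Longrightarrow> \<exists>w\<in>Z. w \<otimes> z = \<one>"
    and V: "finite V" "V \<subseteq> carrier R" "\<zero> \<in> V"
    and Vadd: "\<And>v w. \<lbrakk>v \<in> V; w \<in> V\<rbrakk> \<Longrightarrow> v \<oplus> w \<in> V"
    and Vmult: "\<And>z v. \<lbrakk>z \<in> Z; v \<in> V\<rbrakk> \<Longrightarrow> z \<otimes> v \<in> V"
  shows "\<exists>k. card V = card Z ^ k"
proof -
  define P where "P W \<longleftrightarrow> W \<subseteq> V \<and> \<zero> \<in> W \<and> (\<forall>v\<in>W. \<forall>w\<in>W. v \<oplus> w \<in> W) \<and>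
     (\<forall>z\<in>Z. \<forall>v\<in>W. z \<otimes> v \<in> W) \<and> (\<exists>k. card W = card Z ^ k)" for W
  have Z2: "card Z \<ge> 2"
    using card_mono[OF Z(1), of "{\<zero>, \<one>}"] Z by simp
  \<comment> \<open>Induction on the size to be reached stands in for the choice of a basis: at |V|
    + 1 only W = V remains.\<close>
  have "\<exists>W. P W \<and> (W = V \<or> card W \<ge> n)" for n
  proof (induction n)
    case 0
    have "P {\<zero>}" unfolding P_def using V Z by (auto intro!: exI[of _ 0])
    then show ?case by auto
  next
    case (Suc n)
    then obtain W where W: "P W" "W = V \<or> card W \<ge> n" by blast
    show ?case
    proof (cases "W = V")
      case False
      from W(1) have WV: "W \<subseteq> V" and W0: "\<zero> \<in> W" and Wadd: "\<And>v w. \<lbrakk>v \<in> W; w \<in> W\<rbrakk> \<Longrightarrow> v \<oplus> w \<in> W"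
        and Wmult: "\<And>z v. \<lbrakk>z \<in> Z; v \<in> W\<rbrakk> \<Longrightarrow> z \<otimes> v \<in> W"
        unfolding P_def by simp_all
      from W(1) obtain k where k: "card W = card Z ^ k" unfolding P_def by blast
      from False WV obtain v where v: "v \<in> V" "v \<notin> W" by blast
      have Wc: "w \<in> W \<Longrightarrow> w \<in> carrier R" and Zc: "z \<in> Z \<Longrightarrow> z \<in> carrier R" for w z using WV V(2) Z(2) by auto
      have vc: "v \<in> carrier R" using v V by auto
      have Wneg: "\<ominus> w \<in> W" if "w \<in> W" for w
      proof -
        have "(\<zero> \<ominus> \<one>) \<otimes> w \<in> W" using Wmult[OF Zdiff(1)[OF Z(5,3)] that] .
        then show ?thesis using Wc[OF that] by (simp add: a_minus_def l_minus)
      qed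
      define f where "f = (\<lambda>(w, z). w \<oplus> z \<otimes> v)"
      \<comment> \<open>If the scalars z and z' differed, dividing by their difference would put v
        into \<open>W\<close>.\<close>
      have inj: "inj_on f (W \<times> Z)"
      proof (rule inj_onI, clarsimp simp: f_def)
        fix w z w' z'
        assume c: "w \<in> W" "z \<in> Z" "w' \<in> W" "z' \<in> Z" and eq: "w \<oplus> z \<otimes> v = w' \<oplus> z' \<otimes> v"
        note cc = Wc[OF c(1)] Zc[OF c(2)] Wc[OF c(3)] Zc[OF c(4)] vc
        have "(z \<ominus> z') \<otimes> v = w' \<ominus> w"
        proof -
          have "z \<otimes> v = \<ominus> w \<oplus> (w' \<oplus> z' \<otimes> v)"
            unfolding eq[symmetric] using cc by (simp add: r_neg1)
          then show ?thesis using cc by (simp add: a_minus_def l_distr l_minus a_ac r_neg2 r_neg1 r_neg)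
        qed
        then have in_W: "(z \<ominus> z') \<otimes> v \<in> W" using Wadd[OF c(3) Wneg[OF c(1)]] by (simp add: a_minus_def)
        have "z = z'"
        proof (rule ccontr)
          assume "z \<noteq> z'"
          then have "z \<ominus> z' \<noteq> \<zero>" using cc by (simp add: r_right_minus_eq)
          then obtain u where u: "u \<in> Z" "u \<otimes> (z \<ominus> z') = \<one>" using Zinv Zdiff(1) c by blast
          then have "v = u \<otimes> ((z \<ominus> z') \<otimes> v)" using cc Zc[OF u(1)] by (simp flip: m_assoc)
          then show False using v Wmult[OF u(1) in_W] by simp
        qed
        then show "w = w' \<and> z = z'" using eq cc by simp
      qed
      define W' where "W' = f ` (W \<times> Z)"
      have W'I: "w \<oplus> z \<otimes> v \<in> W'" if "w \<in> W" "z \<in> Z" for w z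
        unfolding W'_def f_def using that by force
      have W'E: "\<exists>w\<in>W. \<exists>z\<in>Z. x = w \<oplus> z \<otimes> v" if "x \<in> W'" for x
        using that unfolding W'_def f_def by auto
      have finW: "finite W" using WV V(1) finite_subset by blast
      have cardW': "card W' = card W * card Z"
        unfolding W'_def using card_image[OF inj] by (simp add: card_cartesian_product)
      have "P W'"
        unfolding P_def
      proof (intro conjI ballI subsetI)
        fix x assume "x \<in> W'"
        then obtain w z where x: "w \<in> W" "z \<in> Z" "x = w \<oplus> z \<otimes> v" using W'E by blast
        then show "x \<in> V" using Vadd Vmult v WV by blast
        fix u assume u: "u \<in> Z"
        have "u \<otimes> x = u \<otimes> w \<oplus> (u \<otimes> z) \<otimes> v"
          using x u Wc Zc vc by (simp add: r_distr m_assoc)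
        then show "u \<otimes> x \<in> W'" using W'I Wmult Zmult u x by simp
      next
        fix x y assume "x \<in> W'" "y \<in> W'"
        then obtain w z w' z' where x: "w \<in> W" "z \<in> Z" "x = w \<oplus> z \<otimes> v" and y: "w' \<in> W" "z' \<in> Z" "y = w' \<oplus> z' \<otimes> v"
          using W'E by meson
        have "x \<oplus> y = (w \<oplus> w') \<oplus> (z \<oplus> z') \<otimes> v"
          using x y Wc Zc vc by (simp add: l_distr a_ac)
        then show "x \<oplus> y \<in> W'" using W'I Wadd Zdiff(2) x y by simp
      next
        have "\<zero> \<oplus> \<zero> \<otimes> v \<in> W'" using W'I W0 Z(5) by blast
        then show "\<zero> \<in> W'" using vc by simp
      next
        show "\<exists>k. card W' = card Z ^ k" using cardW' k by (intro exI[of _ "Suc k"]) simp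
      qed
      moreover have "card W' \<ge> Suc n"
      proof -
        have "card W > 0" using finW W0 card_gt_0_iff by blast
        moreover have "card W * 2 \<le> card W * card Z" using Z2 by simp
        ultimately show ?thesis using W(2) False cardW' by linarith
      qed
      ultimately show ?thesis by blast
    qed (use W in blast)
  qed
  then obtain W where W: "P W" "W = V \<or> card W \<ge> Suc (card V)" by blast
  moreover have "card W \<le> card V" using W(1) V(1) card_mono unfolding P_def by blast
  ultimately have "W = V" by linarith
  then show ?thesis using W(1) unfolding P_def by simp
qed

text \<open>Witt's argument. With a proper centre of q elements, the class equation of the unit
  group writes q^n - 1 as q - 1 plus terms (q^n - 1)/(q^d - 1) for proper divisors d of n. The value
  c of the n-th cyclotomic polynomial at q divides these terms and q^n - 1, hence q - 1, although
  |c| > q - 1. Left inverses suffice as assumption: the left inverse of x has a left inverse in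
  turn, and that must be x.\<close>

theorem (in ring) finite_division_ring_imp_field:
  assumes fin: "finite (carrier R)" and ne: "\<one> \<noteq> \<zero>"
    and inv: "\<And>x. \<lbrakk>x \<in> carrier R; x \<noteq> \<zero>\<rbrakk> \<Longrightarrow> \<exists>y\<in>carrier R. y \<otimes> x = \<one>"
  shows "field R"
proof -
  have U: "Units R = carrier R - {\<zero>}"
  proof (intro equalityI subsetI)
    fix x assume x: "x \<in> carrier R - {\<zero>}"
    then obtain y where y: "y \<in> carrier R" "y \<otimes> x = \<one>" using inv by blast
    then have "y \<noteq> \<zero>" using x ne by auto
    then obtain z where z: "z \<in> carrier R" "z \<otimes> y = \<one>" using inv y by blast
    have "z = x" using x y z by (metis DiffD1 inv_unique)
    then show "x \<in> Units R" using x y z by (auto simp: Units_def)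
  next
    fix x assume "x \<in> Units R"
    then show "x \<in> carrier R - {\<zero>}" using ne by (auto simp: Units_def)
  qed
  define Z where "Z = {z \<in> carrier R. \<forall>x\<in>carrier R. z \<otimes> x = x \<otimes> z}"
  have "Z = carrier R"
  proof (rule ccontr)
    assume nZ: "Z \<noteq> carrier R"
    define C where "C = (\<lambda>x. {y \<in> carrier R. y \<otimes> x = x \<otimes> y})"
    have Zc: "z \<in> carrier R" "\<And>x. x \<in> carrier R \<Longrightarrow> z \<otimes> x = x \<otimes> z" if "z \<in> Z" for z
      using that by (simp_all add: Z_def)
    have finZ: "finite Z" using fin by (auto simp: Z_def)
    have Zinv: "\<exists>w\<in>Z. w \<otimes> z = \<one>" if z: "z \<in> Z" "z \<noteq> \<zero>" for z
    proof -
      have zU: "z \<in> Units R" using z Zc U by auto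
      have "inv z \<otimes> x = x \<otimes> inv z" if x: "x \<in> carrier R" for x
      proof -
        have "inv z \<otimes> x = inv z \<otimes> (x \<otimes> z) \<otimes> inv z" using x zU Units_closed[OF zU] by (simp add: m_assoc)
        also have "x \<otimes> z = z \<otimes> x" using Zc(2)[OF z(1) x] by simp
        also have "inv z \<otimes> (z \<otimes> x) \<otimes> inv z = x \<otimes> inv z" using x zU Units_closed[OF zU] by (simp flip: m_assoc)
        finally show ?thesis .
      qed
      then show ?thesis using zU by (intro bexI[of _ "inv z"]) (auto simp: Z_def)
    qed
    have Zring: "z \<ominus> w \<in> Z" "z \<oplus> w \<in> Z" "z \<otimes> w \<in> Z" if "z \<in> Z" "w \<in> Z" for z w
    proof -
      note c = Zc(1)[OF that(1)] Zc(1)[OF that(2)]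
      have "(z \<ominus> w) \<otimes> x = x \<otimes> (z \<ominus> w) \<and> (z \<oplus> w) \<otimes> x = x \<otimes> (z \<oplus> w) \<and> (z \<otimes> w) \<otimes> x = x \<otimes> (z \<otimes> w)"
        if x: "x \<in> carrier R" for x
      proof (intro conjI)
        have zx: "z \<otimes> x = x \<otimes> z" and wx: "w \<otimes> x = x \<otimes> w"
          using Zc(2) \<open>z \<in> Z\<close> \<open>w \<in> Z\<close> x by auto
        show "(z \<ominus> w) \<otimes> x = x \<otimes> (z \<ominus> w)" "(z \<oplus> w) \<otimes> x = x \<otimes> (z \<oplus> w)"
          using c x by (simp_all add: a_minus_def l_distr r_distr l_minus r_minus zx wx)
        have "z \<otimes> w \<otimes> x = z \<otimes> (x \<otimes> w)" using c x by (simp add: m_assoc wx)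
        also have "\<dots> = (x \<otimes> z) \<otimes> w" using c x by (simp only: zx flip: m_assoc)
        also have "\<dots> = x \<otimes> (z \<otimes> w)" using c x by (simp add: m_assoc)
        finally show "z \<otimes> w \<otimes> x = x \<otimes> (z \<otimes> w)" .
      qed
      then show "z \<ominus> w \<in> Z" "z \<oplus> w \<in> Z" "z \<otimes> w \<in> Z" using c by (simp_all add: Z_def)
    qed
    have Z01: "\<one> \<in> Z" "\<zero> \<in> Z" "Z \<subseteq> carrier R" by (auto simp: Z_def)
    define q where "q = card Z"
    have q2: "q \<ge> 2" using card_mono[OF finZ, of "{\<zero>, \<one>}"] Z01 ne by (simp add: q_def)
    note dim = card_eq_power_of_card[OF finZ Z01(3,1) ne Z01(2) Zring(1,2,3) Zinv]
    obtain n where n: "card (carrier R) = q ^ n"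
      using dim[of "carrier R"] fin Zc(1) by (auto simp: q_def)
    have "\<exists>d. card (C x) = q ^ d" if x: "x \<in> carrier R" for x
      unfolding q_def
    proof (rule dim)
      show "finite (C x)" using fin by (auto simp: C_def)
      show "C x \<subseteq> carrier R" "\<zero> \<in> C x" using x by (auto simp: C_def)
      show "v \<oplus> w \<in> C x" if "v \<in> C x" "w \<in> C x" for v w
        using that x by (auto simp: C_def l_distr r_distr)
      show "z \<otimes> v \<in> C x" if "z \<in> Z" "v \<in> C x" for z v
      proof -
        have c: "v \<in> carrier R" "v \<otimes> x = x \<otimes> v" using that(2) by (auto simp: C_def)
        have "z \<otimes> v \<otimes> x = (z \<otimes> x) \<otimes> v" using c x Zc(1)[OF that(1)] by (simp add: m_assoc)
        also have "\<dots> = (x \<otimes> z) \<otimes> v" using Zc(2)[OF that(1) x] by simp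
        also have "\<dots> = x \<otimes> (z \<otimes> v)" using c x Zc(1)[OF that(1)] by (simp add: m_assoc)
        finally show ?thesis using c Zc(1)[OF that(1)] by (simp add: C_def)
      qed
    qed
    then obtain d where d: "\<And>x. x \<in> carrier R \<Longrightarrow> card (C x) = q ^ d x" by metis
    have cardZ: "q < q ^ n"
      using psubset_card_mono[OF fin, of Z] nZ Z01(3) n by (auto simp: q_def)
    have n2: "n \<ge> 2"
    proof (rule ccontr)
      assume "\<not> n \<ge> 2"
      then have "n = 0 \<or> n = 1" by linarith
      then show False using cardZ q2 by auto
    qed
    obtain c where c: "\<bar>c\<bar> > int q - 1" "c dvd int q ^ n - 1"
      "\<And>d. \<lbrakk>d dvd n; d \<noteq> n\<rbrakk> \<Longrightarrow> c * (int q ^ d - 1) dvd int q ^ n - 1"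
      using cyclotomic_divisor[OF n2 q2] by blast
    let ?G = "units_of R"
    interpret G: group ?G by (rule units_group)
    define \<phi> where "\<phi> = (\<lambda>g. \<lambda>h\<in>carrier ?G. g \<otimes>\<^bsub>?G\<^esub> h \<otimes>\<^bsub>?G\<^esub> inv\<^bsub>?G\<^esub> g)"
    interpret A: group_action ?G "carrier ?G" \<phi>
      unfolding \<phi>_def by (rule G.action_by_conjugation)
    have cG: "carrier ?G = carrier R - {\<zero>}" by (simp add: units_of_carrier U)
    have finG: "finite (carrier ?G)" using fin cG by simp
    have ordG: "order ?G = q ^ n - 1" unfolding order_def cG using n fin by simp
    have act: "\<phi> g h = g \<otimes> h \<otimes> inv g" if "g \<in> Units R" "h \<in> Units R" for g h
      using that by (simp add: \<phi>_def units_of_carrier units_of_mult units_of_inv)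
    have commute_iff: "g \<otimes> h \<otimes> inv g = h \<longleftrightarrow> g \<otimes> h = h \<otimes> g" if g: "g \<in> Units R" and h: "h \<in> carrier R" for g h
    proof
      assume "g \<otimes> h \<otimes> inv g = h"
      then have "h \<otimes> g = g \<otimes> h \<otimes> inv g \<otimes> g" by simp
      then show "g \<otimes> h = h \<otimes> g" using g h Units_closed[OF g] by (simp add: m_assoc)
    next
      assume "g \<otimes> h = h \<otimes> g"
      then show "g \<otimes> h \<otimes> inv g = h" using g h Units_closed[OF g] by (simp add: m_assoc)
    qed
    \<comment> \<open>Under conjugation the stabilizer of x is its centralizer without zero, and the
      centralizer is a vector space over the centre, of size q^d.\<close>
    have stab: "card (stabilizer ?G \<phi> x) = q ^ d x - 1" if x: "x \<in> Units R" for x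
    proof -
      have xc: "x \<in> carrier R" using x by (rule Units_closed)
      have "stabilizer ?G \<phi> x = {g \<in> Units R. \<phi> g x = x}"
        by (simp add: stabilizer_def units_of_carrier)
      also have "\<dots> = {g \<in> Units R. g \<otimes> x = x \<otimes> g}"
      proof (intro Collect_cong conj_cong refl)
        fix g assume g: "g \<in> Units R"
        show "(\<phi> g x = x) = (g \<otimes> x = x \<otimes> g)" unfolding act[OF g x] by (rule commute_iff[OF g xc])
      qed
      also have "\<dots> = C x - {\<zero>}" by (auto simp: U C_def)
      finally have "stabilizer ?G \<phi> x = C x - {\<zero>}" .
      moreover have "\<zero> \<in> C x" using xc by (simp add: C_def)
      moreover have "finite (C x)" using fin by (auto simp: C_def)
      ultimately show ?thesis using d[OF xc] by simp
    qed
    \<comment> \<open>The orbits of the nonzero central elements, which are singletons and account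
      for the term q - 1.\<close>
    define S where "S = (\<lambda>z. {z}) ` (Z - {\<zero>})"
    have orb_central: "orbit ?G \<phi> z = {z}" if "z \<in> Z" "z \<noteq> \<zero>" for z
    proof -
      have zU: "z \<in> Units R" using that Zc U by auto
      have fixed: "\<phi> g z = z" if "g \<in> Units R" for g
        using act[OF that zU] commute_iff[OF that Zc(1)[OF \<open>z \<in> Z\<close>]] Zc(2)[OF \<open>z \<in> Z\<close>, of g] Units_closed[OF that] by simp
      then show ?thesis
        unfolding orbit_def units_of_carrier by (auto simp: fixed intro!: exI[of _ \<one>])
    qed
    have S_orb: "S \<subseteq> orbits ?G (carrier ?G) \<phi>"
      unfolding S_def orbits_def cG using orb_central Zc(1) by fastforce
    have fin_orb: "finite (orbits ?G (carrier ?G) \<phi>)"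
    proof -
      have "orbits ?G (carrier ?G) \<phi> = orbit ?G \<phi> ` carrier ?G" by (auto simp: orbits_def)
      then show ?thesis using finG by simp
    qed
    have part: "partition (carrier ?G) (orbits ?G (carrier ?G) \<phi>)" by (rule A.orbit_partition)
    have card_sum: "card (carrier ?G) = (\<Sum>O'\<in>orbits ?G (carrier ?G) \<phi>. card O')"
      using partition.disjoint_sum[OF part finG, of "\<lambda>_. 1 :: nat"] by simp
    have rest: "c dvd int (card O')" if O': "O' \<in> orbits ?G (carrier ?G) \<phi> - S" for O'
    proof -
      from O' obtain x where x: "x \<in> carrier ?G" "O' = orbit ?G \<phi> x" by (auto simp: orbits_def)
      have xU: "x \<in> Units R" and xc: "x \<in> carrier R" "x \<noteq> \<zero>" using x cG by (auto simp: units_of_carrier)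
      have "x \<notin> Z" using O' x orb_central xc by (auto simp: S_def)
      then obtain y where y: "y \<in> carrier R" "x \<otimes> y \<noteq> y \<otimes> x" using xc by (auto simp: Z_def)
      have "C x \<subseteq> carrier R" "y \<notin> C x" using y by (auto simp: C_def)
      with y have "C x \<subset> carrier R" by blast
      then have "q ^ d x < q ^ n" using psubset_card_mono[OF fin, of "C x"] d[OF xc(1)] n by simp
      then have dn: "d x \<noteq> n" by auto
      \<comment> \<open>The exponent d has to be positive before divisibility can be passed to
        exponents; the centralizer contains 0 and 1, so q^d >= 2.\<close>
      have "{\<zero>, \<one>} \<subseteq> C x" "finite (C x)" using xc fin by (auto simp: C_def)
      then have "2 \<le> q ^ d x" using card_mono[of "C x" "{\<zero>, \<one>}"] d[OF xc(1)] ne by simp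
      then have d0: "d x > 0" by (cases "d x") auto
      have os: "card O' * (q ^ d x - 1) = q ^ n - 1"
        using A.orbit_stabilizer_theorem[OF x(1)] stab[OF xU] x(2) ordG by simp
      then have "q ^ d x - 1 dvd q ^ n - 1" by (metis dvd_triv_right)
      then have "d x dvd n" using power_minus_1_dvd_imp_dvd[OF q2 _ d0] by blast
      then have "c * (int q ^ d x - 1) dvd int q ^ n - 1" using c(3) dn by blast
      moreover have "int q ^ n - 1 = int (card O') * (int q ^ d x - 1)"
        using arg_cong[OF os, of int] q2 by (simp add: of_nat_diff)
      ultimately have "c * (int q ^ d x - 1) dvd int (card O') * (int q ^ d x - 1)" by simp
      moreover have "int q ^ d x - 1 \<noteq> 0"
      proof -
        have "2 \<le> int (q ^ d x)" using \<open>2 \<le> q ^ d x\<close> by linarith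
        then show ?thesis by simp
      qed
      ultimately show ?thesis by simp
    qed
    have "int (card (carrier ?G)) = int (\<Sum>O'\<in>orbits ?G (carrier ?G) \<phi> - S. card O') + int (\<Sum>O'\<in>S. card O')"
      unfolding card_sum using sum.subset_diff[OF S_orb fin_orb, of card] by simp
    moreover have "(\<Sum>O'\<in>S. card O') = q - 1"
    proof -
      have "(\<Sum>O'\<in>S. card O') = (\<Sum>z\<in>Z - {\<zero>}. 1)"
        unfolding S_def by (subst sum.reindex) auto
      then show ?thesis using finZ Z01 by (simp add: q_def)
    qed
    moreover have "c dvd int (\<Sum>O'\<in>orbits ?G (carrier ?G) \<phi> - S. card O')"
      unfolding of_nat_sum by (rule dvd_sum) (rule rest)
    moreover have "c dvd int (card (carrier ?G))"
      using ordG c(2) q2 by (simp add: order_def of_nat_diff)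
    ultimately have "c dvd int (q - 1)" by (metis dvd_add_right_iff)
    then have "\<bar>c\<bar> \<le> int (q - 1)" using q2 dvd_imp_le_int[of "int (q - 1)" c] by simp
    then show False using c(1) q2 by simp
  qed
  then have comm: "x \<otimes> y = y \<otimes> x" if "x \<in> carrier R" "y \<in> carrier R" for x y
    using that unfolding Z_def by blast
  have "cring R" by (intro cring.intro ring_axioms comm_monoid.intro monoid_axioms comm_monoid_axioms.intro comm)
  then show ?thesis using U by (rule cring.cring_fieldI)
qed

section \<open>Finite prime rings\<close>

text \<open>\<open>finsum\<close> depends on the carrier of its structure. The comparison is needed
  because entries of matrix products are summed in the corner field fRf, whereas the computations
  take place in \<open>R\<close>.\<close>

lemma (in abelian_monoid) finsum_carrier_update:
  assumes F: "abelian_monoid F" and D: "carrier F \<subseteq> carrier G" "\<zero>\<^bsub>F\<^esub> = \<zero>"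
    "\<And>x y. \<lbrakk>x \<in> carrier F; y \<in> carrier F\<rbrakk> \<Longrightarrow> x \<oplus>\<^bsub>F\<^esub> y = x \<oplus> y"
    and A: "finite A" "f \<in> A \<rightarrow> carrier F"
  shows "finsum F f A = finsum G f A"
proof -
  interpret F: abelian_monoid F by fact
  show ?thesis using A
  proof (induction A rule: finite_induct)
    case (insert a A)
    then have "f a \<in> carrier F" "f \<in> A \<rightarrow> carrier F" "f a \<in> carrier G" "f \<in> A \<rightarrow> carrier G" using D(1) by auto
    moreover have "finsum G f A \<in> carrier F"
      using insert F.finsum_closed[of f A] by (simp add: Pi_iff)
    ultimately show ?case using insert by (simp add: D)
  qed (simp add: D)
qed

section \<open>Left ideals of finite prime rings\<close>

context nonunital_ring
begin

definition left_ideal :: "'a set \<Rightarrow> bool" where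
  "left_ideal L \<longleftrightarrow> L \<subseteq> carrier R \<and> \<zero> \<in> L \<and> (\<forall>x\<in>L. \<forall>y\<in>L. x \<oplus> y \<in> L) \<and> (\<forall>x\<in>L. \<ominus> x \<in> L) \<and>
     (\<forall>t\<in>carrier R. \<forall>x\<in>L. t \<otimes> x \<in> L)"

lemma left_idealD:
  assumes "left_ideal L"
  shows "\<And>x. x \<in> L \<Longrightarrow> x \<in> carrier R" "\<zero> \<in> L" "\<And>x y. \<lbrakk>x \<in> L; y \<in> L\<rbrakk> \<Longrightarrow> x \<oplus> y \<in> L"
    "\<And>x. x \<in> L \<Longrightarrow> \<ominus> x \<in> L" "\<And>x y. \<lbrakk>x \<in> L; y \<in> L\<rbrakk> \<Longrightarrow> x \<ominus> y \<in> L"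
    "\<And>t x. \<lbrakk>t \<in> carrier R; x \<in> L\<rbrakk> \<Longrightarrow> t \<otimes> x \<in> L"
  using assms unfolding left_ideal_def a_minus_def by (auto simp: subset_iff)

lemma left_ideal_image:
  assumes L: "left_ideal L" and a: "a \<in> carrier R"
  shows "left_ideal ((\<lambda>t. t \<otimes> a) ` L)"
  unfolding left_ideal_def
proof (intro conjI ballI subsetI)
  note LD = left_idealD[OF L]
  show "\<zero> \<in> (\<lambda>t. t \<otimes> a) ` L" using a LD(2) by (intro image_eqI[of _ _ \<zero>]) auto
  fix x assume "x \<in> (\<lambda>t. t \<otimes> a) ` L"
  then obtain t where t: "t \<in> L" "x = t \<otimes> a" by blast
  show "x \<in> carrier R" using t a LD by (simp add: m_closed)
  show "\<ominus> x \<in> (\<lambda>t. t \<otimes> a) ` L"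
    using t a LD by (intro image_eqI[of _ _ "\<ominus> t"]) (auto simp: l_minus)
  fix s assume "s \<in> carrier R"
  then show "s \<otimes> x \<in> (\<lambda>t. t \<otimes> a) ` L"
    using t a LD by (intro image_eqI[of _ _ "s \<otimes> t"]) (auto simp: m_assoc)
next
  note LD = left_idealD[OF L]
  fix x y assume "x \<in> (\<lambda>t. t \<otimes> a) ` L" "y \<in> (\<lambda>t. t \<otimes> a) ` L"
  then obtain t s where "t \<in> L" "x = t \<otimes> a" "s \<in> L" "y = s \<otimes> a" by blast
  then show "x \<oplus> y \<in> (\<lambda>t. t \<otimes> a) ` L"
    using a LD by (intro image_eqI[of _ _ "t \<oplus> s"]) (auto simp: l_distr)
qed

lemma left_ideal_carrier: "left_ideal (carrier R)"
  by (simp add: left_ideal_def m_closed)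

end

text \<open>This is the property enjoyed by the quotient by an ideal that is maximal subject to
  avoiding an element idempotent modulo it. The idempotent excludes zero multiplication, which
  simplicity alone would not do in the absence of a unit.\<close>

locale finite_prime_ring = nonunital_ring +
  fixes e
  assumes fin: "finite (carrier R)"
    and e: "e \<in> carrier R" "e \<noteq> \<zero>" "e \<otimes> e = e"
    and e_min: "\<And>I. \<lbrakk>nonunital_ideal I R; I \<noteq> {\<zero>}\<rbrakk> \<Longrightarrow> e \<in> I"
begin

text \<open>Were the left annihilator \<open>A\<close> of \<open>L\<close> nonzero, both \<open>A\<close> and its right annihilator, which
  contains \<open>L\<close>, would contain \<open>e\<close>.\<close>

lemma left_ideal_faithful:
  assumes L: "left_ideal L" "L \<noteq> {\<zero>}" and t: "t \<in> carrier R" "\<And>b. b \<in> L \<Longrightarrow> t \<otimes> b = \<zero>"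
  shows "t = \<zero>"
proof (rule ccontr)
  assume "t \<noteq> \<zero>"
  note LD = left_idealD[OF L(1)]
  define A where "A = {s \<in> carrier R. \<forall>b\<in>L. s \<otimes> b = \<zero>}"
  define B where "B = {s \<in> carrier R. \<forall>a\<in>A. a \<otimes> s = \<zero>}"
  have A: "nonunital_ideal A R"
    by (rule nonunital_idealI) (auto simp: A_def l_distr l_minus m_assoc m_closed LD)
  have "t \<in> A" using t by (simp add: A_def)
  then have eA: "e \<in> A" using e_min[OF A] \<open>t \<noteq> \<zero>\<close> by auto
  have B: "nonunital_ideal B R"
  proof (rule nonunital_idealI)
    fix x y assume xy: "x \<in> B" "y \<in> carrier R"
    then have x: "x \<in> carrier R" "\<And>a. a \<in> A \<Longrightarrow> a \<otimes> x = \<zero>" by (auto simp: B_def)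
    have a: "a \<in> carrier R" "a \<otimes> y \<in> A" if "a \<in> A" for a
      using that nonunital_idealD[OF A] xy(2) by (auto simp: A_def)
    have "a \<otimes> (y \<otimes> x) = \<zero>" if "a \<in> A" for a
      using a[OF that] x xy(2) by (simp flip: m_assoc)
    then show "y \<otimes> x \<in> B" using x xy by (simp add: B_def m_closed)
    have "a \<otimes> (x \<otimes> y) = \<zero>" if "a \<in> A" for a
      using a[OF that] x(1) x(2)[OF that] xy(2) by (simp flip: m_assoc)
    then show "x \<otimes> y \<in> B" using x xy by (simp add: B_def m_closed)
  qed (auto simp: B_def A_def r_distr r_minus)
  obtain b where "b \<in> L" "b \<noteq> \<zero>" using L(2) LD(2) by auto
  then have "b \<in> B" using LD by (auto simp: B_def A_def)
  then have "e \<in> B" using e_min[OF B] \<open>b \<noteq> \<zero>\<close> by auto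
  then show False using eA e by (auto simp: B_def)
qed

text \<open>A nonzero left ideal of least size exists by finiteness; the whole ring is a candidate
  since it contains \<open>e\<close>.\<close>

lemma minimal_left_ideal:
  obtains L where "left_ideal L" "L \<noteq> {\<zero>}" "\<And>M. \<lbrakk>left_ideal M; M \<subseteq> L; M \<noteq> {\<zero>}\<rbrakk> \<Longrightarrow> M = L"
proof -
  have "left_ideal (carrier R) \<and> carrier R \<noteq> {\<zero>}" using left_ideal_carrier e by auto
  then obtain L where L: "left_ideal L \<and> L \<noteq> {\<zero>}"
      "\<And>M. left_ideal M \<and> M \<noteq> {\<zero>} \<Longrightarrow> card L \<le> card M"
    using ex_has_least_nat[of "\<lambda>L. left_ideal L \<and> L \<noteq> {\<zero>}" _ card] by metis
  show thesis
  proof (rule that[of L])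
    fix M assume M: "left_ideal M" "M \<subseteq> L" "M \<noteq> {\<zero>}"
    have "finite L" using L(1) fin by (auto simp: left_ideal_def intro: finite_subset)
    then show "M = L" using M L(2)[of M] by (meson card_seteq)
  qed (use L in auto)
qed

text \<open>Brauer's lemma. A minimal left ideal L does not annihilate itself, so La = L for some a
  in L. The f in L with fa = a is idempotent, because f^2 - f lies in the annihilator of a within L,
  and that is zero by minimality. The condition \<open>v \<otimes> f = v\<close> describes
  membership in L = Rf, so the last two conclusions say that every nonzero element generates L and
  that \<open>R\<close> acts faithfully on L.\<close>

lemma division_corner:
  obtains f where "f \<in> carrier R" "f \<noteq> \<zero>" "f \<otimes> f = f"
    "\<forall>v\<in>carrier R. v \<otimes> f = v \<and> v \<noteq> \<zero> \<longrightarrow> (\<exists>t\<in>carrier R. t \<otimes> v = f)"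
    "\<forall>t\<in>carrier R. (\<forall>v\<in>carrier R. v \<otimes> f = v \<longrightarrow> t \<otimes> v = \<zero>) \<longrightarrow> t = \<zero>"
proof -
  obtain L where L: "left_ideal L" "L \<noteq> {\<zero>}" and Lmin: "\<And>M. \<lbrakk>left_ideal M; M \<subseteq> L; M \<noteq> {\<zero>}\<rbrakk> \<Longrightarrow> M = L"
    by (rule minimal_left_ideal) blast
  note LD = left_idealD[OF L(1)]
  obtain b where b: "b \<in> L" "b \<noteq> \<zero>" using L(2) LD(2) by auto
  then obtain a where a: "a \<in> L" "b \<otimes> a \<noteq> \<zero>"
    using left_ideal_faithful[OF L, of b] LD(1) by blast
  have a0: "a \<noteq> \<zero>" using a b LD(1) by auto
  have "(\<lambda>t. t \<otimes> a) ` L = L"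
  proof (rule Lmin)
    show "left_ideal ((\<lambda>t. t \<otimes> a) ` L)" using left_ideal_image L(1) a(1) LD(1) by blast
    show "(\<lambda>t. t \<otimes> a) ` L \<subseteq> L" using LD a by auto
    show "(\<lambda>t. t \<otimes> a) ` L \<noteq> {\<zero>}" using a b by auto
  qed
  then obtain f where f: "f \<in> L" "f \<otimes> a = a" using a by (metis (no_types, lifting) imageE)
  have fc: "f \<in> carrier R" and ac: "a \<in> carrier R" using f a LD by auto
  define K where "K = {x \<in> L. x \<otimes> a = \<zero>}"
  have "left_ideal K"
    unfolding left_ideal_def K_def using LD ac
    by (auto simp: l_distr l_minus m_assoc)
  moreover have "K \<noteq> L" using a(2) b(1) by (auto simp: K_def)
  ultimately have K: "K = {\<zero>}" using Lmin[of K] by (auto simp: K_def)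
  have "(f \<otimes> f \<ominus> f) \<otimes> a = \<zero>"
    using fc ac f(2) by (simp add: minus_l_distr m_assoc m_closed minus_eq_zero_iff)
  then have "f \<otimes> f \<ominus> f \<in> K" using f LD by (simp add: K_def)
  then have ff: "f \<otimes> f = f" using K fc minus_eq_zero_iff[of "f \<otimes> f" f] m_closed by simp
  have f0: "f \<noteq> \<zero>" using f(2) a0 ac by auto
  have Lv: "(\<lambda>t. t \<otimes> v) ` carrier R = L" if v: "v \<in> L" "v \<noteq> \<zero>" for v
  proof (rule Lmin)
    show "left_ideal ((\<lambda>t. t \<otimes> v) ` carrier R)" using left_ideal_image left_ideal_carrier v LD(1) by blast
    show "(\<lambda>t. t \<otimes> v) ` carrier R \<subseteq> L" using LD v by auto
    show "(\<lambda>t. t \<otimes> v) ` carrier R \<noteq> {\<zero>}"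
    proof
      assume *: "(\<lambda>t. t \<otimes> v) ` carrier R = {\<zero>}"
      \<comment> \<open>The elements of \<open>L\<close> killed by all of \<open>R\<close> from the
        left form a left ideal. It cannot be all of \<open>L\<close>, since f = ff is
        nonzero.\<close>
      define N where "N = {w \<in> L. \<forall>t\<in>carrier R. t \<otimes> w = \<zero>}"
      have "left_ideal N"
        unfolding left_ideal_def N_def using LD
        by (auto simp: r_distr r_minus)
      moreover have "v \<in> N" using v * by (auto simp: N_def)
      ultimately have "N = L" using Lmin[of N] v by (auto simp: N_def)
      then have "f \<in> N" using f by simp
      then show False using fc ff f0 by (simp add: N_def)
    qed
  qed
  have Lf: "v \<in> L \<longleftrightarrow> v \<in> carrier R \<and> v \<otimes> f = v" for v
  proof
    assume "v \<in> L"
    then obtain t where "t \<in> carrier R" "v = t \<otimes> f" using Lv[OF f(1) f0] by blast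
    then show "v \<in> carrier R \<and> v \<otimes> f = v" using fc ff by (simp add: m_closed m_assoc)
  next
    assume "v \<in> carrier R \<and> v \<otimes> f = v"
    then show "v \<in> L" using LD(6)[of v f] f by simp
  qed
  show thesis
  proof (rule that[OF fc f0 ff])
    show "\<forall>v\<in>carrier R. v \<otimes> f = v \<and> v \<noteq> \<zero> \<longrightarrow> (\<exists>t\<in>carrier R. t \<otimes> v = f)"
    proof (intro ballI impI)
      fix v assume "v \<in> carrier R" "v \<otimes> f = v \<and> v \<noteq> \<zero>"
      then have "f \<in> (\<lambda>t. t \<otimes> v) ` carrier R" using Lv[of v] Lf f(1) by simp
      then show "\<exists>t\<in>carrier R. t \<otimes> v = f" by auto
    qed
    show "\<forall>t\<in>carrier R. (\<forall>v\<in>carrier R. v \<otimes> f = v \<longrightarrow> t \<otimes> v = \<zero>) \<longrightarrow> t = \<zero>"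
    proof (intro ballI impI)
      fix t assume "t \<in> carrier R" "\<forall>v\<in>carrier R. v \<otimes> f = v \<longrightarrow> t \<otimes> v = \<zero>"
      then show "t = \<zero>" using left_ideal_faithful[OF L, of t] Lf by simp
    qed
  qed
qed

end

lemma (in abelian_monoid) finsum_delta:
  assumes "finite A" "i \<in> A" "f i \<in> carrier G"
  shows "(\<Oplus>j\<in>A. if j = i then f j else \<zero>) = f i"
proof -
  have "(\<Oplus>j\<in>A. if j = i then f j else \<zero>) = (\<Oplus>j\<in>A. if i = j then f i else \<zero>)"
    using assms by (intro finsum_cong') auto
  also have "\<dots> = f i" using finsum_singleton[OF assms(2,1), of "\<lambda>_. f i"] assms by simp
  finally show ?thesis .
qed

lemma matrix_ring_simps:
  "carrier (matrix_ring F k) = {..<k} \<times> {..<k} \<rightarrow>\<^sub>E carrier F"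
  "A \<oplus>\<^bsub>matrix_ring F k\<^esub> B = (\<lambda>p\<in>{..<k} \<times> {..<k}. A p \<oplus>\<^bsub>F\<^esub> B p)"
  "A \<otimes>\<^bsub>matrix_ring F k\<^esub> B = (\<lambda>(i, j)\<in>{..<k} \<times> {..<k}. \<Oplus>\<^bsub>F\<^esub>l\<in>{..<k}. A (i, l) \<otimes>\<^bsub>F\<^esub> B (l, j))"
  "\<zero>\<^bsub>matrix_ring F k\<^esub> = (\<lambda>_\<in>{..<k} \<times> {..<k}. \<zero>\<^bsub>F\<^esub>)"
  by (simp_all add: matrix_ring_def)

section \<open>Reconstruction of a finite prime ring as a matrix ring\<close>

context finite_prime_ring
begin

text \<open>A finite simple ring is reconstructed from dual bases of \<open>Rf\<close> and \<open>fR\<close> with respect to the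
  pairing \<open>fR \<times> Rf \<rightarrow> fRf\<close>: if \<open>g\<^sub>i v\<^sub>j = \<delta>\<^sub>i\<^sub>j f\<close> and the families are maximal, then
  \<open>\<Sum> v\<^sub>i g\<^sub>i\<close> is an identity of \<open>R\<close>, and \<open>t \<mapsto> (g\<^sub>i t v\<^sub>j)\<close> is an isomorphism.\<close>

lemma dual_bases:
  assumes f: "f \<in> carrier R" "f \<noteq> \<zero>" "f \<otimes> f = f"
    and inv_ex: "\<forall>v\<in>carrier R. v \<otimes> f = v \<and> v \<noteq> \<zero> \<longrightarrow> (\<exists>t\<in>carrier R. t \<otimes> v = f)"
    and faithful_ex: "\<forall>t\<in>carrier R. (\<forall>v\<in>carrier R. v \<otimes> f = v \<longrightarrow> t \<otimes> v = \<zero>) \<longrightarrow> t = \<zero>"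
  obtains k :: nat and v g where "k \<ge> 1"
    "\<forall>i<k. v i \<in> carrier R \<and> v i \<otimes> f = v i \<and> g i \<in> carrier R \<and> f \<otimes> g i = g i"
    "\<forall>i<k. \<forall>j<k. g i \<otimes> v j = (if i = j then f else \<zero>)"
    "\<forall>t\<in>carrier R. (\<Oplus>i\<in>{..<k}. v i \<otimes> g i) \<otimes> t = t \<and> t \<otimes> (\<Oplus>i\<in>{..<k}. v i \<otimes> g i) = t"
proof -
  have inv: "\<exists>t\<in>carrier R. t \<otimes> v = f" if "v \<in> carrier R" "v \<otimes> f = v" "v \<noteq> \<zero>" for v
    using inv_ex that by blast
  have faithful: "t = \<zero>" if "t \<in> carrier R" "\<And>v. \<lbrakk>v \<in> carrier R; v \<otimes> f = v\<rbrakk> \<Longrightarrow> t \<otimes> v = \<zero>" for t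
    using faithful_ex that by blast
  define P where "P k v g \<longleftrightarrow> (\<forall>i<k. v i \<in> carrier R \<and> v i \<otimes> f = v i \<and> g i \<in> carrier R \<and> f \<otimes> g i = g i) \<and>
    (\<forall>i<k. \<forall>j<k. g i \<otimes> v j = (if i = j then f else \<zero>))" for k :: nat and v g
  define K where "K = {k. \<exists>v g. P k v g}"
  \<comment> \<open>The \<open>v i\<close> are pairwise distinct, because \<open>g i\<close> sends
    \<open>v i\<close> to f and the others to zero; hence there is a longest pair of dual
    families.\<close>
  have bound: "k \<le> card (carrier R)" if "P k v g" for k v g
  proof -
    have "inj_on v {..<k}"
    proof (rule inj_onI, rule ccontr)
      fix i j assume ij: "i \<in> {..<k}" "j \<in> {..<k}" "v i = v j" "i \<noteq> j"
      have "g i \<otimes> v i = f" "g i \<otimes> v j = \<zero>" using that ij(1,2,4) unfolding P_def by auto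
      then show False using ij(3) f(2) by simp
    qed
    moreover have "v ` {..<k} \<subseteq> carrier R" using that unfolding P_def by auto
    ultimately show ?thesis using card_inj_on_le[of v "{..<k}" "carrier R"] fin by simp
  qed
  have "K \<subseteq> {..card (carrier R)}"
  proof
    fix k assume "k \<in> K"
    then obtain v g where "P k v g" unfolding K_def by blast
    then show "k \<in> {..card (carrier R)}" using bound[of k v g] by simp
  qed
  then have finK: "finite K" by (rule finite_subset) simp
  have "P 0 (\<lambda>_. f) (\<lambda>_. f)" by (simp add: P_def)
  then have "0 \<in> K" unfolding K_def by blast
  define k where "k = Max K"
  have "k \<in> K" unfolding k_def using finK \<open>0 \<in> K\<close> by (intro Max_in) auto
  then obtain v g where P: "P k v g" unfolding K_def by blast
  have max: "\<not> P (Suc k) v' g'" for v' g'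
  proof
    assume "P (Suc k) v' g'"
    then have "Suc k \<in> K" unfolding K_def by blast
    then show False using Max_ge[OF finK, of "Suc k"] by (simp add: k_def)
  qed
  have v: "\<And>i. i < k \<Longrightarrow> v i \<in> carrier R" "\<And>i. i < k \<Longrightarrow> v i \<otimes> f = v i"
    and g: "\<And>i. i < k \<Longrightarrow> g i \<in> carrier R" "\<And>i. i < k \<Longrightarrow> f \<otimes> g i = g i"
    and gv: "\<And>i j. \<lbrakk>i < k; j < k\<rbrakk> \<Longrightarrow> g i \<otimes> v j = (if i = j then f else \<zero>)"
    using P unfolding P_def by auto
  define u where "u = (\<Oplus>i\<in>{..<k}. v i \<otimes> g i)"
  have uc: "u \<in> carrier R" unfolding u_def using v g m_closed by (intro finsum_closed) auto
  have gu: "g j \<otimes> u = g j" if j: "j < k" for j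
  proof -
    have "g j \<otimes> u = (\<Oplus>i\<in>{..<k}. g j \<otimes> (v i \<otimes> g i))"
      unfolding u_def using v g j m_closed by (intro m_finsum_rdistr) auto
    also have "\<dots> = (\<Oplus>i\<in>{..<k}. if i = j then g i else \<zero>)"
      using v g j gv by (intro finsum_cong') (auto simp: m_assoc[symmetric])
    also have "\<dots> = g j" using j g by (intro finsum_delta) auto
    finally show ?thesis .
  qed
  have uw: "u \<otimes> w = w" if w: "w \<in> carrier R" "w \<otimes> f = w" for w
  proof (rule ccontr)
    assume "u \<otimes> w \<noteq> w"
    \<comment> \<open>This w' would be a nonzero element of Rf killed by all \<open>g j\<close>.
      Some h has hw' = f, and subtracting from h its components along the \<open>g i\<close> makes
      it vanish on all \<open>v i\<close>. The corrected h together with w' would prolong the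
      families.\<close>
    define w' where "w' = w \<ominus> u \<otimes> w"
    have w'c: "w' \<in> carrier R" using w uc by (simp add: w'_def m_closed)
    have w'0: "w' \<noteq> \<zero>" using \<open>u \<otimes> w \<noteq> w\<close> w uc minus_eq_zero_iff[of w "u \<otimes> w"] by (auto simp: w'_def m_closed)
    have w'f: "w' \<otimes> f = w'" unfolding w'_def using w uc f by (simp add: minus_l_distr m_assoc m_closed)
    have gw': "g j \<otimes> w' = \<zero>" if "j < k" for j
    proof -
      have "g j \<otimes> w' = g j \<otimes> w \<ominus> (g j \<otimes> u) \<otimes> w"
        unfolding w'_def using that w uc g by (simp add: minus_r_distr m_assoc m_closed)
      then show ?thesis using gu[OF that] g[OF that] w by (simp add: minus_eq_zero_iff m_closed)
    qed
    obtain t where t: "t \<in> carrier R" "t \<otimes> w' = f" using inv[OF w'c w'f w'0] by blast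
    define h where "h = f \<otimes> t"
    have h: "h \<in> carrier R" "f \<otimes> h = h" "h \<otimes> w' = f"
      using t f w'c by (simp_all add: h_def m_closed m_assoc) (simp add: m_assoc[symmetric] f)
    define h' where "h' = h \<ominus> (\<Oplus>i\<in>{..<k}. (h \<otimes> v i) \<otimes> g i)"
    have Sc: "(\<Oplus>i\<in>{..<k}. (h \<otimes> v i) \<otimes> g i) \<in> carrier R"
      using h v g m_closed by (intro finsum_closed) auto
    have h'c: "h' \<in> carrier R" using Sc h by (simp add: h'_def)
    have fh': "f \<otimes> h' = h'"
    proof -
      have "f \<otimes> (\<Oplus>i\<in>{..<k}. (h \<otimes> v i) \<otimes> g i) = (\<Oplus>i\<in>{..<k}. f \<otimes> ((h \<otimes> v i) \<otimes> g i))"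
        using h v g f m_closed by (intro m_finsum_rdistr) auto
      also have "\<dots> = (\<Oplus>i\<in>{..<k}. (h \<otimes> v i) \<otimes> g i)"
      proof (intro finsum_cong' refl)
        fix i assume "i \<in> {..<k}"
        then have "f \<otimes> ((h \<otimes> v i) \<otimes> g i) = ((f \<otimes> h) \<otimes> v i) \<otimes> g i"
          using f(1) h(1) v g by (simp add: m_assoc m_closed)
        then show "f \<otimes> ((h \<otimes> v i) \<otimes> g i) = (h \<otimes> v i) \<otimes> g i" using h(2) by simp
      qed (use h v g m_closed in auto)
      finally show ?thesis unfolding h'_def using f h Sc by (simp add: minus_r_distr)
    qed
    have h'v: "h' \<otimes> v j = \<zero>" if j: "j < k" for j
    proof -
      have "(\<Oplus>i\<in>{..<k}. (h \<otimes> v i) \<otimes> g i) \<otimes> v j = (\<Oplus>i\<in>{..<k}. ((h \<otimes> v i) \<otimes> g i) \<otimes> v j)"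
        using h v g j m_closed by (intro m_finsum_ldistr) auto
      also have "\<dots> = (\<Oplus>i\<in>{..<k}. if i = j then h \<otimes> v i else \<zero>)"
        using h v g gv j f by (intro finsum_cong') (auto simp: m_assoc m_closed)
      also have "\<dots> = h \<otimes> v j" using j h v m_closed by (intro finsum_delta) auto
      finally show ?thesis unfolding h'_def
        using h v[OF j] Sc by (simp add: minus_l_distr minus_eq_zero_iff m_closed)
    qed
    have h'w': "h' \<otimes> w' = f"
    proof -
      have "(\<Oplus>i\<in>{..<k}. (h \<otimes> v i) \<otimes> g i) \<otimes> w' = (\<Oplus>i\<in>{..<k}. ((h \<otimes> v i) \<otimes> g i) \<otimes> w')"
        using h v g w'c m_closed by (intro m_finsum_ldistr) auto
      also have "\<dots> = (\<Oplus>i\<in>{..<k}. \<zero>)"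
        using h v g w'c gw' by (intro finsum_cong') (auto simp: m_assoc m_closed)
      finally have "(\<Oplus>i\<in>{..<k}. (h \<otimes> v i) \<otimes> g i) \<otimes> w' = \<zero>" by simp
      then show ?thesis unfolding h'_def
        using h Sc w'c f by (simp add: a_minus_def l_distr l_minus)
    qed
    have "P (Suc k) (v(k := w')) (g(k := h'))"
      unfolding P_def less_Suc_eq using v g gv w'c w'f h'c fh' gw' h'v h'w' by auto
    then show False by (rule notE[OF max])
  qed
  have ut: "u \<otimes> t = t" if t: "t \<in> carrier R" for t
  proof -
    have "u \<otimes> t \<ominus> t = \<zero>"
    proof (rule faithful)
      fix w assume w: "w \<in> carrier R" "w \<otimes> f = w"
      have "u \<otimes> (t \<otimes> w) = t \<otimes> w" using w t f by (intro uw) (simp_all add: m_assoc m_closed)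
      then show "(u \<otimes> t \<ominus> t) \<otimes> w = \<zero>" using w t uc by (simp add: minus_l_distr m_assoc m_closed minus_eq_zero_iff)
    qed (use t uc in \<open>simp add: m_closed\<close>)
    then show ?thesis using t uc minus_eq_zero_iff[of "u \<otimes> t" t] m_closed by simp
  qed
  have tu: "t \<otimes> u = t" if t: "t \<in> carrier R" for t
  proof -
    have "t \<otimes> u \<ominus> t = \<zero>"
    proof (rule faithful)
      fix w assume w: "w \<in> carrier R" "w \<otimes> f = w"
      then show "(t \<otimes> u \<ominus> t) \<otimes> w = \<zero>" using t uc uw[OF w] by (simp add: minus_l_distr m_assoc m_closed minus_eq_zero_iff)
    qed (use t uc in \<open>simp add: m_closed\<close>)
    then show ?thesis using t uc minus_eq_zero_iff[of "t \<otimes> u" t] m_closed by simp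
  qed
  have "k \<noteq> 0"
  proof
    assume "k = 0"
    then have "u = \<zero>" by (simp add: u_def)
    then show False using ut[OF f(1)] f by simp
  qed
  then have "k \<ge> 1" by simp
  then show thesis
  proof (rule that)
    show "\<forall>i<k. v i \<in> carrier R \<and> v i \<otimes> f = v i \<and> g i \<in> carrier R \<and> f \<otimes> g i = g i"
      using v g by simp
    show "\<forall>i<k. \<forall>j<k. g i \<otimes> v j = (if i = j then f else \<zero>)" using gv by simp
    show "\<forall>t\<in>carrier R. (\<Oplus>i\<in>{..<k}. v i \<otimes> g i) \<otimes> t = t \<and> t \<otimes> (\<Oplus>i\<in>{..<k}. v i \<otimes> g i) = t"
      using ut tu unfolding u_def by simp
  qed
qed

text \<open>If tx = f, then ftf is a left inverse of x in fRf. So fRf is a finite division ring, and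
  Wedderburn's little theorem applies.\<close>

lemma corner_field:
  assumes f: "f \<in> carrier R" "f \<noteq> \<zero>" "f \<otimes> f = f"
    and inv_ex: "\<forall>v\<in>carrier R. v \<otimes> f = v \<and> v \<noteq> \<zero> \<longrightarrow> (\<exists>t\<in>carrier R. t \<otimes> v = f)"
  shows "field \<lparr>carrier = {x \<in> carrier R. f \<otimes> x = x \<and> x \<otimes> f = x}, monoid.mult = (\<otimes>), monoid.one = f,
    ring.zero = \<zero>, ring.add = (\<oplus>)\<rparr>" (is "field ?F")
proof -
  have fm: "f \<otimes> (x \<otimes> y) = x \<otimes> y" if "x \<in> carrier R" "f \<otimes> x = x" "y \<in> carrier R" for x y
    using that f(1) by (metis m_assoc)
  have "abelian_group ?F"
  proof (rule abelian_groupI)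
    fix x assume "x \<in> carrier ?F"
    then show "\<exists>y\<in>carrier ?F. y \<oplus>\<^bsub>?F\<^esub> x = \<zero>\<^bsub>?F\<^esub>"
      using f by (intro bexI[of _ "\<ominus> x"]) (auto simp: l_minus r_minus l_neg)
  qed (use f in \<open>auto simp: l_distr r_distr a_ac\<close>)
  moreover have "monoid ?F"
    by (rule monoidI) (use f in \<open>auto simp: m_assoc m_closed fm\<close>)
  ultimately interpret F: ring ?F
    by (rule ringI) (auto simp: l_distr r_distr)
  show ?thesis
  proof (rule F.finite_division_ring_imp_field)
    show "finite (carrier ?F)" using fin by simp
    show "\<one>\<^bsub>?F\<^esub> \<noteq> \<zero>\<^bsub>?F\<^esub>" using f by simp
    fix x assume "x \<in> carrier ?F" "x \<noteq> \<zero>\<^bsub>?F\<^esub>"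
    then have x: "x \<in> carrier R" "f \<otimes> x = x" "x \<otimes> f = x" "x \<noteq> \<zero>" by auto
    then obtain t where t: "t \<in> carrier R" "t \<otimes> x = f" using inv_ex by blast
    have "(f \<otimes> t \<otimes> f) \<otimes> x = f" using x t f by (simp add: m_assoc m_closed)
    moreover have "f \<otimes> (f \<otimes> t \<otimes> f) = f \<otimes> t \<otimes> f" "(f \<otimes> t \<otimes> f) \<otimes> f = f \<otimes> t \<otimes> f"
      using t f by (simp_all add: m_assoc m_closed fm)
    ultimately show "\<exists>y\<in>carrier ?F. y \<otimes>\<^bsub>?F\<^esub> x = \<one>\<^bsub>?F\<^esub>"
      using t f by (intro bexI[of _ "f \<otimes> t \<otimes> f"]) (auto simp: m_closed)
  qed
qed

theorem isomorphic_to_matrix_ring: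
  obtains F :: "'a ring" and k h where "field F" "finite (carrier F)" "k \<ge> 1"
    "h \<in> nonunital_hom R (matrix_ring F k)" "bij_betw h (carrier R) (carrier (matrix_ring F k))"
proof -
  obtain f where f: "f \<in> carrier R" "f \<noteq> \<zero>" "f \<otimes> f = f"
    and inv: "\<forall>v\<in>carrier R. v \<otimes> f = v \<and> v \<noteq> \<zero> \<longrightarrow> (\<exists>t\<in>carrier R. t \<otimes> v = f)"
    and faithful: "\<forall>t\<in>carrier R. (\<forall>v\<in>carrier R. v \<otimes> f = v \<longrightarrow> t \<otimes> v = \<zero>) \<longrightarrow> t = \<zero>"
    using division_corner .
  obtain k :: nat and v g where k: "k \<ge> 1"
    and vg: "\<forall>i<k. v i \<in> carrier R \<and> v i \<otimes> f = v i \<and> g i \<in> carrier R \<and> f \<otimes> g i = g i"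
    and dual: "\<forall>i<k. \<forall>j<k. g i \<otimes> v j = (if i = j then f else \<zero>)"
    and ident: "\<forall>t\<in>carrier R. (\<Oplus>i\<in>{..<k}. v i \<otimes> g i) \<otimes> t = t \<and> t \<otimes> (\<Oplus>i\<in>{..<k}. v i \<otimes> g i) = t"
    using dual_bases[OF f inv faithful] .
  have v: "v i \<in> carrier R" "v i \<otimes> f = v i" and g: "g i \<in> carrier R" "f \<otimes> g i = g i" if "i < k" for i
    using vg that by auto
  have gv: "g i \<otimes> v j = (if i = j then f else \<zero>)" if "i < k" "j < k" for i j
    using dual that by blast
  have ut: "(\<Oplus>i\<in>{..<k}. v i \<otimes> g i) \<otimes> t = t" and tu: "t \<otimes> (\<Oplus>i\<in>{..<k}. v i \<otimes> g i) = t"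
    if "t \<in> carrier R" for t
    using ident that by auto
  define F where "F = \<lparr>carrier = {x \<in> carrier R. f \<otimes> x = x \<and> x \<otimes> f = x}, monoid.mult = (\<otimes>), monoid.one = f,
    ring.zero = \<zero>, ring.add = (\<oplus>)\<rparr>"
  have F: "field F" unfolding F_def using corner_field[OF f inv] .
  interpret F: field F by (rule F)
  have Fsimps: "carrier F = {x \<in> carrier R. f \<otimes> x = x \<and> x \<otimes> f = x}"
    "x \<otimes>\<^bsub>F\<^esub> y = x \<otimes> y" "x \<oplus>\<^bsub>F\<^esub> y = x \<oplus> y" "\<zero>\<^bsub>F\<^esub> = \<zero>" for x y
    by (simp_all add: F_def)
  have Fsum: "finsum F x A = finsum R x A" if "finite A" "x \<in> A \<rightarrow> carrier F" for x and A :: "nat set"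
    by (rule finsum_carrier_update[OF F.abelian_monoid_axioms]) (use that in \<open>auto simp: Fsimps\<close>)
  define u where "u = (\<Oplus>i\<in>{..<k}. v i \<otimes> g i)"
  have gtv: "g i \<otimes> t \<otimes> v j \<in> carrier F" if "t \<in> carrier R" "i < k" "j < k" for t i j
  proof -
    have "f \<otimes> (g i \<otimes> t \<otimes> v j) = (f \<otimes> g i) \<otimes> t \<otimes> v j"
      using that f(1) v(1) g(1) by (simp add: m_assoc m_closed)
    moreover have "(g i \<otimes> t \<otimes> v j) \<otimes> f = g i \<otimes> t \<otimes> v j"
      using that f v g by (simp add: m_assoc m_closed)
    ultimately show ?thesis using that f v g by (simp add: Fsimps m_closed)
  qed
  define h where "h = (\<lambda>t. \<lambda>(i, j)\<in>{..<k} \<times> {..<k}. g i \<otimes> t \<otimes> v j)"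
  have h_eq: "h t (i, j) = g i \<otimes> t \<otimes> v j" if "i < k" "j < k" for t i j
    using that by (simp add: h_def)
  have hc: "h t \<in> carrier (matrix_ring F k)" if "t \<in> carrier R" for t
    using that gtv by (auto simp: h_def matrix_ring_simps)
  have "h \<in> nonunital_hom R (matrix_ring F k)"
    unfolding nonunital_hom_def
  proof (intro CollectI conjI ballI Pi_I hc)
    fix s t assume st: "s \<in> carrier R" "t \<in> carrier R"
    show "h (s \<oplus> t) = h s \<oplus>\<^bsub>matrix_ring F k\<^esub> h t"
      using st v g by (auto simp: h_def matrix_ring_simps Fsimps r_distr l_distr m_closed intro!: restrict_ext)
    \<comment> \<open>The identity u, the sum of the \<open>v l \<otimes> g l\<close>, is inserted
      between s and t; this turns the product into a matrix product.\<close>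
    have "g i \<otimes> (s \<otimes> t) \<otimes> v j = (\<Oplus>\<^bsub>F\<^esub>l\<in>{..<k}. h s (i, l) \<otimes>\<^bsub>F\<^esub> h t (l, j))" if ij: "i < k" "j < k" for i j
    proof -
      have "(\<Oplus>\<^bsub>F\<^esub>l\<in>{..<k}. h s (i, l) \<otimes>\<^bsub>F\<^esub> h t (l, j)) = (\<Oplus>\<^bsub>F\<^esub>l\<in>{..<k}. (g i \<otimes> s \<otimes> v l) \<otimes>\<^bsub>F\<^esub> (g l \<otimes> t \<otimes> v j))"
        using ij st gtv by (intro F.finsum_cong') (auto simp: h_eq)
      also have "\<dots> = (\<Oplus>l\<in>{..<k}. (g i \<otimes> s \<otimes> v l) \<otimes> (g l \<otimes> t \<otimes> v j))"
        using ij st gtv F.m_closed by (subst Fsum) (auto simp: Fsimps(2))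
      also have "\<dots> = (\<Oplus>l\<in>{..<k}. (g i \<otimes> s) \<otimes> (v l \<otimes> g l) \<otimes> (t \<otimes> v j))"
        using ij st v g by (intro finsum_cong') (auto simp: m_assoc m_closed)
      also have "\<dots> = (\<Oplus>l\<in>{..<k}. (g i \<otimes> s) \<otimes> (v l \<otimes> g l)) \<otimes> (t \<otimes> v j)"
        using ij st v g by (intro m_finsum_ldistr[symmetric]) (auto simp: m_closed)
      also have "(\<Oplus>l\<in>{..<k}. (g i \<otimes> s) \<otimes> (v l \<otimes> g l)) = (g i \<otimes> s) \<otimes> u"
        unfolding u_def using ij st v g by (intro m_finsum_rdistr[symmetric]) (auto simp: m_closed)
      also have "\<dots> = g i \<otimes> s" unfolding u_def using ij st g by (intro tu) (simp add: m_closed)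
      finally show ?thesis using ij st v g by (simp add: m_assoc m_closed)
    qed
    then show "h (s \<otimes> t) = h s \<otimes>\<^bsub>matrix_ring F k\<^esub> h t"
      by (auto simp: h_def matrix_ring_simps intro!: restrict_ext)
  qed
  moreover have "bij_betw h (carrier R) (carrier (matrix_ring F k))"
  proof (rule bij_betwI')
    fix s t assume st: "s \<in> carrier R" "t \<in> carrier R"
    show "(h s = h t) \<longleftrightarrow> (s = t)"
    proof
      assume "h s = h t"
      then have eq: "g i \<otimes> s \<otimes> v j = g i \<otimes> t \<otimes> v j" if "i < k" "j < k" for i j
        using h_eq[OF that] by metis
      \<comment> \<open>Expanding x = uxu recovers x from its entries, which gives
        injectivity.\<close>
      have ux: "x = (\<Oplus>i\<in>{..<k}. (\<Oplus>j\<in>{..<k}. v i \<otimes> (g i \<otimes> x \<otimes> v j) \<otimes> g j))" if x: "x \<in> carrier R" for x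
      proof -
        have "x = (u \<otimes> x) \<otimes> u" using ut tu x unfolding u_def by simp
        also have "u \<otimes> x = (\<Oplus>i\<in>{..<k}. v i \<otimes> g i \<otimes> x)"
          unfolding u_def using x v g by (intro m_finsum_ldistr) (auto simp: m_closed)
        also have "(\<Oplus>i\<in>{..<k}. v i \<otimes> g i \<otimes> x) \<otimes> u = (\<Oplus>i\<in>{..<k}. v i \<otimes> g i \<otimes> x \<otimes> u)"
          using x v g by (intro m_finsum_ldistr) (auto simp: m_closed u_def intro!: finsum_closed)
        also have "\<dots> = (\<Oplus>i\<in>{..<k}. (\<Oplus>j\<in>{..<k}. v i \<otimes> (g i \<otimes> x \<otimes> v j) \<otimes> g j))"
        proof (intro finsum_cong' refl)
          fix i assume i: "i \<in> {..<k}"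
          have "v i \<otimes> g i \<otimes> x \<otimes> u = (\<Oplus>j\<in>{..<k}. v i \<otimes> g i \<otimes> x \<otimes> (v j \<otimes> g j))"
            unfolding u_def using i x v g by (intro m_finsum_rdistr) (auto simp: m_closed)
          also have "\<dots> = (\<Oplus>j\<in>{..<k}. v i \<otimes> (g i \<otimes> x \<otimes> v j) \<otimes> g j)"
            using i x v g by (intro finsum_cong') (auto simp: m_assoc m_closed)
          finally show "v i \<otimes> g i \<otimes> x \<otimes> u = (\<Oplus>j\<in>{..<k}. v i \<otimes> (g i \<otimes> x \<otimes> v j) \<otimes> g j)" .
        qed (use x v g in \<open>auto simp: m_closed intro!: finsum_closed\<close>)
        finally show ?thesis .
      qed
      have "s = (\<Oplus>i\<in>{..<k}. (\<Oplus>j\<in>{..<k}. v i \<otimes> (g i \<otimes> t \<otimes> v j) \<otimes> g j))"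
        by (subst ux[OF st(1)], intro finsum_cong' refl)
          (use eq st v g in \<open>auto simp: m_closed intro!: finsum_closed finsum_cong'\<close>)
      then show "s = t" using ux[OF st(2)] by simp
    qed simp
  next
    show "h x \<in> carrier (matrix_ring F k)" if "x \<in> carrier R" for x by (rule hc[OF that])
  next
    fix A assume A: "A \<in> carrier (matrix_ring F k)"
    have Ac: "A (i, j) \<in> carrier R" "f \<otimes> A (i, j) = A (i, j)" "A (i, j) \<otimes> f = A (i, j)" if "i < k" "j < k" for i j
      using A that by (auto simp: matrix_ring_simps Fsimps PiE_iff)
    \<comment> \<open>The preimage is the same expansion with the prescribed entries; duality
      collapses both sums once \<open>g a\<close> and \<open>v b\<close> are applied.\<close>
    define t where "t = (\<Oplus>i\<in>{..<k}. (\<Oplus>j\<in>{..<k}. v i \<otimes> A (i, j) \<otimes> g j))"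
    have tc: "t \<in> carrier R" unfolding t_def using Ac v g by (auto simp: m_closed intro!: finsum_closed)
    have "g a \<otimes> t \<otimes> v b = A (a, b)" if ab: "a < k" "b < k" for a b
    proof -
      have "g a \<otimes> t = (\<Oplus>i\<in>{..<k}. g a \<otimes> (\<Oplus>j\<in>{..<k}. v i \<otimes> A (i, j) \<otimes> g j))"
        unfolding t_def using Ac v g ab by (intro m_finsum_rdistr) (auto simp: m_closed intro!: finsum_closed)
      also have "\<dots> = (\<Oplus>i\<in>{..<k}. if i = a then (\<Oplus>j\<in>{..<k}. A (i, j) \<otimes> g j) else \<zero>)"
      proof (intro finsum_cong' refl)
        fix i assume "i \<in> {..<k}"
        then have i: "i < k" by simp
        have "g a \<otimes> (\<Oplus>j\<in>{..<k}. v i \<otimes> A (i, j) \<otimes> g j) = (\<Oplus>j\<in>{..<k}. g a \<otimes> (v i \<otimes> A (i, j) \<otimes> g j))"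
          using i Ac v g ab by (intro m_finsum_rdistr) (auto simp: m_closed)
        also have "\<dots> = (\<Oplus>j\<in>{..<k}. if i = a then A (i, j) \<otimes> g j else \<zero>)"
        proof (intro finsum_cong' refl)
          fix j assume "j \<in> {..<k}"
          then have j: "j < k" by simp
          have "g a \<otimes> (v i \<otimes> A (i, j) \<otimes> g j) = ((g a \<otimes> v i) \<otimes> A (i, j)) \<otimes> g j"
            using i j Ac v g ab by (simp add: m_assoc m_closed)
          then show "g a \<otimes> (v i \<otimes> A (i, j) \<otimes> g j) = (if i = a then A (i, j) \<otimes> g j else \<zero>)"
            using gv[OF ab(1) i] Ac[OF i j] g[OF j] by auto
        qed (use i Ac g in \<open>auto simp: m_closed\<close>)
        also have "\<dots> = (if i = a then (\<Oplus>j\<in>{..<k}. A (i, j) \<otimes> g j) else \<zero>)" by simp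
        finally show "g a \<otimes> (\<Oplus>j\<in>{..<k}. v i \<otimes> A (i, j) \<otimes> g j) = (if i = a then (\<Oplus>j\<in>{..<k}. A (i, j) \<otimes> g j) else \<zero>)" .
      qed (use Ac g in \<open>auto simp: m_closed intro!: finsum_closed\<close>)
      also have "\<dots> = (\<Oplus>j\<in>{..<k}. A (a, j) \<otimes> g j)"
        using ab Ac g by (intro finsum_delta) (auto simp: m_closed intro!: finsum_closed)
      finally have "g a \<otimes> t \<otimes> v b = (\<Oplus>j\<in>{..<k}. A (a, j) \<otimes> g j) \<otimes> v b" by simp
      also have "\<dots> = (\<Oplus>j\<in>{..<k}. A (a, j) \<otimes> g j \<otimes> v b)"
        using ab Ac v g by (intro m_finsum_ldistr) (auto simp: m_closed)
      also have "\<dots> = (\<Oplus>j\<in>{..<k}. if j = b then A (a, j) else \<zero>)"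
        using ab Ac v g gv by (intro finsum_cong') (auto simp: m_assoc)
      also have "\<dots> = A (a, b)" using ab Ac by (intro finsum_delta) auto
      finally show ?thesis .
    qed
    then have "h t = A"
      using A by (intro PiE_ext[of _ "{..<k} \<times> {..<k}" "\<lambda>_. carrier F"]) (auto simp: h_def matrix_ring_simps intro!: gtv[OF tc])
    then show "\<exists>t\<in>carrier R. A = h t" using tc by blast
  qed
  moreover have "finite (carrier F)" using fin by (simp add: Fsimps)
  ultimately show thesis using that F k by blast
qed

end

section \<open>Matrix rings\<close>

definition matrix_unit :: "('a, 'm) ring_scheme \<Rightarrow> nat \<Rightarrow> nat \<Rightarrow> nat \<Rightarrow> 'a \<Rightarrow> nat \<times> nat \<Rightarrow> 'a" where
  "matrix_unit F k p q c = (\<lambda>(i, j)\<in>{..<k} \<times> {..<k}. if i = p \<and> j = q then c else \<zero>\<^bsub>F\<^esub>)"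

context ring
begin

lemma matrix_add_entry:
  "\<lbrakk>i < k; j < k\<rbrakk> \<Longrightarrow> (A \<oplus>\<^bsub>matrix_ring R k\<^esub> B) (i, j) = A (i, j) \<oplus> B (i, j)"
  by (simp add: matrix_ring_simps)

lemma matrix_mult_entry:
  "\<lbrakk>i < k; j < k\<rbrakk> \<Longrightarrow> (A \<otimes>\<^bsub>matrix_ring R k\<^esub> B) (i, j) = (\<Oplus>l\<in>{..<k}. A (i, l) \<otimes> B (l, j))"
  by (simp add: matrix_ring_simps)

lemma matrix_zero_entry: "\<lbrakk>i < k; j < k\<rbrakk> \<Longrightarrow> \<zero>\<^bsub>matrix_ring R k\<^esub> (i, j) = \<zero>"
  by (simp add: matrix_ring_simps)

lemma matrix_one_entry: "\<lbrakk>i < k; j < k\<rbrakk> \<Longrightarrow> \<one>\<^bsub>matrix_ring R k\<^esub> (i, j) = (if i = j then \<one> else \<zero>)"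
  by (simp add: matrix_ring_def)

lemma matrix_entry_closed: "\<lbrakk>A \<in> carrier (matrix_ring R k); i < k; j < k\<rbrakk> \<Longrightarrow> A (i, j) \<in> carrier R"
  by (auto simp: matrix_ring_simps PiE_iff)

lemma matrix_eqI:
  assumes "A \<in> carrier (matrix_ring R k)" "B \<in> carrier (matrix_ring R k)"
    and "\<And>i j. \<lbrakk>i < k; j < k\<rbrakk> \<Longrightarrow> A (i, j) = B (i, j)"
  shows "A = B"
  using assms by (intro PiE_ext[of A "{..<k} \<times> {..<k}" "\<lambda>_. carrier R" B]) (auto simp: matrix_ring_simps)

lemma matrix_mult_closed:
  assumes "A \<in> carrier (matrix_ring R k)" "B \<in> carrier (matrix_ring R k)"
  shows "A \<otimes>\<^bsub>matrix_ring R k\<^esub> B \<in> carrier (matrix_ring R k)"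
proof -
  have "(\<Oplus>l\<in>{..<k}. A (i, l) \<otimes> B (l, j)) \<in> carrier R" if "i < k" "j < k" for i j
    using assms that by (intro finsum_closed) (auto simp: matrix_entry_closed)
  then show ?thesis by (auto simp: matrix_ring_simps)
qed

lemma matrix_add_closed:
  assumes "A \<in> carrier (matrix_ring R k)" "B \<in> carrier (matrix_ring R k)"
  shows "A \<oplus>\<^bsub>matrix_ring R k\<^esub> B \<in> carrier (matrix_ring R k)"
  using assms by (auto simp: matrix_ring_simps PiE_iff)

lemma matrix_zero_closed: "\<zero>\<^bsub>matrix_ring R k\<^esub> \<in> carrier (matrix_ring R k)"
  by (auto simp: matrix_ring_simps)

lemma matrix_one_closed: "\<one>\<^bsub>matrix_ring R k\<^esub> \<in> carrier (matrix_ring R k)"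
  by (auto simp: matrix_ring_def)

lemma matrix_unit_closed: "c \<in> carrier R \<Longrightarrow> matrix_unit R k p q c \<in> carrier (matrix_ring R k)"
  by (auto simp: matrix_unit_def matrix_ring_simps)

lemma matrix_unit_entry:
  "\<lbrakk>i < k; j < k\<rbrakk> \<Longrightarrow> matrix_unit R k p q c (i, j) = (if i = p \<and> j = q then c else \<zero>)"
  by (simp add: matrix_unit_def)

lemma matrix_unit_mult:
  assumes "c \<in> carrier R" "A \<in> carrier (matrix_ring R k)" "i < k" "j < k" "q < k"
  shows "(matrix_unit R k p q c \<otimes>\<^bsub>matrix_ring R k\<^esub> A) (i, j) = (if i = p then c \<otimes> A (q, j) else \<zero>)"
proof -
  have "(\<Oplus>l\<in>{..<k}. matrix_unit R k p q c (i, l) \<otimes> A (l, j)) =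
      (\<Oplus>l\<in>{..<k}. if l = q then (if i = p then c \<otimes> A (l, j) else \<zero>) else \<zero>)"
    using assms by (intro finsum_cong') (auto simp: matrix_unit_entry matrix_entry_closed)
  also have "\<dots> = (if i = p then c \<otimes> A (q, j) else \<zero>)"
    using assms by (subst finsum_delta) (auto simp: matrix_entry_closed)
  finally show ?thesis using assms by (simp add: matrix_mult_entry)
qed

lemma mult_matrix_unit:
  assumes "c \<in> carrier R" "A \<in> carrier (matrix_ring R k)" "i < k" "j < k" "p < k"
  shows "(A \<otimes>\<^bsub>matrix_ring R k\<^esub> matrix_unit R k p q c) (i, j) = (if j = q then A (i, p) \<otimes> c else \<zero>)"
proof -
  have "(\<Oplus>l\<in>{..<k}. A (i, l) \<otimes> matrix_unit R k p q c (l, j)) =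
      (\<Oplus>l\<in>{..<k}. if l = p then (if j = q then A (i, l) \<otimes> c else \<zero>) else \<zero>)"
    using assms by (intro finsum_cong') (auto simp: matrix_unit_entry matrix_entry_closed)
  also have "\<dots> = (if j = q then A (i, p) \<otimes> c else \<zero>)"
    using assms by (subst finsum_delta) (auto simp: matrix_entry_closed)
  finally show ?thesis using assms by (simp add: matrix_mult_entry)
qed

lemma matrix_one_mult:
  assumes A: "A \<in> carrier (matrix_ring R k)"
  shows "\<one>\<^bsub>matrix_ring R k\<^esub> \<otimes>\<^bsub>matrix_ring R k\<^esub> A = A"
proof (rule matrix_eqI)
  fix i j assume ij: "i < k" "j < k"
  have "(\<Oplus>l\<in>{..<k}. \<one>\<^bsub>matrix_ring R k\<^esub> (i, l) \<otimes> A (l, j)) = (\<Oplus>l\<in>{..<k}. if l = i then A (l, j) else \<zero>)"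
    using ij A by (intro finsum_cong') (auto simp: matrix_one_entry matrix_entry_closed)
  also have "\<dots> = A (i, j)" using ij A by (intro finsum_delta) (auto simp: matrix_entry_closed)
  finally show "(\<one>\<^bsub>matrix_ring R k\<^esub> \<otimes>\<^bsub>matrix_ring R k\<^esub> A) (i, j) = A (i, j)"
    using ij by (simp add: matrix_mult_entry)
qed (use A in \<open>auto intro: matrix_mult_closed matrix_one_closed\<close>)

lemma finsum_swap:
  assumes "finite A" "finite B" "\<And>a b. \<lbrakk>a \<in> A; b \<in> B\<rbrakk> \<Longrightarrow> f a b \<in> carrier R"
  shows "(\<Oplus>a\<in>A. \<Oplus>b\<in>B. f a b) = (\<Oplus>b\<in>B. \<Oplus>a\<in>A. f a b)"
  using assms(1,3)
proof (induction A rule: finite_induct)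
  case empty
  then show ?case by simp
next
  case (insert a A)
  have 1: "(\<lambda>a. \<Oplus>b\<in>B. f a b) \<in> A \<rightarrow> carrier R" "(\<Oplus>b\<in>B. f a b) \<in> carrier R"
    using insert.prems assms(2) by (auto intro!: finsum_closed)
  have "(\<Oplus>b\<in>B. \<Oplus>a\<in>insert a A. f a b) = (\<Oplus>b\<in>B. f a b \<oplus> (\<Oplus>a\<in>A. f a b))"
    using insert by (intro finsum_cong') (auto intro!: finsum_closed)
  also have "\<dots> = (\<Oplus>b\<in>B. f a b) \<oplus> (\<Oplus>b\<in>B. \<Oplus>a\<in>A. f a b)"
    using insert by (intro finsum_addf) (auto intro!: finsum_closed)
  also have "(\<Oplus>b\<in>B. \<Oplus>a\<in>A. f a b) = (\<Oplus>a\<in>A. \<Oplus>b\<in>B. f a b)"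
    using insert by simp
  finally show ?case using 1 insert.hyps by (simp add: finsum_insert)
qed

lemma matrix_mult_assoc:
  assumes A: "A \<in> carrier (matrix_ring R k)" "B \<in> carrier (matrix_ring R k)" "C \<in> carrier (matrix_ring R k)"
  shows "(A \<otimes>\<^bsub>matrix_ring R k\<^esub> B) \<otimes>\<^bsub>matrix_ring R k\<^esub> C = A \<otimes>\<^bsub>matrix_ring R k\<^esub> (B \<otimes>\<^bsub>matrix_ring R k\<^esub> C)"
proof (rule matrix_eqI)
  fix i j assume ij: "i < k" "j < k"
  note cl = matrix_entry_closed[OF A(1)] matrix_entry_closed[OF A(2)] matrix_entry_closed[OF A(3)]
  have "((A \<otimes>\<^bsub>matrix_ring R k\<^esub> B) \<otimes>\<^bsub>matrix_ring R k\<^esub> C) (i, j) = (\<Oplus>l\<in>{..<k}. (\<Oplus>m\<in>{..<k}. A (i, m) \<otimes> B (m, l)) \<otimes> C (l, j))"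
    using ij cl by (simp only: matrix_mult_entry) (intro finsum_cong', auto simp: matrix_mult_entry intro!: finsum_closed)
  also have "\<dots> = (\<Oplus>l\<in>{..<k}. \<Oplus>m\<in>{..<k}. A (i, m) \<otimes> B (m, l) \<otimes> C (l, j))"
    using ij cl by (intro finsum_cong' finsum_ldistr) (auto intro!: finsum_closed)
  also have "\<dots> = (\<Oplus>m\<in>{..<k}. \<Oplus>l\<in>{..<k}. A (i, m) \<otimes> B (m, l) \<otimes> C (l, j))"
    using ij cl by (intro finsum_swap) auto
  also have "\<dots> = (\<Oplus>m\<in>{..<k}. A (i, m) \<otimes> (\<Oplus>l\<in>{..<k}. B (m, l) \<otimes> C (l, j)))"
  proof (intro finsum_cong' refl)
    fix m assume m: "m \<in> {..<k}"
    have "A (i, m) \<otimes> (\<Oplus>l\<in>{..<k}. B (m, l) \<otimes> C (l, j)) = (\<Oplus>l\<in>{..<k}. A (i, m) \<otimes> (B (m, l) \<otimes> C (l, j)))"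
      using m ij cl by (intro finsum_rdistr) auto
    also have "\<dots> = (\<Oplus>l\<in>{..<k}. A (i, m) \<otimes> B (m, l) \<otimes> C (l, j))"
      using m ij cl by (intro finsum_cong') (auto simp: m_assoc)
    finally show "(\<Oplus>l\<in>{..<k}. A (i, m) \<otimes> B (m, l) \<otimes> C (l, j)) = A (i, m) \<otimes> (\<Oplus>l\<in>{..<k}. B (m, l) \<otimes> C (l, j))" by simp
  qed (use ij cl in \<open>auto intro!: finsum_closed\<close>)
  also have "\<dots> = (A \<otimes>\<^bsub>matrix_ring R k\<^esub> (B \<otimes>\<^bsub>matrix_ring R k\<^esub> C)) (i, j)"
    using ij cl by (simp only: matrix_mult_entry) (intro finsum_cong', auto simp: matrix_mult_entry intro!: finsum_closed)
  finally show "((A \<otimes>\<^bsub>matrix_ring R k\<^esub> B) \<otimes>\<^bsub>matrix_ring R k\<^esub> C) (i, j) = (A \<otimes>\<^bsub>matrix_ring R k\<^esub> (B \<otimes>\<^bsub>matrix_ring R k\<^esub> C)) (i, j)" .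
qed (use A in \<open>auto intro: matrix_mult_closed\<close>)

lemma matrix_ring_nonunital: "nonunital_ring (matrix_ring R k)"
proof (intro nonunital_ring.intro nonunital_ring_axioms.intro abelian_groupI)
  let ?M = "matrix_ring R k"
  fix x assume x: "x \<in> carrier ?M"
  show "\<zero>\<^bsub>?M\<^esub> \<oplus>\<^bsub>?M\<^esub> x = x"
    using x by (intro matrix_eqI) (auto simp: matrix_add_entry matrix_zero_entry matrix_entry_closed
        intro: matrix_add_closed matrix_zero_closed)
  have n: "(\<lambda>p\<in>{..<k} \<times> {..<k}. \<ominus> x p) \<in> carrier ?M" using x by (auto simp: matrix_ring_simps PiE_iff)
  moreover have "(\<lambda>p\<in>{..<k} \<times> {..<k}. \<ominus> x p) \<oplus>\<^bsub>?M\<^esub> x = \<zero>\<^bsub>?M\<^esub>"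
    using x n by (intro matrix_eqI) (auto simp: matrix_add_entry matrix_zero_entry matrix_entry_closed l_neg
        intro: matrix_add_closed matrix_zero_closed)
  ultimately show "\<exists>y\<in>carrier ?M. y \<oplus>\<^bsub>?M\<^esub> x = \<zero>\<^bsub>?M\<^esub>" by blast
  fix y assume y: "y \<in> carrier ?M"
  show "x \<oplus>\<^bsub>?M\<^esub> y = y \<oplus>\<^bsub>?M\<^esub> x"
    using x y by (intro matrix_eqI) (auto simp: matrix_add_entry matrix_entry_closed a_comm intro: matrix_add_closed)
  fix z assume z: "z \<in> carrier ?M"
  show "x \<oplus>\<^bsub>?M\<^esub> y \<oplus>\<^bsub>?M\<^esub> z = x \<oplus>\<^bsub>?M\<^esub> (y \<oplus>\<^bsub>?M\<^esub> z)"
    using x y z by (intro matrix_eqI) (auto simp: matrix_add_entry matrix_entry_closed a_assoc intro: matrix_add_closed)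
  show "(x \<oplus>\<^bsub>?M\<^esub> y) \<otimes>\<^bsub>?M\<^esub> z = x \<otimes>\<^bsub>?M\<^esub> z \<oplus>\<^bsub>?M\<^esub> y \<otimes>\<^bsub>?M\<^esub> z"
  proof (rule matrix_eqI)
    fix i j assume ij: "i < k" "j < k"
    have "(\<Oplus>l\<in>{..<k}. (x \<oplus>\<^bsub>?M\<^esub> y) (i, l) \<otimes> z (l, j)) = (\<Oplus>l\<in>{..<k}. x (i, l) \<otimes> z (l, j) \<oplus> y (i, l) \<otimes> z (l, j))"
      using ij x y z by (intro finsum_cong') (auto simp: matrix_add_entry matrix_entry_closed l_distr)
    also have "\<dots> = (\<Oplus>l\<in>{..<k}. x (i, l) \<otimes> z (l, j)) \<oplus> (\<Oplus>l\<in>{..<k}. y (i, l) \<otimes> z (l, j))"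
      using ij x y z by (intro finsum_addf) (auto simp: matrix_entry_closed)
    finally show "((x \<oplus>\<^bsub>?M\<^esub> y) \<otimes>\<^bsub>?M\<^esub> z) (i, j) = (x \<otimes>\<^bsub>?M\<^esub> z \<oplus>\<^bsub>?M\<^esub> y \<otimes>\<^bsub>?M\<^esub> z) (i, j)"
      using ij by (simp add: matrix_mult_entry matrix_add_entry)
  qed (use x y z in \<open>auto intro!: matrix_add_closed matrix_mult_closed\<close>)
  show "z \<otimes>\<^bsub>?M\<^esub> (x \<oplus>\<^bsub>?M\<^esub> y) = z \<otimes>\<^bsub>?M\<^esub> x \<oplus>\<^bsub>?M\<^esub> z \<otimes>\<^bsub>?M\<^esub> y"
  proof (rule matrix_eqI)
    fix i j assume ij: "i < k" "j < k"
    have "(\<Oplus>l\<in>{..<k}. z (i, l) \<otimes> (x \<oplus>\<^bsub>?M\<^esub> y) (l, j)) = (\<Oplus>l\<in>{..<k}. z (i, l) \<otimes> x (l, j) \<oplus> z (i, l) \<otimes> y (l, j))"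
      using ij x y z by (intro finsum_cong') (auto simp: matrix_add_entry matrix_entry_closed r_distr)
    also have "\<dots> = (\<Oplus>l\<in>{..<k}. z (i, l) \<otimes> x (l, j)) \<oplus> (\<Oplus>l\<in>{..<k}. z (i, l) \<otimes> y (l, j))"
      using ij x y z by (intro finsum_addf) (auto simp: matrix_entry_closed)
    finally show "(z \<otimes>\<^bsub>?M\<^esub> (x \<oplus>\<^bsub>?M\<^esub> y)) (i, j) = (z \<otimes>\<^bsub>?M\<^esub> x \<oplus>\<^bsub>?M\<^esub> z \<otimes>\<^bsub>?M\<^esub> y) (i, j)"
      using ij by (simp add: matrix_mult_entry matrix_add_entry)
  qed (use x y z in \<open>auto intro!: matrix_add_closed matrix_mult_closed\<close>)
qed (auto intro: matrix_add_closed matrix_mult_closed matrix_zero_closed matrix_mult_assoc)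

lemma finite_matrix_ring: "finite (carrier R) \<Longrightarrow> finite (carrier (matrix_ring R k))"
  by (auto simp: matrix_ring_simps intro!: finite_PiE)

lemma matrix_nonzero_entry:
  assumes "A \<in> carrier (matrix_ring R k)" "A \<noteq> \<zero>\<^bsub>matrix_ring R k\<^esub>"
  obtains a b where "a < k" "b < k" "A (a, b) \<noteq> \<zero>"
  using assms matrix_eqI[OF assms(1) matrix_zero_closed] by (metis matrix_zero_entry)

end

section \<open>Ideals and quasi-regularity in matrix rings over a field\<close>

context field
begin

lemma nonzero_inverse: "\<lbrakk>c \<in> carrier R; c \<noteq> \<zero>\<rbrakk> \<Longrightarrow> inv c \<in> carrier R \<and> inv c \<otimes> c = \<one> \<and> c \<otimes> inv c = \<one>"
  using field_Units by auto

text \<open>A nonzero entry of some element of the ideal is moved to any diagonal position by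
  multiplication with matrix units on both sides, and is normalised by its inverse. The diagonal
  units so obtained add up to the identity, one partial identity after another.\<close>

lemma matrix_ring_simple:
  assumes I: "nonunital_ideal I (matrix_ring R k)" "I \<noteq> {\<zero>\<^bsub>matrix_ring R k\<^esub>}"
  shows "I = carrier (matrix_ring R k)"
proof -
  let ?M = "matrix_ring R k"
  interpret M: nonunital_ring ?M by (rule matrix_ring_nonunital)
  note ID = M.nonunital_idealD[OF I(1)]
  obtain A where A: "A \<in> I" "A \<noteq> \<zero>\<^bsub>?M\<^esub>" using I(2) ID(2) by auto
  have Ac: "A \<in> carrier ?M" using A(1) ID(1) by auto
  obtain a b where ab: "a < k" "b < k" "A (a, b) \<noteq> \<zero>" using matrix_nonzero_entry[OF Ac A(2)] .
  define c where "c = inv (A (a, b))"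
  have c: "c \<in> carrier R" "c \<otimes> A (a, b) = \<one>"
    using nonzero_inverse[OF matrix_entry_closed[OF Ac ab(1,2)] ab(3)] by (auto simp: c_def)
  have unit: "matrix_unit R k p p \<one> \<in> I" if p: "p < k" for p
  proof -
    let ?U = "matrix_unit R k p a c" and ?V = "matrix_unit R k b p \<one>"
    have UA: "?U \<otimes>\<^bsub>?M\<^esub> A \<in> I" using ID(6)[OF A(1)] matrix_unit_closed[OF c(1)] by blast
    then have UAV: "(?U \<otimes>\<^bsub>?M\<^esub> A) \<otimes>\<^bsub>?M\<^esub> ?V \<in> I" using ID(7) matrix_unit_closed[OF one_closed] by blast
    have UAc: "?U \<otimes>\<^bsub>?M\<^esub> A \<in> carrier ?M" using UA ID(1) by blast
    have "(?U \<otimes>\<^bsub>?M\<^esub> A) \<otimes>\<^bsub>?M\<^esub> ?V = matrix_unit R k p p \<one>"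
    proof (rule matrix_eqI)
      fix i j assume ij: "i < k" "j < k"
      show "((?U \<otimes>\<^bsub>?M\<^esub> A) \<otimes>\<^bsub>?M\<^esub> ?V) (i, j) = matrix_unit R k p p \<one> (i, j)"
        using ij ab p c by (simp add: mult_matrix_unit[OF one_closed UAc] matrix_unit_mult[OF c(1) Ac] matrix_unit_entry)
    qed (use UAV ID(1) in \<open>auto intro: matrix_unit_closed\<close>)
    then show ?thesis using UAV by simp
  qed
  have "(\<lambda>(i, j)\<in>{..<k} \<times> {..<k}. if i = j \<and> i < m then \<one> else \<zero>) \<in> I" if "m \<le> k" for m
    using that
  proof (induction m)
    case 0
    have "(\<lambda>(i, j)\<in>{..<k} \<times> {..<k}. if i = j \<and> i < 0 then \<one> else \<zero>) = \<zero>\<^bsub>?M\<^esub>"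
      by (auto simp: matrix_ring_simps restrict_def)
    then show ?case using ID(2) by (simp only:)
  next
    case (Suc m)
    let ?D = "\<lambda>m. (\<lambda>(i, j)\<in>{..<k} \<times> {..<k}. if i = j \<and> i < m then \<one> else \<zero>)"
    have "?D (Suc m) = ?D m \<oplus>\<^bsub>?M\<^esub> matrix_unit R k m m \<one>"
      by (auto simp: matrix_ring_simps matrix_unit_def intro!: restrict_ext)
    moreover have "?D m \<in> I" by (rule Suc.IH) (use Suc.prems in simp)
    moreover have "matrix_unit R k m m \<one> \<in> I" using unit Suc.prems by simp
    ultimately show ?case using ID(3) by (simp only:)
  qed
  from this[of k] have "\<one>\<^bsub>?M\<^esub> \<in> I"
    by (rule back_subst[of "\<lambda>x. x \<in> I", OF _ ext]) (auto simp: matrix_ring_def restrict_def)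
  then have "B \<in> I" if "B \<in> carrier ?M" for B
    using ID(7)[of "\<one>\<^bsub>?M\<^esub>" B] that by (simp add: matrix_one_mult)
  then show ?thesis using ID(1) by blast
qed

text \<open>For a nonzero entry x(a,b) let y be the matrix with the only entry -1/x(a,b) at (b,a).
  Then column b of yx is minus the b-th unit vector, so the (b,b) entry of yx + z + zyx is -1 +
  z(b,b) - z(b,b) = -1 for every z.\<close>

lemma matrix_ring_not_quasi_regular:
  assumes x: "x \<in> carrier (matrix_ring R k)" "x \<noteq> \<zero>\<^bsub>matrix_ring R k\<^esub>"
  obtains y where "y \<in> carrier (matrix_ring R k)"
    "\<And>z. z \<in> carrier (matrix_ring R k) \<Longrightarrow>
      y \<otimes>\<^bsub>matrix_ring R k\<^esub> x \<oplus>\<^bsub>matrix_ring R k\<^esub> z \<oplus>\<^bsub>matrix_ring R k\<^esub> z \<otimes>\<^bsub>matrix_ring R k\<^esub> y \<otimes>\<^bsub>matrix_ring R k\<^esub> x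
        \<noteq> \<zero>\<^bsub>matrix_ring R k\<^esub>"
proof -
  let ?M = "matrix_ring R k"
  obtain a b where ab: "a < k" "b < k" "x (a, b) \<noteq> \<zero>" using matrix_nonzero_entry[OF x] .
  define c where "c = \<ominus> (inv (x (a, b)))"
  have xc: "x (a, b) \<in> carrier R" using matrix_entry_closed[OF x(1)] ab by simp
  have c: "c \<in> carrier R" "c \<otimes> x (a, b) = \<ominus> \<one>"
    using nonzero_inverse[OF xc ab(3)] xc by (auto simp: c_def l_minus)
  let ?y = "matrix_unit R k b a c"
  let ?w = "?y \<otimes>\<^bsub>?M\<^esub> x"
  have yc: "?y \<in> carrier ?M" by (rule matrix_unit_closed[OF c(1)])
  have wc: "?w \<in> carrier ?M" using matrix_mult_closed yc x(1) by blast
  have w: "?w (i, b) = (if i = b then \<ominus> \<one> else \<zero>)" if "i < k" for i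
    using matrix_unit_mult[OF c(1) x(1) that ab(2,1)] c(2) by simp
  show thesis
  proof (rule that[OF yc])
    fix z assume z: "z \<in> carrier ?M"
    have zc: "z (b, l) \<in> carrier R" if "l < k" for l using matrix_entry_closed[OF z ab(2) that] .
    have "(z \<otimes>\<^bsub>?M\<^esub> ?w) (b, b) = (\<Oplus>l\<in>{..<k}. z (b, l) \<otimes> ?w (l, b))"
      using ab by (simp add: matrix_mult_entry)
    also have "\<dots> = (\<Oplus>l\<in>{..<k}. if l = b then \<ominus> z (b, l) else \<zero>)"
      using zc by (intro finsum_cong') (auto simp: w r_minus)
    also have "\<dots> = \<ominus> z (b, b)" using ab zc by (intro finsum_delta) auto
    finally have zw: "(z \<otimes>\<^bsub>?M\<^esub> ?w) (b, b) = \<ominus> z (b, b)" .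
    have "z \<otimes>\<^bsub>?M\<^esub> ?y \<otimes>\<^bsub>?M\<^esub> x = z \<otimes>\<^bsub>?M\<^esub> ?w" by (rule matrix_mult_assoc[OF z yc x(1)])
    then have "(?w \<oplus>\<^bsub>?M\<^esub> z \<oplus>\<^bsub>?M\<^esub> z \<otimes>\<^bsub>?M\<^esub> ?y \<otimes>\<^bsub>?M\<^esub> x) (b, b) = \<ominus> \<one>"
      using ab zc[OF ab(2)] by (simp add: matrix_add_entry w zw a_assoc r_neg)
    moreover have "\<ominus> \<one> \<noteq> \<zero>" using one_not_zero by (metis a_inv_closed minus_minus minus_zero one_closed)
    ultimately show "?w \<oplus>\<^bsub>?M\<^esub> z \<oplus>\<^bsub>?M\<^esub> z \<otimes>\<^bsub>?M\<^esub> ?y \<otimes>\<^bsub>?M\<^esub> x \<noteq> \<zero>\<^bsub>?M\<^esub>"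
      using ab by (metis matrix_zero_entry)
  qed
qed

end

lemma (in nonunital_ring) neg_zero [simp]: "\<ominus> \<zero> = \<zero>"
  using minus_equality[of \<zero> \<zero>] by simp

lemma (in nonunital_ring) diff_zero [simp]: "x \<in> carrier R \<Longrightarrow> x \<ominus> \<zero> = x"
  by (simp add: a_minus_def)

section \<open>Topological rings\<close>

lemma compact_space_fipD:
  assumes "compact_space T" and closed: "\<And>K. K \<in> U \<Longrightarrow> closedin T K"
    and fip: "\<And>F. \<lbrakk>finite F; F \<subseteq> U\<rbrakk> \<Longrightarrow> \<Inter>F \<noteq> {}"
  shows "\<Inter>U \<noteq> {}"
proof -
  have "(\<forall>K\<in>U. closedin T K) \<and> (\<forall>F. finite F \<and> F \<subseteq> U \<longrightarrow> \<Inter>F \<noteq> {})"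
    by (intro conjI ballI allI impI closed fip) auto
  then show ?thesis using assms(1)[unfolded compact_space_fip] by simp
qed

locale top_ring = nonunital_ring R for R (structure) and T +
  assumes topspace: "topspace T = carrier R"
    and Hausdorff: "Hausdorff_space T"
    and cont_add_prod: "continuous_map (prod_topology T T) T (\<lambda>(x, y). x \<oplus> y)"
    and cont_neg: "continuous_map T T (\<lambda>x. \<ominus> x)"
    and cont_mult_prod: "continuous_map (prod_topology T T) T (\<lambda>(x, y). x \<otimes> y)"

lemma top_ring_iff: "top_ring R T \<longleftrightarrow> topological_ring R T"
  by (simp add: top_ring_def top_ring_axioms_def topological_ring_def)

context top_ring
begin

lemma cont_add:
  assumes "continuous_map Y T f" "continuous_map Y T g"
  shows "continuous_map Y T (\<lambda>x. f x \<oplus> g x)"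
  using continuous_map_compose[OF continuous_map_pairedI[OF assms] cont_add_prod] by (simp add: o_def)

lemma cont_mult:
  assumes "continuous_map Y T f" "continuous_map Y T g"
  shows "continuous_map Y T (\<lambda>x. f x \<otimes> g x)"
  using continuous_map_compose[OF continuous_map_pairedI[OF assms] cont_mult_prod] by (simp add: o_def)

lemma cont_minus:
  assumes "continuous_map Y T f" "continuous_map Y T g"
  shows "continuous_map Y T (\<lambda>x. f x \<ominus> g x)"
  unfolding a_minus_def
  using cont_add[OF assms(1) continuous_map_compose[OF assms(2) cont_neg]] by (simp add: o_def)

lemma cont_const: "a \<in> carrier R \<Longrightarrow> continuous_map Y T (\<lambda>_. a)"
  by (simp add: topspace)

lemma cont_id: "continuous_map T T (\<lambda>x. x)"
  by simp

lemmas cont_intros = cont_add cont_mult cont_minus cont_const cont_id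

lemma openin_preimage:
  assumes "continuous_map T T f" "openin T U"
  shows "openin T {x \<in> carrier R. f x \<in> U}"
  using openin_continuous_map_preimage[OF assms] by (simp add: topspace)

lemma closedin_preimage:
  assumes "continuous_map T T f" "closedin T U"
  shows "closedin T {x \<in> carrier R. f x \<in> U}"
  using closedin_continuous_map_preimage[OF assms] by (simp add: topspace)

lemma openin_translate: "\<lbrakk>openin T U; a \<in> carrier R\<rbrakk> \<Longrightarrow> openin T {x \<in> carrier R. x \<ominus> a \<in> U}"
  by (intro openin_preimage cont_intros)

lemma additive_subgroupD:
  assumes "additive_subgroup H R"
  shows "H \<subseteq> carrier R" "\<zero> \<in> H" "\<And>x y. \<lbrakk>x \<in> H; y \<in> H\<rbrakk> \<Longrightarrow> x \<oplus> y \<in> H" "\<And>x. x \<in> H \<Longrightarrow> \<ominus> x \<in> H"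
    "\<And>x y. \<lbrakk>x \<in> H; y \<in> H\<rbrakk> \<Longrightarrow> x \<ominus> y \<in> H"
  using assms unfolding additive_subgroup_iff a_minus_def by (auto simp: subset_iff)

text \<open>The inner point may be anywhere: translating \<open>U\<close> by x - a gives a
  neighbourhood of an arbitrary x of \<open>H\<close> inside \<open>H\<close>. This suits Baire's
  theorem, which yields an inner point at no particular place.\<close>

lemma subgroup_openI:
  assumes H: "additive_subgroup H R" and U: "openin T U" "a \<in> U" "U \<subseteq> H"
  shows "openin T H"
  unfolding openin_subopen[of T H]
proof
  fix x assume x: "x \<in> H"
  note HD = additive_subgroupD[OF H]
  have ac: "a \<in> carrier R" "a \<in> H" and xc: "x \<in> carrier R" using x U HD by auto
  let ?V = "{y \<in> carrier R. y \<ominus> x \<oplus> a \<in> U}"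
  have "openin T ?V" using U(1) xc ac by (intro openin_preimage cont_intros) auto
  moreover have "x \<in> ?V" using xc ac U(2) minus_eq_zero_iff[of x x] by simp
  moreover have "?V \<subseteq> H"
  proof
    fix y assume "y \<in> ?V"
    then have y: "y \<in> carrier R" "y \<ominus> x \<oplus> a \<in> H" using U(3) by auto
    have "(y \<ominus> x \<oplus> a) \<oplus> (x \<ominus> a) \<in> H" using HD(3)[OF y(2) HD(5)[OF x ac(2)]] .
    moreover have "(y \<ominus> x \<oplus> a) \<oplus> (x \<ominus> a) = (y \<ominus> x) \<oplus> (x \<ominus> a \<oplus> a)"
      using y xc ac by (simp add: a_ac)
    moreover have "\<dots> = y" using y xc ac by (simp add: minus_add_cancel)
    ultimately show "y \<in> H" by simp
  qed
  ultimately show "\<exists>T'. openin T T' \<and> x \<in> T' \<and> T' \<subseteq> H" by blast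
qed

lemma open_subgroup_closed:
  assumes H: "additive_subgroup H R" "openin T H"
  shows "closedin T H"
proof -
  note HD = additive_subgroupD[OF H(1)]
  have "openin T (carrier R - H)"
    unfolding openin_subopen[of T "carrier R - H"]
  proof
    fix x assume x: "x \<in> carrier R - H"
    let ?V = "{y \<in> carrier R. y \<ominus> x \<in> H}"
    have "openin T ?V" using openin_translate[OF H(2)] x by blast
    moreover have "x \<in> ?V" using x HD(2) minus_eq_zero_iff[of x x] by simp
    moreover have "?V \<subseteq> carrier R - H"
    proof
      fix y assume y: "y \<in> ?V"
      have "y \<notin> H"
      proof
        assume "y \<in> H"
        then have "y \<ominus> (y \<ominus> x) \<in> H" using y HD(5) by blast
        moreover have "y \<ominus> (y \<ominus> x) = x"
          using x y by (simp add: a_minus_def minus_add r_neg2 r_neg1)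
        ultimately show False using x by simp
      qed
      then show "y \<in> carrier R - H" using y by simp
    qed
    ultimately show "\<exists>T'. openin T T' \<and> x \<in> T' \<and> T' \<subseteq> carrier R - H" by blast
  qed
  then show ?thesis using HD(1) by (simp add: closedin_def topspace)
qed

section \<open>Open ideals in compact rings\<close>

definition open_ideal :: "'a set \<Rightarrow> bool" where
  "open_ideal M \<longleftrightarrow> nonunital_ideal M R \<and> openin T M"

text \<open>For compact rings this is equivalent to profiniteness, but it speaks only of subsets of
  \<open>R\<close> and of no index type; the structural arguments use this form.\<close>

definition open_ideals_separate :: bool where
  "open_ideals_separate \<longleftrightarrow> (\<forall>x\<in>carrier R. x \<noteq> \<zero> \<longrightarrow> (\<exists>M. open_ideal M \<and> x \<notin> M))"

lemma open_ideal_closed: "open_ideal M \<Longrightarrow> closedin T M"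
  unfolding open_ideal_def nonunital_ideal_def using open_subgroup_closed by blast

lemma open_ideal_Int: "\<lbrakk>open_ideal M; open_ideal N\<rbrakk> \<Longrightarrow> open_ideal (M \<inter> N)"
  unfolding open_ideal_def
  by (auto intro!: nonunital_idealI dest: nonunital_idealD)

lemma open_ideal_carrier: "open_ideal (carrier R)"
  unfolding open_ideal_def using openin_topspace[of T]
  by (auto intro!: nonunital_idealI simp: topspace m_closed)

lemma open_idealI: "\<lbrakk>nonunital_ideal N R; open_ideal M; M \<subseteq> N\<rbrakk> \<Longrightarrow> open_ideal N"
  unfolding open_ideal_def nonunital_ideal_def
  using subgroup_openI[of N M \<zero>] additive_subgroupD(2) by blast

lemma finite_lower_open_ideal:
  assumes "finite A" "\<And>M. M \<in> A \<Longrightarrow> open_ideal M"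
  shows "\<exists>N. open_ideal N \<and> (\<forall>M\<in>A. N \<subseteq> M)"
  using assms
proof (induction A rule: finite_induct)
  case empty
  then show ?case using open_ideal_carrier by auto
next
  case (insert M A)
  then obtain N where "open_ideal N" "\<forall>M\<in>A. N \<subseteq> M" by auto
  then have "open_ideal (M \<inter> N)" "\<forall>L\<in>insert M A. M \<inter> N \<subseteq> L" using open_ideal_Int insert.prems by auto
  then show ?case by blast
qed

text \<open>Open ideals are closed under finite intersections, so the monotone family
  \<open>C\<close> has the finite intersection property. By this device a problem that is solvable
  modulo every open ideal is solved in \<open>R\<close>.\<close>

lemma compact_open_ideals:
  assumes comp: "compact_space T"
    and C: "\<And>M. open_ideal M \<Longrightarrow> closedin T (C M)" "\<And>M. open_ideal M \<Longrightarrow> C M \<noteq> {}"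
    and mono: "\<And>M N. \<lbrakk>open_ideal M; open_ideal N; M \<subseteq> N\<rbrakk> \<Longrightarrow> C M \<subseteq> C N"
  shows "\<exists>x. \<forall>M. open_ideal M \<longrightarrow> x \<in> C M"
proof -
  let ?U = "C ` {M. open_ideal M}"
  have fip: "\<Inter>\<F> \<noteq> {}" if \<F>: "finite \<F>" "\<F> \<subseteq> ?U" for \<F>
  proof -
    obtain A where A: "finite A" "A \<subseteq> {M. open_ideal M}" "\<F> = C ` A"
      using finite_subset_image[OF \<F>] by blast
    obtain N where N: "open_ideal N" "\<forall>M\<in>A. N \<subseteq> M" using finite_lower_open_ideal[OF A(1)] A(2) by blast
    have "C N \<subseteq> C M" if "M \<in> A" for M using mono[OF N(1), of M] N(2) A(2) that by blast
    then show ?thesis using C(2)[OF N(1)] A(3) by blast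
  qed
  have "\<Inter>?U \<noteq> {}"
  proof (rule compact_space_fipD[OF comp])
    fix K assume "K \<in> ?U"
    then obtain M where "open_ideal M" "K = C M" by blast
    then show "closedin T K" using C(1) by simp
  qed (rule fip)
  then obtain x where "x \<in> \<Inter>?U" by blast
  then have "\<forall>M. open_ideal M \<longrightarrow> x \<in> C M" by simp
  then show ?thesis by (rule exI)
qed

lemma compact_finite_cover:
  assumes comp: "compact_space T" and U: "openin T U" "\<zero> \<in> U"
  obtains F where "finite F" "F \<subseteq> carrier R" "\<forall>x\<in>carrier R. \<exists>f\<in>F. x \<ominus> f \<in> U"
proof -
  let ?V = "\<lambda>f. {x \<in> carrier R. x \<ominus> f \<in> U}"
  have "\<forall>W\<in>?V ` carrier R. openin T W" using openin_translate[OF U(1)] by blast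
  moreover have "topspace T \<subseteq> \<Union> (?V ` carrier R)"
  proof
    fix x assume "x \<in> topspace T"
    then have "x \<in> carrier R" by (simp add: topspace)
    then have "x \<in> ?V x" using U(2) minus_eq_zero_iff[of x x] by simp
    then show "x \<in> \<Union> (?V ` carrier R)" using \<open>x \<in> carrier R\<close> by blast
  qed
  ultimately obtain \<F> where \<F>: "finite \<F>" "\<F> \<subseteq> ?V ` carrier R" "topspace T \<subseteq> \<Union>\<F>"
    using comp unfolding compact_space_alt by meson
  obtain F where F: "finite F" "F \<subseteq> carrier R" "\<F> = ?V ` F" using finite_subset_image[OF \<F>(1,2)] by blast
  show thesis
    using that[OF F(1,2)] \<F>(3) F(3) by (auto simp: topspace)
qed

lemma finite_quotient:
  assumes comp: "compact_space T" and M: "open_ideal M" and e: "inj e"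
  shows "finite (quotient_map e R M ` carrier R)"
proof -
  have M': "nonunital_ideal M R" "openin T M" using M by (auto simp: open_ideal_def)
  obtain F where F: "finite F" "F \<subseteq> carrier R" "\<forall>x\<in>carrier R. \<exists>f\<in>F. x \<ominus> f \<in> M"
    using compact_finite_cover[OF comp M'(2) nonunital_idealD(2)[OF M'(1)]] .
  have "quotient_map e R M ` carrier R \<subseteq> quotient_map e R M ` F"
  proof
    fix u assume "u \<in> quotient_map e R M ` carrier R"
    then obtain x where x: "x \<in> carrier R" "u = quotient_map e R M x" by blast
    then obtain f where f: "f \<in> F" "x \<ominus> f \<in> M" using F(3) by blast
    then have "u = quotient_map e R M f" using x F(2) quotient_map_eq_iff[OF e M'(1), of x f] by auto
    then show "u \<in> quotient_map e R M ` F" using f by blast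
  qed
  then show ?thesis using F(1) finite_surj by blast
qed

end

subsection \<open>Powers in rings without unit\<close>

text \<open>The value of \<open>spow R x n\<close> is x^(n+1): without a unit, powers begin with the
  first.\<close>

fun spow :: "('a, 'm) ring_scheme \<Rightarrow> 'a \<Rightarrow> nat \<Rightarrow> 'a" where
  "spow R x 0 = x"
| "spow R x (Suc n) = spow R x n \<otimes>\<^bsub>R\<^esub> x"

context nonunital_ring
begin

lemma spow_closed: "x \<in> carrier R \<Longrightarrow> spow R x n \<in> carrier R"
  by (induction n) (auto simp: m_closed)

lemma spow_mult: "x \<in> carrier R \<Longrightarrow> spow R x m \<otimes> spow R x n = spow R x (Suc (m + n))"
  by (induction n) (auto simp: m_assoc[symmetric] spow_closed)

lemma spow_idempotent:
  assumes fin: "finite (carrier R)" and x: "x \<in> carrier R"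
  obtains n where "spow R x n \<otimes> spow R x n = spow R x n"
proof -
  have "\<not> inj (spow R x)"
  proof
    assume "inj (spow R x)"
    then have "infinite (range (spow R x))" by (rule range_inj_infinite)
    moreover have "range (spow R x) \<subseteq> carrier R" using spow_closed[OF x] by auto
    ultimately show False using fin finite_subset by blast
  qed
  then obtain i j where ij: "i < j" "spow R x i = spow R x j"
    unfolding inj_def by (metis linorder_neqE_nat)
  define d where "d = j - i"
  have d: "d > 0" "spow R x (i + d) = spow R x i" using ij by (auto simp: d_def)
  have per: "spow R x (i + m + d) = spow R x (i + m)" for m
    by (induction m) (use d in \<open>auto simp: add.commute add.left_commute\<close>)
  have per': "spow R x (i + m + c * d) = spow R x (i + m)" for m c
  proof (induction c)
    case (Suc c)
    have "spow R x (i + m + Suc c * d) = spow R x (i + (m + c * d) + d)" by (simp add: algebra_simps)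
    also have "\<dots> = spow R x (i + (m + c * d))" by (rule per)
    finally show ?case using Suc by (simp add: add.assoc)
  qed simp
  \<comment> \<open>The true exponent n + 1 = (i + 1) d is a multiple of the period d, and n is at
    least i, so squaring only advances by whole periods.\<close>
  define n where "n = Suc i * d - 1"
  have n: "Suc n = Suc i * d" using d(1) by (simp add: n_def)
  have "i \<le> n"
  proof -
    have "Suc i * 1 \<le> Suc i * d" using d(1) by (intro mult_le_mono2) simp
    then have "Suc i \<le> Suc n" unfolding n by (simp only: mult_1_right)
    then show ?thesis by simp
  qed
  have "spow R x n \<otimes> spow R x n = spow R x (n + Suc n)" using spow_mult[OF x] by simp
  also have "\<dots> = spow R x (i + (n - i) + Suc i * d)" using n \<open>i \<le> n\<close> by simp
  also have "\<dots> = spow R x n" using per'[of "n - i" "Suc i"] \<open>i \<le> n\<close> by simp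
  finally show thesis by (rule that)
qed

text \<open>If \<open>z \<mapsto> z + zw\<close> is not injective on a finite ring, some \<open>z \<noteq> 0\<close> satisfies \<open>zw = -z\<close>, so that no
  power of \<open>w\<close> vanishes.\<close>

lemma quasi_regular_or_idempotent:
  assumes fin: "finite (carrier R)" and w: "w \<in> carrier R"
  shows "(\<exists>z\<in>carrier R. w \<oplus> z \<oplus> z \<otimes> w = \<zero>) \<or>
    (\<exists>n. spow R w n \<otimes> spow R w n = spow R w n \<and> spow R w n \<noteq> \<zero>)"
proof (cases "inj_on (\<lambda>z. z \<oplus> z \<otimes> w) (carrier R)")
  case True
  have "(\<lambda>z. z \<oplus> z \<otimes> w) ` carrier R = carrier R"
  proof (rule endo_inj_surj[OF fin _ True])
    show "(\<lambda>z. z \<oplus> z \<otimes> w) ` carrier R \<subseteq> carrier R" using w by (auto simp: m_closed)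
  qed
  then have "\<ominus> w \<in> (\<lambda>z. z \<oplus> z \<otimes> w) ` carrier R" using w by simp
  then obtain z where z: "z \<in> carrier R" "\<ominus> w = z \<oplus> z \<otimes> w" by blast
  have "w \<oplus> z \<oplus> z \<otimes> w = w \<oplus> (z \<oplus> z \<otimes> w)" using z(1) w by (simp add: a_assoc m_closed)
  also have "\<dots> = \<zero>" using w by (simp flip: z(2) add: r_neg)
  finally show ?thesis using z(1) by blast
next
  case False
  then obtain a b where ab: "a \<in> carrier R" "b \<in> carrier R" "a \<oplus> a \<otimes> w = b \<oplus> b \<otimes> w" "a \<noteq> b"
    unfolding inj_on_def by blast
  define z where "z = a \<ominus> b"
  have z: "z \<in> carrier R" "z \<noteq> \<zero>" using ab minus_eq_zero_iff by (auto simp: z_def)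
  have "z \<oplus> z \<otimes> w = (a \<oplus> a \<otimes> w) \<ominus> (b \<oplus> b \<otimes> w)"
    using ab(1,2) w by (simp add: z_def a_minus_def l_distr l_minus minus_add m_closed a_ac)
  also have "\<dots> = \<zero>" using ab w minus_eq_zero_iff[of "b \<oplus> b \<otimes> w"] by (simp add: m_closed)
  finally have "z \<otimes> w \<oplus> z = \<zero>" using z w a_comm[of "z \<otimes> w" z] by (simp add: m_closed)
  then have zw: "z \<otimes> w = \<ominus> z" using minus_equality[of "z \<otimes> w" z] z w by (simp add: m_closed)
  have pz: "z \<otimes> spow R w n = z \<or> z \<otimes> spow R w n = \<ominus> z" for n
  proof (induction n)
    case (Suc n)
    have "z \<otimes> spow R w (Suc n) = (z \<otimes> spow R w n) \<otimes> w" using z w by (simp add: m_assoc spow_closed)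
    then show ?case using Suc z w zw by (auto simp: l_minus)
  qed (simp add: zw)
  obtain n where "spow R w n \<otimes> spow R w n = spow R w n" using spow_idempotent[OF fin w] .
  moreover have "spow R w n \<noteq> \<zero>"
  proof
    assume "spow R w n = \<zero>"
    then have "z \<otimes> spow R w n = \<zero>" using z(1) by simp
    then have "z = \<zero> \<or> \<ominus> z = \<zero>" using pz[of n] by metis
    moreover have "z = \<zero>" if "\<ominus> z = \<zero>"
      using minus_minus[OF z(1)] unfolding that by simp
    ultimately have "z = \<zero>" by blast
    then show False using z(2) by simp
  qed
  ultimately show ?thesis by blast
qed

end

lemma spow_hom:
  assumes "nonunital_ring R" "h \<in> nonunital_hom R S" "x \<in> carrier R"
  shows "h (spow R x n) = spow S (h x) n"
proof -
  interpret nonunital_ring R by fact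
  show ?thesis by (induction n) (simp_all add: nonunital_homD[OF assms(2)] assms(3) spow_closed)
qed

section \<open>Structure of compact semisimple rings\<close>

lemma hom_preimage_ideal:
  assumes "nonunital_ring R" "nonunital_ring S" "h \<in> nonunital_hom R S" "nonunital_ideal I S"
  shows "nonunital_ideal {x \<in> carrier R. h x \<in> I} R"
proof -
  interpret R: nonunital_ring R by fact
  interpret S: nonunital_ring S by fact
  note H = nonunital_homD[OF assms(3)] nonunital_hom_zero[OF R.abelian_group_axioms S.abelian_group_axioms assms(3)]
    nonunital_hom_a_inv[OF R.abelian_group_axioms S.abelian_group_axioms assms(3)]
  note ID = S.nonunital_idealD[OF assms(4)]
  show ?thesis by (rule R.nonunital_idealI) (auto simp: H R.m_closed ID)
qed

lemma hom_image_ideal: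
  assumes "nonunital_ring R" "nonunital_ring S" "h \<in> nonunital_hom R S" "h ` carrier R = carrier S"
    and I: "nonunital_ideal I R"
  shows "nonunital_ideal (h ` I) S"
proof -
  interpret R: nonunital_ring R by fact
  interpret S: nonunital_ring S by fact
  note H = nonunital_homD[OF assms(3)] nonunital_hom_zero[OF R.abelian_group_axioms S.abelian_group_axioms assms(3)]
    nonunital_hom_a_inv[OF R.abelian_group_axioms S.abelian_group_axioms assms(3)]
  note ID = R.nonunital_idealD[OF I]
  have Ic: "x \<in> carrier R" if "x \<in> I" for x using ID(1) that by blast
  show ?thesis
  proof (rule S.nonunital_idealI)
    show "h ` I \<subseteq> carrier S" using H(1) Ic by auto
    show "\<zero>\<^bsub>S\<^esub> \<in> h ` I" using H(4) ID(2) by (metis image_eqI)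
    fix u assume "u \<in> h ` I"
    then obtain x where x: "x \<in> I" "u = h x" by blast
    show "\<ominus>\<^bsub>S\<^esub> u \<in> h ` I"
      using x ID(4) H(5)[OF Ic[OF x(1)]] by (intro image_eqI[of _ _ "\<ominus>\<^bsub>R\<^esub> x"]) auto
    fix v assume "v \<in> carrier S"
    then obtain y where y: "y \<in> carrier R" "v = h y" using assms(4) by blast
    show "v \<otimes>\<^bsub>S\<^esub> u \<in> h ` I"
      using x y ID(6) H(3)[OF y(1) Ic[OF x(1)]] by (intro image_eqI[of _ _ "y \<otimes>\<^bsub>R\<^esub> x"]) auto
    show "u \<otimes>\<^bsub>S\<^esub> v \<in> h ` I"
      using x y ID(7) H(3)[OF Ic[OF x(1)] y(1)] by (intro image_eqI[of _ _ "x \<otimes>\<^bsub>R\<^esub> y"]) auto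
  next
    fix u v assume "u \<in> h ` I" "v \<in> h ` I"
    then obtain x y where xy: "x \<in> I" "u = h x" "y \<in> I" "v = h y" by blast
    then show "u \<oplus>\<^bsub>S\<^esub> v \<in> h ` I"
      using ID(3) H(2)[OF Ic[OF xy(1)] Ic[OF xy(3)]] by (intro image_eqI[of _ _ "x \<oplus>\<^bsub>R\<^esub> y"]) auto
  qed
qed

section \<open>Matrix quotients of a compact ring\<close>

context top_ring
begin

text \<open>The kernel \<open>N\<close> is an argument since the factors of the decomposition are
  indexed by kernels, not by homomorphisms. In this way no factor is repeated.\<close>

definition matrix_quotient :: "'a set \<Rightarrow> 'u ring \<Rightarrow> nat \<Rightarrow> ('a \<Rightarrow> nat \<times> nat \<Rightarrow> 'u) \<Rightarrow> bool" where
  "matrix_quotient N F k h \<longleftrightarrow> field F \<and> finite (carrier F) \<and> k \<ge> 1 \<and> h \<in> nonunital_hom R (matrix_ring F k) \<and>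
     h ` carrier R = carrier (matrix_ring F k) \<and> (\<forall>x\<in>carrier R. h x = \<zero>\<^bsub>matrix_ring F k\<^esub> \<longleftrightarrow> x \<in> N)"

lemma spow_in_ideal: "\<lbrakk>nonunital_ideal N R; w \<in> N\<rbrakk> \<Longrightarrow> spow R w n \<in> N"
  by (induction n) (auto dest: nonunital_idealD)

text \<open>If \<open>w\<close> is not quasi-regular modulo \<open>M\<close>, some power \<open>a\<close> of \<open>w\<close> is a nonzero idempotent modulo
  \<open>M\<close>, and the quotient by an ideal \<open>N \<supseteq> M\<close> maximal subject to \<open>a \<notin> N\<close> is a matrix ring.\<close>

lemma matrix_quotient_of_not_quasi_regular:
  fixes e :: "'a set \<Rightarrow> 'u"
  assumes comp: "compact_space T" and e: "inj e" and M: "open_ideal M" and w: "w \<in> carrier R"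
    and nqr: "\<And>z. z \<in> carrier R \<Longrightarrow> w \<oplus> z \<oplus> z \<otimes> w \<notin> M"
  obtains N and F :: "'u ring" and k h where "open_ideal N" "matrix_quotient N F k h" "w \<notin> N"
proof -
  have M': "nonunital_ideal M R" "openin T M" using M by (auto simp: open_ideal_def)
  define \<pi> where "\<pi> = quotient_map e R M"
  define Q where "Q = transport_ring \<pi> R"
  have Qring: "nonunital_ring Q" and \<pi>hom: "\<pi> \<in> nonunital_hom R Q"
    using quotient_ring[OF e M'(1)] by (auto simp: Q_def \<pi>_def)
  interpret Q: nonunital_ring Q by (rule Qring)
  have Qc: "carrier Q = \<pi> ` carrier R" "\<zero>\<^bsub>Q\<^esub> = \<pi> \<zero>" by (simp_all add: Q_def transport_ring_simps)
  have finQ: "finite (carrier Q)" using finite_quotient[OF comp M e] by (simp add: Qc \<pi>_def)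
  have \<pi>eq: "\<pi> x = \<pi> y \<longleftrightarrow> x \<ominus> y \<in> M" if "x \<in> carrier R" "y \<in> carrier R" for x y
    unfolding \<pi>_def by (rule quotient_map_eq_iff[OF e M'(1) that])
  have \<pi>0: "\<pi> x = \<zero>\<^bsub>Q\<^esub> \<longleftrightarrow> x \<in> M" if "x \<in> carrier R" for x
    using \<pi>eq[OF that zero_closed] that by (simp add: Qc)
  have "\<not> (\<exists>z\<in>carrier Q. \<pi> w \<oplus>\<^bsub>Q\<^esub> z \<oplus>\<^bsub>Q\<^esub> z \<otimes>\<^bsub>Q\<^esub> \<pi> w = \<zero>\<^bsub>Q\<^esub>)"
  proof
    assume "\<exists>z\<in>carrier Q. \<pi> w \<oplus>\<^bsub>Q\<^esub> z \<oplus>\<^bsub>Q\<^esub> z \<otimes>\<^bsub>Q\<^esub> \<pi> w = \<zero>\<^bsub>Q\<^esub>"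
    then obtain z where z: "z \<in> carrier R" "\<pi> w \<oplus>\<^bsub>Q\<^esub> \<pi> z \<oplus>\<^bsub>Q\<^esub> \<pi> z \<otimes>\<^bsub>Q\<^esub> \<pi> w = \<zero>\<^bsub>Q\<^esub>"
      by (auto simp: Qc(1))
    then have "\<pi> (w \<oplus> z \<oplus> z \<otimes> w) = \<zero>\<^bsub>Q\<^esub>"
      using w by (simp add: nonunital_homD[OF \<pi>hom] m_closed)
    then have "w \<oplus> z \<oplus> z \<otimes> w \<in> M" using \<pi>0[of "w \<oplus> z \<oplus> z \<otimes> w"] w z(1) by (simp add: m_closed)
    then show False using nqr[OF z(1)] by simp
  qed
  then obtain n where n: "spow Q (\<pi> w) n \<otimes>\<^bsub>Q\<^esub> spow Q (\<pi> w) n = spow Q (\<pi> w) n" "spow Q (\<pi> w) n \<noteq> \<zero>\<^bsub>Q\<^esub>"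
    using Q.quasi_regular_or_idempotent[OF finQ, of "\<pi> w"] w Qc(1) by blast
  define a where "a = spow R w n"
  have a: "a \<in> carrier R" unfolding a_def by (rule spow_closed[OF w])
  have \<pi>a: "\<pi> a = spow Q (\<pi> w) n" unfolding a_def by (rule spow_hom[OF nonunital_ring_axioms \<pi>hom w])
  have "\<pi> (a \<otimes> a) = \<pi> a" using n(1) a by (simp add: nonunital_homD(3)[OF \<pi>hom] \<pi>a)
  then have aa: "a \<otimes> a \<ominus> a \<in> M" using \<pi>eq[of "a \<otimes> a" a] a by (simp add: m_closed)
  have aM: "a \<notin> M" using n(2) \<pi>0[OF a] by (simp add: \<pi>a)
  define P where "P N \<longleftrightarrow> nonunital_ideal N R \<and> M \<subseteq> N \<and> a \<notin> N" for N
  have Pc: "N \<subseteq> carrier R" if "P N" for N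
    using that nonunital_idealD(1) unfolding P_def by blast
  have "P M" using M' aM by (simp add: P_def)
  \<comment> \<open>Maximality is measured by the size of the image in the finite quotient
    \<open>Q\<close>; for ideals that contain \<open>M\<close>, equal images mean equal
    ideals.\<close>
  moreover have "\<forall>N. P N \<longrightarrow> card (\<pi> ` N) < Suc (card (carrier Q))"
  proof (intro allI impI)
    fix N assume "P N"
    then have "\<pi> ` N \<subseteq> carrier Q" using Pc by (auto simp: Qc(1))
    then show "card (\<pi> ` N) < Suc (card (carrier Q))" using card_mono[OF finQ] by (simp add: less_Suc_eq_le)
  qed
  ultimately obtain N where N: "P N" and Nmax: "\<forall>N'. P N' \<longrightarrow> card (\<pi> ` N') \<le> card (\<pi> ` N)"
    using ex_has_greatest_nat[of P M "\<lambda>N. card (\<pi> ` N)" "Suc (card (carrier Q))"] by blast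
  have N': "nonunital_ideal N R" "M \<subseteq> N" "a \<notin> N" using N by (auto simp: P_def)
  have maximal: "L = N" if L: "P L" "N \<subseteq> L" for L
  proof
    show "L \<subseteq> N"
    proof
      fix x assume x: "x \<in> L"
      have fin: "finite (\<pi> ` L)" using finite_subset[OF image_mono[OF Pc[OF L(1)]]] finQ by (simp add: Qc(1))
      have "card (\<pi> ` L) \<le> card (\<pi> ` N)" using Nmax L(1) by simp
      then have "\<pi> ` N = \<pi> ` L" by (intro card_seteq[OF fin image_mono[OF L(2)]])
      then have "\<pi> x \<in> \<pi> ` N" using x by simp
      then obtain y where y: "y \<in> N" "\<pi> x = \<pi> y" by auto
      have xc: "x \<in> carrier R" and yc: "y \<in> carrier R" using x y Pc[OF L(1)] Pc[OF N] by auto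
      have "x \<ominus> y \<in> N" using y \<pi>eq[OF xc yc] N'(2) by auto
      then have "x \<ominus> y \<oplus> y \<in> N" using nonunital_idealD(3)[OF N'(1)] y(1) by blast
      then show "x \<in> N" using minus_add_cancel[OF xc yc] by simp
    qed
  qed (rule L(2))
  have openN: "open_ideal N" by (rule open_idealI[OF N'(1) M N'(2)])
  define \<sigma> where "\<sigma> = quotient_map e R N"
  define S where "S = transport_ring \<sigma> R"
  have Sring: "nonunital_ring S" and \<sigma>hom: "\<sigma> \<in> nonunital_hom R S"
    using quotient_ring[OF e N'(1)] by (auto simp: S_def \<sigma>_def)
  interpret S: nonunital_ring S by (rule Sring)
  have Sc: "carrier S = \<sigma> ` carrier R" "\<zero>\<^bsub>S\<^esub> = \<sigma> \<zero>" by (simp_all add: S_def transport_ring_simps)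
  have \<sigma>eq: "\<sigma> x = \<sigma> y \<longleftrightarrow> x \<ominus> y \<in> N" if "x \<in> carrier R" "y \<in> carrier R" for x y
    unfolding \<sigma>_def by (rule quotient_map_eq_iff[OF e N'(1) that])
  have \<sigma>0: "\<sigma> x = \<zero>\<^bsub>S\<^esub> \<longleftrightarrow> x \<in> N" if "x \<in> carrier R" for x
    using \<sigma>eq[OF that zero_closed] that by (simp add: Sc)
  \<comment> \<open>A nonzero ideal of the quotient by \<open>N\<close> pulls back to an ideal
    strictly above \<open>N\<close>, which contains a by maximality.\<close>
  interpret S: finite_prime_ring S "\<sigma> a"
  proof (unfold_locales)
    show "finite (carrier S)" using finite_quotient[OF comp openN e] by (simp add: Sc \<sigma>_def)
    show "\<sigma> a \<in> carrier S" using a by (simp add: Sc)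
    show "\<sigma> a \<noteq> \<zero>\<^bsub>S\<^esub>" using \<sigma>0[OF a] N'(3) by simp
    have "\<sigma> (a \<otimes> a) = \<sigma> a" using \<sigma>eq[of "a \<otimes> a" a] a aa N'(2) by (auto simp: m_closed)
    then show "\<sigma> a \<otimes>\<^bsub>S\<^esub> \<sigma> a = \<sigma> a" using a by (simp add: nonunital_homD(3)[OF \<sigma>hom])
    fix I assume I: "nonunital_ideal I S" "I \<noteq> {\<zero>\<^bsub>S\<^esub>}"
    note ID = S.nonunital_idealD[OF I(1)]
    define L where "L = {x \<in> carrier R. \<sigma> x \<in> I}"
    have L: "nonunital_ideal L R"
      unfolding L_def by (rule hom_preimage_ideal[OF nonunital_ring_axioms Sring \<sigma>hom I(1)])
    have NL: "N \<subseteq> L"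
    proof
      fix x assume x: "x \<in> N"
      then have xc: "x \<in> carrier R" using Pc[OF N] by blast
      then have "\<sigma> x = \<zero>\<^bsub>S\<^esub>" using \<sigma>0 x by simp
      then show "x \<in> L" using xc ID(2) by (simp add: L_def)
    qed
    show "\<sigma> a \<in> I"
    proof (rule ccontr)
      assume "\<sigma> a \<notin> I"
      then have "a \<notin> L" by (simp add: L_def)
      then have "P L" using L NL N'(2) by (auto simp: P_def)
      then have LN: "L = N" using NL by (rule maximal)
      have "u = \<zero>\<^bsub>S\<^esub>" if "u \<in> I" for u
      proof -
        have "u \<in> \<sigma> ` carrier R" using that ID(1) Sc(1) by blast
        then obtain x where x: "x \<in> carrier R" "u = \<sigma> x" by blast
        then have "x \<in> N" using that LN by (auto simp: L_def)
        then show ?thesis using \<sigma>0 x by simp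
      qed
      then show False using I(2) ID(2) by blast
    qed
  qed
  obtain F :: "'u ring" and k h where F: "field F" "finite (carrier F)" "k \<ge> 1"
    and h: "h \<in> nonunital_hom S (matrix_ring F k)" "bij_betw h (carrier S) (carrier (matrix_ring F k))"
    using S.isomorphic_to_matrix_ring .
  interpret F: field F by (rule F)
  interpret MF: nonunital_ring "matrix_ring F k" by (rule F.matrix_ring_nonunital)
  have h0: "h \<zero>\<^bsub>S\<^esub> = \<zero>\<^bsub>matrix_ring F k\<^esub>"
    by (rule nonunital_hom_zero[OF S.abelian_group_axioms MF.abelian_group_axioms h(1)])
  have "matrix_quotient N F k (h \<circ> \<sigma>)"
    unfolding matrix_quotient_def
  proof (intro conjI ballI F)
    show "h \<circ> \<sigma> \<in> nonunital_hom R (matrix_ring F k)" by (rule nonunital_hom_compose[OF \<sigma>hom h(1)])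
    show "(h \<circ> \<sigma>) ` carrier R = carrier (matrix_ring F k)"
      unfolding image_comp[symmetric] Sc(1)[symmetric] using h(2) by (simp only: bij_betw_def)
    fix x assume x: "x \<in> carrier R"
    have "h (\<sigma> x) = h \<zero>\<^bsub>S\<^esub> \<longleftrightarrow> \<sigma> x = \<zero>\<^bsub>S\<^esub>"
      using h(2) x by (auto simp: bij_betw_def Sc(1) intro: inj_onD[of h "carrier S"])
    then show "((h \<circ> \<sigma>) x = \<zero>\<^bsub>matrix_ring F k\<^esub>) = (x \<in> N)" using \<sigma>0[OF x] h0 by simp
  qed
  moreover have "w \<notin> N" using spow_in_ideal[OF N'(1), of w n] N'(3) by (auto simp: a_def)
  ultimately show thesis using that openN by blast
qed

text \<open>Suppose that x lies in the kernels of all matrix quotients. For each y so does yx, which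
  is therefore quasi-regular modulo every open ideal. Compactness provides one z that works for all
  open ideals at once, and separation makes the equation hold in \<open>R\<close>. Then x would be
  in the radical.\<close>

lemma matrix_quotients_separate:
  fixes e :: "'a set \<Rightarrow> 'u"
  assumes comp: "compact_space T" and e: "inj e" and sep: "open_ideals_separate" and ss: "semisimple_ring R"
    and x: "x \<in> carrier R" "x \<noteq> \<zero>"
  obtains N and F :: "'u ring" and k h where "open_ideal N" "matrix_quotient N F k h" "x \<notin> N"
proof -
  have "\<exists>N (F :: 'u ring) k h. open_ideal N \<and> matrix_quotient N F k h \<and> x \<notin> N"
  proof (rule ccontr)
    assume neg: "\<not> ?thesis"
    have "\<exists>z\<in>carrier R. y \<otimes> x \<oplus> z \<oplus> z \<otimes> y \<otimes> x = \<zero>" if y: "y \<in> carrier R" for y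
    proof -
      define w where "w = y \<otimes> x"
      have w: "w \<in> carrier R" using x y by (simp add: w_def m_closed)
      define C where "C = (\<lambda>M. {z \<in> carrier R. w \<oplus> z \<oplus> z \<otimes> w \<in> M})"
      have "\<exists>z. \<forall>M. open_ideal M \<longrightarrow> z \<in> C M"
      proof (rule compact_open_ideals[OF comp])
        fix M assume M: "open_ideal M"
        show "closedin T (C M)"
          unfolding C_def using open_ideal_closed[OF M] w by (intro closedin_preimage cont_intros)
        show "C M \<noteq> {}"
        proof
          assume "C M = {}"
          then have *: "w \<oplus> z \<oplus> z \<otimes> w \<notin> M" if "z \<in> carrier R" for z using that by (auto simp: C_def)
          obtain N and F :: "'u ring" and k h where N: "open_ideal N" "matrix_quotient N F k h" "w \<notin> N"
            using matrix_quotient_of_not_quasi_regular[OF comp e M w *] .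
          have "x \<in> N" using neg N by blast
          moreover have "nonunital_ideal N R" using N(1) by (simp add: open_ideal_def)
          ultimately have "w \<in> N" unfolding w_def using nonunital_idealD(6) y by blast
          then show False using N(3) by simp
        qed
      next
        fix M N :: "'a set" assume "M \<subseteq> N"
        then show "C M \<subseteq> C N" by (auto simp: C_def)
      qed
      then obtain z where z: "\<And>M. open_ideal M \<Longrightarrow> z \<in> C M" by blast
      have zc: "z \<in> carrier R" using z[OF open_ideal_carrier] by (simp add: C_def)
      have "w \<oplus> z \<oplus> z \<otimes> w = \<zero>"
      proof (rule ccontr)
        assume "w \<oplus> z \<oplus> z \<otimes> w \<noteq> \<zero>"
        then obtain M where "open_ideal M" "w \<oplus> z \<oplus> z \<otimes> w \<notin> M"
          using sep w zc unfolding open_ideals_separate_def by (meson a_closed m_closed)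
        then show False using z by (auto simp: C_def)
      qed
      then have "y \<otimes> x \<oplus> z \<oplus> z \<otimes> y \<otimes> x = \<zero>" using x y zc by (simp add: w_def m_assoc)
      then show ?thesis using zc by blast
    qed
    then have "x \<in> jacobson_radical R" using x by (simp add: jacobson_radical_def)
    then show False using ss x by (simp add: semisimple_ring_def)
  qed
  then show thesis using that by blast
qed

text \<open>If \<open>N'\<close> were inside \<open>N\<close>, the image of \<open>N\<close> in the
  second quotient would be a nonzero ideal of a simple ring, hence everything, and \<open>N\<close>
  would be all of \<open>R\<close>. So \<open>N'\<close> has a nonzero image in the first quotient,
  and by simplicity this image contains the identity.\<close>

lemma matrix_quotient_comaximal:
  assumes N: "nonunital_ideal N R" "matrix_quotient N F k h" and N': "nonunital_ideal N' R" "matrix_quotient N' F' k' h'"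
    and ne: "N \<noteq> N'"
  shows "\<exists>u\<in>N'. h u = \<one>\<^bsub>matrix_ring F k\<^esub>"
proof -
  have F: "field F" "k \<ge> 1" and h: "h \<in> nonunital_hom R (matrix_ring F k)" "h ` carrier R = carrier (matrix_ring F k)"
    and ker: "\<And>x. x \<in> carrier R \<Longrightarrow> h x = \<zero>\<^bsub>matrix_ring F k\<^esub> \<longleftrightarrow> x \<in> N"
    using N(2) by (auto simp: matrix_quotient_def)
  have F': "field F'" and h': "h' \<in> nonunital_hom R (matrix_ring F' k')" "h' ` carrier R = carrier (matrix_ring F' k')"
    and ker': "\<And>x. x \<in> carrier R \<Longrightarrow> h' x = \<zero>\<^bsub>matrix_ring F' k'\<^esub> \<longleftrightarrow> x \<in> N'"
    using N'(2) by (auto simp: matrix_quotient_def)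
  interpret F: field F by (rule F)
  interpret F': field F' by (rule F')
  interpret MF: nonunital_ring "matrix_ring F k" by (rule F.matrix_ring_nonunital)
  interpret MF': nonunital_ring "matrix_ring F' k'" by (rule F'.matrix_ring_nonunital)
  note ND = nonunital_idealD[OF N(1)] and ND' = nonunital_idealD[OF N'(1)]
  have "\<not> N' \<subseteq> N"
  proof
    assume sub: "N' \<subseteq> N"
    have "h' ` N \<noteq> {\<zero>\<^bsub>matrix_ring F' k'\<^esub>}"
    proof
      assume "h' ` N = {\<zero>\<^bsub>matrix_ring F' k'\<^esub>}"
      then have "N \<subseteq> N'" using ker' ND(1) by blast
      then show False using sub ne by blast
    qed
    then have all: "h' ` N = carrier (matrix_ring F' k')"
      by (intro F'.matrix_ring_simple hom_image_ideal[OF nonunital_ring_axioms MF'.nonunital_ring_axioms h' N(1)])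
    have "x \<in> N" if x: "x \<in> carrier R" for x
    proof -
      have "h' x \<in> h' ` N" using all h'(2) x by blast
      then obtain m where m: "m \<in> N" "h' x = h' m" by blast
      then have mc: "m \<in> carrier R" using ND(1) by blast
      have "h' (x \<ominus> m) = \<zero>\<^bsub>matrix_ring F' k'\<^esub>"
        using nonunital_hom_minus[OF abelian_group_axioms MF'.abelian_group_axioms h'(1) x mc] m(2)
          MF'.minus_eq_zero_iff[of "h' m" "h' m"] nonunital_homD(1)[OF h'(1) mc] by simp
      then have "x \<ominus> m \<in> N" using ker' x mc sub by auto
      then have "x \<ominus> m \<oplus> m \<in> N" using ND(3) m(1) by blast
      then show ?thesis using minus_add_cancel[OF x mc] by simp
    qed
    then have "h x = \<zero>\<^bsub>matrix_ring F k\<^esub>" if "x \<in> carrier R" for x using ker that by blast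
    moreover have "\<one>\<^bsub>matrix_ring F k\<^esub> \<in> h ` carrier R" using h(2) F.matrix_one_closed by blast
    ultimately have "\<one>\<^bsub>matrix_ring F k\<^esub> = \<zero>\<^bsub>matrix_ring F k\<^esub>" by auto
    then have "\<one>\<^bsub>F\<^esub> = \<zero>\<^bsub>F\<^esub>"
      using F.matrix_one_entry[of 0 k 0] F.matrix_zero_entry[of 0 k 0] F(2) by simp
    then show False by simp
  qed
  then obtain x where "x \<in> N'" "x \<notin> N" by blast
  then have "h ` N' \<noteq> {\<zero>\<^bsub>matrix_ring F k\<^esub>}" using ker ND'(1) by blast
  then have "h ` N' = carrier (matrix_ring F k)"
    by (intro F.matrix_ring_simple hom_image_ideal[OF nonunital_ring_axioms MF.nonunital_ring_axioms h N'(1)])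
  then have "\<one>\<^bsub>matrix_ring F k\<^esub> \<in> h ` N'" using F.matrix_one_closed by simp
  then show ?thesis by auto
qed

text \<open>A new coordinate is adjusted by adding us, where u is the identity in the new quotient
  and lies in all older kernels. Such a u is a product of elements supplied by comaximality;
  identities are taken only in the quotients, never in \<open>R\<close>.\<close>

lemma matrix_quotients_crt:
  assumes "finite A" and A: "\<And>N. N \<in> A \<Longrightarrow> open_ideal N" "\<And>N. N \<in> A \<Longrightarrow> matrix_quotient N (F N) (k N) (h N)"
    and t: "\<And>N. N \<in> A \<Longrightarrow> t N \<in> carrier (matrix_ring (F N) (k N))"
  shows "\<exists>x\<in>carrier R. \<forall>N\<in>A. h N x = t N"
  using assms
proof (induction A rule: finite_induct)
  case empty
  then show ?case by auto
next
  case (insert M A)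
  obtain x where x: "x \<in> carrier R" "\<forall>N\<in>A. h N x = t N" using insert by auto
  have fld: "field (F N)" and hom: "h N \<in> nonunital_hom R (matrix_ring (F N) (k N))"
    and surj: "h N ` carrier R = carrier (matrix_ring (F N) (k N))"
    and ker: "\<And>x. x \<in> carrier R \<Longrightarrow> h N x = \<zero>\<^bsub>matrix_ring (F N) (k N)\<^esub> \<longleftrightarrow> x \<in> N"
    and idl: "nonunital_ideal N R" if "N \<in> insert M A" for N
    using insert.prems(1,2)[OF that] by (auto simp: matrix_quotient_def open_ideal_def)
  have "\<exists>u\<in>carrier R. h M u = \<one>\<^bsub>matrix_ring (F M) (k M)\<^esub> \<and> (\<forall>N\<in>B. u \<in> N)" if "finite B" "B \<subseteq> A" for B
    using that
  proof (induction B rule: finite_induct)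
    case empty
    have "\<one>\<^bsub>matrix_ring (F M) (k M)\<^esub> \<in> h M ` carrier R"
      using surj[of M] ring.matrix_one_closed[of "F M"] fld[of M] by (simp add: field.is_ring)
    then show ?case by auto
  next
    case (insert N B)
    have NA: "N \<in> A" "N \<noteq> M" using insert.prems \<open>M \<notin> A\<close> by auto
    obtain u where u: "u \<in> carrier R" "h M u = \<one>\<^bsub>matrix_ring (F M) (k M)\<^esub>" "\<forall>N\<in>B. u \<in> N" using insert by auto
    obtain v where v: "v \<in> N" "h M v = \<one>\<^bsub>matrix_ring (F M) (k M)\<^esub>"
      using matrix_quotient_comaximal[OF idl _ idl, of M "F M" "k M" "h M" N "F N" "k N" "h N"] NA
        \<open>\<And>N. N \<in> insert M A \<Longrightarrow> matrix_quotient N (F N) (k N) (h N)\<close> by auto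
    have vc: "v \<in> carrier R" using v nonunital_idealD(1)[OF idl[of N]] NA by auto
    interpret FM: field "F M" by (rule fld) simp
    have "h M (u \<otimes> v) = \<one>\<^bsub>matrix_ring (F M) (k M)\<^esub>"
      using nonunital_homD(3)[OF hom[of M] u(1) vc] u(2) v(2) FM.matrix_one_mult[OF FM.matrix_one_closed] by simp
    moreover have "u \<otimes> v \<in> L" if "L \<in> insert N B" for L
    proof (cases "L = N")
      case True
      then show ?thesis using nonunital_idealD(6)[OF idl[of N] v(1) u(1)] NA by simp
    next
      case False
      then have "L \<in> B" "L \<in> A" using that insert.prems by auto
      then show ?thesis using nonunital_idealD(7)[OF idl[of L] _ vc] u(3) by simp
    qed
    ultimately show ?case using u(1) vc m_closed by blast
  qed
  from this[of A] obtain u where u: "u \<in> carrier R" "h M u = \<one>\<^bsub>matrix_ring (F M) (k M)\<^esub>" "\<forall>N\<in>A. u \<in> N"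
    using \<open>finite A\<close> by auto
  interpret FM: field "F M" by (rule fld) simp
  interpret MF: nonunital_ring "matrix_ring (F M) (k M)" by (rule FM.matrix_ring_nonunital)
  have tM: "t M \<in> carrier (matrix_ring (F M) (k M))" using insert.prems(3) by simp
  have hx: "h M x \<in> carrier (matrix_ring (F M) (k M))" using nonunital_homD(1)[OF hom[of M] x(1)] by simp
  have "t M \<ominus>\<^bsub>matrix_ring (F M) (k M)\<^esub> h M x \<in> h M ` carrier R"
    using surj[of M] tM hx by simp
  then obtain s where s: "s \<in> carrier R" "h M s = t M \<ominus>\<^bsub>matrix_ring (F M) (k M)\<^esub> h M x" by auto
  have "h M (u \<otimes> s \<oplus> x) = h M u \<otimes>\<^bsub>matrix_ring (F M) (k M)\<^esub> h M s \<oplus>\<^bsub>matrix_ring (F M) (k M)\<^esub> h M x"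
    using nonunital_homD(2,3)[OF hom[of M]] u(1) s(1) x(1) by (simp add: m_closed)
  also have "\<dots> = t M"
    using FM.matrix_one_mult[of "h M s"] tM hx by (simp add: u(2) s(2) MF.minus_add_cancel)
  finally have "h M (u \<otimes> s \<oplus> x) = t M" .
  moreover have "h N (u \<otimes> s \<oplus> x) = t N" if N: "N \<in> A" for N
  proof -
    interpret FN: field "F N" by (rule fld) (use N in simp)
    interpret MFN: nonunital_ring "matrix_ring (F N) (k N)" by (rule FN.matrix_ring_nonunital)
    have "u \<otimes> s \<in> N" using nonunital_idealD(7)[OF idl[of N] _ s(1)] u(3) N by simp
    then have "h N (u \<otimes> s) = \<zero>\<^bsub>matrix_ring (F N) (k N)\<^esub>" using ker[of N] N u(1) s(1) by (simp add: m_closed)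
    then show ?thesis
      using nonunital_homD(1,2)[OF hom[of N]] N u(1) s(1) x insert.prems(3)[of N] by (simp add: m_closed)
  qed
  ultimately show ?case using u(1) s(1) x(1) m_closed by (intro bexI[of _ "u \<otimes> s \<oplus> x"]) auto
qed

end

section \<open>Assembling the matrix quotients into a product\<close>

lemma product_ring_simps:
  "carrier (product_ring I S) = (\<Pi>\<^sub>E i\<in>I. carrier (S i))"
  "x \<oplus>\<^bsub>product_ring I S\<^esub> y = (\<lambda>i\<in>I. x i \<oplus>\<^bsub>S i\<^esub> y i)"
  "x \<otimes>\<^bsub>product_ring I S\<^esub> y = (\<lambda>i\<in>I. x i \<otimes>\<^bsub>S i\<^esub> y i)"
  by (simp_all add: product_ring_def)

lemma product_hom_iff:
  "H \<in> nonunital_hom R (product_ring I S) \<longleftrightarrow>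
     (\<forall>x\<in>carrier R. H x \<in> extensional I) \<and> (\<forall>i\<in>I. (\<lambda>x. H x i) \<in> nonunital_hom R (S i))" if "nonunital_ring R"
proof -
  interpret nonunital_ring R by fact
  show ?thesis
  proof
    assume H: "H \<in> nonunital_hom R (product_ring I S)"
    note HD = nonunital_homD[OF H, unfolded product_ring_simps]
    show "(\<forall>x\<in>carrier R. H x \<in> extensional I) \<and> (\<forall>i\<in>I. (\<lambda>x. H x i) \<in> nonunital_hom R (S i))"
      unfolding nonunital_hom_def using HD by (auto simp: PiE_def Pi_def)
  next
    assume *: "(\<forall>x\<in>carrier R. H x \<in> extensional I) \<and> (\<forall>i\<in>I. (\<lambda>x. H x i) \<in> nonunital_hom R (S i))"
    then have ext: "H x \<in> extensional I" if "x \<in> carrier R" for x using that by blast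
    have hom: "(\<lambda>x. H x i) \<in> nonunital_hom R (S i)" if "i \<in> I" for i using * that by blast
    show "H \<in> nonunital_hom R (product_ring I S)"
      unfolding nonunital_hom_def product_ring_simps
    proof (intro CollectI conjI ballI Pi_I)
      fix x assume x: "x \<in> carrier R"
      show "H x \<in> (\<Pi>\<^sub>E i\<in>I. carrier (S i))"
        using ext[OF x] nonunital_homD(1)[OF hom _] x by (auto simp: PiE_def)
      fix y assume y: "y \<in> carrier R"
      show "H (x \<oplus>\<^bsub>R\<^esub> y) = (\<lambda>i\<in>I. H x i \<oplus>\<^bsub>S i\<^esub> H y i)"
      proof (rule extensionalityI[of _ I])
        show "H (x \<oplus>\<^bsub>R\<^esub> y) i = (\<lambda>i\<in>I. H x i \<oplus>\<^bsub>S i\<^esub> H y i) i" if "i \<in> I" for i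
          using nonunital_homD(2)[OF hom[OF that] x y] that by simp
      qed (use ext x y in auto)
      show "H (x \<otimes>\<^bsub>R\<^esub> y) = (\<lambda>i\<in>I. H x i \<otimes>\<^bsub>S i\<^esub> H y i)"
      proof (rule extensionalityI[of _ I])
        show "H (x \<otimes>\<^bsub>R\<^esub> y) i = (\<lambda>i\<in>I. H x i \<otimes>\<^bsub>S i\<^esub> H y i) i" if "i \<in> I" for i
          using nonunital_homD(3)[OF hom[OF that] x y] that by simp
      qed (use ext x y m_closed in auto)
    qed
  qed
qed

text \<open>The fibre through x is the translate of the open kernel by x.\<close>

lemma (in top_ring) hom_discrete_continuous:
  assumes S: "nonunital_ring S" and h: "h \<in> nonunital_hom R S" and ker: "openin T {x \<in> carrier R. h x = \<zero>\<^bsub>S\<^esub>}"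
  shows "continuous_map T (discrete_topology (carrier S)) h"
  unfolding continuous_map_def
proof (intro conjI allI impI)
  interpret S: nonunital_ring S by fact
  show "h \<in> topspace T \<rightarrow> topspace (discrete_topology (carrier S))"
    using nonunital_homD(1)[OF h] by (simp add: topspace)
  fix U
  show "openin T {x \<in> topspace T. h x \<in> U}"
    unfolding openin_subopen[of T "{x \<in> topspace T. h x \<in> U}"]
  proof
    fix x assume "x \<in> {x \<in> topspace T. h x \<in> U}"
    then have x: "x \<in> carrier R" "h x \<in> U" by (auto simp: topspace)
    let ?V = "{y \<in> carrier R. y \<ominus> x \<in> {x \<in> carrier R. h x = \<zero>\<^bsub>S\<^esub>}}"
    have "openin T ?V" by (rule openin_translate[OF ker x(1)])
    moreover have heq: "h (y \<ominus> x) = \<zero>\<^bsub>S\<^esub> \<longleftrightarrow> h y = h x" if "y \<in> carrier R" for y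
      using nonunital_hom_minus[OF abelian_group_axioms S.abelian_group_axioms h that x(1)]
        S.minus_eq_zero_iff[OF nonunital_homD(1)[OF h that] nonunital_homD(1)[OF h x(1)]] by simp
    moreover have "x \<in> ?V" using x heq[of x] by simp
    moreover have "?V \<subseteq> {x \<in> topspace T. h x \<in> U}" using heq x(2) by (auto simp: topspace)
    ultimately show "\<exists>W. openin T W \<and> x \<in> W \<and> W \<subseteq> {x \<in> topspace T. h x \<in> U}" by blast
  qed
qed

text \<open>Injectivity is the separation by matrix quotients. Surjectivity is the Chinese remainder
  theorem for finitely many coordinates, extended to all of them by compactness. A continuous
  bijection from a compact space to a Hausdorff space is a homeomorphism.\<close>

theorem (in top_ring) compact_semisimple_product:
  fixes e :: "'a set \<Rightarrow> 'u"
  assumes comp: "compact_space T" and e: "inj e" and sep: "open_ideals_separate" and ss: "semisimple_ring R"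
  obtains I :: "'u set" and F :: "'u \<Rightarrow> 'u ring" and k
  where "\<And>i. i \<in> I \<Longrightarrow> field (F i) \<and> finite (carrier (F i)) \<and> k i \<ge> 1"
    "topological_ring_iso R T (product_ring I (\<lambda>i. matrix_ring (F i) (k i)))
       (discrete_product_topology I (\<lambda>i. matrix_ring (F i) (k i)))"
proof -
  define Ms where "Ms = {N. open_ideal N \<and> (\<exists>(F :: 'u ring) k h. matrix_quotient N F k h)}"
  have "\<exists>(F :: 'u ring) k h. matrix_quotient N F k h" if "N \<in> Ms" for N using that by (simp add: Ms_def)
  then obtain F0 :: "'a set \<Rightarrow> 'u ring" and k0 h0 where
    mq: "\<And>N. N \<in> Ms \<Longrightarrow> matrix_quotient N (F0 N) (k0 N) (h0 N)" by metis
  have op: "open_ideal N" if "N \<in> Ms" for N using that by (simp add: Ms_def)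
  \<comment> \<open>All open kernels of matrix quotients serve as indices, named by
    \<open>e\<close>; one quotient map per kernel has been fixed in \<open>h0\<close>.\<close>
  define I where "I = e ` Ms"
  define F where "F = (\<lambda>i. F0 (inv_into UNIV e i))"
  define k where "k = (\<lambda>i. k0 (inv_into UNIV e i))"
  define S where "S = (\<lambda>i. matrix_ring (F i) (k i))"
  define H where "H = (\<lambda>x. \<lambda>i\<in>I. h0 (inv_into UNIV e i) x)"
  have ie: "inv_into UNIV e (e N) = N" for N using e by simp
  have IMs: "inv_into UNIV e i \<in> Ms" if "i \<in> I" for i using that ie by (auto simp: I_def)
  have fld: "field (F i)" "finite (carrier (F i))" "k i \<ge> 1"
    and hom: "h0 (inv_into UNIV e i) \<in> nonunital_hom R (S i)" and surj: "h0 (inv_into UNIV e i) ` carrier R = carrier (S i)"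
    and ker: "\<And>x. x \<in> carrier R \<Longrightarrow> h0 (inv_into UNIV e i) x = \<zero>\<^bsub>S i\<^esub> \<longleftrightarrow> x \<in> inv_into UNIV e i" if "i \<in> I" for i
    using mq[OF IMs[OF that]] by (auto simp: matrix_quotient_def F_def k_def S_def)
  have Sring: "nonunital_ring (S i)" if "i \<in> I" for i
    using fld(1)[OF that] unfolding S_def by (simp add: field.is_ring ring.matrix_ring_nonunital)
  have Hhom: "H \<in> nonunital_hom R (product_ring I S)"
    unfolding product_hom_iff[OF nonunital_ring_axioms] using hom by (auto simp: H_def)
  have coord: "continuous_map T (discrete_topology (carrier (S i))) (h0 (inv_into UNIV e i))" if i: "i \<in> I" for i
  proof (rule hom_discrete_continuous[OF Sring[OF i] hom[OF i]])
    have o: "open_ideal (inv_into UNIV e i)" using op[OF IMs[OF i]] .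
    then have "inv_into UNIV e i \<subseteq> carrier R" using nonunital_idealD(1) unfolding open_ideal_def by blast
    then have "{x \<in> carrier R. h0 (inv_into UNIV e i) x = \<zero>\<^bsub>S i\<^esub>} = inv_into UNIV e i" using ker[OF i] by auto
    then show "openin T {x \<in> carrier R. h0 (inv_into UNIV e i) x = \<zero>\<^bsub>S i\<^esub>}" using o by (simp add: open_ideal_def)
  qed
  have Hcont: "continuous_map T (discrete_product_topology I S) H"
    unfolding discrete_product_topology_def continuous_map_componentwise
  proof (intro conjI ballI)
    show "H ` topspace T \<subseteq> extensional I" by (auto simp: H_def)
    fix i assume i: "i \<in> I"
    then have "(\<lambda>x. H x i) = h0 (inv_into UNIV e i)" by (simp add: H_def)
    then show "continuous_map T (discrete_topology (carrier (S i))) (\<lambda>x. H x i)" using coord[OF i] by simp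
  qed
  have Hinj: "inj_on H (carrier R)"
  proof (rule inj_onI, rule ccontr)
    fix x y assume xy: "x \<in> carrier R" "y \<in> carrier R" "H x = H y" "x \<noteq> y"
    then have d: "x \<ominus> y \<in> carrier R" "x \<ominus> y \<noteq> \<zero>" using minus_eq_zero_iff by auto
    obtain N and F' :: "'u ring" and k' h' where N: "open_ideal N" "matrix_quotient N F' k' h'" "x \<ominus> y \<notin> N"
      using matrix_quotients_separate[OF comp e sep ss d] .
    then have NMs: "N \<in> Ms" by (auto simp: Ms_def)
    then have iI: "e N \<in> I" by (simp add: I_def)
    interpret Si: nonunital_ring "S (e N)" by (rule Sring[OF iI])
    have "h0 N x = h0 N y" using fun_cong[OF xy(3), of "e N"] iI by (simp add: H_def ie)
    then have "h0 N (x \<ominus> y) = \<zero>\<^bsub>S (e N)\<^esub>"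
      using nonunital_hom_minus[OF abelian_group_axioms Si.abelian_group_axioms hom[OF iI] xy(1,2)]
        Si.minus_eq_zero_iff[of "h0 N y" "h0 N y"] nonunital_homD(1)[OF hom[OF iI] xy(2)] by (simp add: ie)
    then show False using ker[OF iI d(1)] N(3) by (simp add: ie)
  qed
  have Hsurj: "H ` carrier R = carrier (product_ring I S)"
  proof
    show "H ` carrier R \<subseteq> carrier (product_ring I S)" using nonunital_homD(1)[OF Hhom] by blast
    show "carrier (product_ring I S) \<subseteq> H ` carrier R"
    proof
      fix y assume y: "y \<in> carrier (product_ring I S)"
      define C where "C = (\<lambda>N. {x \<in> carrier R. h0 N x = y (e N)})"
      \<comment> \<open>Adding \<open>carrier R\<close> keeps the intersection inside the ring when
        there are no matrix quotients at all.\<close>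
      have "\<Inter>(insert (carrier R) (C ` Ms)) \<noteq> {}"
      proof (rule compact_space_fipD[OF comp])
        fix K assume "K \<in> insert (carrier R) (C ` Ms)"
        then consider "K = carrier R" | N where "N \<in> Ms" "K = C N" by blast
        then show "closedin T K"
        proof cases
          case 1
          then show ?thesis using closedin_topspace[of T] by (simp add: topspace)
        next
          case 2
          then have iI: "e N \<in> I" by (simp add: I_def)
          have "closedin (discrete_topology (carrier (S (e N)))) {y (e N)}"
            using y iI by (auto simp: product_ring_simps)
          then have "closedin T {x \<in> topspace T. h0 N x \<in> {y (e N)}}"
            using closedin_continuous_map_preimage[OF coord[OF iI], unfolded ie] by blast
          then show ?thesis using 2 by (simp add: C_def topspace)
        qed
      next
        fix \<F> assume \<F>: "finite \<F>" "\<F> \<subseteq> insert (carrier R) (C ` Ms)"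
        have "finite (\<F> - {carrier R})" "\<F> - {carrier R} \<subseteq> C ` Ms" using \<F> by auto
        then obtain A where A: "finite A" "A \<subseteq> Ms" "\<F> - {carrier R} = C ` A" using finite_subset_image by metis
        have "\<exists>x\<in>carrier R. \<forall>N\<in>A. h0 N x = y (e N)"
        proof (rule matrix_quotients_crt[OF A(1)])
          fix N assume "N \<in> A"
          then have N: "N \<in> Ms" "e N \<in> I" using A(2) by (auto simp: I_def)
          then show "open_ideal N" "matrix_quotient N (F0 N) (k0 N) (h0 N)" using op mq by auto
          show "y (e N) \<in> carrier (matrix_ring (F0 N) (k0 N))"
            using y N(2) by (auto simp: product_ring_simps S_def F_def k_def ie dest!: PiE_mem)
        qed
        then obtain x where x: "x \<in> carrier R" "\<forall>N\<in>A. h0 N x = y (e N)" by blast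
        have "x \<in> K" if "K \<in> \<F>" for K
        proof (cases "K = carrier R")
          case False
          then have "K \<in> C ` A" using that A(3) by blast
          then show ?thesis using x by (auto simp: C_def)
        qed (use x in simp)
        then show "\<Inter>\<F> \<noteq> {}" by blast
      qed
      then obtain x where x: "x \<in> carrier R" "\<And>N. N \<in> Ms \<Longrightarrow> x \<in> C N" by blast
      have "H x = y"
      proof (rule extensionalityI[of _ I])
        show "H x i = y i" if i: "i \<in> I" for i
        proof -
          obtain N where N: "N \<in> Ms" "i = e N" using i by (auto simp: I_def)
          then show ?thesis using x(2)[OF N(1)] i by (simp add: H_def C_def ie)
        qed
      qed (use y in \<open>auto simp: H_def product_ring_simps PiE_def\<close>)
      then show "y \<in> H ` carrier R" using x(1) by blast
    qed
  qed
  have top: "topspace (discrete_product_topology I S) = carrier (product_ring I S)"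
    by (simp add: discrete_product_topology_def product_ring_simps)
  have "homeomorphic_map T (discrete_product_topology I S) H"
  proof (rule continuous_imp_homeomorphic_map[OF Hcont comp])
    show "Hausdorff_space (discrete_product_topology I S)"
      by (auto simp: discrete_product_topology_def Hausdorff_space_product_topology Hausdorff_space_discrete_topology)
  qed (simp_all only: top topspace Hsurj Hinj)
  then have "topological_ring_iso R T (product_ring I S) (discrete_product_topology I S)"
    unfolding topological_ring_iso_def using Hhom Hinj Hsurj by (auto simp: bij_betw_def)
  then show thesis using that[of I F k] fld unfolding S_def by blast
qed

section \<open>Products of matrix rings\<close>

lemma product_iso_coordinates:
  assumes R: "nonunital_ring R" and iso: "topological_ring_iso R T (product_ring I S) U"
  obtains H where "bij_betw H (carrier R) (\<Pi>\<^sub>E i\<in>I. carrier (S i))" "homeomorphic_map T U H"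
    "\<forall>i\<in>I. (\<lambda>x. H x i) \<in> nonunital_hom R (S i)"
proof -
  obtain H where "H \<in> nonunital_hom R (product_ring I S)" "bij_betw H (carrier R) (carrier (product_ring I S))" "homeomorphic_map T U H"
    using iso unfolding topological_ring_iso_def by blast
  then show thesis using that[of H] product_hom_iff[OF R, of H I S] unfolding product_ring_simps by blast
qed

section \<open>Bounding the factors by the powers of single elements\<close>

lemma spow_generated_subring: "spow R x n \<in> generated_subring R {x}"
proof -
  have "spow R x n \<in> H" if "nonunital_subring H R" "x \<in> H" for H
    using that by (induction n) (auto simp: nonunital_subring_def)
  then show ?thesis unfolding generated_subring_def by auto
qed

text \<open>One element of the product has the coordinates \<open>a i\<close> in all factors at
  once. The subring it generates is finite, and its projection to each factor contains all powers of
  \<open>a i\<close>; so its size is a uniform bound.\<close>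

lemma weakly_locally_finite_bounded_powers:
  assumes R: "nonunital_ring R" and wlf: "weakly_locally_finite_ring R"
    and bij: "bij_betw H (carrier R) (\<Pi>\<^sub>E i\<in>I. carrier (S i))"
    and hom: "\<And>i. i \<in> I \<Longrightarrow> (\<lambda>x. H x i) \<in> nonunital_hom R (S i)"
    and a: "\<And>i. i \<in> I \<Longrightarrow> a i \<in> carrier (S i)"
  shows "\<exists>C. \<forall>i\<in>I. card (range (spow (S i) (a i))) \<le> C"
proof -
  have "(\<lambda>i\<in>I. a i) \<in> H ` carrier R" using bij a by (simp add: bij_betw_def)
  then obtain x where x: "x \<in> carrier R" "H x = (\<lambda>i\<in>I. a i)" by auto
  define G where "G = generated_subring R {x}"
  have fin: "finite G" using wlf x(1) by (auto simp: G_def weakly_locally_finite_ring_def)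
  have "card (range (spow (S i) (a i))) \<le> card G" if i: "i \<in> I" for i
  proof -
    have "spow (S i) (a i) n = H (spow R x n) i" for n
      using spow_hom[OF R hom[OF i] x(1), of n] x(2) i by simp
    then have "range (spow (S i) (a i)) \<subseteq> (\<lambda>g. H g i) ` G"
      using spow_generated_subring[of R x] by (auto simp: G_def)
    then show ?thesis using fin surj_card_le by blast
  qed
  then show ?thesis by blast
qed

text \<open>The shift matrix: its first k powers have ones on successive superdiagonals, ending with
  zero, and are distinct. The size of the matrices thus shows in the number of powers.\<close>

lemma (in field) matrix_nilpotent_powers:
  assumes fin: "finite (carrier R)"
  obtains A where "A \<in> carrier (matrix_ring R k)" "k \<le> card (range (spow (matrix_ring R k) A))"
proof -
  let ?M = "matrix_ring R k"
  interpret M: nonunital_ring ?M by (rule matrix_ring_nonunital)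
  define A where "A = (\<lambda>(i, j)\<in>{..<k} \<times> {..<k}. if j = Suc i then \<one> else \<zero>)"
  have A: "A \<in> carrier ?M" by (auto simp: A_def matrix_ring_simps)
  have Aent: "A (i, j) = (if j = Suc i then \<one> else \<zero>)" if "i < k" "j < k" for i j
    using that by (simp add: A_def)
  have pow: "spow ?M A n (i, j) = (if j = i + Suc n then \<one> else \<zero>)" if "i < k" "j < k" for n i j
    using that
  proof (induction n arbitrary: i j)
    case 0
    then show ?case by (simp add: Aent)
  next
    case (Suc n)
    have "spow ?M A (Suc n) (i, j) = (\<Oplus>l\<in>{..<k}. spow ?M A n (i, l) \<otimes> A (l, j))"
      using Suc.prems by (simp add: matrix_mult_entry)
    also have "\<dots> = (\<Oplus>l\<in>{..<k}. if l = i + Suc n then (if j = Suc l then \<one> else \<zero>) else \<zero>)"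
      using Suc by (intro finsum_cong') (auto simp: Aent)
    also have "\<dots> = (if j = i + Suc (Suc n) then \<one> else \<zero>)"
    proof (cases "i + Suc n < k")
      case True
      then show ?thesis by (subst finsum_delta) auto
    next
      case False
      then have "(\<Oplus>l\<in>{..<k}. if l = i + Suc n then (if j = Suc l then \<one> else \<zero>) else \<zero>) = (\<Oplus>l\<in>{..<k}. \<zero>)"
        by (intro finsum_cong') auto
      then show ?thesis using False Suc.prems by simp
    qed
    finally show ?case .
  qed
  have "inj_on (spow ?M A) {..<k}"
  proof (rule linorder_inj_onI)
    fix m n assume mn: "m < n" "m \<in> {..<k}" "n \<in> {..<k}"
    have "spow ?M A m (0, Suc m) = \<one>" "spow ?M A n (0, Suc m) = \<zero>"
      using mn by (auto simp: pow)
    then show "spow ?M A m \<noteq> spow ?M A n" by auto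
  qed auto
  then have "k = card (spow ?M A ` {..<k})" by (simp add: card_image)
  also have "\<dots> \<le> card (range (spow ?M A))"
  proof (rule card_mono)
    have "range (spow ?M A) \<subseteq> carrier ?M" using M.spow_closed[OF A] by auto
    then show "finite (range (spow ?M A))" using finite_matrix_ring[OF fin] finite_subset by blast
  qed auto
  finally show thesis using that[OF A] by blast
qed

text \<open>The scalar matrix of a generator of the cyclic multiplicative group: its powers produce
  every nonzero scalar, so the size of the field shows in their number.\<close>

lemma (in field) matrix_scalar_powers:
  assumes fin: "finite (carrier R)" and k: "k \<ge> 1"
  obtains A where "A \<in> carrier (matrix_ring R k)" "card (carrier R) - 1 \<le> card (range (spow (matrix_ring R k) A))"
proof -
  let ?M = "matrix_ring R k"
  interpret M: nonunital_ring ?M by (rule matrix_ring_nonunital)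
  obtain g where g: "g \<in> carrier (Multiplicative_Group.mult_of R)" "carrier (Multiplicative_Group.mult_of R) = {g [^] i | i::nat. i \<in> UNIV}"
    using finite_field_mult_group_has_gen[OF fin] by blast
  have gc: "g \<in> carrier R" "g \<noteq> \<zero>" using g(1) by auto
  define A where "A = (\<lambda>(i, j)\<in>{..<k} \<times> {..<k}. if i = j then g else \<zero>)"
  have A: "A \<in> carrier ?M" using gc by (auto simp: A_def matrix_ring_simps)
  have Aent: "A (i, j) = (if i = j then g else \<zero>)" if "i < k" "j < k" for i j
    using that by (simp add: A_def)
  have pow: "spow ?M A n (i, j) = (if i = j then g [^] Suc n else \<zero>)" if "i < k" "j < k" for n i j
    using that
  proof (induction n arbitrary: i j)
    case 0
    then show ?case using gc by (simp add: Aent)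
  next
    case (Suc n)
    have "spow ?M A (Suc n) (i, j) = (\<Oplus>l\<in>{..<k}. spow ?M A n (i, l) \<otimes> A (l, j))"
      using Suc.prems by (simp add: matrix_mult_entry)
    also have "\<dots> = (\<Oplus>l\<in>{..<k}. if l = i then (if l = j then g [^] Suc n \<otimes> g else \<zero>) else \<zero>)"
      using Suc gc by (intro finsum_cong') (auto simp: Aent)
    also have "\<dots> = (if i = j then g [^] Suc n \<otimes> g else \<zero>)"
      using Suc.prems gc by (subst finsum_delta) auto
    finally show ?case using gc by simp
  qed
  have sub: "carrier (Multiplicative_Group.mult_of R) \<subseteq> (\<lambda>B. B (0, 0)) ` range (spow ?M A)"
  proof
    fix y assume y: "y \<in> carrier (Multiplicative_Group.mult_of R)"
    \<comment> \<open>Powers begin with exponent one, so the generator property is applied to y/g in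
      order to write y as g^(i+1).\<close>
    have ig: "inv g \<in> carrier R" "inv g \<otimes> g = \<one>" using nonzero_inverse[OF gc] by auto
    have yc: "y \<in> carrier R" "y \<noteq> \<zero>" using y by auto
    have "y \<otimes> inv g \<noteq> \<zero>"
    proof
      assume "y \<otimes> inv g = \<zero>"
      then have "y \<otimes> inv g \<otimes> g = \<zero>" using gc by simp
      then show False using yc ig gc by (simp add: m_assoc)
    qed
    then have "y \<otimes> inv g \<in> carrier (Multiplicative_Group.mult_of R)" using yc ig by simp
    then obtain i :: nat where "y \<otimes> inv g = g [^] i" using g(2) by auto
    then have "g [^] Suc i = y \<otimes> inv g \<otimes> g" by simp
    also have "\<dots> = y" using yc ig gc by (simp add: m_assoc)
    finally have "y = spow ?M A i (0, 0)" using pow[of 0 0 i] k by simp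
    then show "y \<in> (\<lambda>B. B (0, 0)) ` range (spow ?M A)" by blast
  qed
  have finr: "finite (range (spow ?M A))"
  proof -
    have "range (spow ?M A) \<subseteq> carrier ?M" using M.spow_closed[OF A] by auto
    then show ?thesis using finite_matrix_ring[OF fin] finite_subset by blast
  qed
  have "card (carrier R) - 1 = card (carrier (Multiplicative_Group.mult_of R))" using fin by simp
  also have "\<dots> \<le> card (range (spow ?M A))" using surj_card_le[OF finr sub] .
  finally show thesis using that[OF A] by blast
qed

text \<open>A factor has |F|^(k^2) elements, so k and |F| are bounded separately, each by its own
  element of the product.\<close>

lemma weakly_locally_finite_bounded:
  assumes R: "nonunital_ring R" and wlf: "weakly_locally_finite_ring R"
    and fld: "\<And>i. i \<in> I \<Longrightarrow> field (F i) \<and> finite (carrier (F i)) \<and> k i \<ge> 1"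
    and iso: "topological_ring_iso R T (product_ring I (\<lambda>i. matrix_ring (F i) (k i))) U"
  shows "\<exists>N. \<forall>i\<in>I. card (carrier (matrix_ring (F i) (k i))) \<le> N"
proof -
  let ?S = "\<lambda>i. matrix_ring (F i) (k i)"
  obtain H where bij: "bij_betw H (carrier R) (\<Pi>\<^sub>E i\<in>I. carrier (?S i))"
    and "homeomorphic_map T U H" and homs: "\<forall>i\<in>I. (\<lambda>x. H x i) \<in> nonunital_hom R (?S i)"
    using product_iso_coordinates[OF R iso] .
  have hom: "(\<lambda>x. H x i) \<in> nonunital_hom R (?S i)" if "i \<in> I" for i using homs that by blast
  note H = bij hom
  have "\<exists>A. A \<in> carrier (?S i) \<and> k i \<le> card (range (spow (?S i) A))" if "i \<in> I" for i
    using field.matrix_nilpotent_powers[of "F i" "k i"] fld[OF that] by metis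
  then obtain a where a: "\<And>i. i \<in> I \<Longrightarrow> a i \<in> carrier (?S i)" "\<And>i. i \<in> I \<Longrightarrow> k i \<le> card (range (spow (?S i) (a i)))"
    by metis
  obtain C where C: "\<forall>i\<in>I. card (range (spow (?S i) (a i))) \<le> C"
    using weakly_locally_finite_bounded_powers[OF R wlf H a(1)] by blast
  have "\<exists>A. A \<in> carrier (?S i) \<and> card (carrier (F i)) - 1 \<le> card (range (spow (?S i) A))" if "i \<in> I" for i
    using field.matrix_scalar_powers[of "F i" "k i"] fld[OF that] by metis
  then obtain b where b: "\<And>i. i \<in> I \<Longrightarrow> b i \<in> carrier (?S i)"
    "\<And>i. i \<in> I \<Longrightarrow> card (carrier (F i)) - 1 \<le> card (range (spow (?S i) (b i)))"
    by metis
  obtain D where D: "\<forall>i\<in>I. card (range (spow (?S i) (b i))) \<le> D"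
    using weakly_locally_finite_bounded_powers[OF R wlf H b(1)] by blast
  have "card (carrier (?S i)) \<le> Suc D ^ (C * C)" if i: "i \<in> I" for i
  proof -
    have kC: "k i \<le> C" using a(2)[OF i] bspec[OF C i] by linarith
    have FD: "card (carrier (F i)) \<le> Suc D" using b(2)[OF i] bspec[OF D i] by linarith
    have "card (carrier (?S i)) = card (carrier (F i)) ^ (k i * k i)"
      by (simp add: matrix_ring_simps card_PiE card_cartesian_product)
    also have "\<dots> \<le> Suc D ^ (k i * k i)" using FD by (rule power_mono) simp
    also have "\<dots> \<le> Suc D ^ (C * C)" using kC by (intro power_increasing mult_le_mono) auto
    finally show ?thesis .
  qed
  then show ?thesis by blast
qed

text \<open>A radical element with a nonzero coordinate is tested against an element supported at
  that coordinate alone; its quasi-inverse would project to one in a matrix ring, where there is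
  none.\<close>

lemma matrix_product_semisimple:
  assumes R: "nonunital_ring R" and fld: "\<And>i. i \<in> I \<Longrightarrow> field (F i)"
    and iso: "topological_ring_iso R T (product_ring I (\<lambda>i. matrix_ring (F i) (k i))) U"
  shows "semisimple_ring R"
proof -
  let ?S = "\<lambda>i. matrix_ring (F i) (k i)"
  interpret nonunital_ring R by fact
  obtain H where bij: "bij_betw H (carrier R) (\<Pi>\<^sub>E i\<in>I. carrier (?S i))"
    and "homeomorphic_map T U H" and homs: "\<forall>i\<in>I. (\<lambda>x. H x i) \<in> nonunital_hom R (?S i)"
    using product_iso_coordinates[OF R iso] .
  have hom: "(\<lambda>x. H x i) \<in> nonunital_hom R (?S i)" if "i \<in> I" for i using homs that by blast
  have Sring: "nonunital_ring (?S i)" if "i \<in> I" for i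
    using fld[OF that] by (simp add: field.is_ring ring.matrix_ring_nonunital)
  have "x = \<zero>\<^bsub>R\<^esub>" if J: "x \<in> jacobson_radical R" for x
  proof (rule ccontr)
    assume x0: "x \<noteq> \<zero>\<^bsub>R\<^esub>"
    have x: "x \<in> carrier R" and J': "\<And>y. y \<in> carrier R \<Longrightarrow> \<exists>z\<in>carrier R. y \<otimes>\<^bsub>R\<^esub> x \<oplus>\<^bsub>R\<^esub> z \<oplus>\<^bsub>R\<^esub> z \<otimes>\<^bsub>R\<^esub> y \<otimes>\<^bsub>R\<^esub> x = \<zero>\<^bsub>R\<^esub>"
      using J by (auto simp: jacobson_radical_def)
    have h0: "H \<zero>\<^bsub>R\<^esub> i = \<zero>\<^bsub>?S i\<^esub>" if "i \<in> I" for i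
    proof -
      interpret Si: nonunital_ring "?S i" by (rule Sring[OF that])
      show ?thesis using nonunital_hom_zero[OF abelian_group_axioms Si.abelian_group_axioms hom[OF that]] .
    qed
    have "H x \<noteq> H \<zero>\<^bsub>R\<^esub>" using bij x x0 by (auto simp: bij_betw_def dest: inj_onD)
    moreover have "H x \<in> (\<Pi>\<^sub>E i\<in>I. carrier (?S i))" "H \<zero>\<^bsub>R\<^esub> \<in> (\<Pi>\<^sub>E i\<in>I. carrier (?S i))"
      using bij x by (auto simp: bij_betw_def)
    ultimately have "\<exists>i\<in>I. H x i \<noteq> H \<zero>\<^bsub>R\<^esub> i" using PiE_ext[of "H x" I _ "H \<zero>\<^bsub>R\<^esub>"] by blast
    then obtain i where i: "i \<in> I" "H x i \<noteq> \<zero>\<^bsub>?S i\<^esub>" using h0 by auto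
    interpret Fi: field "F i" by (rule fld[OF i(1)])
    interpret Si: nonunital_ring "?S i" by (rule Sring[OF i(1)])
    note hD = nonunital_homD[OF hom[OF i(1)]]
    have zc: "\<zero>\<^bsub>?S j\<^esub> \<in> carrier (?S j)" if "j \<in> I" for j
      by (rule ring.matrix_zero_closed) (rule field.is_ring[OF fld[OF that]])
    show False
    proof (rule Fi.matrix_ring_not_quasi_regular[OF hD(1)[OF x] i(2)])
      fix b assume b: "b \<in> carrier (?S i)" "\<And>z. z \<in> carrier (?S i) \<Longrightarrow>
        b \<otimes>\<^bsub>?S i\<^esub> H x i \<oplus>\<^bsub>?S i\<^esub> z \<oplus>\<^bsub>?S i\<^esub> z \<otimes>\<^bsub>?S i\<^esub> b \<otimes>\<^bsub>?S i\<^esub> H x i \<noteq> \<zero>\<^bsub>?S i\<^esub>"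
      define y where "y = (\<lambda>j\<in>I. if j = i then b else \<zero>\<^bsub>?S j\<^esub>)"
      have "y \<in> (\<Pi>\<^sub>E i\<in>I. carrier (?S i))"
        using b(1) zc by (auto simp: y_def)
      then have "y \<in> H ` carrier R" using bij by (simp add: bij_betw_def)
      then obtain y' where y': "y' \<in> carrier R" "H y' = y" by blast
      obtain z where z: "z \<in> carrier R" "y' \<otimes>\<^bsub>R\<^esub> x \<oplus>\<^bsub>R\<^esub> z \<oplus>\<^bsub>R\<^esub> z \<otimes>\<^bsub>R\<^esub> y' \<otimes>\<^bsub>R\<^esub> x = \<zero>\<^bsub>R\<^esub>"
        using J'[OF y'(1)] by blast
      have "H (y' \<otimes>\<^bsub>R\<^esub> x \<oplus>\<^bsub>R\<^esub> z \<oplus>\<^bsub>R\<^esub> z \<otimes>\<^bsub>R\<^esub> y' \<otimes>\<^bsub>R\<^esub> x) i =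
          H y' i \<otimes>\<^bsub>?S i\<^esub> H x i \<oplus>\<^bsub>?S i\<^esub> H z i \<oplus>\<^bsub>?S i\<^esub> H z i \<otimes>\<^bsub>?S i\<^esub> H y' i \<otimes>\<^bsub>?S i\<^esub> H x i"
        using x y'(1) z(1) by (simp add: hD m_closed)
      moreover have "H y' i = b" using y'(2) i(1) by (simp add: y_def)
      ultimately show False using b(2)[OF hD(1)[OF z(1)]] z(2) h0[OF i(1)] by simp
    qed
  qed
  moreover have "\<zero>\<^bsub>R\<^esub> \<in> jacobson_radical R"
    unfolding jacobson_radical_def by (auto simp: m_closed intro!: bexI[of _ "\<zero>\<^bsub>R\<^esub>"])
  ultimately show ?thesis unfolding semisimple_ring_def by blast
qed

section \<open>Families of rings of bounded size\<close>

text \<open>The factors are finite rings on unrelated sets. Numbering each carrier turns the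
  operations into tables of natural numbers. There are finitely many codes, consisting of a size and
  two tables, and for equal codes the numberings match up to an isomorphism. Places outside the
  actual carrier are filled with 0 so that all tables have the same domain.\<close>

lemma ring_codes:
  fixes S :: "'i \<Rightarrow> ('a, 'm) ring_scheme"
  assumes S: "\<And>i. i \<in> I \<Longrightarrow> nonunital_ring (S i)" "\<And>i. i \<in> I \<Longrightarrow> finite (carrier (S i))"
    and N: "\<And>i. i \<in> I \<Longrightarrow> card (carrier (S i)) \<le> N"
  obtains b :: "'i \<Rightarrow> 'a \<Rightarrow> nat" and code :: "'i \<Rightarrow> nat \<times> (nat \<times> nat \<Rightarrow> nat) \<times> (nat \<times> nat \<Rightarrow> nat)"
  where "\<forall>i\<in>I. inj_on (b i) (carrier (S i))" "\<forall>i\<in>I. b i ` carrier (S i) \<subseteq> {..<N}" "finite (code ` I)"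
    "\<forall>i\<in>I. \<forall>j\<in>I. code i = code j \<longrightarrow> b i ` carrier (S i) = b j ` carrier (S j)"
    "\<forall>i\<in>I. \<forall>j\<in>I. code i = code j \<longrightarrow> (\<forall>x\<in>carrier (S i). \<forall>x'\<in>carrier (S i). \<forall>y\<in>carrier (S j). \<forall>y'\<in>carrier (S j).
       b i x = b j y \<and> b i x' = b j y' \<longrightarrow>
         b i (x \<oplus>\<^bsub>S i\<^esub> x') = b j (y \<oplus>\<^bsub>S j\<^esub> y') \<and> b i (x \<otimes>\<^bsub>S i\<^esub> x') = b j (y \<otimes>\<^bsub>S j\<^esub> y'))"
proof -
  have "\<exists>g. bij_betw g (carrier (S i)) {..<card (carrier (S i))}" if "i \<in> I" for i
    using ex_bij_betw_finite_nat[OF S(2)[OF that]] by (simp add: atLeast0LessThan)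
  then obtain b where b: "\<And>i. i \<in> I \<Longrightarrow> bij_betw (b i) (carrier (S i)) {..<card (carrier (S i))}" by metis
  define s where "s = (\<lambda>i. inv_into (carrier (S i)) (b i))"
  define D where "D = (\<lambda>i. {..<card (carrier (S i))} \<times> {..<card (carrier (S i))})"
  define ta where "ta = (\<lambda>i. \<lambda>p\<in>{..<N} \<times> {..<N}. if p \<in> D i then b i (s i (fst p) \<oplus>\<^bsub>S i\<^esub> s i (snd p)) else 0)"
  define tm where "tm = (\<lambda>i. \<lambda>p\<in>{..<N} \<times> {..<N}. if p \<in> D i then b i (s i (fst p) \<otimes>\<^bsub>S i\<^esub> s i (snd p)) else 0)"
  define code where "code = (\<lambda>i. (card (carrier (S i)), ta i, tm i))"
  have inj: "inj_on (b i) (carrier (S i))" and im: "b i ` carrier (S i) = {..<card (carrier (S i))}" if "i \<in> I" for i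
    using b[OF that] by (auto simp: bij_betw_def)
  have sb: "s i (b i x) = x" if "i \<in> I" "x \<in> carrier (S i)" for i x
    unfolding s_def using inj[OF that(1)] that(2) by simp
  have sc: "s i u \<in> carrier (S i)" if "i \<in> I" "u < card (carrier (S i))" for i u
    unfolding s_def using im[OF that(1)] that(2) by (intro inv_into_into) auto
  have lt: "b i x < card (carrier (S i))" if "i \<in> I" "x \<in> carrier (S i)" for i x
    using imageI[OF that(2), of "b i"] im[OF that(1)] by simp
  have bN: "b i x < N" if "i \<in> I" "x \<in> carrier (S i)" for i x
    using lt[OF that] N[OF that(1)] by simp
  have fin: "finite (code ` I)"
  proof (rule finite_subset)
    let ?P = "({..<N} \<times> {..<N}) \<rightarrow>\<^sub>E {..<Suc N}"
    have "ta i \<in> ?P \<and> tm i \<in> ?P" if i: "i \<in> I" for i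
    proof -
      interpret Si: nonunital_ring "S i" by (rule S(1)[OF i])
      have "b i (s i u \<oplus>\<^bsub>S i\<^esub> s i v) < Suc N" "b i (s i u \<otimes>\<^bsub>S i\<^esub> s i v) < Suc N"
        if "(u, v) \<in> D i" for u v
        using that sc[OF i] bN[OF i] by (auto simp: D_def Si.m_closed intro!: less_SucI)
      then show ?thesis by (auto simp: ta_def tm_def)
    qed
    then show "code ` I \<subseteq> {..N} \<times> ?P \<times> ?P" using N by (auto simp: code_def)
    show "finite ({..N} \<times> ?P \<times> ?P)" by (intro finite_cartesian_product finite_PiE) auto
  qed
  show thesis
  proof (rule that[of b code])
    show "\<forall>i\<in>I. inj_on (b i) (carrier (S i))" using inj by blast
    show "\<forall>i\<in>I. b i ` carrier (S i) \<subseteq> {..<N}" using bN by auto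
    show "finite (code ` I)" by (rule fin)
    show "\<forall>i\<in>I. \<forall>j\<in>I. code i = code j \<longrightarrow> b i ` carrier (S i) = b j ` carrier (S j)"
      using im by (auto simp: code_def)
    show "\<forall>i\<in>I. \<forall>j\<in>I. code i = code j \<longrightarrow> (\<forall>x\<in>carrier (S i). \<forall>x'\<in>carrier (S i). \<forall>y\<in>carrier (S j). \<forall>y'\<in>carrier (S j).
       b i x = b j y \<and> b i x' = b j y' \<longrightarrow>
         b i (x \<oplus>\<^bsub>S i\<^esub> x') = b j (y \<oplus>\<^bsub>S j\<^esub> y') \<and> b i (x \<otimes>\<^bsub>S i\<^esub> x') = b j (y \<otimes>\<^bsub>S j\<^esub> y'))"
    proof (intro ballI impI)
      fix i j x x' y y' assume ij: "i \<in> I" "j \<in> I" and cd: "code i = code j"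
        and x: "x \<in> carrier (S i)" "x' \<in> carrier (S i)" and y: "y \<in> carrier (S j)" "y' \<in> carrier (S j)"
        and eq: "b i x = b j y \<and> b i x' = b j y'"
      have tbl: "ta i (b i x, b i x') = b i (x \<oplus>\<^bsub>S i\<^esub> x')" "tm i (b i x, b i x') = b i (x \<otimes>\<^bsub>S i\<^esub> x')"
        if "i \<in> I" "x \<in> carrier (S i)" "x' \<in> carrier (S i)" for i x x'
        using that sb[OF that(1)] bN[OF that(1)] lt[OF that(1)] by (auto simp: ta_def tm_def D_def)
      have "ta i = ta j" "tm i = tm j" using cd by (simp_all add: code_def)
      then show "b i (x \<oplus>\<^bsub>S i\<^esub> x') = b j (y \<oplus>\<^bsub>S j\<^esub> y') \<and> b i (x \<otimes>\<^bsub>S i\<^esub> x') = b j (y \<otimes>\<^bsub>S j\<^esub> y')"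
        using tbl[OF ij(1) x] tbl[OF ij(2) y] eq by simp
    qed
  qed
qed

text \<open>The addition table determines zero and negatives: zero is the only x with x = x + x, and
  the negative of x is determined by its sum with x.\<close>

lemma coded_zero_minus:
  assumes S: "nonunital_ring S" "nonunital_ring S'" and im: "b ` carrier S = b' ` carrier S'"
    and inj: "inj_on b (carrier S)" "inj_on b' (carrier S')"
    and add: "\<And>x x' y y'. \<lbrakk>x \<in> carrier S; x' \<in> carrier S; y \<in> carrier S'; y' \<in> carrier S'; b x = b' y; b x' = b' y'\<rbrakk>
      \<Longrightarrow> b (x \<oplus>\<^bsub>S\<^esub> x') = b' (y \<oplus>\<^bsub>S'\<^esub> y')"
  shows "b \<zero>\<^bsub>S\<^esub> = b' \<zero>\<^bsub>S'\<^esub>"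
    "\<And>x y. \<lbrakk>x \<in> carrier S; y \<in> carrier S'; b x = b' y\<rbrakk> \<Longrightarrow> b (\<ominus>\<^bsub>S\<^esub> x) = b' (\<ominus>\<^bsub>S'\<^esub> y)"
proof -
  interpret S: nonunital_ring S by fact
  interpret S': nonunital_ring S' by fact
  have "b \<zero>\<^bsub>S\<^esub> \<in> b' ` carrier S'" using im S.zero_closed by blast
  then obtain y where y: "y \<in> carrier S'" "b \<zero>\<^bsub>S\<^esub> = b' y" by auto
  have "b' y = b' (y \<oplus>\<^bsub>S'\<^esub> y)" using add[OF S.zero_closed S.zero_closed y(1) y(1) y(2) y(2)] y(2) by simp
  then have "y = y \<oplus>\<^bsub>S'\<^esub> y" using inj_onD[OF inj(2)] y(1) by simp
  then have "y = \<zero>\<^bsub>S'\<^esub>" using y(1) S'.add.r_cancel_one' by blast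
  then show zero: "b \<zero>\<^bsub>S\<^esub> = b' \<zero>\<^bsub>S'\<^esub>" using y(2) by simp
  fix x y assume x: "x \<in> carrier S" and y: "y \<in> carrier S'" and xy: "b x = b' y"
  have "b (\<ominus>\<^bsub>S\<^esub> x) \<in> b' ` carrier S'" using im x by blast
  then obtain w where w: "w \<in> carrier S'" "b (\<ominus>\<^bsub>S\<^esub> x) = b' w" by auto
  have "b (\<ominus>\<^bsub>S\<^esub> x \<oplus>\<^bsub>S\<^esub> x) = b' (w \<oplus>\<^bsub>S'\<^esub> y)" by (rule add) (use x y w xy in auto)
  then have "b' (w \<oplus>\<^bsub>S'\<^esub> y) = b' \<zero>\<^bsub>S'\<^esub>" using x zero by (simp add: S.l_neg)
  then have "w \<oplus>\<^bsub>S'\<^esub> y = \<zero>\<^bsub>S'\<^esub>" using inj_onD[OF inj(2)] w(1) y by simp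
  then have "\<ominus>\<^bsub>S'\<^esub> y = w" using S'.minus_equality w(1) y by blast
  then show "b (\<ominus>\<^bsub>S\<^esub> x) = b' (\<ominus>\<^bsub>S'\<^esub> y)" using w(2) by simp
qed

lemma bounded_product_locally_finite:
  fixes S :: "'i \<Rightarrow> ('b, 'm) ring_scheme"
  assumes R: "nonunital_ring R"
    and S: "\<And>i. i \<in> I \<Longrightarrow> nonunital_ring (S i)" "\<And>i. i \<in> I \<Longrightarrow> finite (carrier (S i))"
    and N: "\<And>i. i \<in> I \<Longrightarrow> card (carrier (S i)) \<le> N"
    and bij: "bij_betw H (carrier R) (\<Pi>\<^sub>E i\<in>I. carrier (S i))"
    and hom: "\<And>i. i \<in> I \<Longrightarrow> (\<lambda>x. H x i) \<in> nonunital_hom R (S i)"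
  shows "locally_finite_ring R"
  unfolding locally_finite_ring_def
proof (intro allI impI)
  fix A assume A: "finite A \<and> A \<subseteq> carrier R"
  interpret R: nonunital_ring R by fact
  obtain b :: "'i \<Rightarrow> 'b \<Rightarrow> nat"
    and code :: "'i \<Rightarrow> nat \<times> (nat \<times> nat \<Rightarrow> nat) \<times> (nat \<times> nat \<Rightarrow> nat)"
    where inj: "\<forall>i\<in>I. inj_on (b i) (carrier (S i))" and bN: "\<forall>i\<in>I. b i ` carrier (S i) \<subseteq> {..<N}"
    and fin: "finite (code ` I)"
    and im: "\<forall>i\<in>I. \<forall>j\<in>I. code i = code j \<longrightarrow> b i ` carrier (S i) = b j ` carrier (S j)"
    and ops: "\<forall>i\<in>I. \<forall>j\<in>I. code i = code j \<longrightarrow> (\<forall>x\<in>carrier (S i). \<forall>x'\<in>carrier (S i). \<forall>y\<in>carrier (S j). \<forall>y'\<in>carrier (S j).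
       b i x = b j y \<and> b i x' = b j y' \<longrightarrow>
         b i (x \<oplus>\<^bsub>S i\<^esub> x') = b j (y \<oplus>\<^bsub>S j\<^esub> y') \<and> b i (x \<otimes>\<^bsub>S i\<^esub> x') = b j (y \<otimes>\<^bsub>S j\<^esub> y'))"
    using ring_codes[OF S N] .
  \<comment> \<open>The partition of the index set: two indices belong to one class if their factors
    have the same tables and each element of \<open>A\<close> has equally numbered coordinates
    there.\<close>
  define c where "c = (\<lambda>i. (code i, \<lambda>a\<in>A. b i (H a i)))"
  have Hc: "H x i \<in> carrier (S i)" if "x \<in> carrier R" "i \<in> I" for x i
    using nonunital_homD(1)[OF hom[OF that(2)] that(1)] .
  have blt: "b i (H x i) < N" if "x \<in> carrier R" "i \<in> I" for x i
    using bN Hc[OF that] that(2) by auto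
  have finc: "finite (c ` I)"
  proof (rule finite_subset)
    show "c ` I \<subseteq> code ` I \<times> (A \<rightarrow>\<^sub>E {..<N})"
    proof
      fix u assume "u \<in> c ` I"
      then obtain i where i: "i \<in> I" "u = c i" by blast
      have "b i (H a i) < N" if "a \<in> A" for a using blt[OF _ i(1)] A that by blast
      then have "(\<lambda>a\<in>A. b i (H a i)) \<in> A \<rightarrow>\<^sub>E {..<N}" by simp
      then show "u \<in> code ` I \<times> (A \<rightarrow>\<^sub>E {..<N})" using i by (simp add: c_def)
    qed
    show "finite (code ` I \<times> (A \<rightarrow>\<^sub>E {..<N}))" using A fin by (intro finite_cartesian_product finite_PiE) auto
  qed
  define K where "K = {x \<in> carrier R. \<forall>i\<in>I. \<forall>j\<in>I. c i = c j \<longrightarrow> b i (H x i) = b j (H x j)}"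
  have KE: "b i (H x i) = b j (H x j)" if "x \<in> K" "i \<in> I" "j \<in> I" "c i = c j" for x i j
    using that unfolding K_def by blast
  have Kc: "x \<in> carrier R" if "x \<in> K" for x using that unfolding K_def by blast
  have KI: "x \<in> K" if "x \<in> carrier R" "\<And>i j. \<lbrakk>i \<in> I; j \<in> I; c i = c j\<rbrakk> \<Longrightarrow> b i (H x i) = b j (H x j)" for x
    unfolding K_def by (intro CollectI conjI ballI impI that)
  have opsE: "b i (x \<oplus>\<^bsub>S i\<^esub> x') = b j (y \<oplus>\<^bsub>S j\<^esub> y')" "b i (x \<otimes>\<^bsub>S i\<^esub> x') = b j (y \<otimes>\<^bsub>S j\<^esub> y')"
    if "i \<in> I" "j \<in> I" "c i = c j" "x \<in> carrier (S i)" "x' \<in> carrier (S i)" "y \<in> carrier (S j)" "y' \<in> carrier (S j)"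
      "b i x = b j y" "b i x' = b j y'" for i j x x' y y'
  proof -
    have "code i = code j" using that(3) unfolding c_def by (rule Pair_inject)
    then have "b i (x \<oplus>\<^bsub>S i\<^esub> x') = b j (y \<oplus>\<^bsub>S j\<^esub> y') \<and> b i (x \<otimes>\<^bsub>S i\<^esub> x') = b j (y \<otimes>\<^bsub>S j\<^esub> y')"
      using ops that(1,2,4-9) by blast
    then show "b i (x \<oplus>\<^bsub>S i\<^esub> x') = b j (y \<oplus>\<^bsub>S j\<^esub> y')" "b i (x \<otimes>\<^bsub>S i\<^esub> x') = b j (y \<otimes>\<^bsub>S j\<^esub> y')"
      by (rule conjunct1, rule conjunct2)
  qed
  have zm: "b i \<zero>\<^bsub>S i\<^esub> = b j \<zero>\<^bsub>S j\<^esub>"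
    "\<And>x y. \<lbrakk>x \<in> carrier (S i); y \<in> carrier (S j); b i x = b j y\<rbrakk> \<Longrightarrow> b i (\<ominus>\<^bsub>S i\<^esub> x) = b j (\<ominus>\<^bsub>S j\<^esub> y)"
    if ij: "i \<in> I" "j \<in> I" "c i = c j" for i j
  proof -
    have cd: "code i = code j" using ij(3) by (simp add: c_def)
    have im': "b i ` carrier (S i) = b j ` carrier (S j)" using im ij cd by blast
    have inj': "inj_on (b i) (carrier (S i))" "inj_on (b j) (carrier (S j))" using inj ij by auto
    note * = coded_zero_minus[OF S(1)[OF ij(1)] S(1)[OF ij(2)] im' inj' opsE(1)[OF ij]]
    show "b i \<zero>\<^bsub>S i\<^esub> = b j \<zero>\<^bsub>S j\<^esub>" by (rule *)
    show "b i (\<ominus>\<^bsub>S i\<^esub> x) = b j (\<ominus>\<^bsub>S j\<^esub> y)" if "x \<in> carrier (S i)" "y \<in> carrier (S j)" "b i x = b j y" for x y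
      by (rule *(2)[OF _ _ _ _ _ _ that])
  qed
  have hS: "H \<zero>\<^bsub>R\<^esub> i = \<zero>\<^bsub>S i\<^esub>" "\<And>x. x \<in> carrier R \<Longrightarrow> H (\<ominus>\<^bsub>R\<^esub> x) i = \<ominus>\<^bsub>S i\<^esub> H x i" if i: "i \<in> I" for i
  proof -
    interpret Si: nonunital_ring "S i" by (rule S(1)[OF i])
    show "H \<zero>\<^bsub>R\<^esub> i = \<zero>\<^bsub>S i\<^esub>"
      using nonunital_hom_zero[OF R.abelian_group_axioms Si.abelian_group_axioms hom[OF i]] .
    show "H (\<ominus>\<^bsub>R\<^esub> x) i = \<ominus>\<^bsub>S i\<^esub> H x i" if "x \<in> carrier R" for x
      using nonunital_hom_a_inv[OF R.abelian_group_axioms Si.abelian_group_axioms hom[OF i] that] .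
  qed
  have "nonunital_subring K R"
    unfolding nonunital_subring_def R.additive_subgroup_iff
  proof (intro conjI ballI subsetI)
    show "x \<in> carrier R" if "x \<in> K" for x using Kc[OF that] .
    show "\<zero>\<^bsub>R\<^esub> \<in> K"
    proof (rule KI[OF R.zero_closed])
      fix i j assume ij: "i \<in> I" "j \<in> I" "c i = c j"
      show "b i (H \<zero>\<^bsub>R\<^esub> i) = b j (H \<zero>\<^bsub>R\<^esub> j)"
        unfolding hS(1)[OF ij(1)] hS(1)[OF ij(2)] by (rule zm(1)[OF ij])
    qed
    fix x assume x: "x \<in> K"
    show "\<ominus>\<^bsub>R\<^esub> x \<in> K"
    proof (rule KI[OF R.a_inv_closed[OF Kc[OF x]]])
      fix i j assume ij: "i \<in> I" "j \<in> I" "c i = c j"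
      show "b i (H (\<ominus>\<^bsub>R\<^esub> x) i) = b j (H (\<ominus>\<^bsub>R\<^esub> x) j)"
        unfolding hS(2)[OF ij(1) Kc[OF x]] hS(2)[OF ij(2) Kc[OF x]]
        by (rule zm(2)[OF ij Hc[OF Kc[OF x] ij(1)] Hc[OF Kc[OF x] ij(2)] KE[OF x ij]])
    qed
    fix y assume y: "y \<in> K"
    note xy = Kc[OF x] Kc[OF y]
    show "x \<oplus>\<^bsub>R\<^esub> y \<in> K"
    proof (rule KI[OF R.a_closed[OF xy]])
      fix i j assume ij: "i \<in> I" "j \<in> I" "c i = c j"
      show "b i (H (x \<oplus>\<^bsub>R\<^esub> y) i) = b j (H (x \<oplus>\<^bsub>R\<^esub> y) j)"
        unfolding nonunital_homD(2)[OF hom[OF ij(1)] xy] nonunital_homD(2)[OF hom[OF ij(2)] xy]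
        by (rule opsE(1)[OF ij Hc[OF xy(1) ij(1)] Hc[OF xy(2) ij(1)] Hc[OF xy(1) ij(2)] Hc[OF xy(2) ij(2)]
              KE[OF x ij] KE[OF y ij]])
    qed
    show "x \<otimes>\<^bsub>R\<^esub> y \<in> K"
    proof (rule KI[OF R.m_closed[OF xy]])
      fix i j assume ij: "i \<in> I" "j \<in> I" "c i = c j"
      show "b i (H (x \<otimes>\<^bsub>R\<^esub> y) i) = b j (H (x \<otimes>\<^bsub>R\<^esub> y) j)"
        unfolding nonunital_homD(3)[OF hom[OF ij(1)] xy] nonunital_homD(3)[OF hom[OF ij(2)] xy]
        by (rule opsE(2)[OF ij Hc[OF xy(1) ij(1)] Hc[OF xy(2) ij(1)] Hc[OF xy(1) ij(2)] Hc[OF xy(2) ij(2)]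
              KE[OF x ij] KE[OF y ij]])
    qed
  qed
  moreover have "A \<subseteq> K"
  proof
    fix a assume a: "a \<in> A"
    have same: "b i (H a i) = b j (H a j)" if "c i = c j" for i j
    proof -
      have "snd (c i) a = snd (c j) a" unfolding that ..
      then show ?thesis using a by (simp add: c_def)
    qed
    have "a \<in> carrier R" using a A by blast
    then show "a \<in> K" by (rule KI) (rule same)
  qed
  ultimately have sub: "generated_subring R A \<subseteq> K" unfolding generated_subring_def by blast
  have "finite K"
  proof -
    \<comment> \<open>One index per class. An element of \<open>K\<close> is determined by its
      numbers at these finitely many indices.\<close>
    define r where "r = (\<lambda>u. SOME i. i \<in> I \<and> c i = u)"
    have r: "r (c i) \<in> I" "c (r (c i)) = c i" if "i \<in> I" for i
      using someI[of "\<lambda>j. j \<in> I \<and> c j = c i" i] that by (auto simp: r_def)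
    define f where "f = (\<lambda>x. \<lambda>u\<in>c ` I. b (r u) (H x (r u)))"
    have "f ` K \<subseteq> (c ` I \<rightarrow>\<^sub>E {..<N})" using r blt Kc by (auto simp: f_def)
    moreover have "finite (c ` I \<rightarrow>\<^sub>E {..<N})" using finc by (intro finite_PiE) auto
    ultimately have fK: "finite (f ` K)" by (rule finite_subset)
    have "inj_on f K"
    proof (rule inj_onI)
      fix x y assume xy: "x \<in> K" "y \<in> K" "f x = f y"
      have "H x i = H y i" if i: "i \<in> I" for i
      proof -
        have "b (r (c i)) (H x (r (c i))) = b (r (c i)) (H y (r (c i)))"
          using fun_cong[OF xy(3), of "c i"] i by (simp add: f_def)
        then have "b i (H x i) = b i (H y i)"
          using KE[OF xy(1) i r(1)[OF i]] KE[OF xy(2) i r(1)[OF i]] r(2)[OF i] by simp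
        then show ?thesis using inj i Hc[OF Kc[OF xy(1)] i] Hc[OF Kc[OF xy(2)] i] by (auto dest: inj_onD)
      qed
      moreover have "H x \<in> (\<Pi>\<^sub>E i\<in>I. carrier (S i))" "H y \<in> (\<Pi>\<^sub>E i\<in>I. carrier (S i))"
        using bij Kc[OF xy(1)] Kc[OF xy(2)] by (auto simp: bij_betw_def)
      ultimately have "H x = H y" by (intro PiE_ext[of "H x" I _ "H y"])
      then show "x = y" using bij Kc[OF xy(1)] Kc[OF xy(2)] by (auto simp: bij_betw_def dest: inj_onD)
    qed
    then show ?thesis using fK finite_image_iff by blast
  qed
  then show "finite (generated_subring R A)" using sub finite_subset by blast
qed

lemma locally_finite_imp_weakly: "locally_finite_ring R \<Longrightarrow> weakly_locally_finite_ring R"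
  unfolding locally_finite_ring_def weakly_locally_finite_ring_def by simp

section \<open>Profinite rings\<close>

lemma inverse_limit_ring_simps:
  "carrier (inverse_limit_ring I r S p) =
     {x \<in> (\<Pi>\<^sub>E i\<in>I. carrier (S i)). \<forall>i\<in>I. \<forall>j\<in>I. (i, j) \<in> r \<longrightarrow> p i j (x j) = x i}"
  "x \<oplus>\<^bsub>inverse_limit_ring I r S p\<^esub> y = x \<oplus>\<^bsub>product_ring I S\<^esub> y"
  "x \<otimes>\<^bsub>inverse_limit_ring I r S p\<^esub> y = x \<otimes>\<^bsub>product_ring I S\<^esub> y"
  by (simp_all add: inverse_limit_ring_def product_ring_simps)

lemma closedin_discrete_product_coordinate:
  assumes "i \<in> I" "V \<subseteq> carrier (S i)"
  shows "closedin (discrete_product_topology I S) {x \<in> topspace (discrete_product_topology I S). x i \<in> V}"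
  using closedin_continuous_map_preimage[OF continuous_map_product_projection[OF assms(1), of "\<lambda>i. discrete_topology (carrier (S i))"], of V] assms(2)
  by (simp add: discrete_product_topology_def)

lemma compact_finite_discrete_product:
  assumes "\<And>i. i \<in> I \<Longrightarrow> finite (carrier (S i))"
  shows "compact_space (discrete_product_topology I S)"
  unfolding discrete_product_topology_def compact_space_product_topology
  using assms by (auto simp: compact_space_discrete_topology)

text \<open>Compatibility of the coordinates i and j is a finite union of closed boxes, one for each
  value at j.\<close>

lemma closedin_inverse_limit:
  assumes fin: "\<And>i. i \<in> I \<Longrightarrow> finite (carrier (S i))"
    and p: "\<And>i j x. \<lbrakk>i \<in> I; j \<in> I; (i, j) \<in> r; x \<in> carrier (S j)\<rbrakk> \<Longrightarrow> p i j x \<in> carrier (S i)"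
  shows "closedin (discrete_product_topology I S) (carrier (inverse_limit_ring I r S p))"
proof -
  let ?T = "discrete_product_topology I S"
  have top: "topspace ?T = (\<Pi>\<^sub>E i\<in>I. carrier (S i))" by (simp add: discrete_product_topology_def)
  define C where "C = (\<lambda>(i, j). {x \<in> topspace ?T. p i j (x j) = x i})"
  have C: "closedin ?T (C (i, j))" if ij: "i \<in> I" "j \<in> I" "(i, j) \<in> r" for i j
  proof -
    define D where "D = (\<lambda>a. {x \<in> topspace ?T. x j \<in> {a}} \<inter> {x \<in> topspace ?T. x i \<in> {p i j a}})"
    have D: "closedin ?T (D a)" if "a \<in> carrier (S j)" for a
      unfolding D_def using that p[OF ij that]
      by (intro closedin_Int closedin_discrete_product_coordinate ij) auto
    have "C (i, j) = \<Union>(D ` carrier (S j))"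
      using ij by (auto simp: C_def D_def top PiE_iff)
    moreover have "closedin ?T (\<Union>(D ` carrier (S j)))"
      using fin[OF ij(2)] D by (intro closedin_Union) auto
    ultimately show ?thesis by simp
  qed
  let ?P = "{(i, j). i \<in> I \<and> j \<in> I \<and> (i, j) \<in> r}"
  have "carrier (inverse_limit_ring I r S p) = \<Inter>(insert (topspace ?T) (C ` ?P))"
    by (auto simp: inverse_limit_ring_simps top C_def)
  moreover have "closedin ?T (\<Inter>(insert (topspace ?T) (C ` ?P)))"
    using C by (intro closedin_Inter) auto
  ultimately show ?thesis by simp
qed

text \<open>A nonzero element has a nonzero coordinate, and the kernel of that coordinate is an open
  ideal as the factor is discrete. This serves inverse limits and products alike.\<close>

lemma (in top_ring) coordinates_separate:
  assumes S: "\<And>i. i \<in> I \<Longrightarrow> nonunital_ring (S i)"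
    and hom: "\<And>i. i \<in> I \<Longrightarrow> (\<lambda>x. h x i) \<in> nonunital_hom R (S i)"
    and inj: "inj_on h (carrier R)" and im: "h ` carrier R \<subseteq> (\<Pi>\<^sub>E i\<in>I. carrier (S i))"
    and cont: "continuous_map T (discrete_product_topology I S) h"
  shows "open_ideals_separate"
  unfolding open_ideals_separate_def
proof (intro ballI impI)
  fix x assume x: "x \<in> carrier R" "x \<noteq> \<zero>"
  have "h x \<noteq> h \<zero>" using x inj by (auto dest: inj_onD)
  moreover have "h x \<in> (\<Pi>\<^sub>E i\<in>I. carrier (S i))" "h \<zero> \<in> (\<Pi>\<^sub>E i\<in>I. carrier (S i))"
    using im x by auto
  ultimately have "\<exists>i\<in>I. h x i \<noteq> h \<zero> i" using PiE_ext[of "h x" I _ "h \<zero>"] by blast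
  then obtain i where i: "i \<in> I" "h x i \<noteq> h \<zero> i" by blast
  interpret Si: nonunital_ring "S i" by (rule S[OF i(1)])
  have h0: "h \<zero> i = \<zero>\<^bsub>S i\<^esub>"
    using nonunital_hom_zero[OF abelian_group_axioms Si.abelian_group_axioms hom[OF i(1)]] .
  define M where "M = {y \<in> carrier R. h y i = \<zero>\<^bsub>S i\<^esub>}"
  have "nonunital_ideal M R"
    unfolding M_def by (rule hom_kernel_ideal[OF nonunital_ring_axioms S[OF i(1)] hom[OF i(1)]])
  moreover have "openin T M"
  proof -
    have "continuous_map T (discrete_topology (carrier (S i))) (\<lambda>y. h y i)"
      using cont i(1) unfolding discrete_product_topology_def continuous_map_componentwise by blast
    then have "openin T {y \<in> topspace T. h y i \<in> {\<zero>\<^bsub>S i\<^esub>}}"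
      by (rule openin_continuous_map_preimage) simp
    then show ?thesis by (simp add: M_def topspace)
  qed
  moreover have "x \<notin> M" using i(2) h0 by (simp add: M_def)
  ultimately show "\<exists>M. open_ideal M \<and> x \<notin> M" unfolding open_ideal_def by blast
qed

lemma (in top_ring) profinite_imp_compact_separated:
  assumes "profinite_ring TYPE('u) R T"
  shows "compact_space T" "open_ideals_separate"
proof -
  obtain I :: "'u set" and r and S :: "'u \<Rightarrow> 'u ring" and p where sys: "finite_ring_inverse_system I r S p"
    and iso: "topological_ring_iso R T (inverse_limit_ring I r S p)
          (subtopology (discrete_product_topology I S) (carrier (inverse_limit_ring I r S p)))"
    using assms unfolding profinite_ring_def by blast
  let ?L = "inverse_limit_ring I r S p" and ?T = "discrete_product_topology I S"
  have S: "nonunital_ring (S i)" "finite (carrier (S i))" if "i \<in> I" for i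
    using sys that unfolding finite_ring_inverse_system_def by auto
  have p: "p i j x \<in> carrier (S i)" if "i \<in> I" "j \<in> I" "(i, j) \<in> r" "x \<in> carrier (S j)" for i j x
    using sys that nonunital_homD(1)[of "p i j" "S j" "S i"] unfolding finite_ring_inverse_system_def by blast
  have cl: "closedin ?T (carrier ?L)" using closedin_inverse_limit S(2) p by blast
  obtain h where h: "h \<in> nonunital_hom R ?L" "bij_betw h (carrier R) (carrier ?L)"
    and hm: "homeomorphic_map T (subtopology ?T (carrier ?L)) h"
    using iso unfolding topological_ring_iso_def by blast
  have "compact_space (subtopology ?T (carrier ?L))"
    using closedin_compact_space[OF compact_finite_discrete_product cl] S(2) by (simp add: compact_space_subtopology)
  then show "compact_space T"
    using homeomorphic_compact_space[OF homeomorphic_map_imp_homeomorphic_space[OF hm]] by simp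
  have "h \<in> nonunital_hom R (product_ring I S)"
    using h(1) unfolding nonunital_hom_def by (auto simp: inverse_limit_ring_simps product_ring_simps)
  then have hom: "(\<lambda>x. h x i) \<in> nonunital_hom R (S i)" if "i \<in> I" for i
    using product_hom_iff[OF nonunital_ring_axioms, of h I S] that by blast
  show "open_ideals_separate"
  proof (rule coordinates_separate[OF S(1) hom])
    show "inj_on h (carrier R)" using h(2) by (simp add: bij_betw_def)
    show "h ` carrier R \<subseteq> (\<Pi>\<^sub>E i\<in>I. carrier (S i))"
      using h(2) by (auto simp: bij_betw_def inverse_limit_ring_simps)
    show "continuous_map T ?T h"
      using homeomorphic_imp_continuous_map[OF hm] by (simp add: continuous_map_in_subtopology)
  qed
qed

text \<open>All open ideals serve as indices, named by \<open>e\<close>, and intersections make the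
  system directed. A compatible family is a choice of one coset for each open ideal, and compactness
  provides a common element.\<close>

lemma (in top_ring) compact_separated_imp_profinite:
  fixes e :: "'a set \<Rightarrow> 'u"
  assumes comp: "compact_space T" and sep: "open_ideals_separate" and e: "inj e"
  shows "profinite_ring TYPE('u) R T"
proof -
  define I where "I = e ` {M. open_ideal M}"
  define J where "J = inv_into UNIV e"
  have Je: "J (e M) = M" for M using e by (simp add: J_def)
  have JI: "open_ideal (J i)" "e (J i) = i" if "i \<in> I" for i using that Je by (auto simp: I_def)
  have eI: "e M \<in> I" if "open_ideal M" for M using that by (simp add: I_def)
  have Jid: "nonunital_ideal (J i) R" if "i \<in> I" for i using JI(1)[OF that] by (simp add: open_ideal_def)
  \<comment> \<open>Smaller ideals come later, since transition maps lead from finer to coarser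
    quotients.\<close>
  define r where "r = {(i, j). i \<in> I \<and> j \<in> I \<and> J j \<subseteq> J i}"
  define q where "q = (\<lambda>i. quotient_map e R (J i))"
  define S where "S = (\<lambda>i. transport_ring (q i) R)"
  define p where "p = (\<lambda>i j u. q i (inv_into (carrier R) (q j) u))"
  have qeq: "q i x = q i y \<longleftrightarrow> x \<ominus> y \<in> J i" if "i \<in> I" "x \<in> carrier R" "y \<in> carrier R" for i x y
    unfolding q_def by (rule quotient_map_eq_iff[OF e Jid[OF that(1)] that(2,3)])
  have Sring: "nonunital_ring (S i)" and qhom: "q i \<in> nonunital_hom R (S i)" if "i \<in> I" for i
    using quotient_ring[OF e Jid[OF that]] by (auto simp: S_def q_def)
  have Sc: "carrier (S i) = q i ` carrier R" and S0: "\<zero>\<^bsub>S i\<^esub> = q i \<zero>" for i by (simp_all add: S_def transport_ring_simps)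
  have Sfin: "finite (carrier (S i))" if "i \<in> I" for i
    using finite_quotient[OF comp JI(1)[OF that] e] by (simp add: Sc q_def)
  have pq: "p i j (q j x) = q i x" if ij: "(i, j) \<in> r" and x: "x \<in> carrier R" for i j x
  proof -
    have I: "i \<in> I" "j \<in> I" "J j \<subseteq> J i" using ij by (auto simp: r_def)
    define y where "y = inv_into (carrier R) (q j) (q j x)"
    have y: "y \<in> carrier R" "q j y = q j x" unfolding y_def using x by (auto intro: inv_into_into f_inv_into_f)
    then have "y \<ominus> x \<in> J i" using qeq[OF I(2) y(1) x] I(3) by auto
    then show ?thesis using qeq[OF I(1) y(1) x] by (simp add: p_def y_def)
  qed
  have sys: "finite_ring_inverse_system I r S p"
    unfolding finite_ring_inverse_system_def
  proof (intro conjI ballI impI)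
    show "directed_poset I r"
      unfolding directed_poset_def partial_order_on_def preorder_on_def
    proof (intro conjI ballI)
      show "r \<subseteq> I \<times> I" "refl_on I r" "trans r" by (auto simp: r_def refl_on_def trans_def)
      show "antisym r"
        unfolding antisym_def r_def using JI(2) by (auto dest!: equalityI) (metis subset_antisym)
      show "I \<noteq> {}" using eI[OF open_ideal_carrier] by blast
      fix i j assume ij: "i \<in> I" "j \<in> I"
      have "e (J i \<inter> J j) \<in> I" using eI open_ideal_Int JI(1) ij by blast
      then show "\<exists>k\<in>I. (i, k) \<in> r \<and> (j, k) \<in> r"
        using ij by (intro bexI[of _ "e (J i \<inter> J j)"]) (auto simp: r_def Je)
    qed
    fix i assume i: "i \<in> I"
    show "nonunital_ring (S i)" "finite (carrier (S i))" using Sring Sfin i by auto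
    have ii: "(i, i) \<in> r" using i by (simp add: r_def)
    show "p i i x = x" if "x \<in> carrier (S i)" for x using that pq[OF ii] by (auto simp: Sc)
    fix j assume j: "j \<in> I"
    show "p i j \<in> nonunital_hom (S j) (S i)" if ij: "(i, j) \<in> r"
      unfolding nonunital_hom_def
    proof (intro CollectI conjI ballI Pi_I)
      fix u assume "u \<in> carrier (S j)"
      then obtain x where x: "x \<in> carrier R" "u = q j x" by (auto simp: Sc)
      show "p i j u \<in> carrier (S i)" using x pq[OF ij] by (simp add: Sc)
      fix v assume "v \<in> carrier (S j)"
      then obtain y where y: "y \<in> carrier R" "v = q j y" by (auto simp: Sc)
      note D = nonunital_homD(2,3)[OF qhom[OF j] x(1) y(1)] nonunital_homD(2,3)[OF qhom[OF i] x(1) y(1)]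
      show "p i j (u \<oplus>\<^bsub>S j\<^esub> v) = p i j u \<oplus>\<^bsub>S i\<^esub> p i j v"
        "p i j (u \<otimes>\<^bsub>S j\<^esub> v) = p i j u \<otimes>\<^bsub>S i\<^esub> p i j v"
        using x y pq[OF ij] by (simp_all add: D[symmetric] m_closed)
    qed
    fix k x assume k: "k \<in> I" and rr: "(i, j) \<in> r \<and> (j, k) \<in> r" and x: "x \<in> carrier (S k)"
    then have ik: "(i, k) \<in> r" by (auto simp: r_def)
    show "p i j (p j k x) = p i k x" using x rr pq ik by (auto simp: Sc)
  qed
  let ?L = "inverse_limit_ring I r S p" and ?T = "discrete_product_topology I S"
  define h where "h = (\<lambda>x. \<lambda>i\<in>I. q i x)"
  have hprod: "h \<in> nonunital_hom R (product_ring I S)"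
    unfolding product_hom_iff[OF nonunital_ring_axioms] using qhom by (auto simp: h_def)
  have hL: "h x \<in> carrier ?L" if "x \<in> carrier R" for x
    unfolding inverse_limit_ring_simps using that pq by (auto simp: h_def Sc)
  have hhom: "h \<in> nonunital_hom R ?L"
    using hprod hL unfolding nonunital_hom_def by (auto simp: inverse_limit_ring_simps(2,3))
  have hinj: "inj_on h (carrier R)"
  proof (rule inj_onI, rule ccontr)
    fix x y assume xy: "x \<in> carrier R" "y \<in> carrier R" "h x = h y" "x \<noteq> y"
    then have "x \<ominus> y \<in> carrier R" "x \<ominus> y \<noteq> \<zero>" using minus_eq_zero_iff by auto
    then obtain M where M: "open_ideal M" "x \<ominus> y \<notin> M" using sep unfolding open_ideals_separate_def by blast
    have "q (e M) x = q (e M) y" using fun_cong[OF xy(3), of "e M"] eI[OF M(1)] by (simp add: h_def)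
    then show False using qeq[OF eI[OF M(1)] xy(1,2)] M(2) by (simp add: Je)
  qed
  have coord: "continuous_map T (discrete_topology (carrier (S i))) (q i)" if i: "i \<in> I" for i
  proof (rule hom_discrete_continuous[OF Sring[OF i] qhom[OF i]])
    have "J i \<subseteq> carrier R" using nonunital_idealD(1)[OF Jid[OF i]] .
    then have "{x \<in> carrier R. q i x = \<zero>\<^bsub>S i\<^esub>} = J i" using qeq[OF i _ zero_closed] by (auto simp: S0)
    then show "openin T {x \<in> carrier R. q i x = \<zero>\<^bsub>S i\<^esub>}" using JI(1)[OF i] by (simp add: open_ideal_def)
  qed
  have hsurj: "h ` carrier R = carrier ?L"
  proof
    show "h ` carrier R \<subseteq> carrier ?L" using hL by blast
    show "carrier ?L \<subseteq> h ` carrier R"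
    proof
      fix y assume y: "y \<in> carrier ?L"
      then have yP: "y \<in> (\<Pi>\<^sub>E i\<in>I. carrier (S i))" and yp: "\<And>i j. (i, j) \<in> r \<Longrightarrow> p i j (y j) = y i"
        by (auto simp: inverse_limit_ring_simps r_def)
      define C where "C = (\<lambda>M. {x \<in> carrier R. q (e M) x = y (e M)})"
      have "\<exists>x. \<forall>M. open_ideal M \<longrightarrow> x \<in> C M"
      proof (rule compact_open_ideals[OF comp])
        fix M assume M: "open_ideal M"
        have yM: "y (e M) \<in> carrier (S (e M))" using yP eI[OF M] by auto
        then have "closedin (discrete_topology (carrier (S (e M)))) {y (e M)}" by simp
        then have "closedin T {x \<in> topspace T. q (e M) x \<in> {y (e M)}}"
          by (rule closedin_continuous_map_preimage[OF coord[OF eI[OF M]]])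
        then show "closedin T (C M)" by (simp add: C_def topspace)
        show "C M \<noteq> {}" using yM by (auto simp: C_def Sc)
      next
        fix M N assume MN: "open_ideal M" "open_ideal N" "M \<subseteq> N"
        then have rMN: "(e N, e M) \<in> r" using eI by (simp add: r_def Je)
        show "C M \<subseteq> C N"
        proof
          fix x assume "x \<in> C M"
          then have x: "x \<in> carrier R" "q (e M) x = y (e M)" by (auto simp: C_def)
          then have "q (e N) x = y (e N)" using pq[OF rMN x(1)] yp[OF rMN] by simp
          then show "x \<in> C N" using x(1) by (simp add: C_def)
        qed
      qed
      then obtain x where x: "\<forall>M. open_ideal M \<longrightarrow> x \<in> C M" by blast
      have xc: "x \<in> carrier R" using x open_ideal_carrier by (auto simp: C_def)
      have "h x = y"
      proof (rule extensionalityI[of _ I])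
        fix i assume i: "i \<in> I"
        then have "x \<in> C (J i)" using x JI(1) by blast
        then show "h x i = y i" using i JI(2) by (simp add: h_def C_def)
      qed (use yP in \<open>auto simp: h_def PiE_def\<close>)
      then show "y \<in> h ` carrier R" using xc by blast
    qed
  qed
  have topL: "topspace (subtopology ?T (carrier ?L)) = carrier ?L"
    by (auto simp: discrete_product_topology_def inverse_limit_ring_simps)
  have "continuous_map T ?T h"
    unfolding discrete_product_topology_def continuous_map_componentwise
  proof (intro conjI ballI)
    show "h ` topspace T \<subseteq> extensional I" by (auto simp: h_def)
    fix i assume i: "i \<in> I"
    then have "(\<lambda>x. h x i) = q i" by (simp add: h_def)
    then show "continuous_map T (discrete_topology (carrier (S i))) (\<lambda>x. h x i)" using coord[OF i] by simp
  qed
  then have hcont: "continuous_map T (subtopology ?T (carrier ?L)) h"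
    using hL by (auto simp: continuous_map_in_subtopology topspace)
  have "homeomorphic_map T (subtopology ?T (carrier ?L)) h"
  proof (rule continuous_imp_homeomorphic_map[OF hcont comp])
    show "Hausdorff_space (subtopology ?T (carrier ?L))"
      by (auto simp: discrete_product_topology_def Hausdorff_space_product_topology intro!: Hausdorff_space_subtopology)
  qed (simp_all only: topL topspace hsurj hinj)
  then have "topological_ring_iso R T ?L (subtopology ?T (carrier ?L))"
    unfolding topological_ring_iso_def using hhom hinj hsurj by (auto simp: bij_betw_def)
  then show ?thesis
    unfolding profinite_ring_def using sys top_ring_axioms by (auto simp: top_ring_iff)
qed

section \<open>Compact abelian groups of finite exponent\<close>

text \<open>With finitely many possible values, a condition on finitely many coordinates is a finite
  union of closed boxes. \<open>Q\<close> may be arbitrary, as it sees only the restriction of c to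
  \<open>D\<close>.\<close>

lemma closedin_finite_coordinates:
  fixes D :: "'a set"
  assumes D: "finite D" "D \<subseteq> I" and M: "finite M"
  shows "closedin (product_topology (\<lambda>_. discrete_topology M) I)
    {c \<in> topspace (product_topology (\<lambda>_. discrete_topology M) I). Q (restrict c D)}" (is "closedin ?Y _")
proof -
  define E where "E = (\<lambda>s a. {c \<in> topspace ?Y. c a \<in> {s a}})"
  define B where "B = (\<lambda>s. \<Inter>(insert (topspace ?Y) (E s ` D)))"
  have E: "closedin ?Y (E s a)" if "a \<in> D" "s \<in> D \<rightarrow>\<^sub>E M" for s a
    using closedin_continuous_map_preimage[OF continuous_map_product_projection[of a I "\<lambda>_. discrete_topology M"], of "{s a}"] that D(2)
    unfolding E_def by auto
  have B: "closedin ?Y (B s)" if "s \<in> D \<rightarrow>\<^sub>E M" for s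
    unfolding B_def
  proof (rule closedin_Inter)
    fix K assume "K \<in> insert (topspace ?Y) (E s ` D)"
    then consider "K = topspace ?Y" | a where "a \<in> D" "K = E s a" by blast
    then show "closedin ?Y K"
    proof cases
      case 1
      then show ?thesis by (simp only: closedin_topspace)
    next
      case 2
      then show ?thesis using E that by simp
    qed
  qed simp
  have "{c \<in> topspace ?Y. Q (restrict c D)} = \<Union>(B ` {s \<in> D \<rightarrow>\<^sub>E M. Q s})"
  proof (intro equalityI subsetI)
    fix c assume c: "c \<in> {c \<in> topspace ?Y. Q (restrict c D)}"
    then have "restrict c D \<in> {s \<in> D \<rightarrow>\<^sub>E M. Q s}" using D(2) by auto
    moreover have "c \<in> B (restrict c D)" using c by (auto simp: B_def E_def)
    ultimately show "c \<in> \<Union>(B ` {s \<in> D \<rightarrow>\<^sub>E M. Q s})" by blast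
  next
    fix c assume "c \<in> \<Union>(B ` {s \<in> D \<rightarrow>\<^sub>E M. Q s})"
    then obtain s where s: "s \<in> D \<rightarrow>\<^sub>E M" "Q s" "c \<in> B s" by blast
    then have "restrict c D = s" by (intro extensionalityI[of _ D]) (auto simp: B_def E_def PiE_def)
    then show "c \<in> {c \<in> topspace ?Y. Q (restrict c D)}" using s by (simp add: B_def)
  qed
  moreover have "finite {s \<in> D \<rightarrow>\<^sub>E M. Q s}"
    using finite_PiE[OF D(1), of "\<lambda>_. M"] M by simp
  moreover have "closedin ?Y (\<Union>(B ` {s \<in> D \<rightarrow>\<^sub>E M. Q s}))"
    using calculation(2) B by (intro closedin_Union) auto
  ultimately show ?thesis by simp
qed

section \<open>Linear combinations with coefficients modulo m\<close>

context nonunital_ring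
begin

lemma add_diff_cancel: "\<lbrakk>x \<in> carrier R; y \<in> carrier R\<rbrakk> \<Longrightarrow> (x \<oplus> y) \<ominus> x = y"
  using a_comm[of "x \<oplus> y" "\<ominus> x"] by (simp add: a_minus_def r_neg1)

lemma add_pow_cong_mod:
  assumes m: "m > 0" and x: "x \<in> carrier R" "[m] \<cdot> x = \<zero>" and eq: "a mod m = b mod (m :: nat)"
  shows "[a] \<cdot> x = [b] \<cdot> x"
proof -
  have red: "[a] \<cdot> x = [(a mod m)] \<cdot> x" for a :: nat
  proof -
    have "[a] \<cdot> x = [(m * (a div m))] \<cdot> x \<oplus> [(a mod m)] \<cdot> x"
      using x(1) by (simp add: add.nat_pow_mult)
    moreover have "[(m * (a div m))] \<cdot> x = \<zero>"
      using add.nat_pow_pow[OF x(1), of "a div m" m] x by (simp add: mult.commute)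
    ultimately show ?thesis using x(1) by simp
  qed
  show ?thesis using red[of a] red[of b] eq by simp
qed

text \<open>For elements of exponent m this represents the homomorphism from (Z/m)^E that sends unit
  vectors to elements of \<open>E\<close>. It is meant for vectors with nonnegative entries, on
  which \<open>nat\<close> loses nothing.\<close>

definition combination :: "'a set \<Rightarrow> ('a \<Rightarrow> int) \<Rightarrow> 'a" where
  "combination E x = (\<Oplus>a\<in>E. [nat (x a)] \<cdot> a)"

lemma combination_closed: "E \<subseteq> carrier R \<Longrightarrow> combination E x \<in> carrier R"
  unfolding combination_def by (intro finsum_closed) auto

text \<open>Addition in (Z/m)^E enters as a congruence: \<open>z\<close> may be any nonnegative
  vector congruent to the sum, in particular the reduced one.\<close>

lemma combination_add_cong:
  assumes E: "finite E" "E \<subseteq> carrier R" and m: "m > 0" "\<And>a. a \<in> E \<Longrightarrow> [m] \<cdot> a = \<zero>"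
    and pos: "\<And>a. a \<in> E \<Longrightarrow> x a \<ge> 0 \<and> y a \<ge> 0 \<and> z a \<ge> 0"
    and dvd: "\<And>a. a \<in> E \<Longrightarrow> int m dvd x a + y a - z a"
  shows "combination E x \<oplus> combination E y = combination E z"
proof -
  have "combination E x \<oplus> combination E y = (\<Oplus>a\<in>E. [nat (x a)] \<cdot> a \<oplus> [nat (y a)] \<cdot> a)"
    unfolding combination_def using E by (intro finsum_addf[symmetric]) auto
  also have "\<dots> = combination E z"
    unfolding combination_def
  proof (intro finsum_cong' refl)
    fix a assume a: "a \<in> E"
    have ac: "a \<in> carrier R" using a E by auto
    have "[nat (x a)] \<cdot> a \<oplus> [nat (y a)] \<cdot> a = [(nat (x a) + nat (y a))] \<cdot> a"
      using add.nat_pow_mult[OF ac] by simp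
    also have "\<dots> = [nat (z a)] \<cdot> a"
    proof (rule add_pow_cong_mod[OF m(1) ac m(2)[OF a]])
      have "int ((nat (x a) + nat (y a)) mod m) = int (nat (z a) mod m)"
        using pos[OF a] dvd[OF a] by (simp add: zmod_int mod_eq_dvd_iff)
      then show "(nat (x a) + nat (y a)) mod m = nat (z a) mod m" by simp
    qed
    finally show "[nat (x a)] \<cdot> a \<oplus> [nat (y a)] \<cdot> a = [nat (z a)] \<cdot> a" .
  qed (use E in auto)
  finally show ?thesis .
qed

end

context top_ring
begin

lemma halve_neighbourhood:
  assumes U: "openin T U" "\<zero> \<in> U"
  obtains V where "openin T V" "\<zero> \<in> V" "V \<subseteq> U" "\<forall>x\<in>V. \<ominus> x \<in> V" "\<forall>x\<in>V. \<forall>y\<in>V. x \<oplus> y \<in> U"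
proof -
  have "openin (prod_topology T T) {p \<in> topspace (prod_topology T T). (\<lambda>(x, y). x \<oplus> y) p \<in> U}"
    by (rule openin_continuous_map_preimage[OF cont_add_prod U(1)])
  moreover have "(\<zero>, \<zero>) \<in> {p \<in> topspace (prod_topology T T). (\<lambda>(x, y). x \<oplus> y) p \<in> U}"
    using U(2) by (simp add: topspace)
  ultimately obtain A B where AB: "openin T A" "openin T B" "\<zero> \<in> A" "\<zero> \<in> B"
    and sub: "A \<times> B \<subseteq> {p \<in> topspace (prod_topology T T). (\<lambda>(x, y). x \<oplus> y) p \<in> U}"
    unfolding openin_prod_topology_alt by meson
  define W where "W = A \<inter> B \<inter> U"
  have W: "openin T W" "\<zero> \<in> W" using AB U by (auto simp: W_def)
  define V where "V = W \<inter> {x \<in> carrier R. \<ominus> x \<in> W}"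
  have Wc: "W \<subseteq> carrier R" using openin_subset[OF W(1)] by (simp add: topspace)
  show thesis
  proof (rule that[of V])
    show "openin T V" unfolding V_def using W openin_preimage[OF cont_neg] by blast
    show "\<zero> \<in> V" using W by (simp add: V_def)
    show "V \<subseteq> U" by (auto simp: V_def W_def)
    show "\<forall>x\<in>V. \<ominus> x \<in> V" using Wc by (auto simp: V_def)
    show "\<forall>x\<in>V. \<forall>y\<in>V. x \<oplus> y \<in> U" using sub by (auto simp: V_def W_def)
  qed
qed

text \<open>Bogolyubov's lemma, applied to the preimage of a translate of \<open>V\<close> in \<open>(\<int>/m)\<^sup>E\<close>, yields a
  subgroup of the group generated by \<open>E\<close> that lies in \<open>U\<close>; its index is bounded independently of \<open>E\<close>.
  The colouring \<open>c\<close> enumerates its cosets.\<close>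

lemma coset_colouring:
  assumes m: "m > (1 :: nat)" and exp: "\<And>x. x \<in> carrier R \<Longrightarrow> [m] \<cdot> x = \<zero>"
    and V: "V \<subseteq> carrier R" "\<forall>x\<in>V. \<ominus> x \<in> V"
      "\<And>a b c d. \<lbrakk>a \<in> V; b \<in> V; c \<in> V; d \<in> V\<rbrakk> \<Longrightarrow> (a \<oplus> b) \<oplus> (c \<oplus> d) \<in> U"
    and Fin: "finite Fs" "Fs \<subseteq> carrier R" "\<forall>x\<in>carrier R. \<exists>f\<in>Fs. x \<ominus> f \<in> V"
    and E: "finite E" "E \<subseteq> carrier R"
  shows "\<exists>c. (\<forall>x. c x < m ^ (2 * (card Fs)\<^sup>2)) \<and>
    (\<forall>x\<in>E. \<forall>y\<in>E. \<forall>z\<in>E. c x = c y \<longleftrightarrow> c (x \<oplus> z) = c (y \<oplus> z)) \<and> (\<forall>x\<in>E. c x = c \<zero> \<longrightarrow> x \<in> U)"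
proof -
  define Q where "Q = E \<rightarrow>\<^sub>E {0..<int m}"
  define \<phi> where "\<phi> = combination E"
  have \<phi>c: "\<phi> x \<in> carrier R" for x unfolding \<phi>_def by (rule combination_closed[OF E(2)])
  have finQ: "finite Q" unfolding Q_def using E(1) by (intro finite_PiE) auto
  have cardQ: "card Q = m ^ card E" unfolding Q_def using E(1) by (simp add: card_PiE)
  have Qpos: "x a \<ge> 0" if "x \<in> Q" "a \<in> E" for x a using that by (auto simp: Q_def)
  have m0: "m > 0" using m by simp
  have \<phi>add: "\<phi> x \<oplus> \<phi> y = \<phi> z" if "x \<in> Q" "y \<in> Q" "z \<in> Q" "\<And>a. a \<in> E \<Longrightarrow> int m dvd x a + y a - z a" for x y z
    unfolding \<phi>_def
    using that Qpos exp E(2) by (intro combination_add_cong[OF E m0]) auto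
  define red where "red = (\<lambda>x :: 'a \<Rightarrow> int. \<lambda>a\<in>E. x a mod int m)"
  have redQ: "red x \<in> Q" for x unfolding red_def Q_def using m0 by auto
  have red_dvd: "int m dvd u a - red u a" if "a \<in> E" for u a
    using that by (simp add: red_def minus_mod_eq_mult_div)
  have Fs0: "card Fs > 0" using Fin(1,3) zero_closed by (auto simp: card_gt_0_iff)
  \<comment> \<open>Pigeonhole: some translate of \<open>V\<close> captures at least the fraction
    1/|Fs| of all vectors. Thus \<open>card Fs\<close> becomes the K of Bogolyubov's lemma.\<close>
  have "\<exists>f\<in>Fs. card Q \<le> card Fs * card {x \<in> Q. \<phi> x \<ominus> f \<in> V}"
  proof (rule ccontr)
    assume "\<not> ?thesis"
    then have lt: "card Fs * card {x \<in> Q. \<phi> x \<ominus> f \<in> V} < card Q" if "f \<in> Fs" for f using that by (simp add: not_le)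
    have "Q \<subseteq> (\<Union>f\<in>Fs. {x \<in> Q. \<phi> x \<ominus> f \<in> V})"
    proof
      fix x assume "x \<in> Q"
      moreover obtain f where "f \<in> Fs" "\<phi> x \<ominus> f \<in> V" using bspec[OF Fin(3) \<phi>c[of x]] by blast
      ultimately show "x \<in> (\<Union>f\<in>Fs. {x \<in> Q. \<phi> x \<ominus> f \<in> V})" by blast
    qed
    then have "card Q \<le> card (\<Union>f\<in>Fs. {x \<in> Q. \<phi> x \<ominus> f \<in> V})"
      by (intro card_mono finite_UN_I Fin(1)) (use finQ in auto)
    also have "\<dots> \<le> (\<Sum>f\<in>Fs. card {x \<in> Q. \<phi> x \<ominus> f \<in> V})" by (rule card_UN_le[OF Fin(1)])
    finally have "card Q \<le> (\<Sum>f\<in>Fs. card {x \<in> Q. \<phi> x \<ominus> f \<in> V})" .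
    then have "card Fs * card Q \<le> (\<Sum>f\<in>Fs. card Fs * card {x \<in> Q. \<phi> x \<ominus> f \<in> V})"
      by (simp add: sum_distrib_left[symmetric])
    also have "\<dots> < (\<Sum>f\<in>Fs. card Q)"
      using lt Fs0 Fin(1) by (intro sum_strict_mono) (auto simp: card_gt_0_iff)
    finally show False by simp
  qed
  then obtain f where f: "f \<in> Fs" "card Q \<le> card Fs * card {x \<in> Q. \<phi> x \<ominus> f \<in> V}" by blast
  define A where "A = {x \<in> Q. \<phi> x \<ominus> f \<in> V}"
  have "card Q > 0" using cardQ m0 by simp
  then have "A \<noteq> {}" using f(2) unfolding A_def[symmetric] by (intro notI) simp
  have fc: "f \<in> carrier R" using f(1) Fin(2) by auto
  obtain \<Lambda> where \<Lambda>: "finite \<Lambda>" "card \<Lambda> \<le> 2 * (card Fs)\<^sup>2"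
    and bog: "\<forall>x. (\<forall>\<xi>\<in>\<Lambda>. int m dvd (\<Sum>i\<in>E. \<xi> i * x i)) \<longrightarrow>
       (\<exists>a\<in>A. \<exists>b\<in>A. \<exists>c\<in>A. \<exists>d\<in>A. \<forall>i\<in>E. int m dvd a i + b i - c i - d i - x i)"
  proof (rule bogolyubov[OF E(1) m0])
    show "A \<subseteq> E \<rightarrow>\<^sub>E {0..<int m}" by (auto simp: A_def Q_def)
    show "A \<noteq> {}" by fact
    show "m ^ card E \<le> card Fs * card A" using f(2) by (simp add: cardQ A_def)
    fix \<Lambda> assume L: "finite \<Lambda>" "card \<Lambda> \<le> 2 * (card Fs)\<^sup>2"
      and b: "\<And>x. (\<forall>\<xi>\<in>\<Lambda>. int m dvd (\<Sum>i\<in>E. \<xi> i * x i)) \<Longrightarrow>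
        \<exists>a\<in>A. \<exists>b\<in>A. \<exists>c\<in>A. \<exists>d\<in>A. \<forall>i\<in>E. int m dvd a i + b i - c i - d i - x i"
    show thesis by (rule that[OF L]) (intro allI impI b)
  qed
  define ip where "ip = (\<lambda>\<xi> (x :: 'a \<Rightarrow> int). \<Sum>i\<in>E. \<xi> i * x i)"
  \<comment> \<open>The image of the annihilator of \<open>\<Lambda>\<close>: a subgroup, and by
    Bogolyubov's lemma contained in \<open>U\<close>.\<close>
  define W where "W = \<phi> ` {x \<in> Q. \<forall>\<xi>\<in>\<Lambda>. int m dvd ip \<xi> x}"
  have WU: "w \<in> U" if "w \<in> W" for w
  proof -
    obtain x where x: "x \<in> Q" "\<forall>\<xi>\<in>\<Lambda>. int m dvd ip \<xi> x" "w = \<phi> x" using \<open>w \<in> W\<close> by (auto simp: W_def)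
    obtain a b c d where abcd: "a \<in> A" "b \<in> A" "c \<in> A" "d \<in> A"
      and dv: "\<forall>i\<in>E. int m dvd a i + b i - c i - d i - x i"
      using mp[OF spec[OF bog, of x]] x(2) unfolding ip_def by blast
    have Q4: "a \<in> Q" "b \<in> Q" "c \<in> Q" "d \<in> Q" using abcd by (auto simp: A_def)
    define u where "u = red (\<lambda>i. a i + b i)"
    define v where "v = red (\<lambda>i. c i + d i)"
    have "\<phi> a \<oplus> \<phi> b = \<phi> u" unfolding u_def using Q4 redQ red_dvd by (intro \<phi>add) auto
    moreover have "\<phi> c \<oplus> \<phi> d = \<phi> v" unfolding v_def using Q4 redQ red_dvd by (intro \<phi>add) auto
    moreover have "\<phi> v \<oplus> \<phi> x = \<phi> u"
    proof (rule \<phi>add)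
      fix i assume i: "i \<in> E"
      have d: "int m dvd (c i + d i) - v i" "int m dvd (a i + b i) - u i" "int m dvd a i + b i - c i - d i - x i"
        using red_dvd[OF i] dv i unfolding u_def v_def by auto
      have "int m dvd ((a i + b i) - u i) - ((c i + d i) - v i) - (a i + b i - c i - d i - x i)"
        by (rule dvd_diff[OF dvd_diff[OF d(2,1)] d(3)])
      then show "int m dvd v i + x i - u i" by (simp add: algebra_simps)
    qed (use redQ x in \<open>auto simp: u_def v_def\<close>)
    ultimately have eq: "(\<phi> c \<oplus> \<phi> d) \<oplus> \<phi> x = \<phi> a \<oplus> \<phi> b" by simp
    have VV: "\<phi> a \<ominus> f \<in> V" "\<phi> b \<ominus> f \<in> V" "\<ominus> (\<phi> c \<ominus> f) \<in> V" "\<ominus> (\<phi> d \<ominus> f) \<in> V"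
      using abcd V(2) by (auto simp: A_def)
    \<comment> \<open>Two additions and two subtractions make the translation by f cancel; this is
      why a + b - c - d is the right shape.\<close>
    have "((\<phi> a \<ominus> f) \<oplus> (\<phi> b \<ominus> f)) \<oplus> (\<ominus> (\<phi> c \<ominus> f) \<oplus> \<ominus> (\<phi> d \<ominus> f)) = (\<phi> a \<oplus> \<phi> b) \<ominus> (\<phi> c \<oplus> \<phi> d)"
    proof -
      have "((\<phi> a \<ominus> f) \<oplus> (\<phi> b \<ominus> f)) \<oplus> (\<ominus> (\<phi> c \<ominus> f) \<oplus> \<ominus> (\<phi> d \<ominus> f))
          = (\<phi> a \<oplus> \<phi> b) \<oplus> ((\<ominus> \<phi> c \<oplus> \<ominus> \<phi> d) \<oplus> ((f \<oplus> \<ominus> f) \<oplus> (f \<oplus> \<ominus> f)))"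
        using \<phi>c fc by (simp add: a_minus_def minus_add a_ac del: r_neg l_neg)
      then show ?thesis using \<phi>c fc by (simp add: r_neg a_minus_def minus_add)
    qed
    also have "\<dots> = \<phi> x"
      unfolding eq[symmetric] by (intro add_diff_cancel a_closed \<phi>c)
    finally have "\<phi> x = ((\<phi> a \<ominus> f) \<oplus> (\<phi> b \<ominus> f)) \<oplus> (\<ominus> (\<phi> c \<ominus> f) \<oplus> \<ominus> (\<phi> d \<ominus> f))" by simp
    then show ?thesis using V(3)[OF VV] x(3) by simp
  qed
  have ip_cong: "int m dvd ip \<xi> x - ip \<xi> y" if "\<And>a. a \<in> E \<Longrightarrow> int m dvd x a - y a" for \<xi> x y
  proof -
    have "ip \<xi> x - ip \<xi> y = (\<Sum>i\<in>E. \<xi> i * (x i - y i))"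
      unfolding ip_def by (simp add: right_diff_distrib sum_subtractf)
    then show ?thesis using that by (auto intro!: dvd_sum)
  qed
  have ip_diff: "ip \<xi> (\<lambda>i. x i - y i) = ip \<xi> x - ip \<xi> y" and ip_add: "ip \<xi> (\<lambda>i. x i + y i) = ip \<xi> x + ip \<xi> y" for \<xi> x y
    unfolding ip_def by (simp_all add: right_diff_distrib distrib_left sum_subtractf sum.distrib)
  have diffW: "\<phi> x \<ominus> \<phi> y = \<phi> (red (\<lambda>i. x i - y i))" if "x \<in> Q" "y \<in> Q" for x y
  proof -
    have eq: "\<phi> (red (\<lambda>i. x i - y i)) \<oplus> \<phi> y = \<phi> x"
    proof (rule \<phi>add[OF redQ that(2,1)])
      fix a assume a: "a \<in> E"
      have "int m dvd - ((x a - y a) - red (\<lambda>i. x i - y i) a)" using red_dvd[OF a] by (simp only: dvd_minus_iff)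
      then show "int m dvd red (\<lambda>i. x i - y i) a + y a - x a" by (simp add: algebra_simps)
    qed
    show ?thesis unfolding eq[symmetric] using \<phi>c by (simp add: a_minus_def a_assoc r_neg)
  qed
  have W_diffI: "\<phi> x \<ominus> \<phi> y \<in> W" if xy: "x \<in> Q" "y \<in> Q" "\<And>\<xi>. \<xi> \<in> \<Lambda> \<Longrightarrow> int m dvd ip \<xi> x - ip \<xi> y" for x y
  proof -
    have "int m dvd ip \<xi> (red (\<lambda>i. x i - y i))" if "\<xi> \<in> \<Lambda>" for \<xi>
    proof -
      have "int m dvd ip \<xi> (\<lambda>i. x i - y i) - ip \<xi> (red (\<lambda>i. x i - y i))" using red_dvd by (intro ip_cong)
      then show ?thesis using xy(3)[OF that] by (simp add: ip_diff dvd_diff_right_iff)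
    qed
    then show ?thesis unfolding diffW[OF xy(1,2)] W_def using redQ by blast
  qed
  have W_diff: "u \<ominus> v \<in> W" if "u \<in> W" "v \<in> W" for u v
  proof -
    obtain x y where xy: "x \<in> Q" "y \<in> Q" "u = \<phi> x" "v = \<phi> y" "\<forall>\<xi>\<in>\<Lambda>. int m dvd ip \<xi> x" "\<forall>\<xi>\<in>\<Lambda>. int m dvd ip \<xi> y"
      using \<open>u \<in> W\<close> \<open>v \<in> W\<close> by (auto simp: W_def)
    then show ?thesis using W_diffI[OF xy(1,2)] by auto
  qed
  have Wc: "u \<in> carrier R" if "u \<in> W" for u using \<open>u \<in> W\<close> \<phi>c by (auto simp: W_def)
  have W0: "\<zero> \<in> W"
  proof -
    have "\<phi> (red (\<lambda>_. 0)) \<ominus> \<phi> (red (\<lambda>_. 0)) \<in> W" using redQ by (intro W_diffI) auto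
    moreover have "\<phi> (red (\<lambda>_. 0)) \<ominus> \<phi> (red (\<lambda>_. 0)) = \<zero>"
      using minus_eq_zero_iff[OF \<phi>c \<phi>c] by blast
    ultimately show ?thesis by simp
  qed
  have W_neg: "\<ominus> u \<in> W" if "u \<in> W" for u using W_diff[OF W0 that] Wc[OF that] by (simp add: a_minus_def)
  have W_add: "u \<oplus> v \<in> W" if "u \<in> W" "v \<in> W" for u v
    using W_diff[OF that(1) W_neg[OF that(2)]] Wc that by (simp add: a_minus_def)
  define H where "H = \<phi> ` Q"
  have Hc: "u \<in> carrier R" if "u \<in> H" for u using \<open>u \<in> H\<close> \<phi>c by (auto simp: H_def)
  have H_diff: "u \<ominus> v \<in> H" if "u \<in> H" "v \<in> H" for u v
    using \<open>u \<in> H\<close> \<open>v \<in> H\<close> diffW redQ by (auto simp: H_def)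
  have EH: "a \<in> H" if a: "a \<in> E" for a
  proof -
    \<comment> \<open>The unit vector at a; its entry 1 is a reduced residue because m > 1.\<close>
    define x where "x = (\<lambda>i\<in>E. if i = a then 1 else 0 :: int)"
    have "x \<in> Q" using m by (auto simp: x_def Q_def)
    moreover have "\<phi> x = (\<Oplus>i\<in>E. if i = a then i else \<zero>)"
      unfolding \<phi>_def combination_def x_def using E(2) by (intro finsum_cong') auto
    moreover have "\<dots> = a" using finsum_delta[OF E(1) a, of "\<lambda>i. i"] a E(2) by auto
    ultimately show ?thesis by (auto simp: H_def)
  qed
  have H0: "\<zero> \<in> H" using W0 by (auto simp: H_def W_def)
  have H_add: "u \<oplus> v \<in> H" if "u \<in> H" "v \<in> H" for u v
  proof -
    have "\<ominus> v \<in> H" using H_diff[OF H0 that(2)] Hc[OF that(2)] by (simp add: a_minus_def)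
    then show ?thesis using H_diff[OF that(1)] Hc that by (fastforce simp: a_minus_def)
  qed
  define cls where "cls = (\<lambda>h. {h' \<in> H. h' \<ominus> h \<in> W})"
  \<comment> \<open>A vector mapped to h is not unique, and neither are its pairings with
    \<open>\<Lambda>\<close>. Fixing one representative in each coset of \<open>W\<close>, and one
    vector above it, makes the colour depend on the coset only.\<close>
  define rep where "rep = (\<lambda>h. SOME h'. h' \<in> cls h)"
  define xs where "xs = (\<lambda>h. SOME x. x \<in> Q \<and> \<phi> x = h)"
  have self: "h \<in> cls h" if "h \<in> H" for h
    using that Hc[OF that] W0 minus_eq_zero_iff[of h h] by (simp add: cls_def)
  have rep: "rep h \<in> H" "rep h \<ominus> h \<in> W" if "h \<in> H" for h
    using someI[of "\<lambda>h'. h' \<in> cls h", OF self[OF that]] unfolding rep_def by (auto simp: cls_def)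
  have xs: "xs h \<in> Q" "\<phi> (xs h) = h" if "h \<in> H" for h
  proof -
    obtain x where "x \<in> Q \<and> \<phi> x = h" using \<open>h \<in> H\<close> by (auto simp: H_def)
    then show "xs h \<in> Q" "\<phi> (xs h) = h" using someI[of "\<lambda>x. x \<in> Q \<and> \<phi> x = h" x] unfolding xs_def by auto
  qed
  define col where "col = (\<lambda>h. \<lambda>\<xi>\<in>\<Lambda>. ip \<xi> (xs (rep h)) mod int m)"
  have tri: "a \<ominus> c \<in> W" if "a \<ominus> b \<in> W" "b \<ominus> c \<in> W" "a \<in> carrier R" "b \<in> carrier R" "c \<in> carrier R" for a b c
  proof -
    have "a \<ominus> c = (a \<ominus> b) \<oplus> (b \<ominus> c)" using that(3-5) by (simp add: a_minus_def a_assoc r_neg1)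
    then show ?thesis using W_add[OF that(1,2)] by simp
  qed
  have swap: "b \<ominus> a \<in> W" if "a \<ominus> b \<in> W" "a \<in> carrier R" "b \<in> carrier R" for a b
  proof -
    have "b \<ominus> a = \<ominus> (a \<ominus> b)" using that(2,3) by (simp add: a_minus_def minus_add a_comm)
    then show ?thesis using W_neg[OF that(1)] by simp
  qed
  have col_iff: "col h = col h' \<longleftrightarrow> h \<ominus> h' \<in> W" if h: "h \<in> H" "h' \<in> H" for h h'
  proof
    assume eq: "col h = col h'"
    have "\<phi> (xs (rep h)) \<ominus> \<phi> (xs (rep h')) \<in> W"
    proof (rule W_diffI)
      fix \<xi> assume "\<xi> \<in> \<Lambda>"
      then have "ip \<xi> (xs (rep h)) mod int m = ip \<xi> (xs (rep h')) mod int m"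
        using fun_cong[OF eq, of \<xi>] by (simp add: col_def)
      then show "int m dvd ip \<xi> (xs (rep h)) - ip \<xi> (xs (rep h'))" by (simp add: mod_eq_dvd_iff)
    qed (use xs rep h in auto)
    then have 1: "rep h \<ominus> rep h' \<in> W" using xs rep h by simp
    note cc = Hc[OF h(1)] Hc[OF h(2)] Hc[OF rep(1)[OF h(1)]] Hc[OF rep(1)[OF h(2)]]
    have "h \<ominus> rep h \<in> W" using swap[OF rep(2)[OF h(1)]] cc by simp
    then have "h \<ominus> rep h' \<in> W" using tri[OF _ 1] cc by simp
    then show "h \<ominus> h' \<in> W" using tri[OF _ rep(2)[OF h(2)]] cc by simp
  next
    assume d: "h \<ominus> h' \<in> W"
    note cc = Hc[OF h(1)] Hc[OF h(2)]
    have d': "h' \<ominus> h \<in> W" using swap[OF d] cc by simp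
    have "cls h = cls h'"
      unfolding cls_def
    proof (intro Collect_cong conj_cong refl)
      fix u assume "u \<in> H"
      then have u: "u \<in> carrier R" by (rule Hc)
      show "(u \<ominus> h \<in> W) = (u \<ominus> h' \<in> W)"
        using tri[OF _ d u cc] tri[OF _ d' u cc(2,1)] by (rule iffI)
    qed
    then show "col h = col h'" by (simp add: col_def rep_def)
  qed
  define P where "P = \<Lambda> \<rightarrow>\<^sub>E {0..<int m}"
  have finP: "finite P" unfolding P_def using \<Lambda>(1) by (intro finite_PiE) auto
  have "card P = m ^ card \<Lambda>" unfolding P_def using \<Lambda>(1) by (simp add: card_PiE)
  also have "\<dots> \<le> m ^ (2 * (card Fs)\<^sup>2)" using \<Lambda>(2) m0 by (intro power_increasing) auto
  finally have cardP: "card P \<le> m ^ (2 * (card Fs)\<^sup>2)" .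
  obtain num where num: "bij_betw num P {0..<card P}" using ex_bij_betw_finite_nat[OF finP] by blast
  have colP: "col h \<in> P" for h unfolding col_def P_def using m0 by auto
  define c where "c = (\<lambda>h. num (col h))"
  have c_iff: "c h = c h' \<longleftrightarrow> h \<ominus> h' \<in> W" if "h \<in> H" "h' \<in> H" for h h'
  proof -
    have "c h = c h' \<longleftrightarrow> col h = col h'"
      unfolding c_def using num colP[of h] colP[of h'] by (auto simp: bij_betw_def dest: inj_onD)
    then show ?thesis using col_iff[OF that] by simp
  qed
  have c_lt: "c h < m ^ (2 * (card Fs)\<^sup>2)" for h
  proof -
    have "num (col h) \<in> {0..<card P}" using num colP[of h] by (auto simp: bij_betw_def)
    then show ?thesis using cardP by (simp add: c_def)
  qed
  show ?thesis
  proof (intro exI[of _ c] conjI ballI allI impI)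
    show "c x < m ^ (2 * (card Fs)\<^sup>2)" for x by (rule c_lt)
    fix x assume x: "x \<in> E"
    show "x \<in> U" if "c x = c \<zero>"
      using c_iff[OF EH[OF x] H0] that WU Hc[OF EH[OF x]] by simp
    fix y z assume yz: "y \<in> E" "z \<in> E"
    note hh = EH[OF x] EH[OF yz(1)] EH[OF yz(2)]
    have "(x \<oplus> z) \<ominus> (y \<oplus> z) = x \<ominus> y"
    proof -
      have "(x \<oplus> z) \<ominus> (y \<oplus> z) = (x \<oplus> \<ominus> y) \<oplus> (z \<oplus> \<ominus> z)"
        using hh[THEN Hc] by (simp add: a_minus_def minus_add a_ac del: r_neg l_neg)
      then show ?thesis using hh[THEN Hc] by (simp add: r_neg a_minus_def)
    qed
    then show "c x = c y \<longleftrightarrow> c (x \<oplus> z) = c (y \<oplus> z)"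
      using c_iff[OF hh(1,2)] c_iff[OF H_add[OF hh(1,3)] H_add[OF hh(2,3)]] by simp
  qed
qed

end

section \<open>From colourings to open subgroups and open ideals\<close>

context top_ring
begin

text \<open>Closedness under subtraction is extended to the closure in one variable at a time, by
  continuity in that variable.\<close>

lemma closure_of_subgroup:
  assumes W: "additive_subgroup W R"
  shows "additive_subgroup (T closure_of W) R"
proof -
  note WD = additive_subgroupD[OF W]
  let ?C = "T closure_of W"
  have WT: "W \<subseteq> topspace T" using WD(1) by (simp add: topspace)
  have WC: "W \<subseteq> ?C" by (rule closure_of_subset[OF WT])
  have Cc: "?C \<subseteq> carrier R" using closure_of_subset_topspace[of T W] by (simp add: topspace)
  have cl: "closedin T ?C" by simp
  have 1: "x \<ominus> w \<in> ?C" if "x \<in> ?C" "w \<in> W" for x w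
  proof -
    have wc: "w \<in> carrier R" using that(2) WD(1) by blast
    have "closedin T {x \<in> carrier R. x \<ominus> w \<in> ?C}" by (intro closedin_preimage[OF _ cl] cont_intros wc)
    moreover have "W \<subseteq> {x \<in> carrier R. x \<ominus> w \<in> ?C}"
    proof
      fix u assume u: "u \<in> W"
      then show "u \<in> {x \<in> carrier R. x \<ominus> w \<in> ?C}" using WD(5)[OF u that(2)] WC WD(1) by blast
    qed
    ultimately have "?C \<subseteq> {x \<in> carrier R. x \<ominus> w \<in> ?C}" by (intro closure_of_minimal)
    then show ?thesis using that(1) by blast
  qed
  have 2: "x \<ominus> y \<in> ?C" if "x \<in> ?C" "y \<in> ?C" for x y
  proof -
    have xc: "x \<in> carrier R" using that(1) Cc by blast
    have "closedin T {y \<in> carrier R. x \<ominus> y \<in> ?C}" by (intro closedin_preimage[OF _ cl] cont_intros xc)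
    moreover have "W \<subseteq> {y \<in> carrier R. x \<ominus> y \<in> ?C}" using 1[OF that(1)] WD(1) by blast
    ultimately have "?C \<subseteq> {y \<in> carrier R. x \<ominus> y \<in> ?C}" by (intro closure_of_minimal)
    then show ?thesis using that(2) by blast
  qed
  have 0: "\<zero> \<in> ?C" using WC WD(2) by blast
  have neg: "\<ominus> x \<in> ?C" if "x \<in> ?C" for x
    using 2[OF 0 that] Cc that by (auto simp: a_minus_def)
  have add: "x \<oplus> y \<in> ?C" if "x \<in> ?C" "y \<in> ?C" for x y
    using 2[OF that(1) neg[OF that(2)]] Cc that by (auto simp: a_minus_def subset_iff)
  show ?thesis unfolding additive_subgroup_iff using Cc 0 neg add by simp
qed

text \<open>Finitely many constraints can be met by a colouring whose number of colours does not
  depend on them. Each constraint concerns finitely many values, so by Tychonoff's theorem some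
  colouring meets all of them. The colour class of zero is then a subgroup of finite index inside a
  small neighbourhood. It need not be closed, but its closure is, and a closed subgroup of finite
  index is open.\<close>

lemma compact_exponent_open_subgroup:
  assumes comp: "compact_space T" and m: "m > (0 :: nat)" and exp: "\<And>x. x \<in> carrier R \<Longrightarrow> [m] \<cdot> x = \<zero>"
    and U: "openin T U" "\<zero> \<in> U"
  obtains W where "additive_subgroup W R" "openin T W" "W \<subseteq> U"
proof -
  \<comment> \<open>The coset colouring requires a modulus greater than 1; doubling the exponent
    covers m = 1.\<close>
  define n where "n = m * 2"
  have n: "n > 1" using m by (simp add: n_def)
  have nexp: "[n] \<cdot> x = \<zero>" if "x \<in> carrier R" for x
    using add.nat_pow_pow[OF that, of 2 m] exp[OF that] by (simp add: n_def)
  \<comment> \<open>Three halvings: two of them bring sums of four elements of \<open>V\<close> into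
    \<open>U1\<close>, and the outermost leaves room for the closure.\<close>
  obtain U1 where U1: "openin T U1" "\<zero> \<in> U1" "U1 \<subseteq> U" "\<forall>x\<in>U1. \<ominus> x \<in> U1" "\<forall>x\<in>U1. \<forall>y\<in>U1. x \<oplus> y \<in> U"
    using halve_neighbourhood[OF U] .
  obtain U2 where U2: "openin T U2" "\<zero> \<in> U2" "U2 \<subseteq> U1" "\<forall>x\<in>U2. \<ominus> x \<in> U2" "\<forall>x\<in>U2. \<forall>y\<in>U2. x \<oplus> y \<in> U1"
    using halve_neighbourhood[OF U1(1,2)] .
  obtain V where V: "openin T V" "\<zero> \<in> V" "V \<subseteq> U2" "\<forall>x\<in>V. \<ominus> x \<in> V" "\<forall>x\<in>V. \<forall>y\<in>V. x \<oplus> y \<in> U2"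
    using halve_neighbourhood[OF U2(1,2)] .
  have Vc: "V \<subseteq> carrier R" using openin_subset[OF V(1)] by (simp add: topspace)
  have U1c: "U1 \<subseteq> carrier R" using openin_subset[OF U1(1)] by (simp add: topspace)
  have V4: "(a \<oplus> b) \<oplus> (c \<oplus> d) \<in> U1" if "a \<in> V" "b \<in> V" "c \<in> V" "d \<in> V" for a b c d
    using V(5) U2(5) that by simp
  obtain Fs where Fs: "finite Fs" "Fs \<subseteq> carrier R" "\<forall>x\<in>carrier R. \<exists>f\<in>Fs. x \<ominus> f \<in> V"
    using compact_finite_cover[OF comp V(1,2)] .
  define k where "k = n ^ (2 * (card Fs)\<^sup>2)"
  define Y where "Y = product_topology (\<lambda>_. discrete_topology {..<k}) (carrier R)"
  have Ytop: "topspace Y = carrier R \<rightarrow>\<^sub>E {..<k}" by (simp add: Y_def)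
  have compY: "compact_space Y"
    unfolding Y_def compact_space_product_topology by (simp add: compact_space_discrete_topology)
  \<comment> \<open>The first constraint makes equality of colours invariant under translation, the
    second confines the colour of zero to \<open>U1\<close>. A triple involves the colours of at
    most five elements.\<close>
  define good where "good = (\<lambda>(x, y, z) (c :: 'a \<Rightarrow> nat). (c x = c y \<longleftrightarrow> c (x \<oplus> z) = c (y \<oplus> z)) \<and> (c x = c \<zero> \<longrightarrow> x \<in> U1))"
  define C where "C = (\<lambda>p. {c \<in> topspace Y. good p c})"
  let ?P = "carrier R \<times> carrier R \<times> carrier R"
  have Cclosed: "closedin Y (C p)" if p: "p \<in> ?P" for p
  proof -
    obtain x y z where xyz: "p = (x, y, z)" "x \<in> carrier R" "y \<in> carrier R" "z \<in> carrier R" using p by auto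
    let ?D = "{x, y, x \<oplus> z, y \<oplus> z, \<zero>}"
    have "closedin Y {c \<in> topspace Y. good p (restrict c ?D)}"
      unfolding Y_def using xyz by (intro closedin_finite_coordinates) auto
    moreover have "good p (restrict c ?D) \<longleftrightarrow> good p c" for c by (simp add: good_def xyz(1))
    ultimately show ?thesis by (simp add: C_def)
  qed
  have "\<Inter>(insert (topspace Y) (C ` ?P)) \<noteq> {}"
  proof (rule compact_space_fipD[OF compY])
    fix K assume "K \<in> insert (topspace Y) (C ` ?P)"
    then consider "K = topspace Y" | p where "p \<in> ?P" "K = C p" by blast
    then show "closedin Y K" by cases (simp_all add: Cclosed)
  next
    fix \<F> assume \<F>: "finite \<F>" "\<F> \<subseteq> insert (topspace Y) (C ` ?P)"
    have "finite (\<F> - {topspace Y})" "\<F> - {topspace Y} \<subseteq> C ` ?P" using \<F> by auto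
    then obtain A where A: "finite A" "A \<subseteq> ?P" "\<F> - {topspace Y} = C ` A" using finite_subset_image by metis
    define E where "E = fst ` A \<union> (fst \<circ> snd) ` A \<union> (snd \<circ> snd) ` A"
    have E: "finite E" "E \<subseteq> carrier R" using A(1,2) by (auto simp: E_def)
    obtain c where c: "\<forall>x. c x < k" "\<forall>x\<in>E. \<forall>y\<in>E. \<forall>z\<in>E. c x = c y \<longleftrightarrow> c (x \<oplus> z) = c (y \<oplus> z)"
      "\<forall>x\<in>E. c x = c \<zero> \<longrightarrow> x \<in> U1"
      using coset_colouring[OF n nexp Vc V(4) V4 Fs E] unfolding k_def by blast
    define c' where "c' = restrict c (carrier R)"
    have c'Y: "c' \<in> topspace Y" using c(1) by (auto simp: Ytop c'_def)
    have "c' \<in> C p" if p: "p \<in> A" for p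
    proof -
      obtain x y z where xyz: "p = (x, y, z)" by (cases p)
      have EE: "x \<in> E" "y \<in> E" "z \<in> E" using p xyz by (force simp: E_def)+
      then have cc: "x \<in> carrier R" "y \<in> carrier R" "z \<in> carrier R" using E(2) by auto
      have "(c x = c y \<longleftrightarrow> c (x \<oplus> z) = c (y \<oplus> z)) \<and> (c x = c \<zero> \<longrightarrow> x \<in> U1)" using c(2,3) EE by blast
      then have "good p c" unfolding good_def xyz prod.case .
      then have "good p c'" using cc by (simp add: good_def xyz c'_def)
      then show ?thesis using c'Y by (simp add: C_def)
    qed
    moreover have "K \<in> C ` A \<or> K = topspace Y" if "K \<in> \<F>" for K using that A(3) by blast
    ultimately have "c' \<in> K" if "K \<in> \<F>" for K using that c'Y by blast
    then show "\<Inter>\<F> \<noteq> {}" by blast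
  qed
  then obtain c where cC: "c \<in> \<Inter>(insert (topspace Y) (C ` ?P))" by blast
  have cY: "c \<in> carrier R \<rightarrow>\<^sub>E {..<k}" unfolding Ytop[symmetric] by (rule InterD[OF cC]) (rule insertI1)
  have good: "good (x, y, z) c" if "x \<in> carrier R" "y \<in> carrier R" "z \<in> carrier R" for x y z
  proof -
    have "c \<in> C (x, y, z)"
      by (rule InterD[OF cC], rule insertI2, rule imageI) (simp add: that)
    then show ?thesis by (simp add: C_def)
  qed
  have c_shift: "c x = c y \<longleftrightarrow> c (x \<oplus> z) = c (y \<oplus> z)" if "x \<in> carrier R" "y \<in> carrier R" "z \<in> carrier R" for x y z
    using good[OF that] by (simp add: good_def)
  define W where "W = {x \<in> carrier R. c x = c \<zero>}"
  have W_iff: "x \<ominus> y \<in> W \<longleftrightarrow> c x = c y" if "x \<in> carrier R" "y \<in> carrier R" for x y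
    using c_shift[OF that a_inv_closed[OF that(2)]] that by (simp add: W_def a_minus_def r_neg)
  have Wsub: "additive_subgroup W R"
    unfolding additive_subgroup_iff
  proof (intro conjI ballI subsetI)
    show "\<zero> \<in> W" by (simp add: W_def)
    fix x assume x: "x \<in> W"
    then show xc: "x \<in> carrier R" by (simp add: W_def)
    show "\<ominus> x \<in> W"
      using c_shift[OF xc zero_closed a_inv_closed[OF xc]] x xc by (simp add: W_def r_neg)
    fix y assume y: "y \<in> W"
    then have yc: "y \<in> carrier R" by (simp add: W_def)
    show "x \<oplus> y \<in> W"
      using c_shift[OF xc zero_closed yc] x y xc yc by (simp add: W_def)
  qed
  have WU1: "W \<subseteq> U1" using good[OF _ zero_closed zero_closed] by (auto simp: W_def good_def)
  define D where "D = T closure_of W"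
  have Dsub: "additive_subgroup D R" unfolding D_def by (rule closure_of_subgroup[OF Wsub])
  note DD = additive_subgroupD[OF Dsub]
  have WD: "W \<subseteq> D" unfolding D_def using WU1 U1c by (intro closure_of_subset) (auto simp: topspace)
  have Dcl: "closedin T D" by (simp add: D_def)
  have Dopen: "openin T D"
  proof -
    have fin: "finite (c ` carrier R)" using cY by (auto intro: finite_subset[of _ "{..<k}"])
    define r where "r = inv_into (carrier R) c"
    define Rs where "Rs = r ` c ` carrier R"
    have Rs: "finite Rs" "Rs \<subseteq> carrier R" using fin by (auto simp: Rs_def r_def intro: inv_into_into)
    \<comment> \<open>The complement of \<open>D\<close> consists of cosets of \<open>D\<close>
      through one element of each colour, so it is a finite union of closed sets.\<close>
    have "carrier R - D = (\<Union>s\<in>{s \<in> Rs. s \<notin> D}. {x \<in> carrier R. x \<ominus> s \<in> D})"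
    proof (intro equalityI subsetI)
      fix x assume x: "x \<in> carrier R - D"
      define s where "s = r (c x)"
      have s: "s \<in> Rs" "s \<in> carrier R" "c s = c x"
        using x by (auto simp: s_def Rs_def r_def intro: inv_into_into f_inv_into_f)
      have xs: "x \<ominus> s \<in> D" using W_iff[of x s] x s WD by auto
      have "s \<notin> D"
      proof
        assume "s \<in> D"
        then have "x \<ominus> s \<oplus> s \<in> D" using DD(3)[OF xs] by blast
        then show False using x minus_add_cancel s(2) by auto
      qed
      then show "x \<in> (\<Union>s\<in>{s \<in> Rs. s \<notin> D}. {x \<in> carrier R. x \<ominus> s \<in> D})" using s xs x by blast
    next
      fix x assume "x \<in> (\<Union>s\<in>{s \<in> Rs. s \<notin> D}. {x \<in> carrier R. x \<ominus> s \<in> D})"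
      then obtain s where s: "s \<in> Rs" "s \<notin> D" "x \<in> carrier R" "x \<ominus> s \<in> D" by blast
      have sc: "s \<in> carrier R" using s(1) Rs(2) by blast
      have "x \<notin> D"
      proof
        assume "x \<in> D"
        then have "x \<ominus> (x \<ominus> s) \<in> D" using DD(5) s(4) by blast
        moreover have "x \<ominus> (x \<ominus> s) = s" using s(3) sc by (simp add: a_minus_def minus_add r_neg2 r_neg1)
        ultimately show False using s(2) by simp
      qed
      then show "x \<in> carrier R - D" using s(3) by blast
    qed
    moreover have "closedin T (\<Union>s\<in>{s \<in> Rs. s \<notin> D}. {x \<in> carrier R. x \<ominus> s \<in> D})"
    proof (rule closedin_Union)
      show "finite ((\<lambda>s. {x \<in> carrier R. x \<ominus> s \<in> D}) ` {s \<in> Rs. s \<notin> D})" using Rs(1) by simp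
      fix K assume "K \<in> (\<lambda>s. {x \<in> carrier R. x \<ominus> s \<in> D}) ` {s \<in> Rs. s \<notin> D}"
      then obtain s where "s \<in> carrier R" "K = {x \<in> carrier R. x \<ominus> s \<in> D}" using Rs(2) by blast
      then show "closedin T K" by (auto intro!: closedin_preimage[OF _ Dcl] cont_intros)
    qed
    ultimately have "closedin T (carrier R - D)" by simp
    then show ?thesis using DD(1) by (simp add: openin_closedin_eq topspace)
  qed
  have "D \<subseteq> U"
  proof
    fix x assume x: "x \<in> D"
    have xc: "x \<in> carrier R" using x DD(1) by blast
    \<comment> \<open>Some y of \<open>W\<close> differs from x by an element of \<open>U1\<close>,
      and x = y - (y - x) is then a sum of two elements of \<open>U1\<close>.\<close>
    let ?N = "{y \<in> carrier R. y \<ominus> x \<in> U1}"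
    have op: "openin T ?N" by (rule openin_translate[OF U1(1) xc])
    have mem: "x \<in> ?N" using xc U1(2) minus_eq_zero_iff[of x x] by simp
    have "\<forall>N. x \<in> N \<and> openin T N \<longrightarrow> (\<exists>y. y \<in> W \<and> y \<in> N)"
      using x unfolding D_def in_closure_of by (rule conjunct2)
    from mp[OF spec[OF this, of ?N] conjI[OF mem op]]
    obtain y where y: "y \<in> W" "y \<in> carrier R" "y \<ominus> x \<in> U1" by blast
    have "y \<in> U1" using WU1 y(1) by blast
    then have "y \<oplus> \<ominus> (y \<ominus> x) \<in> U" using bspec[OF bspec[OF U1(5)] bspec[OF U1(4) y(3)]] by simp
    moreover have "y \<oplus> \<ominus> (y \<ominus> x) = x" using y(2) xc by (simp add: a_minus_def minus_add r_neg2 r_neg1)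
    ultimately show "x \<in> U" by simp
  qed
  then show thesis using that[OF Dsub Dopen] by blast
qed

text \<open>The tube lemma: \<open>f\<close> is zero wherever its second argument is, and
  compactness of the first factor makes the neighbourhood of zero uniform.\<close>

lemma compact_open_multiplier:
  assumes comp: "compact_space T" and cont: "continuous_map (prod_topology T T) T f"
    and f0: "\<And>r. r \<in> carrier R \<Longrightarrow> f (r, \<zero>) = \<zero>" and U: "openin T U" "\<zero> \<in> U"
  obtains V where "openin T V" "\<zero> \<in> V" "V \<subseteq> {x \<in> U. \<forall>r\<in>carrier R. f (r, x) \<in> U}"
proof -
  let ?W = "{p \<in> topspace (prod_topology T T). f p \<in> U}"
  have "openin (prod_topology T T) ?W" by (rule openin_continuous_map_preimage[OF cont U(1)])
  moreover have "compactin T (carrier R)" using comp by (simp add: compact_space_def topspace)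
  moreover have "carrier R \<times> {\<zero>} \<subseteq> ?W" using f0 U(2) by (auto simp: topspace)
  ultimately obtain A V where AV: "openin T A" "openin T V" "carrier R \<subseteq> A" "\<zero> \<in> V" "A \<times> V \<subseteq> ?W"
    using tube_lemma_left[of T T ?W "carrier R" \<zero>] by (auto simp: topspace)
  show thesis
  proof (rule that[of "V \<inter> U"])
    show "openin T (V \<inter> U)" using AV(2) U(1) by blast
    show "\<zero> \<in> V \<inter> U" using AV(4) U(2) by blast
    show "V \<inter> U \<subseteq> {x \<in> U. \<forall>r\<in>carrier R. f (r, x) \<in> U}" using AV(3,5) by blast
  qed
qed

text \<open>The elements of the subgroup all of whose left multiples stay in it form a left ideal,
  and repeating this on the right gives a two-sided ideal. Membership of the element itself is
  demanded separately, as without a unit it need not be among its multiples.\<close>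

lemma open_ideal_in_open_subgroup:
  assumes comp: "compact_space T" and U: "additive_subgroup U R" "openin T U"
  obtains M where "open_ideal M" "M \<subseteq> U"
proof -
  note UD = additive_subgroupD[OF U(1)]
  define L where "L = {x \<in> U. \<forall>r\<in>carrier R. r \<otimes> x \<in> U}"
  have Lc: "x \<in> carrier R" if "x \<in> L" for x using that UD(1) by (auto simp: L_def)
  have Lsub: "additive_subgroup L R"
    unfolding additive_subgroup_iff using UD Lc by (auto simp: L_def r_distr r_minus)
  have Lmult: "r \<otimes> x \<in> L" if "x \<in> L" "r \<in> carrier R" for x r
  proof -
    have "s \<otimes> (r \<otimes> x) \<in> U" if "s \<in> carrier R" for s
      using \<open>x \<in> L\<close> that \<open>r \<in> carrier R\<close> Lc[OF \<open>x \<in> L\<close>] by (auto simp: L_def m_closed m_assoc[symmetric])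
    then show ?thesis using that by (auto simp: L_def)
  qed
  obtain V where V: "openin T V" "\<zero> \<in> V" "V \<subseteq> {x \<in> U. \<forall>r\<in>carrier R. (\<lambda>(x, y). x \<otimes> y) (r, x) \<in> U}"
    by (rule compact_open_multiplier[OF comp cont_mult_prod _ U(2) UD(2)]) auto
  have "V \<subseteq> L" using V(3) by (auto simp: L_def)
  then have Lopen: "openin T L" using subgroup_openI[OF Lsub V(1,2)] by blast
  note LD = additive_subgroupD[OF Lsub]
  define M where "M = {x \<in> L. \<forall>r\<in>carrier R. x \<otimes> r \<in> L}"
  have "continuous_map (prod_topology T T) T (\<lambda>p. snd p \<otimes> fst p)"
    by (intro cont_mult continuous_map_fst continuous_map_snd)
  then obtain V' where V': "openin T V'" "\<zero> \<in> V'" "V' \<subseteq> {x \<in> L. \<forall>r\<in>carrier R. (\<lambda>p. snd p \<otimes> fst p) (r, x) \<in> L}"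
    by (rule compact_open_multiplier[OF comp _ _ Lopen LD(2)]) auto
  have M: "nonunital_ideal M R"
  proof (rule nonunital_idealI)
    fix x y assume xy: "x \<in> M" "y \<in> carrier R"
    then have x: "x \<in> L" "x \<in> carrier R" "\<And>r. r \<in> carrier R \<Longrightarrow> x \<otimes> r \<in> L" using Lc by (auto simp: M_def)
    have "y \<otimes> x \<otimes> r \<in> L" if "r \<in> carrier R" for r
      using Lmult[OF x(3)[OF that] xy(2)] x(2) xy(2) that by (simp add: m_assoc)
    then show "y \<otimes> x \<in> M" using Lmult[OF x(1) xy(2)] by (simp add: M_def)
    have "x \<otimes> y \<otimes> r \<in> L" if "r \<in> carrier R" for r
      using x(3)[OF m_closed[OF xy(2) that]] x(2) xy(2) that by (simp add: m_assoc)
    then show "x \<otimes> y \<in> M" using x(3)[OF xy(2)] by (simp add: M_def)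
  qed (use LD Lc in \<open>auto simp: M_def l_distr l_minus\<close>)
  have "V' \<subseteq> M" using V'(3) by (auto simp: M_def)
  moreover have "additive_subgroup M R" using M by (simp add: nonunital_ideal_def)
  ultimately have "openin T M" using subgroup_openI[OF _ V'(1,2)] by blast
  then show thesis using that[of M] M by (auto simp: open_ideal_def M_def L_def)
qed

lemma compact_exponent_separated:
  assumes comp: "compact_space T" and m: "m > (0 :: nat)" and exp: "\<And>x. x \<in> carrier R \<Longrightarrow> [m] \<cdot> x = \<zero>"
  shows "open_ideals_separate"
  unfolding open_ideals_separate_def
proof (intro ballI impI)
  fix x assume x: "x \<in> carrier R" "x \<noteq> \<zero>"
  have "closedin T {x}" using Hausdorff x(1) by (simp add: closedin_Hausdorff_singleton topspace)
  then have op: "openin T (carrier R - {x})" by (simp add: closedin_def topspace)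
  have mem: "\<zero> \<in> carrier R - {x}" using x by simp
  obtain W where W: "additive_subgroup W R" "openin T W" "W \<subseteq> carrier R - {x}"
  proof (rule compact_exponent_open_subgroup[OF comp m _ op mem])
    show "[m] \<cdot> y = \<zero>" if "y \<in> carrier R" for y by (rule exp[OF that])
  qed
  obtain M where "open_ideal M" "M \<subseteq> W" using open_ideal_in_open_subgroup[OF comp W(1,2)] .
  then show "\<exists>M. open_ideal M \<and> x \<notin> M" using W(3) by blast
qed

end

section \<open>Small compact \<open>G\<close>-rings\<close>

text \<open>If the ball of radius r about x is inside the given set, a point of the dense set at
  distance less than 1/(n+1) < r/2 from x has a ball of that radius which contains x and stays
  inside.\<close>

lemma metrizable_separable_imp_second_countable:
  assumes "metrizable_space Y" "separable_space Y"
  shows "second_countable Y"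
proof -
  obtain M d where Md: "Metric_space M d" "Y = Metric_space.mtopology M d"
    using assms(1) unfolding metrizable_space_def by blast
  interpret Metric_space M d by (rule Md(1))
  obtain C where C: "countable C" "C \<subseteq> M" "mtopology closure_of C = M"
    using assms(2) unfolding separable_space_def Md(2) by auto
  define B where "B = (\<lambda>(c, n). mball c (inverse (real (Suc n)))) ` (C \<times> UNIV)"
  have "countable B" unfolding B_def using C(1) by (intro countable_image countable_SIGMA) auto
  moreover have "\<forall>V\<in>B. openin mtopology V" unfolding B_def by auto
  moreover have "\<exists>V\<in>B. x \<in> V \<and> V \<subseteq> U" if U: "openin mtopology U" "x \<in> U" for U x
  proof -
    obtain r where r: "r > 0" "mball x r \<subseteq> U" and x: "x \<in> M" using U unfolding openin_mtopology by blast
    obtain n where n: "inverse (real (Suc n)) < r / 2" using reals_Archimedean[of "r / 2"] r(1) by auto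
    let ?s = "inverse (real (Suc n))"
    have "x \<in> mtopology closure_of C" using x C(3) by simp
    then have "\<forall>N. x \<in> N \<and> openin mtopology N \<longrightarrow> (\<exists>c. c \<in> C \<and> c \<in> N)"
      unfolding in_closure_of by (rule conjunct2)
    moreover have "x \<in> mball x ?s \<and> openin mtopology (mball x ?s)" using x by simp
    ultimately obtain c where c: "c \<in> C" "c \<in> mball x ?s" by blast
    then have cx: "c \<in> M" "d x c < ?s" by auto
    have "x \<in> mball c ?s" using cx x commute by simp
    moreover have "mball c ?s \<subseteq> U"
    proof
      fix y assume "y \<in> mball c ?s"
      then have y: "y \<in> M" "d c y < ?s" by auto
      have "d x y \<le> d x c + d c y" using triangle x cx(1) y(1) by blast
      then have "d x y < r" using cx(2) y(2) n by linarith
      then have "y \<in> mball x r" using x y(1) by simp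
      then show "y \<in> U" using r(2) by blast
    qed
    ultimately show ?thesis using c(1) unfolding B_def by blast
  qed
  ultimately show ?thesis unfolding second_countable_def Md(2) by blast
qed

text \<open>A countable compact Hausdorff group has an isolated point by Baire's theorem, hence is discrete.\<close>

lemma (in top_ring) countable_closed_subgroup_finite:
  assumes comp: "compact_space T" and K: "additive_subgroup K R" "closedin T K" "countable K"
  shows "finite K"
proof -
  note KD = additive_subgroupD[OF K(1)]
  let ?Y = "subtopology T K"
  have topY: "topspace ?Y = K" using KD(1) by (auto simp: topspace)
  have cY: "compact_space ?Y" using closedin_compact_space[OF comp K(2)] by (simp add: compact_space_subtopology)
  have hY: "Hausdorff_space ?Y" by (intro Hausdorff_space_subtopology Hausdorff)
  have reg: "locally_compact_space ?Y \<and> regular_space ?Y"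
    using compact_imp_locally_compact_space[OF cY] compact_Hausdorff_imp_regular_space[OF cY hY] by simp
  have "\<exists>x\<in>K. ?Y interior_of {x} \<noteq> {}"
  proof (rule ccontr)
    assume none: "\<not> ?thesis"
    have "?Y interior_of \<Union>((\<lambda>x. {x}) ` K) = {}"
    proof (rule Baire_category_alt)
      show "completely_metrizable_space ?Y \<or> locally_compact_space ?Y \<and> regular_space ?Y" using reg by simp
      show "countable ((\<lambda>x. {x}) ` K)" using K(3) by simp
      fix S assume "S \<in> (\<lambda>x. {x}) ` K"
      then obtain x where x: "x \<in> K" "S = {x}" by blast
      then have "x \<in> topspace ?Y" using topY by simp
      then show "closedin ?Y S \<and> ?Y interior_of S = {}"
        using x none closedin_Hausdorff_singleton[OF hY] by auto
    qed
    moreover have "\<Union>((\<lambda>x. {x}) ` K) = topspace ?Y" using topY by auto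
    ultimately have "K = {}" using interior_of_topspace[of ?Y] topY by simp
    then show False using KD(2) by simp
  qed
  then obtain x where x: "x \<in> K" "?Y interior_of {x} \<noteq> {}" by blast
  have "?Y interior_of {x} = {x}" using x(2) interior_of_subset[of ?Y "{x}"] by blast
  then have "openin ?Y {x}" using openin_interior_of[of ?Y "{x}"] by simp
  then obtain U where U: "openin T U" "{x} = U \<inter> K" unfolding openin_subtopology by blast
  \<comment> \<open>The neighbourhood that isolates x, translated to y; so all points of
    \<open>K\<close> are isolated, and compactness leaves finitely many.\<close>
  define V where "V = (\<lambda>y. {z \<in> carrier R. z \<ominus> y \<oplus> x \<in> U})"
  have xc: "x \<in> carrier R" using x KD(1) by blast
  have Vo: "openin T (V y)" if "y \<in> K" for y
    unfolding V_def using that KD(1) xc by (intro openin_preimage[OF _ U(1)] cont_intros) auto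
  have VK: "V y \<inter> K = {y}" if y: "y \<in> K" for y
  proof (intro equalityI subsetI)
    have yc: "y \<in> carrier R" using y KD(1) by blast
    fix z assume z: "z \<in> V y \<inter> K"
    then have zc: "z \<in> carrier R" by (simp add: V_def)
    have "z \<ominus> y \<oplus> x \<in> K" using KD(3)[OF KD(5) x(1)] z y by blast
    then have "z \<ominus> y \<oplus> x \<in> U \<inter> K" using z by (simp add: V_def)
    then have "z \<ominus> y \<oplus> x = x" using U(2) by blast
    then have "z \<ominus> y = \<zero>" using zc yc xc by (metis a_comm a_minus_def add.r_cancel_one' a_inv_closed a_closed)
    then show "z \<in> {y}" using minus_eq_zero_iff[OF zc yc] by simp
  next
    fix z assume "z \<in> {y}"
    moreover have "x \<in> U" using U(2) by blast
    moreover have "y \<in> carrier R" using y KD(1) by blast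
    ultimately show "z \<in> V y \<inter> K" using y xc minus_eq_zero_iff[of y y] by (simp add: V_def)
  qed
  have cK: "compactin T K" using closedin_compact_space[OF comp K(2)] .
  have "\<exists>F. finite F \<and> F \<subseteq> V ` K \<and> K \<subseteq> \<Union>F"
  proof (rule compactinD[OF cK])
    show "openin T W" if "W \<in> V ` K" for W using that Vo by blast
    show "K \<subseteq> \<Union>(V ` K)" using VK by blast
  qed
  then obtain F where F: "finite F" "F \<subseteq> V ` K" "K \<subseteq> \<Union>F" by blast
  obtain A where A: "finite A" "A \<subseteq> K" "F = V ` A" using finite_subset_image[OF F(1,2)] by blast
  have "K \<subseteq> A"
  proof
    fix z assume z: "z \<in> K"
    then obtain y where y: "y \<in> A" "z \<in> V y" using F(3) A(3) by blast
    then have "z \<in> V y \<inter> K" "y \<in> K" using z A(2) by auto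
    then have "z \<in> {y}" using VK[of y] by simp
    then show "z \<in> A" using y(1) by simp
  qed
  then show ?thesis using A(1) finite_subset by blast
qed

locale small_ring = top_ring R T for R (structure) and T +
  fixes G :: "'g monoid" and TG and \<phi>
  assumes small: "small_compact_G_ring R T G TG \<phi>"
begin

lemma compact: "compact_space T" and polish: "polish_group G TG" and act: "group_action G (carrier R) \<phi>"
  and hom: "\<And>g. g \<in> carrier G \<Longrightarrow> \<phi> g \<in> nonunital_hom R R"
  and cont_act: "continuous_map (prod_topology TG T) T (\<lambda>(g, x). \<phi> g x)"
  and countable_orbits: "\<And>n. countable (orbits G ({..<n::nat} \<rightarrow>\<^sub>E carrier R)
        (\<lambda>g. \<lambda>x\<in>{..<n} \<rightarrow>\<^sub>E carrier R. \<lambda>i\<in>{..<n}. \<phi> g (x i)))"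
  using small unfolding small_compact_G_ring_def compact_G_ring_def by blast+

sublocale act: group_action G "carrier R" \<phi> by (rule act)

lemma topspace_G: "topspace TG = carrier G" using polish by (simp add: polish_group_def)

sublocale G: group G using polish by (simp add: polish_group_def)

lemma act_one: "x \<in> carrier R \<Longrightarrow> \<phi> \<one>\<^bsub>G\<^esub> x = x"
  using fun_cong[OF act.id_eq_one, of x] by simp

lemma cont_act_element: "g \<in> carrier G \<Longrightarrow> continuous_map T T (\<phi> g)"
proof -
  assume g: "g \<in> carrier G"
  have "continuous_map T (prod_topology TG T) (\<lambda>x. (g, x))"
    using g by (intro continuous_map_pairedI) (simp_all add: topspace_G)
  from continuous_map_compose[OF this cont_act] show ?thesis by (simp add: o_def)
qed

lemma cont_act_point: "x \<in> carrier R \<Longrightarrow> continuous_map TG T (\<lambda>g. \<phi> g x)"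
proof -
  assume x: "x \<in> carrier R"
  have "continuous_map TG (prod_topology TG T) (\<lambda>g. (g, x))"
    using x by (intro continuous_map_pairedI) (simp_all add: topspace)
  from continuous_map_compose[OF this cont_act] show ?thesis by (simp add: o_def)
qed

text \<open>The points fixed by the stabilizer of \<open>a\<close>, an analogue of the definable
  closure of \<open>a\<close>. It contains the subring generated by \<open>a\<close>, is visibly
  closed, and can be counted by orbits of pairs.\<close>

definition fixed :: "'a \<Rightarrow> 'a set" where
  "fixed a = {x \<in> carrier R. \<forall>g\<in>carrier G. \<phi> g a = a \<longrightarrow> \<phi> g x = x}"

lemma fixed_subring: "nonunital_subring (fixed a) R"
  unfolding nonunital_subring_def additive_subgroup_iff
proof (intro conjI ballI subsetI)
  show "x \<in> carrier R" if "x \<in> fixed a" for x using that by (simp add: fixed_def)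
  have h0: "\<phi> g \<zero> = \<zero>" if "g \<in> carrier G" for g
    using nonunital_hom_zero[OF abelian_group_axioms abelian_group_axioms hom[OF that]] .
  show "\<zero> \<in> fixed a" using h0 by (simp add: fixed_def)
  fix x assume x: "x \<in> fixed a"
  then have xc: "x \<in> carrier R" by (simp add: fixed_def)
  show "\<ominus> x \<in> fixed a"
    using x nonunital_hom_a_inv[OF abelian_group_axioms abelian_group_axioms hom xc] by (simp add: fixed_def)
  fix y assume y: "y \<in> fixed a"
  then have yc: "y \<in> carrier R" by (simp add: fixed_def)
  show "x \<oplus> y \<in> fixed a" "x \<otimes> y \<in> fixed a"
    using x y nonunital_homD(2,3)[OF hom xc yc] by (simp_all add: fixed_def m_closed)
qed

lemma fixed_closed: "closedin T (fixed a)"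
proof -
  let ?C = "\<lambda>g. {x \<in> topspace T. \<phi> g x = x}"
  have "fixed a = \<Inter>(insert (topspace T) (?C ` {g \<in> carrier G. \<phi> g a = a}))"
    by (auto simp: fixed_def topspace)
  moreover have "closedin T (\<Inter>(insert (topspace T) (?C ` {g \<in> carrier G. \<phi> g a = a})))"
  proof (rule closedin_Inter)
    fix K assume "K \<in> insert (topspace T) (?C ` {g \<in> carrier G. \<phi> g a = a})"
    then consider "K = topspace T" | g where "g \<in> carrier G" "K = ?C g" by blast
    then show "closedin T K"
      by cases (simp_all add: closedin_continuous_maps_eq[OF Hausdorff cont_act_element cont_id])
  qed simp
  ultimately show ?thesis by simp
qed

text \<open>For \<open>x\<close> fixed by the stabilizer of \<open>a\<close>, the orbit of the pair \<open>(a, x)\<close> determines \<open>x\<close>.\<close>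

lemma fixed_countable:
  assumes a: "a \<in> carrier R"
  shows "countable (fixed a)"
proof -
  let ?E = "{..<2::nat} \<rightarrow>\<^sub>E carrier R"
  let ?\<psi> = "\<lambda>g. \<lambda>x\<in>?E. \<lambda>i\<in>{..<2::nat}. \<phi> g (x i)"
  define t where "t = (\<lambda>x. \<lambda>i\<in>{..<2::nat}. if i = 0 then a else x)"
  have t: "t x \<in> ?E" if "x \<in> carrier R" for x using that a by (auto simp: t_def)
  have t01: "t x 0 = a" "t x (Suc 0) = x" for x by (simp_all add: t_def)
  have inj: "inj_on (\<lambda>x. orbit G ?\<psi> (t x)) (fixed a)"
  proof (rule inj_onI)
    fix x y assume x: "x \<in> fixed a" and y: "y \<in> fixed a" and eq: "orbit G ?\<psi> (t x) = orbit G ?\<psi> (t y)"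
    have xc: "x \<in> carrier R" and yc: "y \<in> carrier R" using x y by (auto simp: fixed_def)
    have "?\<psi> \<one>\<^bsub>G\<^esub> (t y) = t y"
      using t[OF yc] a yc act_one by (auto simp: t_def intro!: restrict_ext)
    then have "t y \<in> orbit G ?\<psi> (t y)" unfolding orbit_def using G.one_closed by (intro CollectI exI[of _ "\<one>\<^bsub>G\<^esub>"]) auto
    then have "t y \<in> orbit G ?\<psi> (t x)" using eq by simp
    \<comment> \<open>A group element that moves (a, x) to (a, y) fixes a, hence fixes x, and so x =
      y.\<close>
    then obtain g where g: "g \<in> carrier G" "t y = ?\<psi> g (t x)" unfolding orbit_def by blast
    have "t y i = \<phi> g (t x i)" if "i < 2" for i
      using fun_cong[OF g(2), of i] t[OF xc] that by simp
    from this[of 0] this[of "Suc 0"] have "\<phi> g a = a" "\<phi> g x = y" by (simp_all add: t01)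
    then show "x = y" using x g(1) by (auto simp: fixed_def)
  qed
  have "(\<lambda>x. orbit G ?\<psi> (t x)) ` fixed a \<subseteq> orbits G ?E ?\<psi>"
    unfolding orbits_def using t by (auto simp: fixed_def)
  then have "countable ((\<lambda>x. orbit G ?\<psi> (t x)) ` fixed a)" using countable_orbits[of 2] countable_subset by blast
  then show ?thesis using countable_image_inj_eq[OF inj] by simp
qed

lemma fixed_finite: "a \<in> carrier R \<Longrightarrow> finite (fixed a)"
  using countable_closed_subgroup_finite[OF compact _ fixed_closed fixed_countable]
    fixed_subring[of a] by (simp add: nonunital_subring_def)

lemma self_fixed: "a \<in> carrier R \<Longrightarrow> a \<in> fixed a" by (simp add: fixed_def)

lemma weakly_locally_finite: "weakly_locally_finite_ring R"
  unfolding weakly_locally_finite_ring_def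
proof
  fix a assume a: "a \<in> carrier R"
  have "generated_subring R {a} \<subseteq> fixed a"
    unfolding generated_subring_def using fixed_subring[of a] self_fixed[OF a] by blast
  then show "finite (generated_subring R {a})" using fixed_finite[OF a] finite_subset by blast
qed

text \<open>The multiples of \<open>a\<close> lie in the finite set \<open>fixed a\<close>, so two
  of them coincide.\<close>

lemma torsion:
  assumes a: "a \<in> carrier R"
  shows "\<exists>n>0. [(n :: nat)] \<cdot> a = \<zero>"
proof -
  have sub: "additive_subgroup (fixed a) R" using fixed_subring by (simp add: nonunital_subring_def)
  have mem: "[(n :: nat)] \<cdot> a \<in> fixed a" for n
  proof (induction n)
    case 0
    then show ?case using additive_subgroupD(2)[OF sub] by simp
  next
    case (Suc n)
    then show ?case using additive_subgroupD(3)[OF sub _ self_fixed[OF a]] a by (simp add: add.nat_pow_Suc)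
  qed
  have "\<not> inj (\<lambda>n :: nat. [n] \<cdot> a)"
  proof
    assume "inj (\<lambda>n :: nat. [n] \<cdot> a)"
    then have "infinite (range (\<lambda>n :: nat. [n] \<cdot> a))" by (rule range_inj_infinite)
    moreover have "range (\<lambda>n :: nat. [n] \<cdot> a) \<subseteq> fixed a" using mem by blast
    ultimately show False using fixed_finite[OF a] finite_subset by blast
  qed
  then obtain i j :: nat where ij: "i < j" "[i] \<cdot> a = [j] \<cdot> a"
    unfolding inj_def by (metis linorder_neqE_nat)
  have "[i] \<cdot> a \<oplus> [(j - i)] \<cdot> a = [i] \<cdot> a"
    using add.nat_pow_mult[OF a, of i "j - i"] ij by simp
  then have "[(j - i)] \<cdot> a = \<zero>" using a by (simp add: add.l_cancel_one)
  then show ?thesis using ij(1) by (intro exI[of _ "j - i"]) simp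
qed

section \<open>Bounded exponent, separation and countability\<close>

lemma cont_multiple: "continuous_map T T (\<lambda>x. [(n :: nat)] \<cdot> x)"
proof (induction n)
  case 0
  then show ?case using cont_const[OF zero_closed] by simp
next
  case (Suc n)
  then have "continuous_map T T (\<lambda>x. [n] \<cdot> x \<oplus> x)" by (intro cont_add cont_id)
  then show ?case
    by (rule continuous_map_eq) (simp add: topspace)
qed

text \<open>The n-torsion subgroups are closed and cover the ring, so one of them has an inner point
  and is open, with finitely many cosets. Multiplying n by the torsion orders of coset
  representatives gives an exponent of the whole ring.\<close>

lemma bounded_exponent:
  obtains m :: nat where "m > 0" "\<forall>x\<in>carrier R. [m] \<cdot> x = \<zero>"
proof -
  define B where "B = (\<lambda>n :: nat. {x \<in> carrier R. [n] \<cdot> x = \<zero>})"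
  have sub: "additive_subgroup (B n) R" for n
    unfolding additive_subgroup_iff B_def
    by (auto simp: add.nat_pow_distrib add.nat_pow_inv)
  have cl: "closedin T (B n)" for n
    using closedin_continuous_maps_eq[OF Hausdorff cont_multiple[of n] cont_const[OF zero_closed]]
    by (simp add: B_def topspace)
  have "\<exists>n>0. T interior_of (B n) \<noteq> {}"
  proof (rule ccontr)
    assume none: "\<not> ?thesis"
    have "T interior_of \<Union>(B ` {0<..}) = {}"
    proof (rule Baire_category_alt)
      show "completely_metrizable_space T \<or> locally_compact_space T \<and> regular_space T"
        using compact_imp_locally_compact_space[OF compact] compact_Hausdorff_imp_regular_space[OF compact Hausdorff] by simp
      show "closedin T S \<and> T interior_of S = {}" if "S \<in> B ` {0<..}" for S
      proof -
        obtain n where "n > 0" "S = B n" using \<open>S \<in> B ` {0<..}\<close> by blast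
        then show ?thesis using cl none by blast
      qed
    qed simp
    moreover have "\<Union>(B ` {0<..}) = topspace T" using torsion by (auto simp: B_def topspace)
    ultimately have "carrier R = {}" using interior_of_topspace[of T] by (simp add: topspace)
    then show False using zero_closed by blast
  qed
  then obtain n where n: "n > 0" "T interior_of (B n) \<noteq> {}" by blast
  then obtain a where "a \<in> T interior_of (B n)" by blast
  then have op: "openin T (B n)"
    using subgroup_openI[OF sub openin_interior_of _ interior_of_subset] by blast
  have "\<zero> \<in> B n" using additive_subgroupD(2)[OF sub] .
  then obtain Fs where Fs: "finite Fs" "Fs \<subseteq> carrier R" "\<forall>x\<in>carrier R. \<exists>f\<in>Fs. x \<ominus> f \<in> B n"
    using compact_finite_cover[OF compact op] by blast
  obtain k where k: "\<And>f. f \<in> carrier R \<Longrightarrow> k f > (0 :: nat) \<and> [(k f)] \<cdot> f = \<zero>" using torsion by metis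
  define m where "m = n * prod k Fs"
  have mult: "[b] \<cdot> x = \<zero>" if x: "x \<in> carrier R" "[a] \<cdot> x = \<zero>" "a dvd b" for a b :: nat and x
  proof -
    obtain c where "b = a * c" using x(3) by blast
    then show ?thesis using add.nat_pow_pow[OF x(1), of c a] x(2) by simp
  qed
  have "[m] \<cdot> x = \<zero>" if x: "x \<in> carrier R" for x
  proof -
    obtain f where f: "f \<in> Fs" "x \<ominus> f \<in> B n" using Fs(3) x by blast
    have fc: "f \<in> carrier R" using f(1) Fs(2) by blast
    have "[m] \<cdot> (x \<ominus> f) = \<zero>" 
      by (rule mult[of _ n]) (use f(2) in \<open>simp_all add: B_def m_def\<close>)
    moreover have "[m] \<cdot> f = \<zero>"
      by (rule mult[of _ "k f"]) (use k[OF fc] fc dvd_prodI[OF Fs(1) f(1), of k] in \<open>simp_all add: m_def\<close>)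
    ultimately have "[m] \<cdot> (x \<ominus> f \<oplus> f) = \<zero>" using x fc by (simp add: add.nat_pow_distrib)
    then show ?thesis using minus_add_cancel[OF x fc] by simp
  qed
  moreover have "m > 0"
  proof -
    have "0 < prod k Fs" using k Fs(2) by (intro prod_pos) blast
    then show ?thesis using n(1) by (simp add: m_def)
  qed
  ultimately show thesis using that by blast
qed

lemma separated: "open_ideals_separate"
proof -
  obtain m :: nat where m: "m > 0" "\<forall>x\<in>carrier R. [m] \<cdot> x = \<zero>" using bounded_exponent .
  show ?thesis using compact_exponent_separated[OF compact m(1)] m(2) by blast
qed

text \<open>The sets are images of open sets under orbit maps and need not be open, so only a
  network is obtained. One point p in each orbit suffices: every point is gp for such a p, and a
  small open set around g is mapped into a given neighbourhood of gp.\<close>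

lemma countable_network:
  obtains NN :: "'a set set" where "countable NN" "\<forall>U x. openin T U \<and> x \<in> U \<longrightarrow> (\<exists>N\<in>NN. x \<in> N \<and> N \<subseteq> U)"
proof -
  have "second_countable TG"
    using polish completely_metrizable_imp_metrizable_space metrizable_separable_imp_second_countable
    unfolding polish_group_def by blast
  then obtain B where B: "countable B" "\<forall>V\<in>B. openin TG V"
    "\<forall>U g. openin TG U \<and> g \<in> U \<longrightarrow> (\<exists>V\<in>B. g \<in> V \<and> V \<subseteq> U)"
    unfolding second_countable_def by blast
  let ?E = "{..<1::nat} \<rightarrow>\<^sub>E carrier R"
  let ?\<psi> = "\<lambda>g. \<lambda>x\<in>?E. \<lambda>i\<in>{..<1::nat}. \<phi> g (x i)"
  define rep where "rep = (\<lambda>o'. (SOME t. t \<in> o' \<and> t \<in> ?E) (0::nat))"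
  define P where "P = rep ` orbits G ?E ?\<psi>"
  have cP: "countable P" unfolding P_def using countable_orbits[of 1] by simp
  have P: "\<exists>p\<in>P. p \<in> carrier R \<and> (\<exists>g\<in>carrier G. \<phi> g p = x)" if x: "x \<in> carrier R" for x
  proof -
    define t where "t = (\<lambda>i\<in>{..<1::nat}. x)"
    have t: "t \<in> ?E" "t 0 = x" using x by (auto simp: t_def)
    let ?o = "orbit G ?\<psi> t"
    have "?\<psi> \<one>\<^bsub>G\<^esub> t = t" using t(1) x act_one by (auto simp: t_def intro!: restrict_ext)
    then have "t \<in> ?o" unfolding orbit_def using G.one_closed by (intro CollectI exI[of _ "\<one>\<^bsub>G\<^esub>"]) auto
    then have ex: "\<exists>s. s \<in> ?o \<and> s \<in> ?E" using t(1) by blast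
    define s where "s = (SOME s. s \<in> ?o \<and> s \<in> ?E)"
    have s: "s \<in> ?o" "s \<in> ?E" using someI_ex[OF ex] by (auto simp: s_def)
    then obtain g where g: "g \<in> carrier G" "s = ?\<psi> g t" unfolding orbit_def by blast
    have s0: "s 0 = \<phi> g x" using g(2) t by simp
    have "\<phi> (inv\<^bsub>G\<^esub> g) (s 0) = x" using act.orbit_sym_aux[OF g(1) x] s0 by simp
    moreover have "s 0 \<in> P" unfolding P_def rep_def s_def using t(1) by (auto simp: orbits_def)
    moreover have "s 0 \<in> carrier R" using s(2) by auto
    ultimately show ?thesis using g(1) G.inv_closed by blast
  qed
  define NN where "NN = (\<lambda>(V, p). (\<lambda>g. \<phi> g p) ` V) ` (B \<times> P)"
  have cNN: "countable NN" unfolding NN_def using B(1) cP by (intro countable_image countable_SIGMA) auto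
  have "\<exists>N\<in>NN. x \<in> N \<and> N \<subseteq> U" if U: "openin T U" "x \<in> U" for U x
  proof -
    have "x \<in> carrier R" using U openin_subset[OF U(1)] by (auto simp: topspace)
    then obtain p g where p: "p \<in> P" "p \<in> carrier R" and g: "g \<in> carrier G" "\<phi> g p = x" using P by blast
    have "openin TG {g \<in> topspace TG. \<phi> g p \<in> U}"
      by (rule openin_continuous_map_preimage[OF cont_act_point[OF p(2)] U(1)])
    moreover have "g \<in> {g \<in> topspace TG. \<phi> g p \<in> U}" using g U(2) by (simp add: topspace_G)
    ultimately obtain V where V: "V \<in> B" "g \<in> V" "V \<subseteq> {g \<in> topspace TG. \<phi> g p \<in> U}" using B(3) by blast
    have "(\<lambda>g. \<phi> g p) ` V \<in> NN" unfolding NN_def using V(1) p(1) by force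
    moreover have "x \<in> (\<lambda>g. \<phi> g p) ` V" using V(2) g(2) by (intro image_eqI[of _ _ g]) simp_all
    moreover have "(\<lambda>g. \<phi> g p) ` V \<subseteq> U"
    proof
      fix y assume "y \<in> (\<lambda>g. \<phi> g p) ` V"
      then obtain h where "h \<in> V" "y = \<phi> h p" by (rule imageE)
      then show "y \<in> U" using subsetD[OF V(3)] by simp
    qed
    ultimately show ?thesis by (intro bexI[of _ "(\<lambda>g. \<phi> g p) ` V"] conjI)
  qed
  then have "\<forall>U x. openin T U \<and> x \<in> U \<longrightarrow> (\<exists>N\<in>NN. x \<in> N \<and> N \<subseteq> U)" by simp
  then show thesis using that[OF cNN] by simp
qed

text \<open>The elements x i supported at the single index i are told apart by the open sets of
  elements with nonzero i-th coordinate: x i lies in \<open>U j\<close> only for i = j. Network sets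
  chosen between x i and \<open>U i\<close> are therefore distinct. Nonzero factors guarantee that x
  i exists.\<close>

lemma countable_product_index:
  assumes S: "\<And>i. i \<in> I \<Longrightarrow> nonunital_ring (S i)" "\<And>i. i \<in> I \<Longrightarrow> carrier (S i) \<noteq> {\<zero>\<^bsub>S i\<^esub>}"
    and iso: "topological_ring_iso R T (product_ring I S) (discrete_product_topology I S)"
  shows "countable I"
proof -
  obtain H where bij: "bij_betw H (carrier R) (\<Pi>\<^sub>E i\<in>I. carrier (S i))"
    and hm: "homeomorphic_map T (discrete_product_topology I S) H"
    and homs: "\<forall>i\<in>I. (\<lambda>x. H x i) \<in> nonunital_hom R (S i)"
    using product_iso_coordinates[OF nonunital_ring_axioms iso] .
  obtain NN :: "'a set set" where NN: "countable NN" "\<forall>U x. openin T U \<and> x \<in> U \<longrightarrow> (\<exists>N\<in>NN. x \<in> N \<and> N \<subseteq> U)"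
    using countable_network .
  have z: "\<zero>\<^bsub>S i\<^esub> \<in> carrier (S i)" if "i \<in> I" for i
  proof -
    interpret Si: nonunital_ring "S i" by (rule S(1)[OF that])
    show ?thesis by simp
  qed
  have "\<exists>a. a \<in> carrier (S i) \<and> a \<noteq> \<zero>\<^bsub>S i\<^esub>" if "i \<in> I" for i using S(2)[OF that] z[OF that] by blast
  then obtain a where a: "\<And>i. i \<in> I \<Longrightarrow> a i \<in> carrier (S i) \<and> a i \<noteq> \<zero>\<^bsub>S i\<^esub>" by metis
  define y where "y = (\<lambda>i. \<lambda>j\<in>I. if j = i then a j else \<zero>\<^bsub>S j\<^esub>)"
  define x where "x = (\<lambda>i. inv_into (carrier R) H (y i))"
  have x: "x i \<in> carrier R" "H (x i) = y i" if "i \<in> I" for i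
  proof -
    have "y i \<in> H ` carrier R" using a z bij by (auto simp: y_def bij_betw_def)
    then show "x i \<in> carrier R" "H (x i) = y i" unfolding x_def by (auto intro: inv_into_into f_inv_into_f)
  qed
  define U where "U = (\<lambda>i. {x \<in> carrier R. H x i \<noteq> \<zero>\<^bsub>S i\<^esub>})"
  have Uopen: "openin T (U i)" if i: "i \<in> I" for i
  proof -
    have "continuous_map T (discrete_product_topology I S) H" by (rule homeomorphic_imp_continuous_map[OF hm])
    then have c: "continuous_map T (discrete_topology (carrier (S i))) (\<lambda>x. H x i)"
      unfolding discrete_product_topology_def continuous_map_componentwise using i by blast
    have "openin (discrete_topology (carrier (S i))) (carrier (S i) - {\<zero>\<^bsub>S i\<^esub>})" by auto
    from openin_continuous_map_preimage[OF c this]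
    have "openin T {x \<in> carrier R. H x i \<in> carrier (S i) - {\<zero>\<^bsub>S i\<^esub>}}" by (simp add: topspace)
    moreover have "{x \<in> carrier R. H x i \<in> carrier (S i) - {\<zero>\<^bsub>S i\<^esub>}} = U i"
      using nonunital_homD(1)[OF bspec[OF homs i]] by (auto simp: U_def)
    ultimately show ?thesis by simp
  qed
  have xU: "x i \<in> U j \<longleftrightarrow> i = j" if "i \<in> I" "j \<in> I" for i j
    using x[OF that(1)] a[OF that(2)] that by (auto simp: U_def y_def)
  have "\<exists>N\<in>NN. x i \<in> N \<and> N \<subseteq> U i" if "i \<in> I" for i using NN(2) Uopen[OF that] xU[OF that that] by blast
  then obtain N where N: "\<And>i. i \<in> I \<Longrightarrow> N i \<in> NN \<and> x i \<in> N i \<and> N i \<subseteq> U i" by metis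
  have "inj_on N I"
  proof (rule inj_onI)
    fix i j assume ij: "i \<in> I" "j \<in> I" "N i = N j"
    then have "x i \<in> U j" using N[OF ij(1)] N[OF ij(2)] by auto
    then show "i = j" using xU ij by simp
  qed
  moreover have "countable (N ` I)" using NN(1) N countable_subset[of "N ` I" NN] by blast
  ultimately show ?thesis using countable_image_inj_eq by blast
qed

end

section \<open>Groups of permutations preserving a labelling\<close>

text \<open>Pointwise convergence, in terms of agreement on finite sets of coordinates. It is
  applied to groups of permutations and to products of finite rings.\<close>

lemma openin_discrete_product_subtopology:
  assumes E: "E \<subseteq> (\<Pi>\<^sub>E i\<in>I. A i)"
  shows "openin (subtopology (product_topology (\<lambda>i. discrete_topology (A i)) I) E) U \<longleftrightarrow>
    U \<subseteq> E \<and> (\<forall>x\<in>U. \<exists>J. finite J \<and> J \<subseteq> I \<and> (\<forall>y\<in>E. (\<forall>i\<in>J. y i = x i) \<longrightarrow> y \<in> U))"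
    (is "openin (subtopology ?P E) U \<longleftrightarrow> ?rhs")
proof
  assume "openin (subtopology ?P E) U"
  then obtain V where V: "openin ?P V" "U = V \<inter> E" unfolding openin_subtopology by blast
  have "\<exists>J. finite J \<and> J \<subseteq> I \<and> (\<forall>y\<in>E. (\<forall>i\<in>J. y i = x i) \<longrightarrow> y \<in> U)" if x: "x \<in> U" for x
  proof -
    have "x \<in> V" using x V(2) by simp
    then obtain W where W: "finite {i \<in> I. W i \<noteq> A i}" "x \<in> Pi\<^sub>E I W" "Pi\<^sub>E I W \<subseteq> V"
      using V(1) unfolding openin_product_topology_alt by auto
    have "y \<in> U" if y: "y \<in> E" "\<forall>i\<in>{i \<in> I. W i \<noteq> A i}. y i = x i" for y
    proof -
      have yA: "y \<in> Pi\<^sub>E I A" using y(1) E by blast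
      have "y i \<in> W i" if "i \<in> I" for i
        using that y(2) PiE_mem[OF yA that] PiE_mem[OF W(2) that] by (cases "W i = A i") auto
      moreover have "y \<in> extensional I" using yA by (simp add: PiE_def)
      ultimately have "y \<in> Pi\<^sub>E I W" by (simp add: PiE_def)
      then show ?thesis using W(3) V(2) y(1) by blast
    qed
    then show ?thesis using W(1) by (intro exI[of _ "{i \<in> I. W i \<noteq> A i}"]) simp
  qed
  then show ?rhs using V(2) by simp
next
  assume r: ?rhs
  then have "\<forall>x\<in>U. \<exists>J. finite J \<and> J \<subseteq> I \<and> (\<forall>y\<in>E. (\<forall>i\<in>J. y i = x i) \<longrightarrow> y \<in> U)" by simp
  then obtain J where J: "\<forall>x\<in>U. finite (J x) \<and> J x \<subseteq> I \<and> (\<forall>y\<in>E. (\<forall>i\<in>J x. y i = x i) \<longrightarrow> y \<in> U)"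
    using bchoice by metis
  define W where "W = (\<lambda>x i. if i \<in> J x then {x i} else A i)"
  define V where "V = (\<Union>x\<in>U. Pi\<^sub>E I (W x))"
  have UA: "x i \<in> A i" if "x \<in> U" "i \<in> I" for x i using that r E by blast
  have "openin ?P (Pi\<^sub>E I (W x))" if x: "x \<in> U" for x
  proof (rule product_topology_basis)
    show "openin (discrete_topology (A i)) (W x i)" for i using UA[OF x] J x by (auto simp: W_def)
    have "{i. W x i \<noteq> topspace (discrete_topology (A i))} \<subseteq> J x" by (auto simp: W_def)
    then show "finite {i. W x i \<noteq> topspace (discrete_topology (A i))}" using J x finite_subset by blast
  qed
  then have "openin ?P V" unfolding V_def by blast
  moreover have "U = V \<inter> E"
  proof (intro equalityI subsetI)
    fix x assume x: "x \<in> U"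
    have xE: "x \<in> E" using x r by blast
    then have "x \<in> Pi\<^sub>E I A" using E by blast
    then have "x \<in> Pi\<^sub>E I (W x)" by (auto simp: W_def PiE_def)
    then show "x \<in> V \<inter> E" using x xE by (auto simp: V_def)
  next
    fix y assume y: "y \<in> V \<inter> E"
    then obtain x where x: "x \<in> U" "y \<in> Pi\<^sub>E I (W x)" by (auto simp: V_def)
    have "y i = x i" if i: "i \<in> J x" for i
    proof -
      have "i \<in> I" using i J x(1) by blast
      then show ?thesis using PiE_mem[OF x(2)] i by (force simp: W_def)
    qed
    then show "y \<in> U" using J x(1) y by blast
  qed
  ultimately show "openin (subtopology ?P E) U" unfolding openin_subtopology by blast
qed

definition code_perms :: "'i set \<Rightarrow> ('i \<Rightarrow> 'c) \<Rightarrow> ('i \<Rightarrow> 'i) set" where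
  "code_perms I code = {\<sigma> \<in> Bij I. \<forall>i\<in>I. code (\<sigma> i) = code i}"

definition perm_group :: "'i set \<Rightarrow> ('i \<Rightarrow> 'c) \<Rightarrow> ('i \<Rightarrow> 'i) monoid" where
  "perm_group I code = (BijGroup I)\<lparr>carrier := code_perms I code\<rparr>"

text \<open>Pointwise convergence on the discrete set \<open>I\<close>, the usual topology of a
  permutation group.\<close>

definition perm_topology :: "'i set \<Rightarrow> ('i \<Rightarrow> 'c) \<Rightarrow> ('i \<Rightarrow> 'i) topology" where
  "perm_topology I code = subtopology (product_topology (\<lambda>_. discrete_topology I) I) (code_perms I code)"

lemma code_permsD:
  assumes "\<sigma> \<in> code_perms I code"
  shows "\<sigma> \<in> Bij I" "bij_betw \<sigma> I I" "\<sigma> \<in> I \<rightarrow>\<^sub>E I" "\<And>i. i \<in> I \<Longrightarrow> \<sigma> i \<in> I" "\<And>i. i \<in> I \<Longrightarrow> code (\<sigma> i) = code i"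
  using assms by (auto simp: code_perms_def Bij_def PiE_def bij_betw_def)

lemma perm_group_subgroup: "subgroup (code_perms I code) (BijGroup I)"
proof (rule group.subgroupI[OF group_BijGroup])
  show "code_perms I code \<subseteq> carrier (BijGroup I)" by (auto simp: code_perms_def BijGroup_def)
  have "(\<lambda>x\<in>I. x) \<in> code_perms I code" by (auto simp: code_perms_def id_Bij)
  then show "code_perms I code \<noteq> {}" by blast
  fix \<sigma> assume \<sigma>: "\<sigma> \<in> code_perms I code"
  note \<sigma>D = code_permsD[OF \<sigma>]
  have "code (inv_into I \<sigma> i) = code i" if "i \<in> I" for i
    using \<sigma>D(5)[of "inv_into I \<sigma> i"] bij_betw_inv_into_right[OF \<sigma>D(2) that] Bij_inv_into_mem[OF \<sigma>D(1) that]
    by simp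
  then show "inv\<^bsub>BijGroup I\<^esub> \<sigma> \<in> code_perms I code"
    using inv_BijGroup[OF \<sigma>D(1)] restrict_inv_into_Bij[OF \<sigma>D(1)] by (simp add: code_perms_def)
  fix \<tau> assume \<tau>: "\<tau> \<in> code_perms I code"
  note \<tau>D = code_permsD[OF \<tau>]
  show "\<sigma> \<otimes>\<^bsub>BijGroup I\<^esub> \<tau> \<in> code_perms I code"
    using compose_Bij[OF \<sigma>D(1) \<tau>D(1)] \<sigma>D(1,5) \<tau>D(1,4,5)
    by (simp add: code_perms_def BijGroup_def compose_def)
qed

lemma group_perm_group: "group (perm_group I code)"
  unfolding perm_group_def by (rule subgroup.subgroup_is_group[OF perm_group_subgroup group_BijGroup])

lemma carrier_perm_group [simp]: "carrier (perm_group I code) = code_perms I code"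
  by (simp add: perm_group_def)

lemma perm_group_mult:
  "\<lbrakk>\<sigma> \<in> code_perms I code; \<tau> \<in> code_perms I code\<rbrakk> \<Longrightarrow> \<sigma> \<otimes>\<^bsub>perm_group I code\<^esub> \<tau> = compose I \<sigma> \<tau>"
  using code_permsD(1)[of \<sigma> I code] code_permsD(1)[of \<tau> I code] by (simp add: perm_group_def BijGroup_def)

lemma perm_group_inv:
  assumes "\<sigma> \<in> code_perms I code"
  shows "inv\<^bsub>perm_group I code\<^esub> \<sigma> = (\<lambda>i\<in>I. inv_into I \<sigma> i)"
  using group.m_inv_consistent[OF group_BijGroup perm_group_subgroup assms] inv_BijGroup[OF code_permsD(1)[OF assms]]
  by (simp add: perm_group_def)

lemma code_perms_PiE: "code_perms I code \<subseteq> (\<Pi>\<^sub>E i\<in>I. I)"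
  using code_permsD(3) by blast

lemma topspace_perm_topology [simp]: "topspace (perm_topology I code) = code_perms I code"
  using code_perms_PiE[of I code] by (auto simp: perm_topology_def)

lemma openin_perm_topology:
  "openin (perm_topology I code) U \<longleftrightarrow> U \<subseteq> code_perms I code \<and>
    (\<forall>\<sigma>\<in>U. \<exists>J. finite J \<and> J \<subseteq> I \<and> (\<forall>\<tau>\<in>code_perms I code. (\<forall>i\<in>J. \<tau> i = \<sigma> i) \<longrightarrow> \<tau> \<in> U))"
  unfolding perm_topology_def by (rule openin_discrete_product_subtopology[OF code_perms_PiE])

lemma openin_perm_value:
  assumes "i \<in> I"
  shows "openin (perm_topology I code) {\<sigma> \<in> code_perms I code. \<sigma> i = j}"
  unfolding openin_perm_topology using assms by (auto intro!: exI[of _ "{i}"])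

lemma continuous_map_into_perm:
  assumes f: "\<And>x. x \<in> topspace Y \<Longrightarrow> f x \<in> code_perms I code"
    and op: "\<And>i j. \<lbrakk>i \<in> I; j \<in> I\<rbrakk> \<Longrightarrow> openin Y {x \<in> topspace Y. f x i = j}"
  shows "continuous_map Y (perm_topology I code) f"
  unfolding perm_topology_def continuous_map_in_subtopology
proof
  show "continuous_map Y (product_topology (\<lambda>_. discrete_topology I) I) f"
    unfolding continuous_map_componentwise
  proof (intro conjI ballI)
    show "f ` topspace Y \<subseteq> extensional I" using code_permsD(3)[OF f] by (auto simp: PiE_def)
    fix i assume i: "i \<in> I"
    have "openin Y {x \<in> topspace Y. f x i \<in> U}" if "U \<subseteq> I" for U
    proof -
      have "{x \<in> topspace Y. f x i \<in> U} = \<Union>((\<lambda>j. {x \<in> topspace Y. f x i = j}) ` U)" by blast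
      moreover have "openin Y \<dots>" using op[OF i] that by blast
      ultimately show ?thesis by simp
    qed
    then show "continuous_map Y (discrete_topology I) (\<lambda>x. f x i)"
      using code_permsD(4)[OF f] i by (auto simp: continuous_map_def)
  qed
  show "f \<in> topspace Y \<rightarrow> code_perms I code" using f by simp
qed

text \<open>Injectivity, preservation of labels and surjectivity amount to countably many open
  conditions, one for each pair, index or target value. Surjectivity is not a closed condition in
  general, so a G-delta set is the natural form.\<close>

lemma gdelta_code_perms:
  assumes I: "countable I"
  shows "gdelta_in (product_topology (\<lambda>_. discrete_topology I) I) (code_perms I code)"
proof -
  let ?P = "product_topology (\<lambda>_. discrete_topology I) I"
  have tP: "topspace ?P = (\<Pi>\<^sub>E i\<in>I. I)" by simp
  have op: "openin ?P {\<sigma> \<in> \<Pi>\<^sub>E i\<in>I. I. Q \<sigma>}"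
    if "\<And>\<sigma>. Q \<sigma> \<Longrightarrow> \<exists>J. finite J \<and> J \<subseteq> I \<and> (\<forall>\<tau>\<in>\<Pi>\<^sub>E i\<in>I. I. (\<forall>i\<in>J. \<tau> i = \<sigma> i) \<longrightarrow> Q \<tau>)" for Q
  proof -
    have "openin (subtopology ?P (\<Pi>\<^sub>E i\<in>I. I)) {\<sigma> \<in> \<Pi>\<^sub>E i\<in>I. I. Q \<sigma>}"
      unfolding openin_discrete_product_subtopology[OF subset_refl] using that by auto
    moreover have "subtopology ?P (\<Pi>\<^sub>E i\<in>I. I) = ?P" using subtopology_topspace[of ?P] by simp
    ultimately show ?thesis by simp
  qed
  let ?A = "\<lambda>(i, j). {\<sigma> \<in> \<Pi>\<^sub>E i\<in>I. I. i \<noteq> j \<longrightarrow> \<sigma> i \<noteq> \<sigma> j}"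
  let ?B = "\<lambda>i. {\<sigma> \<in> \<Pi>\<^sub>E i\<in>I. I. code (\<sigma> i) = code i}"
  let ?C = "\<lambda>j. {\<sigma> \<in> \<Pi>\<^sub>E i\<in>I. I. \<exists>i\<in>I. \<sigma> i = j}"
  let ?F = "insert (\<Pi>\<^sub>E i\<in>I. I) (?A ` (I \<times> I) \<union> ?B ` I \<union> ?C ` I)"
  have "gdelta_in ?P (\<Inter>?F)"
  proof (rule gdelta_in_Inter)
    show "countable ?F" using I by (intro countable_insert countable_Un countable_image countable_SIGMA) auto
    have A: "openin ?P (?A (i, j))" if "i \<in> I" "j \<in> I" for i j
      using op[of "\<lambda>\<sigma>. i \<noteq> j \<longrightarrow> \<sigma> i \<noteq> \<sigma> j"] that by (force intro!: exI[of _ "{i, j}"])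
    have B: "openin ?P (?B i)" if "i \<in> I" for i
      using op[of "\<lambda>\<sigma>. code (\<sigma> i) = code i"] that by (force intro!: exI[of _ "{i}"])
    have C: "openin ?P (?C j)" if "j \<in> I" for j
    proof (rule op)
      fix \<sigma> assume "\<exists>i\<in>I. \<sigma> i = j"
      then obtain i where "i \<in> I" "\<sigma> i = j" by blast
      then show "\<exists>J. finite J \<and> J \<subseteq> I \<and> (\<forall>\<tau>\<in>\<Pi>\<^sub>E i\<in>I. I. (\<forall>i\<in>J. \<tau> i = \<sigma> i) \<longrightarrow> (\<exists>i\<in>I. \<tau> i = j))"
        by (intro exI[of _ "{i}"]) auto
    qed
    have D: "openin ?P (\<Pi>\<^sub>E i\<in>I. I)" using openin_topspace[of ?P] unfolding tP .
    fix S assume "S \<in> ?F"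
    then have "openin ?P S" using A B C D by auto
    then show "gdelta_in ?P S" by (rule open_imp_gdelta_in)
  qed simp
  moreover have "\<Inter>?F = code_perms I code"
  proof (intro equalityI subsetI)
    fix \<sigma> assume s: "\<sigma> \<in> \<Inter>?F"
    have e: "\<sigma> \<in> (\<Pi>\<^sub>E i\<in>I. I)" by (rule InterD[OF s]) (rule insertI1)
    have inj: "\<sigma> i \<noteq> \<sigma> j" if "i \<in> I" "j \<in> I" "i \<noteq> j" for i j
    proof -
      have "?A (i, j) \<in> ?F" using that(1,2) by (intro insertI2 UnI1 imageI SigmaI)
      from InterD[OF s this] show ?thesis using that(3) by simp
    qed
    have lab: "code (\<sigma> i) = code i" if "i \<in> I" for i
    proof -
      have "?B i \<in> ?F" using that by (intro insertI2 UnI1 UnI2 imageI)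
      from InterD[OF s this] show ?thesis by simp
    qed
    have sur: "\<exists>i\<in>I. \<sigma> i = j" if "j \<in> I" for j
    proof -
      have "?C j \<in> ?F" using that by (intro insertI2 UnI2 imageI)
      from InterD[OF s this] show ?thesis by simp
    qed
    have "inj_on \<sigma> I" using inj unfolding inj_on_def by metis
    moreover have "\<sigma> ` I = I" using e sur by force
    moreover have "\<sigma> \<in> extensional I" using e by (simp add: PiE_def)
    ultimately show "\<sigma> \<in> code_perms I code" using lab by (simp add: code_perms_def Bij_def bij_betw_def)
  next
    fix \<sigma> assume "\<sigma> \<in> code_perms I code"
    note \<sigma>D = code_permsD[OF this]
    have inj: "inj_on \<sigma> I" and im: "\<sigma> ` I = I" using \<sigma>D(2) by (auto simp: bij_betw_def)
    have sur: "\<exists>i\<in>I. \<sigma> i = j" if "j \<in> I" for j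
    proof -
      have "j \<in> \<sigma> ` I" using im that by simp
      then show ?thesis by (auto elim: imageE)
    qed
    show "\<sigma> \<in> \<Inter>?F"
    proof (rule InterI)
      fix S assume "S \<in> ?F"
      then consider "S = (\<Pi>\<^sub>E i\<in>I. I)" | i j where "i \<in> I" "j \<in> I" "S = ?A (i, j)"
        | i where "i \<in> I" "S = ?B i" | j where "j \<in> I" "S = ?C j"
        by (elim insertE UnE imageE) auto
      then show "\<sigma> \<in> S"
        using \<sigma>D(3,5) sur inj_on_eq_iff[OF inj] by cases simp_all
    qed
  qed
  ultimately show ?thesis by simp
qed

text \<open>A G-delta subset of a countable power of a discrete space is completely metrizable.
  Separability comes from finite lists of prescribed values: they are countable in number, and one
  permutation is chosen for each list that can be met.\<close>

lemma polish_perm_group: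
  assumes I: "countable I"
  shows "polish_group (perm_group I code) (perm_topology I code)"
  unfolding polish_group_def
proof (intro conjI)
  let ?C = "code_perms I code"
  let ?T = "perm_topology I code"
  interpret group "perm_group I code" by (rule group_perm_group)
  show "group (perm_group I code)" by (rule group_perm_group)
  show "topspace ?T = carrier (perm_group I code)" by simp
  show "continuous_map (prod_topology ?T ?T) ?T (\<lambda>(x, y). x \<otimes>\<^bsub>perm_group I code\<^esub> y)"
  proof (rule continuous_map_into_perm)
    fix p assume "p \<in> topspace (prod_topology ?T ?T)"
    then show "(\<lambda>(x, y). x \<otimes>\<^bsub>perm_group I code\<^esub> y) p \<in> ?C"
      using m_closed by auto
  next
    fix i j assume i: "i \<in> I" and j: "j \<in> I"
    \<comment> \<open>The value of the composite at i is read off through the intermediate index k;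
      for each k this is a product of two basic open sets.\<close>
    let ?V = "\<lambda>k. {\<sigma> \<in> ?C. \<sigma> k = j} \<times> {\<tau> \<in> ?C. \<tau> i = k}"
    have "{p \<in> topspace (prod_topology ?T ?T). (\<lambda>(x, y). x \<otimes>\<^bsub>perm_group I code\<^esub> y) p i = j} = \<Union>(?V ` I)"
    proof (intro equalityI subsetI)
      fix p assume p: "p \<in> {p \<in> topspace (prod_topology ?T ?T). (\<lambda>(x, y). x \<otimes>\<^bsub>perm_group I code\<^esub> y) p i = j}"
      obtain \<sigma> \<tau> where st: "p = (\<sigma>, \<tau>)" by (rule prod.exhaust)
      have c: "\<sigma> \<in> ?C" "\<tau> \<in> ?C" using p st by simp_all
      then have "\<sigma> (\<tau> i) = j" using p st i by (simp add: perm_group_mult compose_def)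
      then show "p \<in> \<Union>(?V ` I)" using c st code_permsD(4)[OF c(2) i] by simp
    next
      fix p assume "p \<in> \<Union>(?V ` I)"
      then obtain k \<sigma> \<tau> where "p = (\<sigma>, \<tau>)" "\<sigma> \<in> ?C" "\<tau> \<in> ?C" "\<sigma> k = j" "\<tau> i = k" by auto
      then show "p \<in> {p \<in> topspace (prod_topology ?T ?T). (\<lambda>(x, y). x \<otimes>\<^bsub>perm_group I code\<^esub> y) p i = j}"
        using i by (simp add: perm_group_mult compose_def)
    qed
    moreover have "openin (prod_topology ?T ?T) (\<Union>(?V ` I))"
    proof (rule openin_Union)
      fix W assume "W \<in> ?V ` I"
      then obtain k where "k \<in> I" "W = ?V k" by (rule imageE)
      then show "openin (prod_topology ?T ?T) W"
        using openin_perm_value[OF i, of code k] openin_perm_value[of k I code j] by (simp add: openin_prod_Times_iff)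
    qed
    ultimately show "openin (prod_topology ?T ?T)
        {p \<in> topspace (prod_topology ?T ?T). (\<lambda>(x, y). x \<otimes>\<^bsub>perm_group I code\<^esub> y) p i = j}" by simp
  qed
  show "continuous_map ?T ?T (\<lambda>x. inv\<^bsub>perm_group I code\<^esub> x)"
  proof (rule continuous_map_into_perm)
    show "inv\<^bsub>perm_group I code\<^esub> x \<in> ?C" if "x \<in> topspace ?T" for x using inv_closed that by simp
    fix i j assume i: "i \<in> I" and j: "j \<in> I"
    have "(inv\<^bsub>perm_group I code\<^esub> \<sigma>) i = j \<longleftrightarrow> \<sigma> j = i" if "\<sigma> \<in> ?C" for \<sigma>
      using code_permsD(2)[OF that] i j perm_group_inv[OF that] bij_betw_inv_into_left bij_betw_inv_into_right
      by fastforce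
    then have "{\<sigma> \<in> topspace ?T. (inv\<^bsub>perm_group I code\<^esub> \<sigma>) i = j} = {\<sigma> \<in> ?C. \<sigma> j = i}" by auto
    then show "openin ?T {\<sigma> \<in> topspace ?T. (inv\<^bsub>perm_group I code\<^esub> \<sigma>) i = j}"
      using openin_perm_value[OF j] by simp
  qed
  show "completely_metrizable_space ?T"
    unfolding perm_topology_def
  proof (rule completely_metrizable_space_gdelta_in)
    show "completely_metrizable_space (product_topology (\<lambda>_. discrete_topology I) I)"
      unfolding completely_metrizable_space_product_topology
      using I by (auto intro: completely_metrizable_space_discrete_topology)
    show "gdelta_in (product_topology (\<lambda>_. discrete_topology I) I) ?C" by (rule gdelta_code_perms[OF I])
  qed
  show "separable_space ?T"
  proof -
    define W where "W = (\<lambda>ps. {\<sigma> \<in> ?C. \<forall>p\<in>set ps. \<sigma> (fst p) = snd p})"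
    define D where "D = {SOME \<sigma>. \<sigma> \<in> W ps | ps. ps \<in> lists (I \<times> I) \<and> W ps \<noteq> {}}"
    have D: "(SOME \<sigma>. \<sigma> \<in> W ps) \<in> W ps" if "W ps \<noteq> {}" for ps using that by (simp add: some_in_eq)
    have "countable (lists (I \<times> I))" using I by (intro countable_lists countable_SIGMA) auto
    then have "countable ((\<lambda>ps. SOME \<sigma>. \<sigma> \<in> W ps) ` lists (I \<times> I))" by (rule countable_image)
    then have cD: "countable D" by (rule countable_subset[rotated]) (auto simp: D_def)
    have DC: "D \<subseteq> ?C"
    proof
      fix \<sigma> assume "\<sigma> \<in> D"
      then obtain ps where "W ps \<noteq> {}" "\<sigma> = (SOME \<sigma>. \<sigma> \<in> W ps)" by (auto simp: D_def)
      then have "\<sigma> \<in> W ps" using D by simp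
      then show "\<sigma> \<in> ?C" by (simp add: W_def)
    qed
    have "?T closure_of D = ?C"
    proof (intro equalityI subsetI)
      show "x \<in> ?C" if "x \<in> ?T closure_of D" for x using that by (simp add: in_closure_of)
      fix \<sigma> assume \<sigma>: "\<sigma> \<in> ?C"
      have "\<exists>\<tau>. \<tau> \<in> D \<and> \<tau> \<in> U" if U: "\<sigma> \<in> U" "openin ?T U" for U
      proof -
        obtain J where J: "finite J" "J \<subseteq> I" "\<forall>\<tau>\<in>?C. (\<forall>i\<in>J. \<tau> i = \<sigma> i) \<longrightarrow> \<tau> \<in> U"
          using U unfolding openin_perm_topology by blast
        obtain js where js: "set js = J" using finite_list[OF J(1)] by blast
        define ps where "ps = map (\<lambda>i. (i, \<sigma> i)) js"
        have "\<sigma> \<in> W ps" using \<sigma> by (simp add: W_def ps_def)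
        then have ne: "W ps \<noteq> {}" by blast
        have "(i, \<sigma> i) \<in> I \<times> I" if "i \<in> J" for i using subsetD[OF J(2) that] code_permsD(4)[OF \<sigma>] by simp
        then have "ps \<in> lists (I \<times> I)" using js by (auto simp: ps_def)
        then have "(SOME \<tau>. \<tau> \<in> W ps) \<in> D" using ne by (auto simp: D_def)
        moreover have "(SOME \<tau>. \<tau> \<in> W ps) \<in> U" using D[OF ne] J(3) js by (auto simp: W_def ps_def)
        ultimately show ?thesis by blast
      qed
      then show "\<sigma> \<in> ?T closure_of D" using \<sigma> by (auto simp: in_closure_of)
    qed
    then show ?thesis unfolding separable_space_def using cD DC by (intro exI[of _ D]) simp
  qed
qed

section \<open>Coded compact rings are small\<close>

lemma countable_image_factor:
  assumes "countable (q ` E)" and "\<And>x y. \<lbrakk>x \<in> E; y \<in> E; q x = q y\<rbrakk> \<Longrightarrow> f x = f y"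
  shows "countable (f ` E)"
proof -
  have "f x = f (inv_into E q (q x))" if "x \<in> E" for x
    using that by (intro assms(2)) (simp_all add: inv_into_into f_inv_into_f)
  then have "f ` E \<subseteq> (\<lambda>u. f (inv_into E q u)) ` q ` E" by blast
  then show ?thesis using assms(1) countable_subset countable_image by meson
qed

text \<open>\<open>None\<close> stands for countably infinite, so the encoded size determines a
  countable set up to bijection.\<close>

lemma equal_size_bij:
  assumes "countable A" "countable B"
    and "(if finite A then Some (card A) else None) = (if finite B then Some (card B) else None)"
  obtains g where "bij_betw g A B"
proof (cases "finite A")
  case True
  then have "finite B" "card A = card B" using assms(3) by (auto split: if_splits)
  then show thesis using that finite_same_card_bij[OF True] by blast
next
  case False
  then have fB: "infinite B" using assms(3) by (auto split: if_splits)
  have "bij_betw (from_nat_into B \<circ> to_nat_on A) A B"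
    using to_nat_on_infinite[OF assms(1) False] bij_betw_from_nat_into[OF assms(2) fB] by (rule bij_betw_trans)
  then show thesis by (rule that)
qed

text \<open>A homeomorphic copy of a product of finite rings, seen through numberings of the factors:
  \<open>c x i\<close> is the number of the \<open>i\<close>-th coordinate of \<open>x\<close>, and \<open>code i\<close> determines the tables of
  the \<open>i\<close>-th factor.\<close>

locale coded_ring = top_ring R T for R (structure) and T +
  fixes I :: "'i set" and code :: "'i \<Rightarrow> 'c" and c :: "'a \<Rightarrow> 'i \<Rightarrow> nat" and N :: nat
  assumes compact: "compact_space T" and countable_I: "countable I" and finite_code: "finite (code ` I)"
    and c_bound: "\<And>x i. \<lbrakk>x \<in> carrier R; i \<in> I\<rbrakk> \<Longrightarrow> c x i < N"
    and c_inj: "\<And>x y. \<lbrakk>x \<in> carrier R; y \<in> carrier R; \<And>i. i \<in> I \<Longrightarrow> c x i = c y i\<rbrakk> \<Longrightarrow> x = y"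
    and c_glue: "\<And>v. (\<And>i. i \<in> I \<Longrightarrow> \<exists>x\<in>carrier R. \<exists>j\<in>I. code j = code i \<and> c x j = v i)
      \<Longrightarrow> \<exists>x\<in>carrier R. \<forall>i\<in>I. c x i = v i"
    and c_open: "\<And>i m. i \<in> I \<Longrightarrow> openin T {x \<in> carrier R. c x i = m}"
    and c_base: "\<And>U x. \<lbrakk>openin T U; x \<in> U\<rbrakk>
      \<Longrightarrow> \<exists>J. finite J \<and> J \<subseteq> I \<and> (\<forall>y\<in>carrier R. (\<forall>i\<in>J. c y i = c x i) \<longrightarrow> y \<in> U)"
    and c_ops: "\<And>x x' y y' i j. \<lbrakk>x \<in> carrier R; x' \<in> carrier R; y \<in> carrier R; y' \<in> carrier R; i \<in> I; j \<in> I;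
        code i = code j; c x i = c y j; c x' i = c y' j\<rbrakk>
      \<Longrightarrow> c (x \<oplus> x') i = c (y \<oplus> y') j \<and> c (x \<otimes> x') i = c (y \<otimes> y') j"
begin

abbreviation "perms \<equiv> code_perms I code"

text \<open>The coordinate at i is moved to the index \<open>\<sigma> i\<close>, not fetched from
  there; this makes it a left action. The restriction to the carrier is what \<open>Bij\<close>
  requires.\<close>

definition shift :: "('i \<Rightarrow> 'i) \<Rightarrow> 'a \<Rightarrow> 'a" where
  "shift \<sigma> = (\<lambda>x\<in>carrier R. SOME y. y \<in> carrier R \<and> (\<forall>i\<in>I. c y (\<sigma> i) = c x i))"

text \<open>\<open>c_glue\<close> applies because the number demanded at j is that of x at the
  preimage of j, an index with the same code.\<close>

lemma shift:
  assumes \<sigma>: "\<sigma> \<in> perms" and x: "x \<in> carrier R"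
  shows "shift \<sigma> x \<in> carrier R" "i \<in> I \<Longrightarrow> c (shift \<sigma> x) (\<sigma> i) = c x i"
proof -
  note \<sigma>D = code_permsD[OF \<sigma>]
  let ?s = "inv_into I \<sigma>"
  have inv: "?s j \<in> I" "\<sigma> (?s j) = j" if "j \<in> I" for j
    using Bij_inv_into_mem[OF \<sigma>D(1) that] bij_betw_inv_into_right[OF \<sigma>D(2) that] by auto
  have "\<exists>y\<in>carrier R. \<forall>j\<in>I. c y j = c x (?s j)"
  proof (rule c_glue)
    fix j assume j: "j \<in> I"
    then have "code (?s j) = code j" using \<sigma>D(5)[OF inv(1)[OF j]] inv(2)[OF j] by simp
    then show "\<exists>y\<in>carrier R. \<exists>i\<in>I. code i = code j \<and> c y i = c x (?s j)"
      using x inv(1)[OF j] by (intro bexI[of _ x] bexI[of _ "?s j"]) simp_all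
  qed
  then obtain y where y: "y \<in> carrier R" "\<forall>j\<in>I. c y j = c x (?s j)" by blast
  have "c y (\<sigma> i) = c x i" if "i \<in> I" for i
    using y(2) \<sigma>D(4)[OF that] bij_betw_inv_into_left[OF \<sigma>D(2) that] by simp
  then have "\<exists>y. y \<in> carrier R \<and> (\<forall>i\<in>I. c y (\<sigma> i) = c x i)" using y(1) by (intro exI[of _ y]) simp
  from someI_ex[OF this] have *: "shift \<sigma> x \<in> carrier R \<and> (\<forall>i\<in>I. c (shift \<sigma> x) (\<sigma> i) = c x i)"
    using x by (simp add: shift_def)
  show "shift \<sigma> x \<in> carrier R" using * by simp
  show "i \<in> I \<Longrightarrow> c (shift \<sigma> x) (\<sigma> i) = c x i" using * by simp
qed

lemma shift_unique:
  assumes \<sigma>: "\<sigma> \<in> perms" and x: "x \<in> carrier R" and y: "y \<in> carrier R" "\<And>i. i \<in> I \<Longrightarrow> c y (\<sigma> i) = c x i"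
  shows "shift \<sigma> x = y"
proof (rule c_inj[OF shift(1)[OF \<sigma> x] y(1)])
  fix j assume "j \<in> I"
  then have "j \<in> \<sigma> ` I" using code_permsD(2)[OF \<sigma>] by (simp add: bij_betw_def)
  then obtain i where "i \<in> I" "j = \<sigma> i" by (auto elim: imageE)
  then show "c (shift \<sigma> x) j = c y j" using shift(2)[OF \<sigma> x] y(2) by simp
qed

lemma shift_one: "x \<in> carrier R \<Longrightarrow> shift (\<lambda>i\<in>I. i) x = x"
  by (rule shift_unique) (auto simp: code_perms_def id_Bij)

lemma shift_compose:
  assumes \<sigma>: "\<sigma> \<in> perms" and \<tau>: "\<tau> \<in> perms" and x: "x \<in> carrier R"
  shows "shift (\<sigma> \<otimes>\<^bsub>perm_group I code\<^esub> \<tau>) x = shift \<sigma> (shift \<tau> x)"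
proof (rule shift_unique)
  interpret group "perm_group I code" by (rule group_perm_group)
  show "\<sigma> \<otimes>\<^bsub>perm_group I code\<^esub> \<tau> \<in> perms" using m_closed \<sigma> \<tau> by simp
  show "shift \<sigma> (shift \<tau> x) \<in> carrier R" using shift(1) \<sigma> \<tau> x by simp
  fix i assume i: "i \<in> I"
  have "c (shift \<sigma> (shift \<tau> x)) (\<sigma> (\<tau> i)) = c x i"
    using shift(2)[OF \<sigma> shift(1)[OF \<tau> x] code_permsD(4)[OF \<tau> i]] shift(2)[OF \<tau> x i] by simp
  then show "c (shift \<sigma> (shift \<tau> x)) ((\<sigma> \<otimes>\<^bsub>perm_group I code\<^esub> \<tau>) i) = c x i"
    using i by (simp add: perm_group_mult[OF \<sigma> \<tau>] compose_def)
qed (rule x)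

lemma shift_inverse:
  assumes \<sigma>: "\<sigma> \<in> perms" and x: "x \<in> carrier R"
  shows "shift \<sigma> (shift (inv\<^bsub>perm_group I code\<^esub> \<sigma>) x) = x" "shift (inv\<^bsub>perm_group I code\<^esub> \<sigma>) (shift \<sigma> x) = x"
proof -
  interpret G: group "perm_group I code" by (rule group_perm_group)
  have s: "inv\<^bsub>perm_group I code\<^esub> \<sigma> \<in> perms" using G.inv_closed \<sigma> by simp
  have one: "\<one>\<^bsub>perm_group I code\<^esub> = (\<lambda>i\<in>I. i)" by (simp add: perm_group_def BijGroup_def)
  show "shift \<sigma> (shift (inv\<^bsub>perm_group I code\<^esub> \<sigma>) x) = x"
    using shift_compose[OF \<sigma> s x] G.r_inv[of \<sigma>] \<sigma> shift_one[OF x] by (simp add: one)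
  show "shift (inv\<^bsub>perm_group I code\<^esub> \<sigma>) (shift \<sigma> x) = x"
    using shift_compose[OF s \<sigma> x] G.l_inv[of \<sigma>] \<sigma> shift_one[OF x] by (simp add: one)
qed

lemma shift_Bij: "\<sigma> \<in> perms \<Longrightarrow> shift \<sigma> \<in> Bij (carrier R)"
proof -
  assume \<sigma>: "\<sigma> \<in> perms"
  interpret G: group "perm_group I code" by (rule group_perm_group)
  have s: "inv\<^bsub>perm_group I code\<^esub> \<sigma> \<in> perms" using G.inv_closed \<sigma> by simp
  have "bij_betw (shift \<sigma>) (carrier R) (carrier R)"
    by (rule bij_betw_byWitness[of _ "shift (inv\<^bsub>perm_group I code\<^esub> \<sigma>)"])
      (use shift_inverse[OF \<sigma>] shift(1)[OF \<sigma>] shift(1)[OF s] in auto)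
  then show ?thesis by (simp add: Bij_def shift_def)
qed

lemma group_action_shift: "group_action (perm_group I code) (carrier R) shift"
  unfolding group_action_def group_hom_def group_hom_axioms_def
proof (intro conjI)
  show "group (perm_group I code)" by (rule group_perm_group)
  show "group (BijGroup (carrier R))" by (rule group_BijGroup)
  show "shift \<in> hom (perm_group I code) (BijGroup (carrier R))"
  proof (rule homI)
    show "shift \<sigma> \<in> carrier (BijGroup (carrier R))" if "\<sigma> \<in> carrier (perm_group I code)" for \<sigma>
      using shift_Bij that by (simp add: BijGroup_def)
    fix \<sigma> \<tau> assume "\<sigma> \<in> carrier (perm_group I code)" "\<tau> \<in> carrier (perm_group I code)"
    then have s: "\<sigma> \<in> perms" and t: "\<tau> \<in> perms" by simp_all
    have "shift (\<sigma> \<otimes>\<^bsub>perm_group I code\<^esub> \<tau>) = compose (carrier R) (shift \<sigma>) (shift \<tau>)"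
    proof (rule ext)
      fix x show "shift (\<sigma> \<otimes>\<^bsub>perm_group I code\<^esub> \<tau>) x = compose (carrier R) (shift \<sigma>) (shift \<tau>) x"
      proof (cases "x \<in> carrier R")
        case True
        then show ?thesis using shift_compose[OF s t] by (simp add: compose_def)
      next
        case False
        then show ?thesis by (simp add: compose_def shift_def)
      qed
    qed
    then show "shift (\<sigma> \<otimes>\<^bsub>perm_group I code\<^esub> \<tau>) = shift \<sigma> \<otimes>\<^bsub>BijGroup (carrier R)\<^esub> shift \<tau>"
      using shift_Bij[OF s] shift_Bij[OF t] by (simp add: BijGroup_def)
  qed
qed

lemma shift_hom:
  assumes \<sigma>: "\<sigma> \<in> perms"
  shows "shift \<sigma> \<in> nonunital_hom R R"
  unfolding nonunital_hom_def
proof (intro CollectI conjI ballI)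
  show "shift \<sigma> \<in> carrier R \<rightarrow> carrier R" using shift(1)[OF \<sigma>] by simp
  fix x y assume x: "x \<in> carrier R" and y: "y \<in> carrier R"
  note s = shift(1)[OF \<sigma> x] shift(1)[OF \<sigma> y]
  have ops: "c (shift \<sigma> x \<oplus> shift \<sigma> y) (\<sigma> i) = c (x \<oplus> y) i \<and> c (shift \<sigma> x \<otimes> shift \<sigma> y) (\<sigma> i) = c (x \<otimes> y) i"
    if i: "i \<in> I" for i
    by (rule c_ops[OF s x y code_permsD(4)[OF \<sigma> i] i code_permsD(5)[OF \<sigma> i] shift(2)[OF \<sigma> x i] shift(2)[OF \<sigma> y i]])
  show "shift \<sigma> (x \<oplus> y) = shift \<sigma> x \<oplus> shift \<sigma> y"
    by (rule shift_unique[OF \<sigma>]) (use x y s ops in auto)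
  show "shift \<sigma> (x \<otimes> y) = shift \<sigma> x \<otimes> shift \<sigma> y"
    by (rule shift_unique[OF \<sigma>]) (use x y s ops m_closed in auto)
qed

text \<open>To control finitely many coordinates of the image it suffices that the permutation
  agrees with \<open>\<sigma>\<close> on their preimages and that the argument agrees with x
  there.\<close>

lemma continuous_shift: "continuous_map (prod_topology (perm_topology I code) T) T (\<lambda>(\<sigma>, x). shift \<sigma> x)"
  unfolding continuous_map_def
proof (intro conjI allI impI)
  let ?P = "prod_topology (perm_topology I code) T"
  show "(\<lambda>(\<sigma>, x). shift \<sigma> x) \<in> topspace ?P \<rightarrow> topspace T" using shift(1) by (auto simp: topspace)
  fix U assume U: "openin T U"
  let ?S = "{p \<in> topspace ?P. (case p of (\<sigma>, x) \<Rightarrow> shift \<sigma> x) \<in> U}"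
  show "openin ?P ?S"
  proof (subst openin_subopen, intro ballI)
    fix p assume p: "p \<in> ?S"
    obtain \<sigma> x where px: "p = (\<sigma>, x)" by (rule prod.exhaust)
    have \<sigma>: "\<sigma> \<in> perms" and x: "x \<in> carrier R" and sU: "shift \<sigma> x \<in> U" using p px by (simp_all add: topspace)
    note \<sigma>D = code_permsD[OF \<sigma>]
    obtain J where J: "finite J" "J \<subseteq> I" "\<forall>y\<in>carrier R. (\<forall>i\<in>J. c y i = c (shift \<sigma> x) i) \<longrightarrow> y \<in> U"
      using c_base[OF U sU] by blast
    let ?s = "inv_into I \<sigma>"
    have inv: "?s j \<in> I" "\<sigma> (?s j) = j" if "j \<in> J" for j
      using Bij_inv_into_mem[OF \<sigma>D(1), of j] bij_betw_inv_into_right[OF \<sigma>D(2), of j] that J(2) by auto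
    define A where "A = \<Inter>(insert perms ((\<lambda>j. {\<tau> \<in> perms. \<tau> (?s j) = j}) ` J))"
    define B where "B = \<Inter>(insert (carrier R) ((\<lambda>j. {y \<in> carrier R. c y (?s j) = c x (?s j)}) ` J))"
    have A: "\<tau> \<in> A \<longleftrightarrow> \<tau> \<in> perms \<and> (\<forall>j\<in>J. \<tau> (?s j) = j)" for \<tau> unfolding A_def by blast
    have B: "y \<in> B \<longleftrightarrow> y \<in> carrier R \<and> (\<forall>j\<in>J. c y (?s j) = c x (?s j))" for y unfolding B_def by blast
    have "openin (perm_topology I code) A" unfolding A_def
    proof (rule openin_Inter)
      fix W assume "W \<in> insert perms ((\<lambda>j. {\<tau> \<in> perms. \<tau> (?s j) = j}) ` J)"
      then consider "W = perms" | j where "j \<in> J" "W = {\<tau> \<in> perms. \<tau> (?s j) = j}" by blast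
      then show "openin (perm_topology I code) W"
        using openin_topspace[of "perm_topology I code"] openin_perm_value[OF inv(1)] by cases simp_all
    qed (use J(1) in simp_all)
    moreover have "openin T B" unfolding B_def
    proof (rule openin_Inter)
      fix W assume "W \<in> insert (carrier R) ((\<lambda>j. {y \<in> carrier R. c y (?s j) = c x (?s j)}) ` J)"
      then consider "W = carrier R" | j where "j \<in> J" "W = {y \<in> carrier R. c y (?s j) = c x (?s j)}" by blast
      then show "openin T W"
        using openin_topspace[of T] c_open[OF inv(1)] by cases (simp_all add: topspace)
    qed (use J(1) in simp_all)
    moreover have "p \<in> A \<times> B" using A B px \<sigma> x inv(2) by simp
    moreover have "A \<times> B \<subseteq> ?S"
    proof
      fix q assume q: "q \<in> A \<times> B"
      obtain \<tau> y where qy: "q = (\<tau>, y)" by (rule prod.exhaust)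
      have t: "\<tau> \<in> perms" "\<forall>j\<in>J. \<tau> (?s j) = j" and y: "y \<in> carrier R" "\<forall>j\<in>J. c y (?s j) = c x (?s j)"
        using q qy A B by simp_all
      have "c (shift \<tau> y) j = c (shift \<sigma> x) j" if j: "j \<in> J" for j
        using shift(2)[OF t(1) y(1) inv(1)[OF j]] shift(2)[OF \<sigma> x inv(1)[OF j]] inv(2)[OF j] t(2) y(2) j by simp
      then have "shift \<tau> y \<in> U" using J(3) shift(1)[OF t(1) y(1)] by simp
      then show "q \<in> ?S" using qy t(1) y(1) by (simp add: topspace)
    qed
    ultimately show "\<exists>V. openin ?P V \<and> p \<in> V \<and> V \<subseteq> ?S"
      by (intro exI[of _ "A \<times> B"]) (simp add: openin_prod_Times_iff)
  qed
qed

lemma countable_orbits_shift: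
  "countable (orbits (perm_group I code) ({..<n::nat} \<rightarrow>\<^sub>E carrier R)
     (\<lambda>g. \<lambda>x\<in>{..<n} \<rightarrow>\<^sub>E carrier R. \<lambda>i\<in>{..<n}. shift g (x i)))"
proof -
  interpret G: group "perm_group I code" by (rule group_perm_group)
  let ?E = "{..<n} \<rightarrow>\<^sub>E carrier R"
  let ?\<psi> = "\<lambda>g. \<lambda>x\<in>?E. \<lambda>i\<in>{..<n}. shift g (x i)"
  let ?orb = "orbit (perm_group I code) ?\<psi>"
  \<comment> \<open>The type of an index: the code of its factor together with the numbers of the
    coordinates of all n entries. Only finitely many types occur.\<close>
  define \<tau> where "\<tau> = (\<lambda>t i. (code i, \<lambda>m\<in>{..<n}. c (t m) i))"
  define \<Theta> where "\<Theta> = code ` I \<times> ({..<n} \<rightarrow>\<^sub>E {..<N})"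
  define fib where "fib = (\<lambda>t \<theta>. {i \<in> I. \<tau> t i = \<theta>})"
  \<comment> \<open>The multiplicity of each type, with \<open>None\<close> for infinitely many. As
    \<open>\<Theta>\<close> is finite, this invariant has countably many values.\<close>
  define q where "q = (\<lambda>t. \<lambda>\<theta>\<in>\<Theta>. if finite (fib t \<theta>) then Some (card (fib t \<theta>)) else None)"
  have tE: "t m \<in> carrier R" if "t \<in> ?E" "m < n" for t m using that by auto
  have \<tau>\<Theta>: "\<tau> t i \<in> \<Theta>" if "t \<in> ?E" "i \<in> I" for t i
    using that c_bound[OF tE] by (auto simp: \<tau>_def \<Theta>_def)
  have "finite \<Theta>" unfolding \<Theta>_def by (intro finite_cartesian_product finite_code finite_PiE) auto
  then have cP: "countable (\<Theta> \<rightarrow>\<^sub>E (UNIV :: nat option set))" by (rule countable_PiE) (rule countableI_type)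
  have "q t \<in> \<Theta> \<rightarrow>\<^sub>E (UNIV :: nat option set)" for t by (simp add: q_def)
  then have "q ` ?E \<subseteq> \<Theta> \<rightarrow>\<^sub>E (UNIV :: nat option set)" by (intro image_subsetI)
  then have cq: "countable (q ` ?E)" by (rule countable_subset[OF _ cP])
  \<comment> \<open>Bijections between the fibres of equal type are glued to a permutation, which
    preserves codes because the type includes the code.\<close>
  have move: "\<exists>\<sigma>\<in>perms. ?\<psi> \<sigma> s = t" if s: "s \<in> ?E" and t: "t \<in> ?E" and qq: "q s = q t" for s t
  proof -
    have "\<exists>g. bij_betw g (fib s \<theta>) (fib t \<theta>)" if "\<theta> \<in> \<Theta>" for \<theta>
    proof -
      have "(if finite (fib s \<theta>) then Some (card (fib s \<theta>)) else None) = (if finite (fib t \<theta>) then Some (card (fib t \<theta>)) else None)"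
        using fun_cong[OF qq, of \<theta>] that by (simp add: q_def)
      moreover have "countable (fib s \<theta>)" "countable (fib t \<theta>)"
        using countable_I by (auto simp: fib_def intro: countable_subset)
      ultimately show ?thesis using equal_size_bij by metis
    qed
    then obtain g where g: "\<forall>\<theta>\<in>\<Theta>. bij_betw (g \<theta>) (fib s \<theta>) (fib t \<theta>)" using bchoice by metis
    define \<sigma> where "\<sigma> = (\<lambda>i\<in>I. g (\<tau> s i) i)"
    have \<sigma>fib: "\<sigma> i \<in> fib t (\<tau> s i)" if "i \<in> I" for i
    proof -
      have "i \<in> fib s (\<tau> s i)" using that by (simp add: fib_def)
      then have "g (\<tau> s i) i \<in> fib t (\<tau> s i)" using g \<tau>\<Theta>[OF s that] by (auto simp: bij_betw_def)
      then show ?thesis using that by (simp add: \<sigma>_def)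
    qed
    then have \<sigma>I: "\<sigma> i \<in> I" and \<sigma>\<tau>: "\<tau> t (\<sigma> i) = \<tau> s i" if "i \<in> I" for i
      using that by (auto simp: fib_def)
    have "inj_on \<sigma> I"
    proof (rule inj_onI)
      fix i j assume ij: "i \<in> I" "j \<in> I" "\<sigma> i = \<sigma> j"
      then have e: "\<tau> s i = \<tau> s j" using \<sigma>\<tau>[OF ij(1)] \<sigma>\<tau>[OF ij(2)] by simp
      have "inj_on (g (\<tau> s j)) (fib s (\<tau> s j))" using g \<tau>\<Theta>[OF s ij(2)] by (auto simp: bij_betw_def)
      moreover have "g (\<tau> s j) i = g (\<tau> s j) j" using ij e by (simp add: \<sigma>_def)
      ultimately show "i = j" by (rule inj_onD) (use ij e in \<open>simp_all add: fib_def\<close>)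
    qed
    moreover have "\<sigma> ` I = I"
    proof (intro equalityI subsetI)
      show "j \<in> I" if "j \<in> \<sigma> ` I" for j using that \<sigma>I by (auto elim: imageE)
      fix j assume j: "j \<in> I"
      let ?\<theta> = "\<tau> t j"
      have "j \<in> fib t ?\<theta>" using j by (simp add: fib_def)
      moreover have "g ?\<theta> ` fib s ?\<theta> = fib t ?\<theta>" using g \<tau>\<Theta>[OF t j] by (simp add: bij_betw_def)
      ultimately have "j \<in> g ?\<theta> ` fib s ?\<theta>" by simp
      then obtain i where i: "i \<in> fib s ?\<theta>" "j = g ?\<theta> i" by (rule imageE) simp
      then have "i \<in> I" "j = \<sigma> i" by (simp_all add: fib_def \<sigma>_def)
      then show "j \<in> \<sigma> ` I" by simp
    qed
    moreover have "code (\<sigma> i) = code i" if "i \<in> I" for i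
      using \<sigma>\<tau>[OF that] by (simp add: \<tau>_def)
    ultimately have \<sigma>: "\<sigma> \<in> perms" by (simp add: code_perms_def Bij_def bij_betw_def \<sigma>_def)
    have "shift \<sigma> (s m) = t m" if m: "m < n" for m
    proof (rule shift_unique[OF \<sigma> tE[OF s m] tE[OF t m]])
      fix i assume i: "i \<in> I"
      have "(\<lambda>m\<in>{..<n}. c (t m) (\<sigma> i)) m = (\<lambda>m\<in>{..<n}. c (s m) i) m" using \<sigma>\<tau>[OF i] by (simp add: \<tau>_def)
      then show "c (t m) (\<sigma> i) = c (s m) i" using m by simp
    qed
    then have "?\<psi> \<sigma> s = t" using s t by (auto simp: PiE_def extensional_def fun_eq_iff)
    then show ?thesis using \<sigma> by blast
  qed
  \<comment> \<open>The assumption is symmetric in s and t, so one inclusion suffices.\<close>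
  have sub: "?orb t \<subseteq> ?orb s" if s: "s \<in> ?E" and t: "t \<in> ?E" and qq: "q s = q t" for s t
  proof
    obtain \<sigma> where \<sigma>: "\<sigma> \<in> perms" "?\<psi> \<sigma> s = t" using move[OF s t qq] by blast
    fix u assume "u \<in> ?orb t"
    then obtain g where g: "g \<in> perms" "u = ?\<psi> g t" by (auto simp: orbit_def)
    have "?\<psi> g t = ?\<psi> (g \<otimes>\<^bsub>perm_group I code\<^esub> \<sigma>) s"
    proof -
      have "t m = shift \<sigma> (s m)" if "m < n" for m using fun_cong[OF \<sigma>(2), of m] s that by simp
      then have "shift g (t m) = shift (g \<otimes>\<^bsub>perm_group I code\<^esub> \<sigma>) (s m)" if "m < n" for m
        using shift_compose[OF g(1) \<sigma>(1) tE[OF s that]] that by simp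
      then have "(\<lambda>m\<in>{..<n}. shift g (t m)) = (\<lambda>m\<in>{..<n}. shift (g \<otimes>\<^bsub>perm_group I code\<^esub> \<sigma>) (s m))"
        by (intro restrict_ext) simp
      then show ?thesis using s t by simp
    qed
    moreover have "g \<otimes>\<^bsub>perm_group I code\<^esub> \<sigma> \<in> carrier (perm_group I code)" using G.m_closed g(1) \<sigma>(1) by simp
    ultimately show "u \<in> ?orb s" unfolding orbit_def g(2) by (intro CollectI exI[of _ "g \<otimes>\<^bsub>perm_group I code\<^esub> \<sigma>"] conjI)
  qed
  have "countable (?orb ` ?E)"
  proof (rule countable_image_factor[OF cq])
    fix s t assume "s \<in> ?E" "t \<in> ?E" "q s = q t"
    then show "?orb s = ?orb t" by (intro equalityI sub) simp_all
  qed
  moreover have "orbits (perm_group I code) ?E ?\<psi> = ?orb ` ?E" unfolding orbits_def by (simp add: Setcompr_eq_image)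
  ultimately show ?thesis by simp
qed

lemma small_shift: "small_compact_G_ring R T (perm_group I code) (perm_topology I code) shift"
  unfolding small_compact_G_ring_def compact_G_ring_def
proof (intro conjI ballI allI)
  show "topological_ring R T" using top_ring_axioms top_ring_iff by blast
  show "compact_space T" by (rule compact)
  show "polish_group (perm_group I code) (perm_topology I code)" by (rule polish_perm_group[OF countable_I])
  show "group_action (perm_group I code) (carrier R) shift" by (rule group_action_shift)
  show "shift g \<in> nonunital_hom R R" if "g \<in> carrier (perm_group I code)" for g
    using that shift_hom by simp
  show "continuous_map (prod_topology (perm_topology I code) T) T (\<lambda>(g, x). shift g x)" by (rule continuous_shift)
qed (rule countable_orbits_shift)

end

section \<open>Bounded products of matrix rings\<close>

text \<open>The i-th number of x is \<open>b i (H x i)\<close>. Gluing holds because factors with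
  the same code use the same set of numbers: a number seen at j is also available at i.\<close>

lemma (in top_ring) coded_product:
  fixes S :: "'i \<Rightarrow> ('s, 'n) ring_scheme"
  assumes S: "\<And>i. i \<in> I \<Longrightarrow> nonunital_ring (S i)" "\<And>i. i \<in> I \<Longrightarrow> finite (carrier (S i))"
    and N: "\<And>i. i \<in> I \<Longrightarrow> card (carrier (S i)) \<le> N" and I: "countable I"
    and iso: "topological_ring_iso R T (product_ring I S) (discrete_product_topology I S)"
  shows "\<exists>(code :: 'i \<Rightarrow> nat \<times> (nat \<times> nat \<Rightarrow> nat) \<times> (nat \<times> nat \<Rightarrow> nat)) c. coded_ring R T I code c N"
proof -
  let ?D = "discrete_product_topology I S" and ?E = "\<Pi>\<^sub>E i\<in>I. carrier (S i)"
  obtain H where bij: "bij_betw H (carrier R) ?E"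
    and hm: "homeomorphic_map T ?D H"
    and homs: "\<forall>i\<in>I. (\<lambda>x. H x i) \<in> nonunital_hom R (S i)"
    using product_iso_coordinates[OF nonunital_ring_axioms iso] .
  obtain b :: "'i \<Rightarrow> 's \<Rightarrow> nat"
    and code :: "'i \<Rightarrow> nat \<times> (nat \<times> nat \<Rightarrow> nat) \<times> (nat \<times> nat \<Rightarrow> nat)"
    where inj: "\<forall>i\<in>I. inj_on (b i) (carrier (S i))" and bN: "\<forall>i\<in>I. b i ` carrier (S i) \<subseteq> {..<N}"
    and fin: "finite (code ` I)"
    and im: "\<forall>i\<in>I. \<forall>j\<in>I. code i = code j \<longrightarrow> b i ` carrier (S i) = b j ` carrier (S j)"
    and ops: "\<forall>i\<in>I. \<forall>j\<in>I. code i = code j \<longrightarrow> (\<forall>x\<in>carrier (S i). \<forall>x'\<in>carrier (S i). \<forall>y\<in>carrier (S j). \<forall>y'\<in>carrier (S j).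
       b i x = b j y \<and> b i x' = b j y' \<longrightarrow>
         b i (x \<oplus>\<^bsub>S i\<^esub> x') = b j (y \<oplus>\<^bsub>S j\<^esub> y') \<and> b i (x \<otimes>\<^bsub>S i\<^esub> x') = b j (y \<otimes>\<^bsub>S j\<^esub> y'))"
    using ring_codes[OF S N] .
  define c where "c = (\<lambda>x i. b i (H x i))"
  have HE: "H x \<in> ?E" if "x \<in> carrier R" for x using bij that by (auto simp: bij_betw_def)
  have Hc: "H x i \<in> carrier (S i)" if "x \<in> carrier R" "i \<in> I" for x i using PiE_mem[OF HE[OF that(1)] that(2)] .
  have Hop: "H (x \<oplus> y) i = H x i \<oplus>\<^bsub>S i\<^esub> H y i" "H (x \<otimes> y) i = H x i \<otimes>\<^bsub>S i\<^esub> H y i"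
    if "x \<in> carrier R" "y \<in> carrier R" "i \<in> I" for x y i
    using nonunital_homD(2,3)[OF bspec[OF homs that(3)] that(1,2)] .
  have Hinj: "x = y" if "x \<in> carrier R" "y \<in> carrier R" "\<And>i. i \<in> I \<Longrightarrow> H x i = H y i" for x y
  proof -
    have "H x = H y" by (rule PiE_ext[OF HE[OF that(1)] HE[OF that(2)] that(3)])
    then show ?thesis using inj_onD[OF bij_betw_imp_inj_on[OF bij]] that(1,2) by simp
  qed
  have Hcont: "continuous_map T ?D H" by (rule homeomorphic_imp_continuous_map[OF hm])
  have beq: "c x i = c y i \<longleftrightarrow> H x i = H y i" if "x \<in> carrier R" "y \<in> carrier R" "i \<in> I" for x y i
    using inj_on_eq_iff[OF bspec[OF inj that(3)] Hc[OF that(1,3)] Hc[OF that(2,3)]] by (simp add: c_def)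
  have "coded_ring R T I code c N"
  proof (intro coded_ring.intro coded_ring_axioms.intro)
    show "top_ring R T" by (rule top_ring_axioms)
    show "compact_space T"
      using compact_finite_discrete_product[of I S, OF S(2)]
        homeomorphic_compact_space[OF homeomorphic_map_imp_homeomorphic_space[OF hm]] by simp
    show "countable I" by (rule I)
    show "finite (code ` I)" by (rule fin)
    show "c x i < N" if "x \<in> carrier R" "i \<in> I" for x i
    proof -
      have "b i (H x i) \<in> {..<N}" using bspec[OF bN that(2)] Hc[OF that] by blast
      then show ?thesis by (simp add: c_def)
    qed
    show "x = y" if "x \<in> carrier R" "y \<in> carrier R" "\<And>i. i \<in> I \<Longrightarrow> c x i = c y i" for x y
      by (rule Hinj[OF that(1,2)]) (use that beq in simp)
    show "\<exists>x\<in>carrier R. \<forall>i\<in>I. c x i = v i"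
      if v: "\<And>i. i \<in> I \<Longrightarrow> \<exists>x\<in>carrier R. \<exists>j\<in>I. code j = code i \<and> c x j = v i" for v
    proof -
      have "\<exists>s. s \<in> carrier (S i) \<and> b i s = v i" if i: "i \<in> I" for i
      proof -
        obtain x j where x: "x \<in> carrier R" "j \<in> I" "code j = code i" "c x j = v i" using v[OF i] by blast
        have "v i \<in> b j ` carrier (S j)" using imageI[OF Hc[OF x(1,2)], of "b j"] x(4) by (simp add: c_def)
        then have "v i \<in> b i ` carrier (S i)" unfolding im[rule_format, OF x(2) i x(3)] .
        then obtain s where "s \<in> carrier (S i)" "v i = b i s" by (rule imageE)
        then show ?thesis by (intro exI[of _ s]) simp
      qed
      then have "\<forall>i\<in>I. \<exists>s. s \<in> carrier (S i) \<and> b i s = v i" by simp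
      then obtain s where s: "\<forall>i\<in>I. s i \<in> carrier (S i) \<and> b i (s i) = v i" using bchoice by metis
      have "restrict s I \<in> ?E" using s by simp
      then have "restrict s I \<in> H ` carrier R" using bij by (simp add: bij_betw_def)
      then obtain x where xR: "x \<in> carrier R" and x: "restrict s I = H x" by (rule imageE)
      have "c x i = v i" if "i \<in> I" for i
      proof -
        have "H x i = s i" using fun_cong[OF x, of i] that by simp
        then show ?thesis using s that by (simp add: c_def)
      qed
      then show ?thesis using xR by (intro bexI[of _ x]) simp_all
    qed
    show "openin T {x \<in> carrier R. c x i = m}" if i: "i \<in> I" for i m
    proof -
      have "continuous_map T (discrete_topology (carrier (S i))) (\<lambda>x. H x i)"
        using Hcont i unfolding discrete_product_topology_def continuous_map_componentwise by blast
      then have "openin T {x \<in> topspace T. H x i \<in> {s \<in> carrier (S i). b i s = m}}"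
        by (rule openin_continuous_map_preimage) auto
      moreover have "{x \<in> topspace T. H x i \<in> {s \<in> carrier (S i). b i s = m}} = {x \<in> carrier R. c x i = m}"
        using Hc[OF _ i] by (auto simp: topspace c_def)
      ultimately show ?thesis by simp
    qed
    show "\<exists>J. finite J \<and> J \<subseteq> I \<and> (\<forall>y\<in>carrier R. (\<forall>i\<in>J. c y i = c x i) \<longrightarrow> y \<in> U)"
      if U: "openin T U" "x \<in> U" for U x
    proof -
      have UR: "U \<subseteq> carrier R" using openin_subset[OF U(1)] by (simp add: topspace)
      have "openin ?D (H ` U)" using homeomorphic_map_openness_eq[OF hm] U(1) by blast
      moreover have "subtopology ?D ?E = ?D"
        using subtopology_topspace[of ?D] by (simp add: discrete_product_topology_def)
      ultimately have "openin (subtopology ?D ?E) (H ` U)" by simp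
      then have "\<forall>z\<in>H ` U. \<exists>J. finite J \<and> J \<subseteq> I \<and> (\<forall>y\<in>?E. (\<forall>i\<in>J. y i = z i) \<longrightarrow> y \<in> H ` U)"
        unfolding discrete_product_topology_def openin_discrete_product_subtopology[OF subset_refl] by (rule conjunct2)
      from bspec[OF this imageI[OF U(2)]]
      obtain J where J: "finite J" "J \<subseteq> I" "\<forall>y\<in>?E. (\<forall>i\<in>J. y i = H x i) \<longrightarrow> y \<in> H ` U" by blast
      have "y \<in> U" if y: "y \<in> carrier R" "\<forall>i\<in>J. c y i = c x i" for y
      proof -
        have xR: "x \<in> carrier R" using U(2) UR by blast
        have "\<forall>i\<in>J. H y i = H x i" using y(2) beq[OF y(1) xR] J(2) by blast
        then have "H y \<in> H ` U" using J(3) HE[OF y(1)] by blast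
        then show ?thesis using inj_on_image_mem_iff[OF bij_betw_imp_inj_on[OF bij] y(1) UR] by simp
      qed
      then show ?thesis using J(1,2) by (intro exI[of _ J]) simp
    qed
    show "c (x \<oplus> x') i = c (y \<oplus> y') j \<and> c (x \<otimes> x') i = c (y \<otimes> y') j"
      if x: "x \<in> carrier R" "x' \<in> carrier R" and y: "y \<in> carrier R" "y' \<in> carrier R" and ij: "i \<in> I" "j \<in> I"
        and cd: "code i = code j" and eq: "c x i = c y j" "c x' i = c y' j" for x x' y y' i j
    proof -
      have "b i (H x i \<oplus>\<^bsub>S i\<^esub> H x' i) = b j (H y j \<oplus>\<^bsub>S j\<^esub> H y' j) \<and>
          b i (H x i \<otimes>\<^bsub>S i\<^esub> H x' i) = b j (H y j \<otimes>\<^bsub>S j\<^esub> H y' j)"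
        using ops[rule_format, OF ij cd Hc[OF x(1) ij(1)] Hc[OF x(2) ij(1)] Hc[OF y(1) ij(2)] Hc[OF y(2) ij(2)]] eq
        by (simp add: c_def)
      then show ?thesis using Hop x y ij by (simp add: c_def)
    qed
  qed
  then show ?thesis by blast
qed

text \<open>A permutation of a countable set is given by its graph, which pairing of natural numbers
  turns into a set of naturals and thus into a real number. A type into which the reals inject can
  therefore carry the group.\<close>

lemma code_perms_embedding:
  fixes e :: "real \<Rightarrow> 'u"
  assumes I: "countable I" and e: "inj e"
  obtains f :: "('i \<Rightarrow> 'i) \<Rightarrow> 'u" where "inj_on f (code_perms I code)"
proof -
  obtain r :: "nat set \<Rightarrow> real" where "bij r" using nat_sets_eqpoll_reals unfolding eqpoll_def by blast
  then have r: "inj r" by (rule bij_is_inj)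
  let ?t = "to_nat_on I"
  define gr where "gr = (\<lambda>\<sigma>. (\<lambda>i. prod_encode (?t i, ?t (\<sigma> i))) ` I)"
  have t: "i = j" if "i \<in> I" "j \<in> I" "?t i = ?t j" for i j
    using inj_onD[OF inj_on_to_nat_on[OF I] that(3) that(1,2)] .
  have "inj_on gr (code_perms I code)"
  proof (rule inj_onI)
    fix \<sigma> \<tau> assume \<sigma>: "\<sigma> \<in> code_perms I code" and \<tau>: "\<tau> \<in> code_perms I code" and eq: "gr \<sigma> = gr \<tau>"
    show "\<sigma> = \<tau>"
    proof (rule PiE_ext[OF code_permsD(3)[OF \<sigma>] code_permsD(3)[OF \<tau>]])
      fix i assume i: "i \<in> I"
      have "prod_encode (?t i, ?t (\<sigma> i)) \<in> gr \<sigma>" unfolding gr_def by (rule image_eqI[OF refl i])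
      then have "prod_encode (?t i, ?t (\<sigma> i)) \<in> gr \<tau>" by (simp only: eq)
      then obtain j where j: "j \<in> I" "prod_encode (?t i, ?t (\<sigma> i)) = prod_encode (?t j, ?t (\<tau> j))"
        unfolding gr_def by (auto elim: imageE)
      then have tt: "?t i = ?t j" "?t (\<sigma> i) = ?t (\<tau> j)" by (simp_all add: inj_eq[OF inj_prod_encode])
      have "i = j" by (rule t[OF i j(1) tt(1)])
      then show "\<sigma> i = \<tau> i" using t[OF code_permsD(4)[OF \<sigma> i] code_permsD(4)[OF \<tau> j(1)] tt(2)] by simp
    qed
  qed
  then have "inj_on (\<lambda>\<sigma>. e (r (gr \<sigma>))) (code_perms I code)"
    unfolding inj_on_def using injD[OF e] injD[OF r] by blast
  then show thesis by (rule that)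
qed

text \<open>Group, topology and action are moved along the bijection onto the image of
  \<open>f\<close>; the orbits are literally the same sets, so smallness is preserved.\<close>

lemma small_compact_G_ring_transport:
  fixes f :: "'g \<Rightarrow> 'u" and G :: "('g, 'm) monoid_scheme"
  assumes small: "small_compact_G_ring R T G TG \<phi>" and f: "inj_on f (carrier G)"
  shows "\<exists>(G' :: 'u monoid) TG' \<phi>'. small_compact_G_ring R T G' TG' \<phi>'"
proof -
  have cG: "compact_G_ring R T G TG \<phi>" using small by (simp add: small_compact_G_ring_def)
  have pol: "polish_group G TG" and act: "group_action G (carrier R) \<phi>"
    and cont: "continuous_map (prod_topology TG T) T (\<lambda>(g, x). \<phi> g x)"
    using cG by (simp_all add: compact_G_ring_def)
  interpret G: group G using pol by (simp add: polish_group_def)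
  have top: "topspace TG = carrier G" using pol by (simp add: polish_group_def)
  let ?C = "f ` carrier G"
  define g where "g = inv_into (carrier G) f"
  have gf: "g (f x) = x" if "x \<in> carrier G" for x using inv_into_f_f[OF f that] by (simp add: g_def)
  have gC: "g u \<in> carrier G" "f (g u) = u" if "u \<in> ?C" for u
    using that by (simp_all add: g_def inv_into_into f_inv_into_f)
  define G' :: "'u monoid" where "G' = \<lparr>carrier = ?C, monoid.mult = (\<lambda>u v. f (g u \<otimes>\<^bsub>G\<^esub> g v)), one = f \<one>\<^bsub>G\<^esub>\<rparr>"
  have carr: "carrier G' = ?C" and mult: "u \<otimes>\<^bsub>G'\<^esub> v = f (g u \<otimes>\<^bsub>G\<^esub> g v)" for u v by (simp_all add: G'_def)
  have fhom: "f \<in> hom G G'" by (rule homI) (simp_all add: carr mult gf)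
  have G': "group G'"
  proof -
    have "G'\<lparr>carrier := ?C, one := f \<one>\<^bsub>G\<^esub>\<rparr> = G'" by (simp add: G'_def)
    then show ?thesis using G.hom_imp_img_group[OF fhom] by simp
  qed
  interpret f: group_hom G G' f by (intro group_hom.intro group_hom_axioms.intro G.is_group G' fhom)
  define TG' where "TG' = pullback_topology ?C g TG"
  have top': "topspace TG' = ?C"
    using gC(1) by (auto simp: TG'_def topspace_pullback_topology top)
  have gcont: "continuous_map TG' TG g"
    using continuous_map_pullback[OF continuous_map_id[of TG], of ?C g] by (simp add: TG'_def o_def id_def)
  have fcont: "continuous_map TG TG' f"
    unfolding TG'_def
  proof (rule continuous_map_pullback')
    show "continuous_map TG TG (g \<circ> f)"
      by (rule continuous_map_eq[OF continuous_map_id]) (simp add: top gf)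
    show "topspace TG \<subseteq> f -` ?C" using top by blast
  qed
  have "homeomorphic_maps TG TG' f g"
    unfolding homeomorphic_maps_def using fcont gcont gf gC(2) by (simp add: top top')
  then have hs: "TG homeomorphic_space TG'" unfolding homeomorphic_space_def by blast
  have pol': "polish_group G' TG'"
    unfolding polish_group_def
  proof (intro conjI)
    show "group G'" by (rule G')
    show "topspace TG' = carrier G'" by (simp add: top' carr)
    let ?P = "prod_topology TG' TG'"
    have m: "continuous_map (prod_topology TG TG) TG (\<lambda>(x, y). x \<otimes>\<^bsub>G\<^esub> y)" using pol by (simp add: polish_group_def)
    have "continuous_map ?P (prod_topology TG TG) (\<lambda>p. (g (fst p), g (snd p)))"
      by (intro continuous_map_pairedI continuous_map_compose[OF continuous_map_fst gcont, unfolded o_def]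
          continuous_map_compose[OF continuous_map_snd gcont, unfolded o_def])
    from continuous_map_compose[OF continuous_map_compose[OF this m] fcont]
    show "continuous_map ?P TG' (\<lambda>(x, y). x \<otimes>\<^bsub>G'\<^esub> y)" by (simp add: o_def mult case_prod_unfold)
    have "continuous_map TG TG (\<lambda>x. inv\<^bsub>G\<^esub> x)" using pol by (simp add: polish_group_def)
    from continuous_map_compose[OF continuous_map_compose[OF gcont this] fcont]
    have "continuous_map TG' TG' (\<lambda>u. f (inv\<^bsub>G\<^esub> (g u)))" by (simp add: o_def)
    then show "continuous_map TG' TG' (\<lambda>u. inv\<^bsub>G'\<^esub> u)"
    proof (rule continuous_map_eq)
      fix u assume "u \<in> topspace TG'"
      then have u: "u \<in> ?C" by (simp add: top')
      show "f (inv\<^bsub>G\<^esub> (g u)) = inv\<^bsub>G'\<^esub> u" using f.hom_inv[OF gC(1)[OF u]] gC(2)[OF u] by simp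
    qed
    show "completely_metrizable_space TG'"
      using pol homeomorphic_completely_metrizable_space[OF hs] by (simp add: polish_group_def)
    show "separable_space TG'" using pol homeomorphic_separable_space[OF hs] by (simp add: polish_group_def)
  qed
  have act': "group_action G' (carrier R) (\<phi> \<circ> g)"
    unfolding group_action_def group_hom_def group_hom_axioms_def
  proof (intro conjI G' group_BijGroup homI)
    have ph: "\<phi> \<in> hom G (BijGroup (carrier R))"
      using act by (simp add: group_action_def group_hom_def group_hom_axioms_def)
    show "(\<phi> \<circ> g) u \<in> carrier (BijGroup (carrier R))" if "u \<in> carrier G'" for u
      unfolding o_apply by (rule hom_in_carrier[OF ph gC(1)[OF that[unfolded carr]]])
    fix u v assume u: "u \<in> carrier G'" and v: "v \<in> carrier G'"
    have uv: "g u \<in> carrier G" "g v \<in> carrier G"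
      using gC(1)[OF u[unfolded carr]] gC(1)[OF v[unfolded carr]] .
    show "(\<phi> \<circ> g) (u \<otimes>\<^bsub>G'\<^esub> v) = (\<phi> \<circ> g) u \<otimes>\<^bsub>BijGroup (carrier R)\<^esub> (\<phi> \<circ> g) v"
      unfolding mult o_apply gf[OF G.m_closed[OF uv]] by (rule hom_mult[OF ph uv])
  qed
  have "small_compact_G_ring R T G' TG' (\<phi> \<circ> g)"
    unfolding small_compact_G_ring_def compact_G_ring_def
  proof (intro conjI allI ballI pol' act')
    show "topological_ring R T" "compact_space T" using cG by (simp_all add: compact_G_ring_def)
    show "(\<phi> \<circ> g) u \<in> nonunital_hom R R" if "u \<in> carrier G'" for u
      using cG gC(1) that by (simp add: compact_G_ring_def carr)
    have "continuous_map (prod_topology TG' T) (prod_topology TG T) (\<lambda>p. (g (fst p), snd p))"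
      by (intro continuous_map_pairedI continuous_map_compose[OF continuous_map_fst gcont, unfolded o_def] continuous_map_snd)
    from continuous_map_compose[OF this cont]
    show "continuous_map (prod_topology TG' T) T (\<lambda>(u, x). (\<phi> \<circ> g) u x)" by (simp add: o_def case_prod_unfold)
    fix n :: nat
    let ?E = "{..<n} \<rightarrow>\<^sub>E carrier R"
    let ?\<psi> = "\<lambda>h. \<lambda>x\<in>?E. \<lambda>i\<in>{..<n}. \<phi> h (x i)"
    have "orbit G' (\<lambda>u. \<lambda>x\<in>?E. \<lambda>i\<in>{..<n}. (\<phi> \<circ> g) u (x i)) x = orbit G ?\<psi> x" for x
    proof -
      have "orbit G' (\<lambda>u. \<lambda>x\<in>?E. \<lambda>i\<in>{..<n}. (\<phi> \<circ> g) u (x i)) x = (\<lambda>u. ?\<psi> (g u) x) ` ?C"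
        unfolding orbit_def carr by (auto simp: image_iff)
      also have "\<dots> = (\<lambda>h. ?\<psi> h x) ` carrier G" unfolding image_image by (intro image_cong) (simp_all add: gf)
      also have "\<dots> = orbit G ?\<psi> x" unfolding orbit_def by auto
      finally show ?thesis .
    qed
    then have "orbits G' ?E (\<lambda>u. \<lambda>x\<in>?E. \<lambda>i\<in>{..<n}. (\<phi> \<circ> g) u (x i)) = orbits G ?E ?\<psi>"
      unfolding orbits_def by simp
    then show "countable (orbits G' ?E (\<lambda>u. \<lambda>x\<in>?E. \<lambda>i\<in>{..<n}. (\<phi> \<circ> g) u (x i)))"
      using small by (simp add: small_compact_G_ring_def)
  qed
  then show ?thesis by blast
qed

section \<open>The three characterisations\<close>

lemma matrix_productD:
  assumes R: "nonunital_ring R" and mp: "matrix_product I F k R T"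
  shows "\<And>i. i \<in> I \<Longrightarrow> field (F i)"
    and "\<And>i. i \<in> I \<Longrightarrow> nonunital_ring (matrix_ring (F i) (k i))"
    and "\<And>i. i \<in> I \<Longrightarrow> finite (carrier (matrix_ring (F i) (k i)))"
    and "topological_ring_iso R T (product_ring I (\<lambda>i. matrix_ring (F i) (k i)))
      (discrete_product_topology I (\<lambda>i. matrix_ring (F i) (k i)))"
proof -
  have fld: "field (F i) \<and> finite (carrier (F i)) \<and> k i \<ge> 1" if "i \<in> I" for i
    using mp that by (simp add: matrix_product_def)
  show F: "field (F i)" if "i \<in> I" for i using fld[OF that] by simp
  have ring: "ring (F i)" if "i \<in> I" for i by (rule field.is_ring[OF F[OF that]])
  show "nonunital_ring (matrix_ring (F i) (k i))" if "i \<in> I" for i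
    by (rule ring.matrix_ring_nonunital[OF ring[OF that]])
  show "finite (carrier (matrix_ring (F i) (k i)))" if "i \<in> I" for i
    using ring.finite_matrix_ring[OF ring[OF that]] fld[OF that] by simp
  show "topological_ring_iso R T (product_ring I (\<lambda>i. matrix_ring (F i) (k i)))
      (discrete_product_topology I (\<lambda>i. matrix_ring (F i) (k i)))"
    using mp by (simp add: matrix_product_def)
qed

lemma (in top_ring) matrix_product_locally_finite:
  assumes mp: "matrix_product I F k R T"
  shows "locally_finite_ring R"
proof -
  note D = matrix_productD[OF nonunital_ring_axioms mp]
  let ?S = "\<lambda>i. matrix_ring (F i) (k i)"
  obtain H where bij: "bij_betw H (carrier R) (\<Pi>\<^sub>E i\<in>I. carrier (?S i))"
    and "homeomorphic_map T (discrete_product_topology I ?S) H"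
    and homs: "\<forall>i\<in>I. (\<lambda>x. H x i) \<in> nonunital_hom R (?S i)"
    using product_iso_coordinates[OF nonunital_ring_axioms D(4)] .
  obtain N where N: "\<forall>i\<in>I. card (carrier (?S i)) \<le> N" using mp unfolding matrix_product_def by blast
  show ?thesis
    by (rule bounded_product_locally_finite[OF nonunital_ring_axioms D(2,3) bspec[OF N] bij bspec[OF homs]])
qed

lemma (in top_ring) matrix_product_profinite:
  fixes e :: "'a set \<Rightarrow> 'u"
  assumes mp: "matrix_product I F k R T" and e: "inj e"
  shows "profinite_ring TYPE('u) R T"
proof -
  note D = matrix_productD[OF nonunital_ring_axioms mp]
  let ?S = "\<lambda>i. matrix_ring (F i) (k i)"
  obtain H where bij: "bij_betw H (carrier R) (\<Pi>\<^sub>E i\<in>I. carrier (?S i))"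
    and hm: "homeomorphic_map T (discrete_product_topology I ?S) H"
    and homs: "\<forall>i\<in>I. (\<lambda>x. H x i) \<in> nonunital_hom R (?S i)"
    using product_iso_coordinates[OF nonunital_ring_axioms D(4)] .
  have "compact_space T"
    using compact_finite_discrete_product[of I ?S, OF D(3)]
      homeomorphic_compact_space[OF homeomorphic_map_imp_homeomorphic_space[OF hm]] by simp
  moreover have "open_ideals_separate"
  proof (rule coordinates_separate[OF D(2) bspec[OF homs]])
    show "inj_on H (carrier R)" "H ` carrier R \<subseteq> (\<Pi>\<^sub>E i\<in>I. carrier (?S i))"
      using bij by (simp_all add: bij_betw_def)
    show "continuous_map T (discrete_product_topology I ?S) H" by (rule homeomorphic_imp_continuous_map[OF hm])
  qed
  ultimately show ?thesis by (rule compact_separated_imp_profinite[OF _ _ e])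
qed

text \<open>The common core of the converse directions: profinite rings and small compact G-rings
  both enter through compactness, separation and weak local finiteness.\<close>

lemma (in top_ring) compact_separated_imp_matrix_product:
  fixes e :: "'a set \<Rightarrow> 'u"
  assumes comp: "compact_space T" and sep: "open_ideals_separate" and e: "inj e"
    and ss: "semisimple_ring R" and wlf: "weakly_locally_finite_ring R"
  shows "\<exists>(I :: 'u set) F k. matrix_product I F k R T"
proof (rule compact_semisimple_product[OF comp e sep ss])
  fix I :: "'u set" and F :: "'u \<Rightarrow> 'u ring" and k
  assume fld: "\<And>i. i \<in> I \<Longrightarrow> field (F i) \<and> finite (carrier (F i)) \<and> k i \<ge> 1"
    and iso: "topological_ring_iso R T (product_ring I (\<lambda>i. matrix_ring (F i) (k i)))
       (discrete_product_topology I (\<lambda>i. matrix_ring (F i) (k i)))"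
  have "\<exists>N. \<forall>i\<in>I. card (carrier (matrix_ring (F i) (k i))) \<le> N"
    by (rule weakly_locally_finite_bounded[OF nonunital_ring_axioms wlf fld iso])
  then have "matrix_product I F k R T" unfolding matrix_product_def using fld iso by (intro conjI ballI) simp_all
  then show ?thesis by (intro exI)
qed

lemma (in top_ring) countable_matrix_product_imp_small:
  fixes e :: "real \<Rightarrow> 'u" and I :: "'i set"
  assumes mp: "matrix_product I F k R T" and I: "countable I" and e: "inj e"
  shows "\<exists>(G :: 'u monoid) TG \<phi>. small_compact_G_ring R T G TG \<phi>"
proof -
  note D = matrix_productD[OF nonunital_ring_axioms mp]
  obtain N where N: "\<forall>i\<in>I. card (carrier (matrix_ring (F i) (k i))) \<le> N"
    using mp unfolding matrix_product_def by blast
  obtain code :: "'i \<Rightarrow> nat \<times> (nat \<times> nat \<Rightarrow> nat) \<times> (nat \<times> nat \<Rightarrow> nat)" and c where "coded_ring R T I code c N"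
    using coded_product[of I "\<lambda>i. matrix_ring (F i) (k i)" N, OF D(2,3) bspec[OF N] I D(4)] by blast
  then interpret coded_ring R T I code c N .
  obtain f :: "('i \<Rightarrow> 'i) \<Rightarrow> 'u" where "inj_on f perms" by (rule code_perms_embedding[OF I e])
  then show ?thesis by (intro small_compact_G_ring_transport[OF small_shift]) simp
qed

lemma (in field) matrix_ring_nontrivial:
  assumes "k \<ge> 1"
  shows "carrier (matrix_ring R k) \<noteq> {\<zero>\<^bsub>matrix_ring R k\<^esub>}"
proof -
  have "\<one>\<^bsub>matrix_ring R k\<^esub> (0, 0) \<noteq> \<zero>\<^bsub>matrix_ring R k\<^esub> (0, 0)"
    using assms by (simp add: matrix_one_entry matrix_zero_entry)
  then show ?thesis using matrix_one_closed[of k] by auto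
qed

text \<open>Since \<open>k i\<close> is at least 1, no factor is zero; this is why the index set
  itself can be counted.\<close>

lemma (in small_ring) countable_matrix_product:
  assumes mp: "matrix_product I F k R T"
  shows "countable I"
proof -
  note D = matrix_productD[OF nonunital_ring_axioms mp]
  show ?thesis
  proof (rule countable_product_index[OF D(2) _ D(4)])
    fix i assume i: "i \<in> I"
    have "k i \<ge> 1" using mp i by (simp add: matrix_product_def)
    then show "carrier (matrix_ring (F i) (k i)) \<noteq> {\<zero>\<^bsub>matrix_ring (F i) (k i)\<^esub>}"
      by (rule field.matrix_ring_nontrivial[OF D(1)[OF i]])
  qed
qed

theorem corollary3p3:
  assumes "\<exists>e :: 'a set \<Rightarrow> 'u. inj e"
    and "\<exists>e :: real \<Rightarrow> 'u. inj e"
  shows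
    "(matrix_products TYPE('u) :: ('a ring \<times> 'a topology) set) =
       {(R, T). topological_ring R T \<and> semisimple_ring R \<and>
          weakly_locally_finite_ring R \<and> profinite_ring TYPE('u) R T} \<and>
     (matrix_products TYPE('u) :: ('a ring \<times> 'a topology) set) =
       {(R, T). topological_ring R T \<and> semisimple_ring R \<and>
          locally_finite_ring R \<and> profinite_ring TYPE('u) R T} \<and>
     (countable_matrix_products TYPE('u) :: ('a ring \<times> 'a topology) set) =
       {(R, T). topological_ring R T \<and> semisimple_ring R \<and>
          (\<exists>(G :: 'u monoid) TG \<phi>. small_compact_G_ring R T G TG \<phi>)}"
proof -
  \<comment> \<open>\<open>e\<close> names cosets and open ideals in the type of the index sets,
    \<open>e'\<close> the elements of the permutation group.\<close>
  obtain e :: "'a set \<Rightarrow> 'u" where e: "inj e" using assms(1) by blast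
  obtain e' :: "real \<Rightarrow> 'u" where e': "inj e'" using assms(2) by blast
  \<comment> \<open>The strong form of local finiteness is concluded here and the weak form is
    assumed in \<open>bwd\<close>; so both are characterised together.\<close>
  have fwd: "semisimple_ring R \<and> locally_finite_ring R \<and> profinite_ring TYPE('u) R T"
    if R: "topological_ring R T" and mp: "matrix_product I F k R T"
    for R :: "'a ring" and T and I :: "'u set" and F k
  proof -
    interpret top_ring R T using R top_ring_iff by blast
    note D = matrix_productD[OF nonunital_ring_axioms mp]
    show ?thesis
      using matrix_product_semisimple[OF nonunital_ring_axioms D(1,4)] matrix_product_locally_finite[OF mp]
        matrix_product_profinite[OF mp e] by simp
  qed
  have bwd: "\<exists>(I :: 'u set) F k. matrix_product I F k R T"
    if R: "topological_ring R T" and ss: "semisimple_ring R" and wlf: "weakly_locally_finite_ring R"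
      and pf: "profinite_ring TYPE('u) R T"
    for R :: "'a ring" and T
  proof -
    interpret top_ring R T using R top_ring_iff by blast
    show ?thesis
      by (rule compact_separated_imp_matrix_product[OF profinite_imp_compact_separated[OF pf] e ss wlf])
  qed
  have iff1: "(\<exists>(I :: 'u set) F k. matrix_product I F k R T) \<longleftrightarrow>
      semisimple_ring R \<and> weakly_locally_finite_ring R \<and> profinite_ring TYPE('u) R T"
    and iff2: "(\<exists>(I :: 'u set) F k. matrix_product I F k R T) \<longleftrightarrow>
      semisimple_ring R \<and> locally_finite_ring R \<and> profinite_ring TYPE('u) R T"
    if R: "topological_ring R T" for R :: "'a ring" and T
    using fwd[OF R] bwd[OF R] locally_finite_imp_weakly[of R] by blast+
  have iff3: "(\<exists>(I :: 'u set) F k. countable I \<and> matrix_product I F k R T) \<longleftrightarrow>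
      semisimple_ring R \<and> (\<exists>(G :: 'u monoid) TG \<phi>. small_compact_G_ring R T G TG \<phi>)"
    if R: "topological_ring R T" for R :: "'a ring" and T
  proof
    interpret top_ring R T using R top_ring_iff by blast
    assume "\<exists>(I :: 'u set) F k. countable I \<and> matrix_product I F k R T"
    then obtain I :: "'u set" and F k where I: "countable I" and mp: "matrix_product I F k R T" by blast
    show "semisimple_ring R \<and> (\<exists>(G :: 'u monoid) TG \<phi>. small_compact_G_ring R T G TG \<phi>)"
      using fwd[OF R mp] countable_matrix_product_imp_small[OF mp I e'] by simp
  next
    assume a: "semisimple_ring R \<and> (\<exists>(G :: 'u monoid) TG \<phi>. small_compact_G_ring R T G TG \<phi>)"
    then obtain G :: "'u monoid" and TG \<phi> where small: "small_compact_G_ring R T G TG \<phi>" by blast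
    have "top_ring R T" using R top_ring_iff by blast
    \<comment> \<open>Compactness, separation and weak local finiteness are read off from the small
      G-ring; countability of the index set is then deduced for whichever product representation was
      found.\<close>
    then interpret small_ring R T G TG \<phi> using small by (intro small_ring.intro small_ring_axioms.intro)
    have "\<exists>(I :: 'u set) F k. matrix_product I F k R T"
      using compact_separated_imp_matrix_product[OF compact separated e _ weakly_locally_finite] a by simp
    then show "\<exists>(I :: 'u set) F k. countable I \<and> matrix_product I F k R T"
      using countable_matrix_product by blast
  qed
  show ?thesis
    unfolding matrix_products_def countable_matrix_products_def
  proof (intro conjI)
    show "{(R :: 'a ring, T). topological_ring R T \<and> (\<exists>(I :: 'u set) F k. matrix_product I F k R T)} =
        {(R, T). topological_ring R T \<and> semisimple_ring R \<and> weakly_locally_finite_ring R \<and> profinite_ring TYPE('u) R T}"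
      by (simp only: iff1 cong: conj_cong)
    show "{(R :: 'a ring, T). topological_ring R T \<and> (\<exists>(I :: 'u set) F k. matrix_product I F k R T)} =
        {(R, T). topological_ring R T \<and> semisimple_ring R \<and> locally_finite_ring R \<and> profinite_ring TYPE('u) R T}"
      by (simp only: iff2 cong: conj_cong)
    show "{(R :: 'a ring, T). topological_ring R T \<and> (\<exists>(I :: 'u set) F k. countable I \<and> matrix_product I F k R T)} =
        {(R, T). topological_ring R T \<and> semisimple_ring R \<and>
          (\<exists>(G :: 'u monoid) TG \<phi>. small_compact_G_ring R T G TG \<phi>)}"
      by (simp only: iff3 cong: conj_cong)
  qed
qed

end
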